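(* Let $0<p<1$ and let $X^p$ denote the closure in $L^p(\mathbb{R}^n)$ of the set of functions in $L^p(\mathbb{R}^n)$ of the form $$f(x_1,\dots,x_n)=\frac{P(x_1,\dots,x_n)}{\prod_{k=1}^n\prod_{j=1}^m(x_k-a_{kj})},$$ where $P(x)=\sum_{s_1=0}^{l_1}\cdots\sum_{s_n=0}^{l_n}a_{s_1\dots s_n}x_1^{s_1}\cdots x_n^{s_n}$ is a polynomial with complex coefficients, $l=\max\{l_1,\dots,l_n\}$, $m$ is a positive integer with $(m-l)p>1$, and for each $k=1,\dots,n$ the numbers $a_{k1},\dots,a_{km}$ are pairwise distinct real numbers. Then $$X^p=\bigcap_{j=1}^{2^n}H^p_{\sigma_j}(\mathbb{R}^n)\neq\emptyset.$$
   Context: For $k=1,\dots,2^n$, $\sigma_k\in\{+1,-1\}^n$ enumerate all sign vectors; $\Gamma_{\sigma_k}=\{y\in\mathbb{R}^n:\sigma_k(l)y_l>0\ \forall l\}$, $T_{\Gamma_{\sigma_k}}=\{x+iy:x\in\mathbb{R}^n,y\in\Gamma_{\sigma_k}\}$. $H^p(T_B)$ is the space of holomorphic $F$ on $T_B$ with $\sup_{y\in B}\int_{\mathbb{R}^n}|F(x+iy)|^p\,dx<\infty$. Every $F\in H^p(T_{\Gamma_{\sigma_k}})$ has a non-tangential boundary limit $F(x)=\lim_{y\in\Gamma_{\sigma_k},y\to0}F(x+iy)$ for a.e. $x\in\mathbb{R}^n$, and $H^p_{\sigma_k}(\mathbb{R}^n)\subset L^p(\mathbb{R}^n)$ denotes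 the set of (a.e.-equivalence classes of) such boundary limit functions of functions in $H^p(T_{\Gamma_{\sigma_k}})$. *)

theory Defs
  imports "HOL-Analysis.Analysis"
begin

definition cplx :: "real^'n \<Rightarrow> real^'n \<Rightarrow> complex^'n" where
  "cplx x y = (\<chi> k. Complex (x$k) (y$k))"

definition tube :: "(real^'n) set \<Rightarrow> (complex^'n) set" where
  "tube B = {z. (\<chi> k. Im (z$k)) \<in> B}"

definition holomorphic_several :: "(complex^'n \<Rightarrow> complex) \<Rightarrow> (complex^'n) set \<Rightarrow> bool" where
  "holomorphic_several F U \<longleftrightarrow>
     (\<forall>z\<in>U. \<exists>D. (F has_derivative D) (at z) \<and> (\<forall>(c::complex) v. D (c *s v) = c * D v))"

definition Hardy_tube :: "real \<Rightarrow> (real^'n) set \<Rightarrow> (complex^'n \<Rightarrow> complex) set" where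
  "Hardy_tube p B = {F. holomorphic_several F (tube B) \<and>
     (SUP y\<in>B. \<integral>\<^sup>+ x. ennreal (cmod (F (cplx x y)) powr p) \<partial>lebesgue) < \<infinity>}"

definition sign_vectors :: "('n \<Rightarrow> real) set" where
  "sign_vectors = {\<sigma>. \<forall>k. \<sigma> k \<in> {-1, 1}}"

definition octant :: "('n \<Rightarrow> real) \<Rightarrow> (real^'n) set" where
  "octant \<sigma> = {y. \<forall>k. \<sigma> k * y$k > 0}"

text \<open>L^p(R^n) (0 < p), as a set of functions (a.e.-classes are handled by the
  quasi-distance integral of abs(f-g)^p).\<close>
definition Lp_space :: "real \<Rightarrow> (real^'n \<Rightarrow> complex) set" where
  "Lp_space p = {f. f \<in> borel_measurable lebesgue \<and>
     (\<integral>\<^sup>+ x. ennreal (cmod (f x) powr p) \<partial>lebesgue) < \<infinity>}"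

definition boundary_Hardy :: "real \<Rightarrow> ('n \<Rightarrow> real) \<Rightarrow> (real^'n \<Rightarrow> complex) set" where
  "boundary_Hardy p \<sigma> = {f \<in> Lp_space p. \<exists>F \<in> Hardy_tube p (octant \<sigma>).
     AE x in lebesgue. ((\<lambda>y. F (cplx x y)) \<longlongrightarrow> f x) (at 0 within octant \<sigma>)}"

definition rational_class :: "real \<Rightarrow> (real^'n \<Rightarrow> complex) set" where
  "rational_class p = {f \<in> Lp_space p. \<exists>(l::'n \<Rightarrow> nat) (c::('n \<Rightarrow> nat) \<Rightarrow> complex)
       (m::nat) (a::'n \<Rightarrow> nat \<Rightarrow> real).
     m > 0 \<and> (real m - real (Max (range l))) * p > 1 \<and> (\<forall>k. inj_on (a k) {1..m}) \<and>
     (\<forall>x. f x = (\<Sum>s\<in>{s. \<forall>k. s k \<le> l k}. c s * (\<Prod>k\<in>UNIV. complex_of_real (x$k) ^ s k)) /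
                 (\<Prod>k\<in>UNIV. \<Prod>j\<in>{1..m}. complex_of_real (x$k - a k j)))}"

definition Lp_closure :: "real \<Rightarrow> (real^'n \<Rightarrow> complex) set \<Rightarrow> (real^'n \<Rightarrow> complex) set" where
  "Lp_closure p S = {g \<in> Lp_space p. \<forall>e>0. \<exists>f\<in>S.
     (\<integral>\<^sup>+ x. ennreal (cmod (f x - g x) powr p) \<partial>lebesgue) < ennreal e}"

end

theory Submission
  imports Defs "HOL-Probability.Sinc_Integral" "HOL-Complex_Analysis.Complex_Analysis"
begin

text \<open>
  Rational functions with real poles lie in every boundary space. Along a finite set of scales the
  Poisson averages satisfy an \<open>L\<^sup>2\<close> maximal inequality. Applied to the subharmonic functions
  \<open>|F|\<^bsup>p/2\<^esup>\<close>, one variable at a time, it bounds the \<open>L\<^sup>p\<close> norm of \<open>sup\<^sub>y |F(x + iy)|\<close> over an octant by that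
  of the boundary values. Hence each boundary space is closed in \<open>L\<^sup>p\<close>.

  Conversely, let \<open>f\<close> be a boundary function for every sign vector. For each \<open>\<sigma>\<close>, pushing the extension
  of \<open>f\<close> into its octant, damping it at infinity, moving it to the polydisc by the Cayley transform and
  interpolating at roots of unity gives an approximation \<open>h\<^sub>\<sigma>\<close> of \<open>f\<close> by polynomials in
  \<open>(x\<^sub>k - i\<sigma>\<^sub>k) / (x\<^sub>k + i\<sigma>\<^sub>k)\<close> over \<open>\<Prod>\<^sub>k (x\<^sub>k + i\<sigma>\<^sub>k)\<^sup>N\<close>. These are glued by the identity
  \<open>1 = 1 / (1 + \<lambda>B) + \<lambda>B / (1 + \<lambda>B)\<close> with \<open>B = ((x - i) / (x + i))\<^sup>m\<close> and \<open>|\<lambda>| = 1\<close>: for large \<open>m\<close> the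
  numerators \<open>(x \<plusminus> i)\<^sup>m\<close> cancel the complex poles of \<open>h\<^sub>\<sigma>\<close> and only the \<open>m\<close> distinct real zeros of \<open>1 + \<lambda>B\<close>
  remain. Since \<open>p < 1\<close>, the average of \<open>|1 + \<lambda>B|\<^bsup>-p\<^esup>\<close> over \<open>\<lambda>\<close> is finite, uniformly in \<open>B\<close>, so some \<open>\<lambda>\<close> makes
  the weighted sum of the differences \<open>h\<^sub>\<sigma> - h\<^sub>\<tau>\<close> small.
\<close>

section \<open>Poisson integrals and subharmonic majorants\<close>

text \<open>For p < 1 a boundary function need not be locally integrable, so F cannot be recovered
  from it by a Poisson or Cauchy integral, and L^p offers no duality or weak compactness. What
  survives is that every positive power of |F| is subharmonic in each variable. The power p/2 is
  taken because its maximal function is then needed in L^2, where adjoints are available.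

  The Poisson majorant asks for a function bounded up to the edge of its half plane, and F is not.
  Hence estimates are first proved for F pushed a distance \<delta> into the octant, where a
  pointwise bound by the Hardy norm makes it bounded, and \<delta> is removed by monotone
  convergence. The gain is an estimate of F by its boundary values alone, not only by its Hardy
  norm; closedness rests on it.

  In the gluing the order of choices matters: the accuracy of the approximants is fixed first, their
  degrees then determine m, and \<lambda> comes last. This is not circular because the price of
  averaging over \<lambda> depends on p and the dimension only, not on m.\<close>

definition cauchy_density :: "real \<Rightarrow> real" where
  "cauchy_density t = 1 / (pi * (1 + t\<^sup>2))"

definition poisson_kernel :: "real \<Rightarrow> real \<Rightarrow> real" where
  "poisson_kernel y s = y / (pi * (s\<^sup>2 + y\<^sup>2))"

lemma cauchy_density_nonneg [simp]: "0 \<le> cauchy_density t"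
  and cauchy_density_measurable [measurable]: "cauchy_density \<in> borel_measurable borel"
  by (auto simp: cauchy_density_def[abs_def] add_nonneg_nonneg)

lemma has_bochner_integral_cauchy_density: "has_bochner_integral lborel cauchy_density 1"
proof -
  have 1: "cauchy_density t = (1/pi) * inverse (1 + t\<^sup>2)" for t
    by (simp add: cauchy_density_def field_simps)
  have "has_bochner_integral lborel (\<lambda>t. (1/pi) * inverse (1 + t\<^sup>2)) ((1/pi) * pi)"
    using integrable_inverse_1_plus_square LBINT_inverse_1_plus_square
    by (intro has_bochner_integral_mult_right)
       (auto simp: set_integrable_def interval_lebesgue_integral_def set_lebesgue_integral_def
         has_bochner_integral_iff)
  thus ?thesis unfolding 1[abs_def] by simp
qed

lemma nn_integral_cauchy_density: "(\<integral>\<^sup>+ t. ennreal (cauchy_density t) \<partial>lborel) = 1"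
  using has_bochner_integral_cauchy_density
  by (subst nn_integral_eq_integral) (auto simp: has_bochner_integral_iff)

lemma poisson_kernel_nonneg: "0 \<le> y \<Longrightarrow> 0 \<le> poisson_kernel y s"
  by (simp add: poisson_kernel_def)

lemma poisson_kernel_measurable [measurable (raw)]:
  assumes [measurable]: "f \<in> borel_measurable M" "g \<in> borel_measurable M"
  shows "(\<lambda>x. poisson_kernel (f x) (g x)) \<in> borel_measurable M"
  unfolding poisson_kernel_def by measurable

lemma cauchy_density_scale:
  assumes "y > 0" shows "cauchy_density (s / y) = y * poisson_kernel y s"
proof -
  have "y\<^sup>2 + s\<^sup>2 > 0" "pi > 0" using assms by (auto intro: add_pos_nonneg)
  thus ?thesis using assms
    unfolding cauchy_density_def poisson_kernel_def
    by (simp add: field_simps power2_eq_square)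
qed

lemma nn_integral_poisson_kernel:
  assumes [measurable]: "u \<in> borel_measurable borel" and "y > 0"
  shows "(\<integral>\<^sup>+ t. ennreal (cauchy_density t) * u (y * t) \<partial>lborel)
     = (\<integral>\<^sup>+ s. ennreal (poisson_kernel y s) * u s \<partial>lborel)"
proof -
  have "(\<integral>\<^sup>+ t. ennreal (cauchy_density t) * u (y * t) \<partial>lborel) =
      ennreal (1/y) * (\<integral>\<^sup>+ s. ennreal (cauchy_density (0 + 1/y * s)) * u (y * (0 + 1/y * s)) \<partial>lborel)"
    using assms by (subst nn_integral_real_affine[where c="1/y" and t=0]) auto
  also have "\<dots> = (\<integral>\<^sup>+ s. ennreal (1/y) * (ennreal (cauchy_density (s / y)) * u s) \<partial>lborel)"
    using assms by (subst nn_integral_cmult[symmetric]) auto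
  also have "\<dots> = (\<integral>\<^sup>+ s. ennreal (poisson_kernel y s) * u s \<partial>lborel)"
    using assms by (intro nn_integral_cong)
      (simp add: cauchy_density_scale mult.assoc[symmetric] ennreal_mult'[symmetric] poisson_kernel_nonneg)
  finally show ?thesis .
qed

lemma integral_poisson_kernel:
  fixes u :: "real \<Rightarrow> real"
  assumes "y > 0"
  shows "(LBINT t. cauchy_density t * u (x + y * t)) = (LBINT s. poisson_kernel y (x - s) * u s)"
proof -
  have "(LBINT t. cauchy_density t * u (x + y * t)) =
      (1/y) * (LBINT s. cauchy_density (- x / y + 1/y * s) * u (x + y * (- x / y + 1/y * s)))"
    using assms by (subst lborel_integral_real_affine[where c="1/y" and t="-x/y"]) auto
  also have "\<dots> = (LBINT s. (1/y) * (cauchy_density ((s - x) / y) * u s))"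
    using assms by (simp add: field_simps)
  also have "\<dots> = (LBINT s. poisson_kernel y (x - s) * u s)"
    using assms by (intro Bochner_Integration.integral_cong)
      (simp_all add: cauchy_density_scale poisson_kernel_def power2_commute)
  finally show ?thesis .
qed

lemma nn_integral_poisson_kernel_1:
  assumes "y > 0" shows "(\<integral>\<^sup>+ s. ennreal (poisson_kernel y (x - s)) \<partial>lborel) = 1"
proof -
  have "1 = (\<integral>\<^sup>+ s. ennreal (poisson_kernel y s) \<partial>lborel)"
    using nn_integral_poisson_kernel[of "\<lambda>_. 1" y] assms nn_integral_cauchy_density by simp
  also have "\<dots> = (\<integral>\<^sup>+ s. ennreal (poisson_kernel y (x - s)) \<partial>lborel)"
    by (subst nn_integral_real_affine[where c="-1" and t=x]) auto
  finally show ?thesis by simp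
qed

text \<open>The circle mean is parametrised over the unit interval, so that no normalisation is needed.\<close>

definition circle_mean :: "(complex \<Rightarrow> 'a::real_normed_vector) \<Rightarrow> complex \<Rightarrow> real \<Rightarrow> 'a" where
  "circle_mean u z r = integral {0..1} (\<lambda>t. u (z + of_real r * cis (2 * pi * t)))"

lemma circle_point_in_cball: "r \<ge> 0 \<Longrightarrow> z + of_real r * cis t \<in> cball z r"
  by (simp add: dist_norm norm_mult)

lemma continuous_on_circle_point [continuous_intros]:
  "continuous_on A (\<lambda>t. z + of_real r * cis (2 * pi * t))"
  unfolding cis_conv_exp by (intro continuous_intros)

lemma continuous_on_circle:
  assumes "continuous_on S u" "r \<ge> 0" "cball z r \<subseteq> S"
  shows "continuous_on A (\<lambda>t. u (z + of_real r * cis (2 * pi * t)))"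
  using assms circle_point_in_cball[of r z]
  by (intro continuous_on_compose2[OF assms(1) continuous_on_circle_point]) blast

lemma has_integral_circle_mean:
  fixes u :: "complex \<Rightarrow> 'a::banach"
  assumes "continuous_on S u" "r \<ge> 0" "cball z r \<subseteq> S"
  shows "((\<lambda>t. u (z + of_real r * cis (2 * pi * t))) has_integral circle_mean u z r) {0..1}"
  unfolding circle_mean_def
  by (intro integrable_integral integrable_continuous_interval continuous_on_circle[OF assms])

lemma circle_mean_holomorphic:
  assumes "g holomorphic_on cball z r" "r > 0"
  shows "((\<lambda>t. g (z + of_real r * cis (2 * pi * t))) has_integral g z) {0..1}"
proof -
  have "((\<lambda>u. g u / (u - z)) has_contour_integral 2 * of_real pi * \<i> * g z) (circlepath z r)"
    using assms by (intro Cauchy_integral_circlepath_simple) auto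
  hence "((\<lambda>t. 1 / (2 * of_real pi * \<i>) * (g (circlepath z r t) / (circlepath z r t - z) *
     vector_derivative (circlepath z r) (at t))) has_integral
      1 / (2 * of_real pi * \<i>) * (2 * of_real pi * \<i> * g z)) {0..1}"
    unfolding has_contour_integral by (intro has_integral_mult_right)
  moreover have "1 / (2 * of_real pi * \<i>) * (g (circlepath z r t) / (circlepath z r t - z) *
     vector_derivative (circlepath z r) (at t)) = g (z + of_real r * cis (2 * pi * t))" for t
  proof -
    have e: "circlepath z r t = z + of_real r * cis (2 * pi * t)"
      by (simp add: circlepath cis_conv_exp mult_ac)
    have v: "vector_derivative (circlepath z r) (at t) =
        2 * of_real pi * \<i> * (of_real r * cis (2 * pi * t))"
      by (simp add: vector_derivative_circlepath cis_conv_exp mult_ac)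
    show ?thesis using assms(2) unfolding v e by simp
  qed
  ultimately show ?thesis by simp
qed

lemma circle_mean_harmonic:
  assumes "g holomorphic_on cball z r" "r > 0"
  shows "((\<lambda>t. Re (g (z + of_real r * cis (2 * pi * t)))) has_integral Re (g z)) {0..1}"
  using has_integral_linear[OF circle_mean_holomorphic[OF assms] bounded_linear_Re]
  by (simp add: o_def)

section \<open>Subharmonicity, the maximum principle and the Poisson majorant\<close>

definition locally_submean :: "(complex \<Rightarrow> real) \<Rightarrow> complex \<Rightarrow> bool" where
  "locally_submean u z \<longleftrightarrow> (\<exists>r0>0. \<forall>r. 0 < r \<and> r < r0 \<longrightarrow> u z \<le> circle_mean u z r)"

text \<open>A positive maximum would be attained in the open half plane, since \<open>w\<close> is
  nonpositive on the real line and far out. Among the points attaining it take one of least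
  imaginary part: the sub-mean inequality makes \<open>w\<close> constant on a small circle around
  it, and the lowest point of that circle contradicts the choice.\<close>

lemma halfplane_maximum_principle:
  fixes w :: "complex \<Rightarrow> real"
  assumes cont: "continuous_on {z. Im z \<ge> 0} w"
    and sub: "\<And>z. Im z > 0 \<Longrightarrow> locally_submean w z"
    and bdry: "\<And>x. w (of_real x) \<le> 0"
    and infty: "\<And>z. Im z \<ge> 0 \<Longrightarrow> norm z \<ge> R \<Longrightarrow> w z \<le> 0"
    and z: "Im z \<ge> 0"
  shows "w z \<le> 0"
proof (rule ccontr)
  assume neg: "\<not> w z \<le> 0"
  define H where "H = {z. Im z \<ge> 0} \<inter> cball 0 (max R 0)"
  have clH: "closed {z. Im z \<ge> 0}" by (rule closed_halfspace_Im_ge)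
  have compH: "compact H" unfolding H_def by (intro closed_Int_compact clH) auto
  have "norm z < R" using neg infty[of z] z by (meson not_le)
  hence zH: "z \<in> H" using z by (simp add: H_def)
  obtain z1 where z1: "z1 \<in> H" "\<And>v. v \<in> H \<Longrightarrow> w v \<le> w z1"
    using continuous_attains_sup[OF compH, of w] zH cont
    by (metis H_def Int_lower1 continuous_on_subset empty_iff)
  have m_pos: "w z1 > 0" using z1(2)[OF zH] neg by linarith
  have max: "w v \<le> w z1" if "Im v \<ge> 0" for v
    using z1(2)[of v] infty[of v] that m_pos by (cases "v \<in> H") (auto simp: H_def max_def split: if_splits)
  define K where "K = {v \<in> H. w v \<ge> w z1}"
  have "closed K" unfolding K_def
    using continuous_on_subset[OF cont, of H] compact_imp_closed[OF compH]
    by (intro continuous_on_closed_Collect_le) (auto simp: H_def)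
  hence compK: "compact K" using compH by (metis K_def compact_Int_closed inf.absorb_iff2 mem_Collect_eq subsetI)
  have "K \<noteq> {}" using z1 by (auto simp: K_def)
  then obtain a where a: "a \<in> K" "\<And>v. v \<in> K \<Longrightarrow> Im a \<le> Im v"
    using continuous_attains_inf[OF compK, of Im] continuous_on_Im[OF continuous_on_id, of K] by blast
  have Ima: "Im a > 0"
  proof (rule ccontr)
    assume "\<not> Im a > 0"
    hence "Im a = 0" using a by (auto simp: K_def H_def)
    hence "a = of_real (Re a)" by (simp add: complex_eq_iff)
    thus False using bdry[of "Re a"] a m_pos by (simp add: K_def)
  qed
  obtain r0 where r0: "r0 > 0" "\<And>r. 0 < r \<Longrightarrow> r < r0 \<Longrightarrow> w a \<le> circle_mean w a r"
    using sub[OF Ima] by (auto simp: locally_submean_def)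
  define r where "r = min r0 (Im a) / 2"
  have r: "0 < r" "r < r0" "r < Im a" using r0 Ima by (auto simp: r_def)
  have sub': "cball a r \<subseteq> {z. Im z \<ge> 0}"
  proof
    fix v assume "v \<in> cball a r"
    hence "\<bar>Im (a - v)\<bar> \<le> r" using abs_Im_le_cmod[of "a - v"] by (simp add: dist_norm)
    thus "v \<in> {z. Im z \<ge> 0}" using r by auto
  qed
  have wa: "w a = w z1" using a max by (force simp: K_def H_def)
  define f where "f t = w z1 - w (a + of_real r * cis (2 * pi * t))" for t
  have contf: "continuous_on {0..1} f"
    unfolding f_def using continuous_on_circle[OF cont _ sub'] r by (intro continuous_intros) auto
  have f0: "f t \<ge> 0" for t
    using max sub' circle_point_in_cball[of r a] r unfolding f_def by (force)
  have "(f has_integral (w z1 - circle_mean w a r)) {0..1}"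
    unfolding f_def using has_integral_const_real[of "w z1" 0 1]
    by (intro has_integral_diff has_integral_circle_mean[OF cont _ sub']) (use r in auto)
  hence i: "integral {0..1} f = w z1 - circle_mean w a r" by (rule integral_unique)
  have "integral {0..1} f \<ge> 0" by (intro integral_nonneg integrable_continuous_interval contf f0)
  hence "integral {0..1} f = 0" using i r0(2)[OF r(1,2)] wa by linarith
  \<comment> \<open>\<open>f\<close> is continuous and nonnegative with integral 0, hence vanishes.
    The parameter 3/4 is the bottom of the circle.\<close>
  hence "f (3/4) = 0" using contf f0 by (subst (asm) integral_eq_0_iff) auto
  moreover have "cis (2 * pi * (3/4)) = - \<i>"
  proof -
    have a: "2 * pi * (3/4) = 3/2 * pi" by simp
    show ?thesis unfolding a by (rule complex_eqI) (simp_all only: cis.simps cos_3over2_pi sin_3over2_pi, simp_all)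
  qed
  moreover have "a + of_real r * (- \<i>) = a - \<i> * of_real r" by simp
  ultimately have e: "w (a - \<i> * of_real r) = w z1" unfolding f_def by (metis eq_iff_diff_eq_0)
  have "norm (a - \<i> * of_real r) < R" using e infty[of "a - \<i> * of_real r"] m_pos r
    by (intro not_le_imp_less notI) auto
  hence "a - \<i> * of_real r \<in> K" using e r by (simp add: K_def H_def)
  from a(2)[OF this] r show False by simp
qed

text \<open>Writing the Poisson integral with the fixed density and the argument Re z + (Im z) t,
  instead of with the kernel of height Im z, makes it meaningful at Im z = 0 too, where it returns
  \<open>u\<close>. Continuity up to the real line is then dominated convergence.\<close>

lemma continuous_on_poisson_integral:
  fixes u :: "real \<Rightarrow> real"
  assumes cont: "continuous_on UNIV u" and bd: "\<And>x. \<bar>u x\<bar> \<le> K"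
  shows "continuous_on A (\<lambda>z. LBINT t. cauchy_density t * u (Re z + Im z * t))"
proof (rule continuous_at_imp_continuous_on, intro ballI)
  fix z
  have [measurable]: "u \<in> borel_measurable borel" using cont by (rule borel_measurable_continuous_onI)
  show "isCont (\<lambda>z. LBINT t. cauchy_density t * u (Re z + Im z * t)) z"
    unfolding continuous_at_sequentially o_def
  proof (intro allI impI)
    fix X assume X: "X \<longlonglongrightarrow> z"
    show "(\<lambda>n. LBINT t. cauchy_density t * u (Re (X n) + Im (X n) * t)) \<longlonglongrightarrow>
      (LBINT t. cauchy_density t * u (Re z + Im z * t))"
    proof (rule integral_dominated_convergence[where w="\<lambda>t. cauchy_density t * K"])
      show "integrable lborel (\<lambda>t. cauchy_density t * K)"
        using has_bochner_integral_cauchy_density by (auto simp: has_bochner_integral_iff)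
      show "AE t in lborel. (\<lambda>n. cauchy_density t * u (Re (X n) + Im (X n) * t))
          \<longlonglongrightarrow> cauchy_density t * u (Re z + Im z * t)"
        by (intro AE_I2 tendsto_mult tendsto_const continuous_on_tendsto_compose[OF cont]
            tendsto_add tendsto_Re tendsto_Im X) auto
      show "AE t in lborel. norm (cauchy_density t * u (Re (X n) + Im (X n) * t)) \<le> cauchy_density t * K" for n
        using bd by (intro AE_I2) (auto simp: abs_mult intro!: mult_left_mono)
    qed measurable
  qed
qed

text \<open>As the real part of a function of z that is holomorphic away from s, the kernel inherits
  the mean value property from Cauchy's formula.\<close>

lemma poisson_kernel_eq_Re:
  "poisson_kernel (Im z) (Re z - s) = Re (\<i> / (of_real pi * (z - of_real s)))"
proof -
  have "Re (\<i> / (of_real pi * (z - of_real s)))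
     = (pi * Im z) / ((pi * (Re z - s))\<^sup>2 + (pi * Im z)\<^sup>2)"
    by (simp add: Re_divide)
  also have "\<dots> = (pi * Im z) / (pi * (pi * ((Re z - s)\<^sup>2 + (Im z)\<^sup>2)))"
    by (simp add: power2_eq_square algebra_simps)
  finally show ?thesis by (simp add: poisson_kernel_def)
qed

lemma circle_mean_poisson_kernel:
  assumes "0 < r" "r < Im z"
  shows "((\<lambda>t. poisson_kernel (Im z + r * sin (2 * pi * t)) (Re z + r * cos (2 * pi * t) - s))
     has_integral poisson_kernel (Im z) (Re z - s)) {0..1}"
proof -
  have pos: "Im v > 0" if "v \<in> cball z r" for v
    using abs_Im_le_cmod[of "z - v"] that assms by (auto simp: dist_norm)
  have "v - of_real s \<noteq> 0" if "v \<in> cball z r" for v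
    using pos[OF that] by (metis Im_complex_of_real eq_iff_diff_eq_0 less_irrefl)
  hence "((\<lambda>t. Re (\<i> / (of_real pi * ((z + of_real r * cis (2 * pi * t)) - of_real s))))
     has_integral Re (\<i> / (of_real pi * (z - of_real s)))) {0..1}"
    using assms by (intro circle_mean_harmonic holomorphic_intros) auto
  moreover have "Re (\<i> / (of_real pi * ((z + of_real r * cis (2 * pi * t)) - of_real s))) =
     poisson_kernel (Im z + r * sin (2 * pi * t)) (Re z + r * cos (2 * pi * t) - s)" for t
    using poisson_kernel_eq_Re[of "z + of_real r * cis (2 * pi * t)" s] by simp
  ultimately show ?thesis using poisson_kernel_eq_Re[of z s] assms by simp
qed


text \<open>The mean value property of the kernel is integrated against \<open>u\<close>. Fubini
  applies because at every point of the circle the kernel has mass 1, and \<open>u\<close> is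
  bounded by \<open>K\<close>.\<close>

lemma circle_mean_poisson_integral:
  fixes u :: "real \<Rightarrow> real"
  assumes cont: "continuous_on UNIV u" and bd: "\<And>x. \<bar>u x\<bar> \<le> K" and r: "0 < r" "r < Im z"
  defines "P \<equiv> \<lambda>z. LBINT t. cauchy_density t * u (Re z + Im z * t)"
  shows "circle_mean P z r = P z"
proof -
  define k where "k t s = poisson_kernel (Im z + r * sin (2 * pi * t)) (Re z + r * cos (2 * pi * t) - s)" for t s
  have [measurable]: "u \<in> borel_measurable borel" using cont by (rule borel_measurable_continuous_onI)
  have pos: "Im z + r * sin x > 0" for x
  proof -
    have "r * (- sin x) \<le> r * 1" using r sin_ge_minus_one[of x] by (intro mult_left_mono) linarith+
    thus ?thesis using r by linarith
  qed
  have K: "K \<ge> 0" using bd[of 0] by linarith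
  have k0: "k t s \<ge> 0" for t s unfolding k_def by (intro poisson_kernel_nonneg less_imp_le pos)
  have [measurable]: "case_prod k \<in> borel_measurable (lborel \<Otimes>\<^sub>M lborel)"
    unfolding k_def by measurable
  define f where "f t s = indicator {0..1::real} t * (k t s * u s)" for t s
  have fm[measurable]: "case_prod f \<in> borel_measurable (lborel \<Otimes>\<^sub>M lborel)"
    unfolding f_def by measurable
  have "(\<integral>\<^sup>+ x. ennreal (norm (case_prod f x)) \<partial>(lborel \<Otimes>\<^sub>M lborel)) =
        (\<integral>\<^sup>+ t. \<integral>\<^sup>+ s. ennreal (norm (f t s)) \<partial>lborel \<partial>lborel)"
    by (subst lborel.nn_integral_fst[symmetric]) auto
  also have "\<dots> \<le> (\<integral>\<^sup>+ t. \<integral>\<^sup>+ s. indicator {0..1} t * ennreal K * ennreal (k t s) \<partial>lborel \<partial>lborel)"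
  proof (intro nn_integral_mono)
    fix t s
    have "k t s * \<bar>u s\<bar> \<le> K * k t s" using bd[of s] k0[of t s] by (metis mult.commute mult_right_mono)
    thus "ennreal (norm (f t s)) \<le> indicator {0..1} t * ennreal K * ennreal (k t s)"
      using k0[of t s] K by (auto simp: f_def indicator_def abs_mult ennreal_mult'[symmetric] intro!: ennreal_leI)
  qed
  also have "\<dots> = (\<integral>\<^sup>+ t. indicator {0..1::real} t * ennreal K * 1 \<partial>lborel)"
  proof (rule nn_integral_cong)
    fix t
    show "(\<integral>\<^sup>+ s. indicator {0..1} t * ennreal K * ennreal (k t s) \<partial>lborel) = indicator {0..1} t * ennreal K * 1"
      unfolding k_def using pos[of "2 * pi * t"]
      by (subst nn_integral_cmult) (simp_all add: nn_integral_poisson_kernel_1)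
  qed
  also have "\<dots> = ennreal K"
    by (simp add: nn_integral_multc)
  finally have "(\<integral>\<^sup>+ x. ennreal (norm (case_prod f x)) \<partial>(lborel \<Otimes>\<^sub>M lborel)) < \<infinity>"
    by (rule le_less_trans) simp
  hence int: "integrable (lborel \<Otimes>\<^sub>M lborel) (case_prod f)"
    by (intro integrableI_bounded) auto
  have PZ: "P (z + of_real r * cis (2 * pi * t)) = (LBINT s. k t s * u s)" for t
    unfolding P_def k_def using integral_poisson_kernel[OF pos, of u "Re z + r * cos (2 * pi * t)" "2 * pi * t"]
    by simp
  have contP: "continuous_on UNIV P" unfolding P_def by (rule continuous_on_poisson_integral[OF cont bd])
  have "circle_mean P z r = (LBINT t:{0..1}. P (z + of_real r * cis (2 * pi * t)))"
    unfolding circle_mean_def using r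
    by (intro set_borel_integral_eq_integral(2)[symmetric] borel_integrable_atLeastAtMost')
       (auto intro!: continuous_on_circle[OF contP])
  also have "\<dots> = (LBINT t. LBINT s. f t s)"
    by (simp add: PZ set_lebesgue_integral_def f_def)
  also have "\<dots> = (LBINT s. LBINT t. f t s)"
    by (rule lborel_pair.Fubini_integral[OF int, symmetric])
  also have "\<dots> = (LBINT s. poisson_kernel (Im z) (Re z - s) * u s)"
  proof (rule Bochner_Integration.integral_cong[OF refl])
    fix s
    have hi: "((\<lambda>t. k t s) has_integral poisson_kernel (Im z) (Re z - s)) {0..1}"
      unfolding k_def by (rule circle_mean_poisson_kernel[OF r])
    have ck: "continuous_on {0..1} (\<lambda>t. k t s)"
      unfolding k_def poisson_kernel_def
      using pos by (auto intro!: continuous_intros simp: add_nonneg_eq_0_iff less_imp_neq[symmetric])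
    have "(LBINT t. f t s) = (LBINT t:{0..1}. k t s) * u s"
      by (simp add: f_def set_lebesgue_integral_def mult.assoc[symmetric])
    also have "(LBINT t:{0..1}. k t s) = poisson_kernel (Im z) (Re z - s)"
      using set_borel_integral_eq_integral(2)[OF borel_integrable_atLeastAtMost'[OF ck]] hi
      by (simp add: integral_unique)
    finally show "(LBINT t. f t s) = poisson_kernel (Im z) (Re z - s) * u s" .
  qed
  also have "\<dots> = P z" unfolding P_def using r by (intro integral_poisson_kernel[symmetric]) auto
  finally show ?thesis .
qed

text \<open>The half plane is unbounded, so the maximum principle is applied to u - P - e L, where P
  is the Poisson integral and L = log |z + i| is harmonic, nonnegative on the real line and tends to
  infinity. Letting e tend to 0 removes L.\<close>

lemma submean_le_poisson_integral:
  fixes u :: "complex \<Rightarrow> real"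
  assumes cont: "continuous_on {z. Im z \<ge> 0} u"
    and bd: "\<And>z. Im z \<ge> 0 \<Longrightarrow> \<bar>u z\<bar> \<le> K"
    and sub: "\<And>z. Im z > 0 \<Longrightarrow> locally_submean u z"
    and z: "Im z \<ge> 0"
  shows "u z \<le> (LBINT t. cauchy_density t * u (of_real (Re z + Im z * t)))"
proof -
  define u0 where "u0 x = u (of_real x)" for x
  define P where "P z = (LBINT t. cauchy_density t * u0 (Re z + Im z * t))" for z
  have c0: "continuous_on UNIV u0"
    unfolding u0_def by (intro continuous_on_compose2[OF cont] continuous_intros) auto
  have [measurable]: "u0 \<in> borel_measurable borel" using c0 by (rule borel_measurable_continuous_onI)
  have b0: "\<bar>u0 x\<bar> \<le> K" for x unfolding u0_def by (intro bd) auto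
  have K0: "K \<ge> 0" using b0[of 0] by linarith
  have contP: "continuous_on A P" for A
    unfolding P_def by (rule continuous_on_poisson_integral[OF c0 b0])
  have intk: "integrable lborel (\<lambda>t. cauchy_density t * K)"
    using has_bochner_integral_cauchy_density by (auto simp: has_bochner_integral_iff)
  have Pge: "P z \<ge> - K" for z
  proof -
    have "norm (P z) \<le> (LBINT t. cauchy_density t * K)"
      unfolding P_def
      by (rule order_trans[OF integral_norm_bound integral_mono'[OF intk]])
         (use b0 K0 in \<open>auto simp: abs_mult intro!: mult_left_mono mult_nonneg_nonneg\<close>)
    also have "\<dots> = K" using has_bochner_integral_cauchy_density by (auto simp: has_bochner_integral_iff)
    finally show ?thesis by simp
  qed
  define L where "L z = Re (Ln (z + \<i>))" for z
  have L: "L z = ln (norm (z + \<i>))" if "Im z \<ge> 0" for z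
  proof -
    have "z + \<i> \<noteq> 0" using that by (auto simp: complex_eq_iff)
    thus ?thesis by (simp add: L_def)
  qed
  have holL: "(\<lambda>z. Ln (z + \<i>)) holomorphic_on {z. Im z > -1}"
    by (intro holomorphic_intros) (auto simp: complex_nonpos_Reals_iff)
  have contL: "continuous_on {z. Im z \<ge> 0} L"
    unfolding L_def by (intro continuous_intros continuous_on_subset[OF holomorphic_on_imp_continuous_on[OF holL]]) auto
  have main: "u z - P z \<le> e * L z" if e: "e > 0" for e
  proof -
    define w where "w z = u z - P z - e * L z" for z
    have contw: "continuous_on {z. Im z \<ge> 0} w"
      unfolding w_def by (intro continuous_intros cont contP contL)
    \<comment> \<open>Beyond \<open>R\<close> the term e L is at least 2 K, and u - P is at most 2
      K.\<close>
    define R where "R = exp (2 * K / e) + 1"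
    have "w z \<le> 0"
    proof (rule halfplane_maximum_principle[OF contw _ _ _ z, of R])
      fix z :: complex assume z: "Im z > 0"
      then obtain r0 where r0: "r0 > 0" "\<And>r. 0 < r \<Longrightarrow> r < r0 \<Longrightarrow> u z \<le> circle_mean u z r"
        using sub[OF z] unfolding locally_submean_def by blast
      show "locally_submean w z" unfolding locally_submean_def
      proof (intro exI conjI allI impI)
        show "min r0 (Im z) > 0" using r0 z by auto
        fix r assume r: "0 < r \<and> r < min r0 (Im z)"
        have sub': "cball z r \<subseteq> {z. Im z \<ge> 0}"
        proof
          fix v assume "v \<in> cball z r"
          hence "\<bar>Im (z - v)\<bar> \<le> r" using abs_Im_le_cmod[of "z - v"] by (simp add: dist_norm)
          thus "v \<in> {z. Im z \<ge> 0}" using r by auto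
        qed
        have 1: "((\<lambda>t. u (z + of_real r * cis (2 * pi * t))) has_integral circle_mean u z r) {0..1}"
          using r by (intro has_integral_circle_mean[OF cont _ sub']) auto
        have 2: "((\<lambda>t. P (z + of_real r * cis (2 * pi * t))) has_integral P z) {0..1}"
          using has_integral_circle_mean[OF contP, of r z UNIV] r
            circle_mean_poisson_integral[OF c0 b0, of r z] unfolding P_def by simp
        have 3: "((\<lambda>t. L (z + of_real r * cis (2 * pi * t))) has_integral L z) {0..1}"
          unfolding L_def using r sub'
          by (intro circle_mean_harmonic holomorphic_on_subset[OF holL]) force+
        have "((\<lambda>t. w (z + of_real r * cis (2 * pi * t))) has_integral
            circle_mean u z r - P z - e * L z) {0..1}"
          unfolding w_def by (intro has_integral_diff has_integral_mult_right 1 2 3)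
        hence "circle_mean w z r = circle_mean u z r - P z - e * L z"
          unfolding circle_mean_def by (rule integral_unique)
        thus "w z \<le> circle_mean w z r" using r0(2)[of r] r by (simp add: w_def)
      qed
    next
      fix x :: real
      have "P (of_real x) = u (of_real x)"
        using has_bochner_integral_cauchy_density by (simp add: P_def u0_def has_bochner_integral_iff)
      moreover have "norm (of_real x + \<i>) \<ge> 1"
        using abs_Im_le_cmod[of "of_real x + \<i>"] by simp
      ultimately show "w (of_real x) \<le> 0" using L[of "of_real x"] e by (simp add: w_def)
    next
      fix z :: complex assume z: "Im z \<ge> 0" "norm z \<ge> R"
      have "norm (z + \<i>) \<ge> exp (2 * K / e)"
        using z norm_triangle_ineq4[of "z + \<i>" \<i>] by (simp add: R_def)
      hence "ln (norm (z + \<i>)) \<ge> ln (exp (2 * K / e))"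
        using exp_gt_zero less_le_trans by (subst ln_le_cancel_iff) blast+
      hence "L z \<ge> 2 * K / e" using L[OF z(1)] by simp
      hence "e * L z \<ge> 2 * K" using e by (simp add: field_simps)
      thus "w z \<le> 0" using Pge[of z] bd[OF z(1)] by (simp add: w_def)
    qed
    thus ?thesis by (simp add: w_def)
  qed
  have "((\<lambda>e. e * L z) \<longlongrightarrow> 0 * L z) (at_right 0)"
    by (intro tendsto_intros)
  hence "u z - P z \<le> 0 * L z"
    by (rule tendsto_lowerbound) (auto simp: eventually_at_filter main intro!: always_eventually)
  thus ?thesis by (simp add: P_def u0_def)
qed

text \<open>Away from zeros \<open>h\<close> has a local holomorphic logarithm g, so |h|^q = |exp (q
  g)|, and the mean value property of exp (q g) gives the claim by the triangle inequality. At a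
  zero the left side is 0.\<close>

lemma locally_submean_norm_powr:
  assumes "open U" "h holomorphic_on U" "z \<in> U" "q > 0"
  shows "locally_submean (\<lambda>z. norm (h z) powr q) z"
proof (cases "h z = 0")
  case True
  \<comment> \<open>The integral of a non-integrable function is 0 by convention, so the mean is
    nonnegative in either case.\<close>
  have "circle_mean (\<lambda>z. norm (h z) powr q) z r \<ge> 0" for r
    unfolding circle_mean_def
    by (cases "(\<lambda>t. norm (h (z + of_real r * cis (2 * pi * t))) powr q) integrable_on {0..1}")
       (auto intro: integral_nonneg simp: not_integrable_integral)
  thus ?thesis using True by (auto simp: locally_submean_def intro!: exI[of _ 1])
next
  case False
  have "continuous_on U h" using assms by (intro holomorphic_on_imp_continuous_on)
  hence "open (h -` (-{0}) \<inter> U)" using assms(1) continuous_on_open_vimage open_Compl closed_singleton by blast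
  moreover have "z \<in> h -` (-{0}) \<inter> U" using False assms by simp
  ultimately obtain R where R: "R > 0" "ball z R \<subseteq> h -` (-{0}) \<inter> U"
    using openE by blast
  obtain g where g: "g holomorphic_on ball z R" "\<And>v. v \<in> ball z R \<Longrightarrow> h v = exp (g v)"
  proof (rule contractible_imp_holomorphic_log)
    show "h holomorphic_on ball z R" using R assms by (auto intro: holomorphic_on_subset)
    show "contractible (ball z R)" by (simp add: convex_imp_contractible)
    show "h v \<noteq> 0" if "v \<in> ball z R" for v using R(2) that by blast
  qed blast
  have eq: "norm (h v) powr q = norm (exp (of_real q * g v))" if "v \<in> ball z R" for v
    using g(2)[OF that] by (simp add: powr_def)
  show ?thesis unfolding locally_submean_def
  proof (intro exI conjI allI impI)
    show "R > 0" by (rule R)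
    fix r assume r: "0 < r \<and> r < R"
    hence sub: "cball z r \<subseteq> ball z R" by auto
    have hol: "(\<lambda>v. exp (of_real q * g v)) holomorphic_on cball z r"
      by (intro holomorphic_intros holomorphic_on_subset[OF g(1) sub])
    have 1: "((\<lambda>t. exp (of_real q * g (z + of_real r * cis (2 * pi * t)))) has_integral exp (of_real q * g z)) {0..1}"
      using circle_mean_holomorphic[OF hol] r by blast
    have 2: "circle_mean (\<lambda>z. norm (h z) powr q) z r =
       integral {0..1} (\<lambda>t. norm (exp (of_real q * g (z + of_real r * cis (2 * pi * t)))))"
      unfolding circle_mean_def using r circle_point_in_cball[of r z] sub
      by (intro integral_cong eq) (metis less_imp_le subsetD)
    have c: "continuous_on {0..1} (\<lambda>t. norm (exp (of_real q * g (z + of_real r * cis (2 * pi * t)))))"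
      using continuous_on_circle[OF holomorphic_on_imp_continuous_on[OF hol], of r z] r
      by (intro continuous_on_norm) auto
    have "norm (exp (of_real q * g z)) \<le>
       integral {0..1} (\<lambda>t. norm (exp (of_real q * g (z + of_real r * cis (2 * pi * t)))))"
      unfolding integral_unique[OF 1, symmetric]
      by (rule integral_norm_bound_integral)
         (use 1 c in \<open>auto intro: integrable_continuous_interval\<close>)
    thus "norm (h z) powr q \<le> circle_mean (\<lambda>z. norm (h z) powr q) z r"
      using 2 eq[of z] r by simp
  qed
qed

lemma norm_powr_le_poisson_integral:
  assumes U: "open U" "{z. Im z \<ge> 0} \<subseteq> U" and h: "h holomorphic_on U" and q: "q > 0"
    and bd: "\<And>z. Im z \<ge> 0 \<Longrightarrow> norm (h z) \<le> K" and y: "y \<ge> 0"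
  shows "ennreal (norm (h (Complex x y)) powr q) \<le>
    (\<integral>\<^sup>+ t. ennreal (cauchy_density t) * ennreal (norm (h (of_real (x + y * t))) powr q) \<partial>lborel)"
proof -
  let ?u = "\<lambda>z. norm (h z) powr q"
  have ch: "continuous_on {z. Im z \<ge> 0} h"
    using holomorphic_on_imp_continuous_on[OF h] U continuous_on_subset by blast
  have c: "continuous_on {z. Im z \<ge> 0} ?u"
    using q by (intro continuous_on_powr' continuous_intros ch) auto
  have c0: "continuous_on UNIV (\<lambda>t::real. ?u (of_real (x + y * t)))"
    by (intro continuous_on_compose2[OF c] continuous_intros) auto
  have [measurable]: "(\<lambda>t::real. ?u (of_real (x + y * t))) \<in> borel_measurable borel"
    using c0 by (rule borel_measurable_continuous_onI)
  have b: "\<bar>?u z\<bar> \<le> K powr q" if "Im z \<ge> 0" for z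
    using bd[OF that] q by (auto intro!: powr_mono2)
  have "?u (Complex x y) \<le> (LBINT t. cauchy_density t * ?u (of_real (Re (Complex x y) + Im (Complex x y) * t)))"
    using y U h q by (intro submean_le_poisson_integral[OF c b] locally_submean_norm_powr[where U=U]) auto
  also have "\<dots> = (LBINT t. cauchy_density t * ?u (of_real (x + y * t)))" by simp
  finally have "ennreal (?u (Complex x y)) \<le> ennreal (LBINT t. cauchy_density t * ?u (of_real (x + y * t)))"
    by (rule ennreal_leI)
  also have "\<dots> = (\<integral>\<^sup>+ t. ennreal (cauchy_density t * ?u (of_real (x + y * t))) \<partial>lborel)"
  proof (rule nn_integral_eq_integral[symmetric])
    have "integrable lborel (\<lambda>t. cauchy_density t * K powr q)"
      using has_bochner_integral_cauchy_density by (auto simp: has_bochner_integral_iff)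
    thus "integrable lborel (\<lambda>t. cauchy_density t * ?u (of_real (x + y * t)))"
      by (rule Bochner_Integration.integrable_bound)
         (use b in \<open>auto simp del: of_real_add simp: abs_mult intro!: mult_left_mono\<close>)
  qed auto
  finally show ?thesis by (simp add: ennreal_mult')
qed

text \<open>This half of the semigroup law serves the maximal inequality. It is the Poisson majorant
  for minus the kernel at height Im z + b, which is harmonic and bounded on the closed half plane;
  the minus sign gives the direction of the inequality.\<close>

lemma poisson_kernel_semigroup_le:
  assumes "a > 0" "b > 0"
  shows "(\<integral>\<^sup>+ t. ennreal (cauchy_density t) * ennreal (poisson_kernel b (x + a * t)) \<partial>lborel)
     \<le> ennreal (poisson_kernel (a + b) x)"
proof -
  define u where "u z = - poisson_kernel (Im z + b) (Re z)" for z
  have u_eq: "u z = Re (- (\<i> / (of_real pi * (z + \<i> * of_real b))))" for z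
    using poisson_kernel_eq_Re[of "z + \<i> * of_real b" 0] by (simp add: u_def)
  have nz: "z + \<i> * of_real b \<noteq> 0" if "Im z \<ge> 0" for z
    using that assms by (auto simp: complex_eq_iff)
  have hol: "(\<lambda>z. - (\<i> / (of_real pi * (z + \<i> * of_real b)))) holomorphic_on {z. Im z \<ge> 0}"
    using nz by (intro holomorphic_intros) auto
  have c: "continuous_on {z. Im z \<ge> 0} u"
    unfolding u_eq by (intro continuous_on_Re holomorphic_on_imp_continuous_on[OF hol])
  have bd: "\<bar>u z\<bar> \<le> 1 / (pi * b)" if "Im z \<ge> 0" for z
  proof -
    have "(Im z + b) * b \<le> (Im z + b) * (Im z + b)" using that assms by (intro mult_left_mono) auto
    hence "(Im z + b) * b \<le> (Re z)\<^sup>2 + (Im z + b)\<^sup>2" by (simp add: power2_eq_square add_increasing)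
    moreover have "(Re z)\<^sup>2 + (Im z + b)\<^sup>2 > 0" using that assms by (intro add_nonneg_pos) auto
    ultimately have "(Im z + b) / ((Re z)\<^sup>2 + (Im z + b)\<^sup>2) \<le> 1 / b"
      using assms by (simp add: field_simps)
    hence "(1 / pi) * ((Im z + b) / ((Re z)\<^sup>2 + (Im z + b)\<^sup>2)) \<le> (1 / pi) * (1 / b)"
      by (intro mult_left_mono) auto
    thus ?thesis using that assms by (simp add: u_def poisson_kernel_def)
  qed
  have "u (Complex x a) \<le> (LBINT t. cauchy_density t * u (of_real (Re (Complex x a) + Im (Complex x a) * t)))"
  proof (rule submean_le_poisson_integral[OF c bd])
    fix z :: complex assume z: "Im z > 0"
    show "locally_submean u z" unfolding locally_submean_def
    proof (intro exI conjI allI impI)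
      fix r assume r: "0 < r \<and> r < Im z"
      have sub': "cball z r \<subseteq> {z. Im z \<ge> 0}"
      proof
        fix v assume "v \<in> cball z r"
        hence "\<bar>Im (z - v)\<bar> \<le> r" using abs_Im_le_cmod[of "z - v"] by (simp add: dist_norm)
        thus "v \<in> {z. Im z \<ge> 0}" using r by auto
      qed
      have "circle_mean u z r = u z" unfolding circle_mean_def u_eq
        using r by (intro integral_unique circle_mean_harmonic holomorphic_on_subset[OF hol sub']) auto
      thus "u z \<le> circle_mean u z r" by simp
    qed (use z in auto)
  qed (use assms in auto)
  hence le: "(LBINT t. cauchy_density t * poisson_kernel b (x + a * t)) \<le> poisson_kernel (a + b) x"
    by (simp add: u_def)
  have "(\<integral>\<^sup>+ t. ennreal (cauchy_density t) * ennreal (poisson_kernel b (x + a * t)) \<partial>lborel)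
    = (\<integral>\<^sup>+ t. ennreal (cauchy_density t * poisson_kernel b (x + a * t)) \<partial>lborel)"
    by (simp add: ennreal_mult')
  also have "\<dots> = ennreal (LBINT t. cauchy_density t * poisson_kernel b (x + a * t))"
  proof (rule nn_integral_eq_integral)
    have "integrable lborel (\<lambda>t. cauchy_density t * (1 / (pi * b)))"
      using has_bochner_integral_cauchy_density by (auto simp: has_bochner_integral_iff)
    thus "integrable lborel (\<lambda>t. cauchy_density t * poisson_kernel b (x + a * t))"
    proof (rule Bochner_Integration.integrable_bound)
      have "\<bar>poisson_kernel b s\<bar> \<le> 1 / (pi * b)" for s using bd[of "of_real s"] by (simp add: u_def)
      thus "AE t in lborel. norm (cauchy_density t * poisson_kernel b (x + a * t)) \<le> norm (cauchy_density t * (1 / (pi * b)))"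
        using assms by (auto simp: abs_mult simp del: times_divide_eq_right intro!: mult_left_mono)
    qed auto
  qed (use assms in \<open>auto intro!: mult_nonneg_nonneg poisson_kernel_nonneg\<close>)
  finally show ?thesis using le by (simp add: ennreal_leI)
qed

section \<open>The maximal function of Poisson averages\<close>

lemma nn_integral_lborel_translate:
  fixes f :: "'a::euclidean_space \<Rightarrow> ennreal"
  assumes [measurable]: "f \<in> borel_measurable borel"
  shows "(\<integral>\<^sup>+ x. f (x + c) \<partial>lborel) = (\<integral>\<^sup>+ x. f x \<partial>lborel)"
proof -
  have "(\<integral>\<^sup>+ x. f x \<partial>lborel) = (\<integral>\<^sup>+ x. f x \<partial>(distr lborel borel ((+) c)))"
    by (simp add: lborel_distr_plus)
  also have "\<dots> = (\<integral>\<^sup>+ x. f (c + x) \<partial>lborel)" by (subst nn_integral_distr) auto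
  finally show ?thesis by (simp add: add.commute)
qed

lemma nn_integral_lborel_uminus:
  fixes f :: "real \<Rightarrow> ennreal"
  assumes "f \<in> borel_measurable borel"
  shows "(\<integral>\<^sup>+ x. f (- x) \<partial>lborel) = (\<integral>\<^sup>+ x. f x \<partial>lborel)"
  using nn_integral_real_affine[of f "-1" 0] assms by simp

text \<open>The Poisson average in the single direction \<open>e\<close> at height
  \<open>\<eta>\<close>. Values in \<open>ennreal\<close> avoid integrability questions. Height 0
  returns \<open>u\<close>, and since the density is even a negative height is as good as a positive
  one.\<close>

definition line_avg :: "'a::euclidean_space \<Rightarrow> real \<Rightarrow> ('a \<Rightarrow> ennreal) \<Rightarrow> 'a \<Rightarrow> ennreal" where
  "line_avg e \<eta> u x = (\<integral>\<^sup>+ t. ennreal (cauchy_density t) * u (x + (\<eta> * t) *\<^sub>R e) \<partial>lborel)"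

lemma line_avg_measurable [measurable (raw)]:
  assumes [measurable]: "u \<in> borel_measurable borel"
  shows "line_avg e \<eta> u \<in> borel_measurable borel"
  unfolding line_avg_def[abs_def] by measurable

lemma line_avg_mono: "(\<And>x. u x \<le> v x) \<Longrightarrow> line_avg e \<eta> u x \<le> line_avg e \<eta> v x"
  unfolding line_avg_def by (intro nn_integral_mono mult_left_mono) auto

lemma line_avg_sum:
  assumes "\<And>i. i \<in> I \<Longrightarrow> u i \<in> borel_measurable borel"
  shows "line_avg e \<eta> (\<lambda>x. \<Sum>i\<in>I. u i x) x = (\<Sum>i\<in>I. line_avg e \<eta> (u i) x)"
proof -
  have "(\<lambda>t. u i (x + (\<eta> * t) *\<^sub>R e)) \<in> borel_measurable borel" if "i \<in> I" for i
    by (rule measurable_compose[OF _ assms[OF that]]) auto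
  thus ?thesis unfolding line_avg_def sum_distrib_left
    by (subst nn_integral_sum[symmetric]) (auto simp: sum_distrib_left)
qed

lemma line_avg_const: "line_avg e \<eta> (\<lambda>_. c) x = c"
  unfolding line_avg_def by (subst nn_integral_multc) (auto simp: nn_integral_cauchy_density)

lemma line_avg_uminus:
  assumes [measurable]: "u \<in> borel_measurable borel"
  shows "line_avg e (- \<eta>) u = line_avg e \<eta> u"
proof
  fix x show "line_avg e (- \<eta>) u x = line_avg e \<eta> u x"
    unfolding line_avg_def
    by (subst nn_integral_lborel_uminus[symmetric]) (auto simp: cauchy_density_def)
qed

text \<open>For fixed t translate \<open>x\<close> by the displacement; the sign this introduces
  disappears because the density is even.\<close>

lemma line_avg_selfadjoint:
  assumes [measurable]: "u \<in> borel_measurable borel" "v \<in> borel_measurable borel"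
  shows "(\<integral>\<^sup>+ x. v x * line_avg e \<eta> u x \<partial>lborel) = (\<integral>\<^sup>+ x. line_avg e \<eta> v x * u x \<partial>lborel)"
proof -
  have "(\<integral>\<^sup>+ x. v x * line_avg e \<eta> u x \<partial>lborel) =
     (\<integral>\<^sup>+ x. \<integral>\<^sup>+ t. v x * (ennreal (cauchy_density t) * u (x + (\<eta> * t) *\<^sub>R e)) \<partial>lborel \<partial>lborel)"
    unfolding line_avg_def by (subst nn_integral_cmult) auto
  also have "\<dots> = (\<integral>\<^sup>+ t. \<integral>\<^sup>+ x. v x * (ennreal (cauchy_density t) * u (x + (\<eta> * t) *\<^sub>R e)) \<partial>lborel \<partial>lborel)"
    by (rule lborel_pair.Fubini') measurable
  also have "\<dots> = (\<integral>\<^sup>+ t. \<integral>\<^sup>+ x. v (x + (- (\<eta> * t)) *\<^sub>R e) * (ennreal (cauchy_density t) * u x) \<partial>lborel \<partial>lborel)"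
  proof (rule nn_integral_cong)
    fix t
    show "(\<integral>\<^sup>+ x. v x * (ennreal (cauchy_density t) * u (x + (\<eta> * t) *\<^sub>R e)) \<partial>lborel) =
      (\<integral>\<^sup>+ x. v (x + (- (\<eta> * t)) *\<^sub>R e) * (ennreal (cauchy_density t) * u x) \<partial>lborel)"
      by (subst nn_integral_lborel_translate[where c="(- (\<eta> * t)) *\<^sub>R e", symmetric]) auto
  qed
  also have "\<dots> = (\<integral>\<^sup>+ t. \<integral>\<^sup>+ x. v (x + (\<eta> * t) *\<^sub>R e) * (ennreal (cauchy_density t) * u x) \<partial>lborel \<partial>lborel)"
    by (subst nn_integral_lborel_uminus[symmetric]) (auto simp: cauchy_density_def)
  also have "\<dots> = (\<integral>\<^sup>+ x. \<integral>\<^sup>+ t. v (x + (\<eta> * t) *\<^sub>R e) * (ennreal (cauchy_density t) * u x) \<partial>lborel \<partial>lborel)"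
    by (rule lborel_pair.Fubini') measurable
  also have "\<dots> = (\<integral>\<^sup>+ x. \<integral>\<^sup>+ t. (ennreal (cauchy_density t) * v (x + (\<eta> * t) *\<^sub>R e)) * u x \<partial>lborel \<partial>lborel)"
    by (simp add: mult_ac)
  also have "\<dots> = (\<integral>\<^sup>+ x. line_avg e \<eta> v x * u x \<partial>lborel)"
    unfolding line_avg_def by (subst nn_integral_multc) auto
  finally show ?thesis .
qed

lemma nn_integral_line_avg:
  assumes [measurable]: "u \<in> borel_measurable borel"
  shows "(\<integral>\<^sup>+ x. line_avg e \<eta> u x \<partial>lborel) = (\<integral>\<^sup>+ x. u x \<partial>lborel)"
  using line_avg_selfadjoint[of u "\<lambda>_. 1" e \<eta>] by (simp add: line_avg_const)

text \<open>Jensen's inequality, from Cauchy-Schwarz with the density split into two square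
  roots.\<close>

lemma line_avg_square_le:
  assumes [measurable]: "u \<in> borel_measurable borel"
  shows "(line_avg e \<eta> u x)\<^sup>2 \<le> line_avg e \<eta> (\<lambda>x. (u x)\<^sup>2) x"
proof -
  let ?f = "\<lambda>t. ennreal (sqrt (cauchy_density t))"
  have f2: "?f t * ?f t = ennreal (cauchy_density t)" for t
    by (simp add: ennreal_mult'[symmetric])
  have "(\<integral>\<^sup>+ t. ?f t * (?f t * u (x + (\<eta> * t) *\<^sub>R e)) \<partial>lborel)\<^sup>2 \<le>
     (\<integral>\<^sup>+ t. (?f t)\<^sup>2 \<partial>lborel) * (\<integral>\<^sup>+ t. (?f t * u (x + (\<eta> * t) *\<^sub>R e))\<^sup>2 \<partial>lborel)"
    by (rule Cauchy_Schwarz_nn_integral) auto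
  moreover have "(?f t * u y)\<^sup>2 = ennreal (cauchy_density t) * (u y)\<^sup>2" for t y
    by (simp add: power2_eq_square f2[symmetric] mult_ac)
  ultimately show ?thesis unfolding line_avg_def
    by (simp add: mult.assoc[symmetric] f2 power2_eq_square[of "?f _"] nn_integral_cauchy_density)
qed

lemma line_avg_poisson:
  assumes [measurable]: "u \<in> borel_measurable borel" and "\<eta> > 0"
  shows "line_avg e \<eta> u x = (\<integral>\<^sup>+ s. ennreal (poisson_kernel \<eta> s) * u (x + s *\<^sub>R e) \<partial>lborel)"
  unfolding line_avg_def using assms by (subst nn_integral_poisson_kernel[symmetric]) auto

lemma line_avg_semigroup_le:
  assumes [measurable]: "u \<in> borel_measurable borel" and ab: "a > 0" "b > 0"
  shows "line_avg e a (line_avg e b u) x \<le> line_avg e (a + b) u x"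
proof -
  have "line_avg e a (line_avg e b u) x = (\<integral>\<^sup>+ t. ennreal (cauchy_density t) *
      (\<integral>\<^sup>+ s. ennreal (poisson_kernel b s) * u (x + (a * t) *\<^sub>R e + s *\<^sub>R e) \<partial>lborel) \<partial>lborel)"
    unfolding line_avg_def[of e a] using ab by (simp add: line_avg_poisson)
  also have "\<dots> = (\<integral>\<^sup>+ t. ennreal (cauchy_density t) *
      (\<integral>\<^sup>+ s. ennreal (poisson_kernel b (- s + a * t)) * u (x + s *\<^sub>R e) \<partial>lborel) \<partial>lborel)"
  proof (rule nn_integral_cong)
    fix t
    have k: "poisson_kernel b (s - a * t) = poisson_kernel b (- s + a * t)" for s
      by (simp add: poisson_kernel_def power2_commute)
    have "(\<integral>\<^sup>+ s. ennreal (poisson_kernel b s) * u (x + (a * t) *\<^sub>R e + s *\<^sub>R e) \<partial>lborel) =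
      (\<integral>\<^sup>+ s. ennreal (poisson_kernel b (- s + a * t)) * u (x + s *\<^sub>R e) \<partial>lborel)"
      by (subst nn_integral_lborel_translate[where c="- (a * t)", symmetric])
         (auto simp: algebra_simps scaleR_left_diff_distrib k)
    thus "ennreal (cauchy_density t) * (\<integral>\<^sup>+ s. ennreal (poisson_kernel b s) * u (x + (a * t) *\<^sub>R e + s *\<^sub>R e) \<partial>lborel) =
      ennreal (cauchy_density t) * (\<integral>\<^sup>+ s. ennreal (poisson_kernel b (- s + a * t)) * u (x + s *\<^sub>R e) \<partial>lborel)"
      by simp
  qed
  also have "\<dots> = (\<integral>\<^sup>+ t. \<integral>\<^sup>+ s. (ennreal (cauchy_density t) * ennreal (poisson_kernel b (- s + a * t))) * u (x + s *\<^sub>R e) \<partial>lborel \<partial>lborel)"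
    by (subst nn_integral_cmult[symmetric]) (auto simp: mult.assoc)
  also have "\<dots> = (\<integral>\<^sup>+ s. \<integral>\<^sup>+ t. (ennreal (cauchy_density t) * ennreal (poisson_kernel b (- s + a * t))) * u (x + s *\<^sub>R e) \<partial>lborel \<partial>lborel)"
    by (rule lborel_pair.Fubini') measurable
  also have "\<dots> = (\<integral>\<^sup>+ s. (\<integral>\<^sup>+ t. ennreal (cauchy_density t) * ennreal (poisson_kernel b (- s + a * t)) \<partial>lborel) * u (x + s *\<^sub>R e) \<partial>lborel)"
    by (subst nn_integral_multc) auto
  also have "\<dots> \<le> (\<integral>\<^sup>+ s. ennreal (poisson_kernel (a + b) (- s)) * u (x + s *\<^sub>R e) \<partial>lborel)"
    by (intro nn_integral_mono mult_right_mono poisson_kernel_semigroup_le ab) auto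
  also have "\<dots> = line_avg e (a + b) u x"
    using ab by (subst line_avg_poisson) (auto simp: poisson_kernel_def)
  finally show ?thesis .
qed

lemma poisson_kernel_le_double:
  assumes "m > 0" "m \<le> c" "c \<le> 2 * m"
  shows "poisson_kernel c s \<le> 2 * poisson_kernel m s"
proof -
  have "m\<^sup>2 \<le> c\<^sup>2" using assms by (intro power_mono) auto
  hence "c / (s\<^sup>2 + c\<^sup>2) \<le> (2 * m) / (s\<^sup>2 + m\<^sup>2)"
    using assms by (intro frac_le) (auto intro!: add_nonneg_pos)
  hence "(1 / pi) * (c / (s\<^sup>2 + c\<^sup>2)) \<le> (1 / pi) * ((2 * m) / (s\<^sup>2 + m\<^sup>2))"
    by (intro mult_left_mono) auto
  thus ?thesis by (simp add: poisson_kernel_def)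
qed

text \<open>The height a + b lies between m = max a b and 2 m, where the kernel is at most twice the
  one at height m. Bounding the average at height m by the sum of both averages makes the estimate
  symmetric, so that its two terms can be summed separately in the maximal inequality.\<close>

lemma line_avg_compose_le:
  assumes [measurable]: "u \<in> borel_measurable borel" and ab: "a > 0" "b > 0"
  shows "line_avg e a (line_avg e b u) x \<le> 2 * (line_avg e a u x + line_avg e b u x)"
proof -
  define m where "m = max a b"
  have m: "m > 0" "m \<le> a + b" "a + b \<le> 2 * m" using ab by (auto simp: m_def max_def)
  have "line_avg e (a + b) u x = (\<integral>\<^sup>+ s. ennreal (poisson_kernel (a + b) s) * u (x + s *\<^sub>R e) \<partial>lborel)"
    using ab by (subst line_avg_poisson) auto
  also have "\<dots> \<le> (\<integral>\<^sup>+ s. 2 * (ennreal (poisson_kernel m s) * u (x + s *\<^sub>R e)) \<partial>lborel)"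
  proof (rule nn_integral_mono)
    fix s
    have "ennreal (poisson_kernel (a + b) s) \<le> ennreal (2 * poisson_kernel m s)"
      using m by (intro ennreal_leI poisson_kernel_le_double)
    also have "\<dots> = 2 * ennreal (poisson_kernel m s)"
      by (simp add: ennreal_mult')
    finally show "ennreal (poisson_kernel (a + b) s) * u (x + s *\<^sub>R e)
       \<le> 2 * (ennreal (poisson_kernel m s) * u (x + s *\<^sub>R e))"
      by (simp add: mult.assoc[symmetric] mult_right_mono)
  qed
  also have "\<dots> = 2 * line_avg e m u x"
    using m by (subst nn_integral_cmult) (auto simp: line_avg_poisson)
  also have "\<dots> \<le> 2 * (line_avg e a u x + line_avg e b u x)"
    by (intro mult_left_mono) (auto simp: m_def max_def add_increasing add_increasing2)
  finally show ?thesis using line_avg_semigroup_le[OF assms, of e x] by (rule order_trans[rotated])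
qed

section \<open>The maximal inequality on L^2\<close>

definition line_max :: "real set \<Rightarrow> 'a::euclidean_space \<Rightarrow> ('a \<Rightarrow> ennreal) \<Rightarrow> 'a \<Rightarrow> ennreal" where
  "line_max D e u x = (SUP \<eta>\<in>D. line_avg e \<eta> u x)"

lemma line_max_measurable [measurable (raw)]:
  assumes "countable D" "u \<in> borel_measurable borel"
  shows "line_max D e u \<in> borel_measurable borel"
  unfolding line_max_def[abs_def] using assms by (intro borel_measurable_SUP) auto

lemma line_avg_le_line_max: "\<eta> \<in> D \<Longrightarrow> line_avg e \<eta> u x \<le> line_max D e u x"
  unfolding line_max_def by (rule SUP_upper)

lemma line_max_attained:
  assumes "finite D" "D \<noteq> {}"
  obtains \<eta> where "\<eta> \<in> D" "line_max D e u x = line_avg e \<eta> u x"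
proof -
  have "line_max D e u x = Max ((\<lambda>\<eta>. line_avg e \<eta> u x) ` D)"
    unfolding line_max_def using assms by (subst Max_Sup) auto
  also have "\<dots> \<in> (\<lambda>\<eta>. line_avg e \<eta> u x) ` D" using assms by (intro Max_in) auto
  finally show ?thesis using that by auto
qed

text \<open>The constant is poor but finite: the bootstrap below improves the best constant for
  \<open>D\<close>, and this bound guarantees that there is one.\<close>

lemma line_max_crude_bound:
  assumes D: "finite D" "D \<noteq> {}" and [measurable]: "u \<in> borel_measurable borel"
  shows "(\<integral>\<^sup>+ x. (line_max D e u x)\<^sup>2 \<partial>lborel) \<le> of_nat (card D) * (\<integral>\<^sup>+ x. (u x)\<^sup>2 \<partial>lborel)"
proof -
  have "(\<integral>\<^sup>+ x. (line_max D e u x)\<^sup>2 \<partial>lborel) \<le> (\<integral>\<^sup>+ x. (\<Sum>\<eta>\<in>D. line_avg e \<eta> (\<lambda>x. (u x)\<^sup>2) x) \<partial>lborel)"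
  proof (rule nn_integral_mono)
    fix x
    obtain \<eta> where \<eta>: "\<eta> \<in> D" "line_max D e u x = line_avg e \<eta> u x"
      using line_max_attained[OF D] by metis
    have "(line_max D e u x)\<^sup>2 \<le> line_avg e \<eta> (\<lambda>x. (u x)\<^sup>2) x"
      unfolding \<eta> by (rule line_avg_square_le) auto
    also have "\<dots> \<le> (\<Sum>\<eta>\<in>D. line_avg e \<eta> (\<lambda>x. (u x)\<^sup>2) x)"
      using D \<eta> by (intro member_le_sum) auto
    finally show "(line_max D e u x)\<^sup>2 \<le> (\<Sum>\<eta>\<in>D. line_avg e \<eta> (\<lambda>x. (u x)\<^sup>2) x)" .
  qed
  also have "\<dots> = (\<Sum>\<eta>\<in>D. \<integral>\<^sup>+ x. line_avg e \<eta> (\<lambda>x. (u x)\<^sup>2) x \<partial>lborel)"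
    by (rule nn_integral_sum) measurable
  also have "\<dots> = of_nat (card D) * (\<integral>\<^sup>+ x. (u x)\<^sup>2 \<partial>lborel)"
    by (simp add: nn_integral_line_avg)
  finally show ?thesis .
qed

text \<open>The \<open>T T\<^sup>*\<close> argument: with \<open>v\<close> the maximal function of \<open>u\<close>, split \<open>v\<close> into the pieces
  \<open>w \<eta>\<close> on which the scale \<open>\<eta>\<close> realises the maximum. The linearised operator then satisfies
  \<open>T T\<^sup>* \<le> 2 (T + T\<^sup>*)\<close>, because composing averages of scales \<open>a\<close> and \<open>b\<close> is dominated by the
  average of the larger scale.\<close>

lemma line_max_TT_star:
  fixes e :: "'a::euclidean_space"
  assumes D: "finite D" "D \<noteq> {}" "D \<subseteq> {0<..}" and [measurable]: "u \<in> borel_measurable borel"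
  defines "v \<equiv> line_max D e u"
  shows "(\<integral>\<^sup>+ x. (v x)\<^sup>2 \<partial>lborel)\<^sup>2 \<le>
     (\<integral>\<^sup>+ x. (u x)\<^sup>2 \<partial>lborel) * (4 * (\<integral>\<^sup>+ x. v x * line_max D e v x \<partial>lborel))"
proof -
  have [measurable]: "v \<in> borel_measurable borel" unfolding v_def
    by (rule line_max_measurable[OF countable_finite[OF D(1)]]) simp
  have [measurable]: "line_max D e v \<in> borel_measurable borel"
    by (rule line_max_measurable[OF countable_finite[OF D(1)]]) simp
  \<comment> \<open>Ties are broken in favour of the least height, so that the sets E \<eta> with
    \<eta> in \<open>D\<close> are disjoint and cover the space.\<close>
  define E where "E \<eta> = {x. line_avg e \<eta> u x = v x \<and> (\<forall>\<eta>'\<in>{\<eta>'\<in>D. \<eta>' < \<eta>}. line_avg e \<eta>' u x \<noteq> v x)}" for \<eta>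
  have fin: "finite {\<eta>'\<in>D. \<eta>' < \<eta>}" for \<eta> using D by auto
  have Em[measurable]: "E \<eta> \<in> sets borel" for \<eta>
  proof -
    have "E \<eta> = {x\<in>space borel. line_avg e \<eta> u x = v x} \<inter>
       (space borel - (\<Union>\<eta>'\<in>{\<eta>'\<in>D. \<eta>' < \<eta>}. {x\<in>space borel. line_avg e \<eta>' u x = v x}))"
      by (auto simp: E_def)
    thus ?thesis using fin by (auto intro!: sets.Int sets.Diff sets.finite_UN)
  qed
  define w where "w \<eta> x = v x * indicator (E \<eta>) x" for \<eta> x
  have [measurable]: "w \<eta> \<in> borel_measurable borel" for \<eta> unfolding w_def by measurable
  have w_sum: "(\<Sum>\<eta>\<in>D. w \<eta> x) = v x" for x
  proof -
    define S where "S = {\<eta>\<in>D. line_avg e \<eta> u x = v x}"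
    obtain \<eta> where "\<eta> \<in> D" "line_max D e u x = line_avg e \<eta> u x" by (rule line_max_attained[OF D(1,2)])
    hence S: "finite S" "S \<noteq> {}" using D(1) by (auto simp: S_def v_def)
    have iff: "x \<in> E \<eta> \<longleftrightarrow> \<eta> = Min S" if "\<eta> \<in> D" for \<eta>
    proof
      assume "x \<in> E \<eta>"
      thus "\<eta> = Min S" using S that by (intro Min_eqI[symmetric]) (auto simp: E_def S_def not_less[symmetric])
    next
      assume *: "\<eta> = Min S"
      hence "\<eta> \<in> S" using S by simp
      moreover have "\<eta>' \<notin> S" if "\<eta>' < \<eta>" for \<eta>' using that S * by (metis Min_le not_le)
      ultimately show "x \<in> E \<eta>" by (auto simp: E_def S_def)
    qed
    have "Min S \<in> D" using Min_in[OF S] by (auto simp: S_def)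
    have "(\<Sum>\<eta>\<in>D. w \<eta> x) = (\<Sum>\<eta>\<in>D. if \<eta> = Min S then v x else 0)"
      by (intro sum.cong) (auto simp: w_def iff)
    also have "\<dots> = v x" using D(1) \<open>Min S \<in> D\<close> by simp
    finally show ?thesis .
  qed
  have w_eq: "w \<eta> x * v x = w \<eta> x * line_avg e \<eta> u x" for \<eta> x
    by (auto simp: w_def E_def indicator_def)
  \<comment> \<open>Let T send a function to the sum over \<eta> of the indicator of E \<eta> times
    its average at height \<eta>. Then T u = v, and \<open>g\<close> is the adjoint of T applied to
    \<open>v\<close>; hence the integral of v^2 equals that of u g.\<close>
  define g where "g x = (\<Sum>\<eta>\<in>D. line_avg e \<eta> (w \<eta>) x)" for x
  have [measurable]: "g \<in> borel_measurable borel" unfolding g_def by measurable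
  have "(\<integral>\<^sup>+ x. (v x)\<^sup>2 \<partial>lborel) = (\<integral>\<^sup>+ x. (\<Sum>\<eta>\<in>D. w \<eta> x * line_avg e \<eta> u x) \<partial>lborel)"
    by (simp only: w_eq[symmetric] sum_distrib_right[symmetric] w_sum power2_eq_square)
  also have "\<dots> = (\<Sum>\<eta>\<in>D. \<integral>\<^sup>+ x. w \<eta> x * line_avg e \<eta> u x \<partial>lborel)"
    by (rule nn_integral_sum) measurable
  also have "\<dots> = (\<Sum>\<eta>\<in>D. \<integral>\<^sup>+ x. line_avg e \<eta> (w \<eta>) x * u x \<partial>lborel)"
    by (intro sum.cong refl line_avg_selfadjoint) auto
  also have "\<dots> = (\<integral>\<^sup>+ x. u x * g x \<partial>lborel)"
    unfolding g_def by (subst nn_integral_sum[symmetric]) (auto simp: sum_distrib_left mult.commute)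
  finally have 1: "(\<integral>\<^sup>+ x. (v x)\<^sup>2 \<partial>lborel)\<^sup>2 \<le> (\<integral>\<^sup>+ x. (u x)\<^sup>2 \<partial>lborel) * (\<integral>\<^sup>+ x. (g x)\<^sup>2 \<partial>lborel)"
    using Cauchy_Schwarz_nn_integral[of u lborel g] by simp
  \<comment> \<open>The composition bound splits the integral of g^2 into two double sums. In one of
    them summing over b restores \<open>v\<close>; in the other summing over a does, followed by
    self-adjointness. Both equal \<open>I\<close>.\<close>
  define I where "I = (\<Sum>\<eta>\<in>D. \<integral>\<^sup>+ x. w \<eta> x * line_avg e \<eta> v x \<partial>lborel)"
  have v_eq: "v = (\<lambda>x. \<Sum>\<eta>\<in>D. w \<eta> x)" by (simp add: w_sum)
  have I1: "(\<Sum>a\<in>D. \<Sum>b\<in>D. \<integral>\<^sup>+ x. w a x * line_avg e a (w b) x \<partial>lborel) = I"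
    unfolding I_def
  proof (intro sum.cong refl)
    fix a assume "a \<in> D"
    have "(\<Sum>b\<in>D. \<integral>\<^sup>+ x. w a x * line_avg e a (w b) x \<partial>lborel) = (\<integral>\<^sup>+ x. (\<Sum>b\<in>D. w a x * line_avg e a (w b) x) \<partial>lborel)"
      by (rule nn_integral_sum[symmetric]) measurable
    also have "\<dots> = (\<integral>\<^sup>+ x. w a x * line_avg e a v x \<partial>lborel)"
    proof (rule nn_integral_cong)
      fix x
      have "line_avg e a (\<lambda>x. \<Sum>b\<in>D. w b x) x = (\<Sum>b\<in>D. line_avg e a (w b) x)"
        by (rule line_avg_sum) simp
      thus "(\<Sum>b\<in>D. w a x * line_avg e a (w b) x) = w a x * line_avg e a v x"
        by (simp add: v_eq[symmetric] sum_distrib_left)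
    qed
    finally show "(\<Sum>b\<in>D. \<integral>\<^sup>+ x. w a x * line_avg e a (w b) x \<partial>lborel) = \<dots>" .
  qed
  have I2: "(\<Sum>a\<in>D. \<Sum>b\<in>D. \<integral>\<^sup>+ x. w a x * line_avg e b (w b) x \<partial>lborel) = I"
  proof -
    have "(\<Sum>a\<in>D. \<Sum>b\<in>D. \<integral>\<^sup>+ x. w a x * line_avg e b (w b) x \<partial>lborel) =
       (\<Sum>b\<in>D. \<Sum>a\<in>D. \<integral>\<^sup>+ x. w a x * line_avg e b (w b) x \<partial>lborel)" by (rule sum.swap)
    also have "\<dots> = (\<Sum>b\<in>D. \<integral>\<^sup>+ x. (\<Sum>a\<in>D. w a x * line_avg e b (w b) x) \<partial>lborel)"
      by (intro sum.cong refl nn_integral_sum[symmetric]) measurable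
    also have "\<dots> = (\<Sum>b\<in>D. \<integral>\<^sup>+ x. v x * line_avg e b (w b) x \<partial>lborel)"
      by (simp only: sum_distrib_right[symmetric] w_sum)
    also have "\<dots> = (\<Sum>b\<in>D. \<integral>\<^sup>+ x. line_avg e b v x * w b x \<partial>lborel)"
      by (intro sum.cong refl line_avg_selfadjoint) auto
    finally show ?thesis by (simp add: I_def mult.commute)
  qed
  have "(\<integral>\<^sup>+ x. (g x)\<^sup>2 \<partial>lborel) = (\<integral>\<^sup>+ x. (\<Sum>a\<in>D. \<Sum>b\<in>D. line_avg e a (w a) x * line_avg e b (w b) x) \<partial>lborel)"
    by (simp add: g_def power2_eq_square sum_product)
  also have "\<dots> = (\<Sum>a\<in>D. \<Sum>b\<in>D. \<integral>\<^sup>+ x. line_avg e a (w a) x * line_avg e b (w b) x \<partial>lborel)"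
    by (subst nn_integral_sum, measurable)+
  also have "\<dots> = (\<Sum>a\<in>D. \<Sum>b\<in>D. \<integral>\<^sup>+ x. w a x * line_avg e a (line_avg e b (w b)) x \<partial>lborel)"
    by (intro sum.cong refl line_avg_selfadjoint[symmetric]) auto
  also have "\<dots> \<le> (\<Sum>a\<in>D. \<Sum>b\<in>D. \<integral>\<^sup>+ x. 2 * (w a x * line_avg e a (w b) x) + 2 * (w a x * line_avg e b (w b) x) \<partial>lborel)"
  proof (intro sum_mono nn_integral_mono)
    fix a b x assume "a \<in> D" "b \<in> D"
    hence "line_avg e a (line_avg e b (w b)) x \<le> 2 * (line_avg e a (w b) x + line_avg e b (w b) x)"
      using D by (intro line_avg_compose_le) auto
    hence "w a x * line_avg e a (line_avg e b (w b)) x \<le> w a x * (2 * (line_avg e a (w b) x + line_avg e b (w b) x))"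
      by (intro mult_left_mono) auto
    thus "w a x * line_avg e a (line_avg e b (w b)) x \<le> 2 * (w a x * line_avg e a (w b) x) + 2 * (w a x * line_avg e b (w b) x)"
      by (simp add: algebra_simps)
  qed
  also have "\<dots> = (\<Sum>a\<in>D. \<Sum>b\<in>D. 2 * (\<integral>\<^sup>+ x. w a x * line_avg e a (w b) x \<partial>lborel) + 2 * (\<integral>\<^sup>+ x. w a x * line_avg e b (w b) x \<partial>lborel))"
    by (intro sum.cong refl) (simp add: nn_integral_add nn_integral_cmult)
  also have "\<dots> = 2 * I + 2 * I"
    by (simp only: sum.distrib sum_distrib_left[symmetric] I1 I2)
  also have "\<dots> = 4 * I" by (simp add: distrib_right[symmetric])
  finally have "(\<integral>\<^sup>+ x. (g x)\<^sup>2 \<partial>lborel) \<le> 4 * I" .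
  also have "I \<le> (\<Sum>\<eta>\<in>D. \<integral>\<^sup>+ x. w \<eta> x * line_max D e v x \<partial>lborel)"
    unfolding I_def by (intro sum_mono nn_integral_mono mult_left_mono line_avg_le_line_max) auto
  also have "\<dots> = (\<integral>\<^sup>+ x. (\<Sum>\<eta>\<in>D. w \<eta> x * line_max D e v x) \<partial>lborel)"
    by (rule nn_integral_sum[symmetric]) measurable
  also have "\<dots> = (\<integral>\<^sup>+ x. v x * line_max D e v x \<partial>lborel)"
    by (simp only: sum_distrib_right[symmetric] w_sum)
  finally have "(\<integral>\<^sup>+ x. (g x)\<^sup>2 \<partial>lborel) \<le> 4 * (\<integral>\<^sup>+ x. v x * line_max D e v x \<partial>lborel)"
    by (simp add: mult_left_mono)
  thus ?thesis using 1 by (meson mult_left_mono order_trans zero_le)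
qed

text \<open>Let a, b, d be the integrals of v^2, of u^2, and of v times its maximal function. The
  adjoint estimate gives a^2 \<le> 4 b d, while Cauchy-Schwarz and the assumed bound, applied to
  \<open>v\<close> itself, give d \<le> sqrt C a. Cancelling a factor a, which is finite, leaves a
  \<le> 4 sqrt C b.\<close>

lemma line_max_bound_improve:
  fixes e :: "'a::euclidean_space"
  assumes D: "finite D" "D \<noteq> {}" "D \<subseteq> {0<..}" and C: "C \<ge> 0"
    and bound: "\<And>u. u \<in> borel_measurable borel \<Longrightarrow>
      (\<integral>\<^sup>+ x. (line_max D e u x)\<^sup>2 \<partial>lborel) \<le> ennreal C * (\<integral>\<^sup>+ x. (u x)\<^sup>2 \<partial>lborel)"
    and [measurable]: "u \<in> borel_measurable borel"
  shows "(\<integral>\<^sup>+ x. (line_max D e u x)\<^sup>2 \<partial>lborel) \<le> ennreal (4 * sqrt C) * (\<integral>\<^sup>+ x. (u x)\<^sup>2 \<partial>lborel)"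
proof -
  define v where "v = line_max D e u"
  have [measurable]: "v \<in> borel_measurable borel" unfolding v_def
    by (rule line_max_measurable[OF countable_finite[OF D(1)]]) simp
  have [measurable]: "line_max D e v \<in> borel_measurable borel"
    by (rule line_max_measurable[OF countable_finite[OF D(1)]]) simp
  define a b d where "a = (\<integral>\<^sup>+ x. (v x)\<^sup>2 \<partial>lborel)" and "b = (\<integral>\<^sup>+ x. (u x)\<^sup>2 \<partial>lborel)"
    and "d = (\<integral>\<^sup>+ x. v x * line_max D e v x \<partial>lborel)"
  have ab: "a \<le> ennreal C * b" unfolding a_def b_def v_def by (rule bound) simp
  have abd: "a\<^sup>2 \<le> b * (4 * d)" unfolding a_def b_def d_def v_def by (rule line_max_TT_star[OF D]) simp
  have "d\<^sup>2 \<le> a * (\<integral>\<^sup>+ x. (line_max D e v x)\<^sup>2 \<partial>lborel)"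
    unfolding a_def d_def by (rule Cauchy_Schwarz_nn_integral) auto
  also have "\<dots> \<le> a * (ennreal C * a)" unfolding a_def by (intro mult_left_mono bound) auto
  finally have da: "d\<^sup>2 \<le> ennreal C * a\<^sup>2" by (simp add: power2_eq_square mult_ac)
  show ?thesis
  proof (cases "b = \<infinity>")
    case True
    show ?thesis
    \<comment> \<open>C = 0 is separate because 0 times \<infinity> is 0 in
      \<open>ennreal\<close>.\<close>
    proof (cases "C = 0")
      case True thus ?thesis using ab by (simp add: a_def v_def)
    next
      case False thus ?thesis using True C
        by (simp add: b_def ennreal_mult_eq_top_iff ennreal_mult_top)
    qed
  next
    case False
    then obtain rb where rb: "b = ennreal rb" "rb \<ge> 0" by (cases b) auto
    have "a \<noteq> \<infinity>" using ab rb C by (auto simp: ennreal_mult[symmetric] top_unique)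
    then obtain ra where ra: "a = ennreal ra" "ra \<ge> 0" by (cases a) auto
    have "d\<^sup>2 \<noteq> \<infinity>" using da ra C by (auto simp: ennreal_mult[symmetric] ennreal_power top_unique)
    hence "d \<noteq> \<infinity>" by auto
    then obtain rd where rd: "d = ennreal rd" "rd \<ge> 0" by (cases d) auto
    have 4: "(4::ennreal) = ennreal 4" by simp
    have 1: "rd\<^sup>2 \<le> C * ra\<^sup>2" using da ra rd C by (simp add: ennreal_mult[symmetric] ennreal_power)
    have 2: "ra\<^sup>2 \<le> rb * (4 * rd)" using abd ra rb rd unfolding 4
      by (simp add: ennreal_mult[symmetric] ennreal_power del: ennreal_numeral)
    have "rd\<^sup>2 \<le> (sqrt C * ra)\<^sup>2" using 1 C by (simp add: power_mult_distrib)
    moreover have "0 \<le> sqrt C * ra" using ra C by simp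
    ultimately have "rd \<le> sqrt C * ra" by (rule power2_le_imp_le)
    hence "rb * (4 * rd) \<le> rb * (4 * (sqrt C * ra))" using rb by (intro mult_left_mono) auto
    hence "ra * ra \<le> (4 * sqrt C * rb) * ra" using 2 by (simp add: power2_eq_square mult_ac)
    hence "ra \<le> 4 * sqrt C * rb" using ra rb C by (cases "ra = 0") auto
    hence "a \<le> ennreal (4 * sqrt C) * b" using ra rb C by (simp add: ennreal_mult[symmetric])
    thus ?thesis by (simp add: a_def b_def v_def)
  qed
qed

text \<open>The best constant c for \<open>D\<close> is itself admissible, so the improvement gives
  c \<le> 4 sqrt c, that is c \<le> 16, whatever the number of heights.\<close>

lemma line_max_finite_bound:
  fixes e :: "'a::euclidean_space"
  assumes D: "finite D" "D \<subseteq> {0<..}" and u: "u \<in> borel_measurable borel"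
  shows "(\<integral>\<^sup>+ x. (line_max D e u x)\<^sup>2 \<partial>lborel) \<le> 16 * (\<integral>\<^sup>+ x. (u x)\<^sup>2 \<partial>lborel)"
proof (cases "D = {}")
  case True thus ?thesis by (simp add: line_max_def bot_ennreal)
next
  case False
  \<comment> \<open>The condition C \<ge> 1 bounds \<open>S\<close> below and survives the passage
    from C to 4 sqrt C.\<close>
  define S where "S = {C. C \<ge> 1 \<and> (\<forall>u\<in>borel_measurable borel.
      (\<integral>\<^sup>+ x. (line_max D e u x)\<^sup>2 \<partial>lborel) \<le> ennreal C * (\<integral>\<^sup>+ x. (u x)\<^sup>2 \<partial>lborel))}"
  have "real (card D) \<in> S"
    using line_max_crude_bound[OF D(1) False, of _ e] D(1) False
    by (auto simp: S_def ennreal_of_nat_eq_real_of_nat Suc_le_eq card_gt_0_iff)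
  hence ne: "S \<noteq> {}" by auto
  have bdd: "bdd_below S" by (auto simp: S_def bdd_below_def)
  define c where "c = Inf S"
  have c1: "c \<ge> 1" unfolding c_def using ne by (intro cInf_greatest) (auto simp: S_def)
  hence c0: "c \<ge> 0" by simp
  have cS: "c \<in> S" unfolding S_def
  proof (intro CollectI conjI c1 ballI)
    fix u :: "'a \<Rightarrow> ennreal" assume u: "u \<in> borel_measurable borel"
    let ?a = "(\<integral>\<^sup>+ x. (line_max D e u x)\<^sup>2 \<partial>lborel)" and ?b = "(\<integral>\<^sup>+ x. (u x)\<^sup>2 \<partial>lborel)"
    have le: "?a \<le> ennreal C * ?b" if "C \<in> S" for C using that u by (auto simp: S_def)
    show "?a \<le> ennreal c * ?b"
    proof (cases "?b = \<infinity>")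
      case True
      thus ?thesis using c1 by (simp add: ennreal_mult_top)
    next
      case False
      then obtain rb where rb: "?b = ennreal rb" "rb \<ge> 0" by (cases ?b) auto
      obtain C where C: "C \<in> S" using ne by auto
      have "?a \<noteq> \<infinity>" using le[OF C] rb C by (auto simp: ennreal_mult[symmetric] top_unique S_def)
      then obtain ra where ra: "?a = ennreal ra" "ra \<ge> 0" by (cases ?a) auto
      have le': "ra \<le> C * rb" if "C \<in> S" for C
        using le[OF that] ra rb that by (simp add: ennreal_mult[symmetric] S_def)
      have "ra \<le> c * rb"
      proof (cases "rb = 0")
        case True thus ?thesis using le'[OF C] by simp
      next
        case False
        hence "ra / rb \<le> C" if "C \<in> S" for C using le'[OF that] rb by (simp add: field_simps)
        hence "ra / rb \<le> c" unfolding c_def using ne by (intro cInf_greatest)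
        thus ?thesis using False rb by (simp add: field_simps)
      qed
      thus ?thesis using ra rb c0 by (simp add: ennreal_mult[symmetric])
    qed
  qed
  have "4 * sqrt c \<in> S"
    unfolding S_def using cS line_max_bound_improve[OF D(1) False D(2) c0, of e] c1
    by (auto simp: S_def intro: order_trans[of 1 "4 * 1"])
  hence "c \<le> 4 * sqrt c" unfolding c_def using bdd by (intro cInf_lower)
  hence "c\<^sup>2 \<le> (4 * sqrt c)\<^sup>2" using c0 by (intro power_mono) auto
  hence "c * c \<le> 16 * c" using c0 by (simp add: power_mult_distrib power2_eq_square)
  hence c16: "c \<le> 16" using c0 by (cases "c = 0") auto
  have "(\<integral>\<^sup>+ x. (line_max D e u x)\<^sup>2 \<partial>lborel) \<le> ennreal c * (\<integral>\<^sup>+ x. (u x)\<^sup>2 \<partial>lborel)"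
    using cS u by (auto simp: S_def)
  also have "\<dots> \<le> ennreal 16 * (\<integral>\<^sup>+ x. (u x)\<^sup>2 \<partial>lborel)"
    using c16 by (intro mult_right_mono ennreal_leI) auto
  finally show ?thesis by simp
qed

lemma SUP_power2_ennreal:
  fixes f :: "nat \<Rightarrow> ennreal"
  assumes "incseq f"
  shows "(SUP n. f n)\<^sup>2 = (SUP n. (f n)\<^sup>2)"
proof (rule antisym)
  show "(SUP n. f n)\<^sup>2 \<le> (SUP n. (f n)\<^sup>2)"
    unfolding power2_eq_square SUP_mult_left_ennreal SUP_mult_right_ennreal
  proof (intro SUP_least)
    fix m n
    have "f m * f n \<le> f (max m n) * f (max m n)" using assms by (intro mult_mono) (auto simp: incseq_def)
    also have "\<dots> \<le> (SUP n. f n * f n)" by (rule SUP_upper) simp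
    finally show "f m * f n \<le> (SUP n. f n * f n)" .
  qed
  show "(SUP n. (f n)\<^sup>2) \<le> (SUP n. f n)\<^sup>2"
    by (intro SUP_least power_mono_ennreal SUP_upper) auto
qed

text \<open>Since 16 does not depend on the finite set of heights, monotone convergence along an
  enumeration of \<open>D\<close> reaches countably many.\<close>

lemma line_max_bound:
  fixes e :: "'a::euclidean_space"
  assumes D: "countable D" "D \<subseteq> {0<..}" and u: "u \<in> borel_measurable borel"
  shows "(\<integral>\<^sup>+ x. (line_max D e u x)\<^sup>2 \<partial>lborel) \<le> 16 * (\<integral>\<^sup>+ x. (u x)\<^sup>2 \<partial>lborel)"
proof (cases "D = {}")
  case True thus ?thesis by (simp add: line_max_def bot_ennreal)
next
  case False
  define F where "F n = from_nat_into D ` {..n}" for n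
  have F: "finite (F n)" "F n \<subseteq> D" for n using from_nat_into[OF False] by (auto simp: F_def)
  have UF: "(\<Union>n. F n) = D"
    using F from_nat_into_surj[OF D(1)] by (fastforce simp: F_def)
  have inc: "incseq (\<lambda>n. line_max (F n) e u x)" for x
    unfolding incseq_def line_max_def by (intro allI impI SUP_subset_mono) (auto simp: F_def)
  have eq: "line_max D e u x = (SUP n. line_max (F n) e u x)" for x
    unfolding line_max_def UF[symmetric] by (simp add: SUP_UNION)
  have "(\<integral>\<^sup>+ x. (line_max D e u x)\<^sup>2 \<partial>lborel) = (\<integral>\<^sup>+ x. (SUP n. (line_max (F n) e u x)\<^sup>2) \<partial>lborel)"
    by (simp add: eq SUP_power2_ennreal[OF inc])
  also have "\<dots> = (SUP n. \<integral>\<^sup>+ x. (line_max (F n) e u x)\<^sup>2 \<partial>lborel)"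
    using inc u F(1)
    by (intro nn_integral_monotone_convergence_SUP)
       (auto simp: incseq_def le_fun_def intro!: power_mono_ennreal borel_measurable_power_ennreal
          line_max_measurable countable_finite)
  also have "\<dots> \<le> 16 * (\<integral>\<^sup>+ x. (u x)\<^sup>2 \<partial>lborel)"
    using F D u by (intro SUP_least line_max_finite_bound) auto
  finally show ?thesis .
qed

section \<open>Pointwise bounds in Hardy spaces of tubes\<close>



lemma open_octant [simp]: "open (octant \<sigma> :: (real^'n) set)"
proof -
  have "octant \<sigma> = (\<Inter>k\<in>UNIV. {y::real^'n. \<sigma> k * y $ k > 0})" by (auto simp: octant_def)
  also have "open \<dots>" by (intro open_INT ballI open_Collect_less continuous_intros) auto
  finally show ?thesis .
qed

lemma open_tube:
  assumes "open B" shows "open (tube B :: (complex^'n) set)"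
proof -
  have "tube B = (\<lambda>z::complex^'n. \<chi> k. Im (z $ k)) -` B" by (auto simp: tube_def)
  thus ?thesis using assms
    by (simp add: open_vimage continuous_on_vec_lambda continuous_on_Im continuous_on_component)
qed

lemma cplx_in_tube [simp]: "cplx x y \<in> tube B \<longleftrightarrow> y \<in> B"
  by (simp add: tube_def cplx_def)

lemma cplx_shift:
  "cplx x y + Complex s t *s axis k 1 = cplx (x + s *\<^sub>R axis k 1) (y + t *\<^sub>R axis k 1)"
  by (simp add: vec_eq_iff cplx_def axis_def complex_eq_iff)

lemma continuous_on_cplx [continuous_intros]:
  assumes "continuous_on S f" "continuous_on S g"
  shows "continuous_on S (\<lambda>s. cplx (f s) (g s :: real^'n))"
  unfolding cplx_def Complex_eq
  by (intro continuous_on_vec_lambda continuous_intros assms)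

lemma bounded_linear_smult_axis: "bounded_linear (\<lambda>c::complex. c *s (v :: complex^'n))"
proof -
  have "linear (\<lambda>c::complex. c *s v)"
    by (rule linearI) (auto simp: vec_eq_iff algebra_simps)
  thus ?thesis by (rule linear_conv_bounded_linear[THEN iffD1])
qed

text \<open>Complex linearity of the derivative makes the restriction to a complex line holomorphic
  in one variable. The estimates in several variables are obtained on such slices.\<close>

lemma holomorphic_several_slice:
  assumes "holomorphic_several F U"
  shows "(\<lambda>c. F (z + c *s v)) holomorphic_on {c. z + c *s v \<in> U}"
  unfolding holomorphic_on_def
proof
  fix c assume c: "c \<in> {c. z + c *s v \<in> U}"
  then obtain D where D: "(F has_derivative D) (at (z + c *s v))" "\<And>(c::complex) v. D (c *s v) = c * D v"
    using assms unfolding holomorphic_several_def by blast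
  have "((\<lambda>c. z + c *s v) has_derivative (\<lambda>h. h *s v)) (at c)"
    by (auto intro!: derivative_eq_intros bounded_linear_imp_has_derivative bounded_linear_smult_axis)
  from diff_chain_at[OF this D(1)] have "((\<lambda>c. F (z + c *s v)) has_derivative (\<lambda>h. D v * h)) (at c)"
    by (simp add: o_def D(2) mult.commute)
  hence "((\<lambda>c. F (z + c *s v)) has_field_derivative D v) (at c)"
    by (simp add: has_field_derivative_def)
  thus "(\<lambda>c. F (z + c *s v)) field_differentiable at c within {c. z + c *s v \<in> U}"
    using field_differentiable_at_within field_differentiable_def by blast
qed

lemma holomorphic_several_imp_continuous_on:
  assumes "holomorphic_several F U" shows "continuous_on U F"
proof (rule continuous_at_imp_continuous_on, rule ballI)
  fix z assume "z \<in> U"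
  thus "isCont F z" using assms unfolding holomorphic_several_def by (metis has_derivative_continuous)
qed

lemma open_smult_slice: "open U \<Longrightarrow> open {c. z + c *s v \<in> (U :: (complex^'n) set)}"
proof -
  assume U: "open U"
  have c: "continuous_on UNIV (\<lambda>c. z + c *s v)"
    by (intro continuous_intros linear_continuous_on bounded_linear_smult_axis)
  show ?thesis using open_vimage[OF U c] by (simp add: vimage_def)
qed

text \<open>The boundary values of the Cayley transform. They carry \<open>cauchy_density\<close> to
  normalised arc length, so means over circles become integrals over the line.\<close>

definition cayley_circle :: "real \<Rightarrow> complex" where
  "cayley_circle t = (of_real t - \<i>) / (of_real t + \<i>)"

lemma of_real_plus_i_nonzero [simp]: "complex_of_real t + \<i> \<noteq> 0" "complex_of_real t - \<i> \<noteq> 0"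
  by (auto simp: complex_eq_iff)

lemma norm_cayley_circle [simp]: "norm (cayley_circle t) = 1"
proof -
  have "norm (complex_of_real t - \<i>) = norm (cnj (complex_of_real t + \<i>))" by simp
  also have "\<dots> = norm (complex_of_real t + \<i>)" by (rule complex_mod_cnj)
  finally show ?thesis by (simp add: cayley_circle_def norm_divide)
qed

lemma cayley_circle_measurable [measurable]: "cayley_circle \<in> borel_measurable borel"
  unfolding cayley_circle_def[abs_def] by (intro borel_measurable_continuous_onI continuous_intros) auto

lemma norm_cayley_le_1:
  assumes "Im z \<ge> 0" shows "norm ((z - \<i>) / (z + \<i>)) \<le> 1"
proof -
  have "(norm (z - \<i>))\<^sup>2 \<le> (norm (z + \<i>))\<^sup>2"
    using assms unfolding cmod_power2 by (simp add: power2_eq_square algebra_simps)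
  hence "norm (z - \<i>) \<le> norm (z + \<i>)" by (rule power2_le_imp_le) simp
  thus ?thesis by (simp add: norm_divide divide_le_eq_1)
qed

text \<open>The Poisson majorant transported from the half plane to the disc of radius \<open>\<rho>\<close> around
  \<open>z0 + s\<close>. Letting the centre move is what allows to integrate over \<open>s\<close> by translation later.\<close>

lemma norm_powr_le_circle_integral:
  assumes U: "open U" "h holomorphic_on U" and cb: "cball z0 (2 * \<rho>) \<subseteq> U"
    and \<rho>: "\<rho> > 0" and s: "\<bar>s\<bar> \<le> \<rho> / 2" and p: "p > 0"
  shows "ennreal (norm (h z0) powr p) \<le>
    27 * (\<integral>\<^sup>+ t. ennreal (cauchy_density t) *
        ennreal (norm (h (z0 + of_real s + of_real \<rho> * cayley_circle t)) powr p) \<partial>lborel)"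
proof -
  \<comment> \<open>The Cayley transform onto the disc of radius \<rho> centred at z0 + s. As |s|
    \<le> \<rho>/2, the image stays within 2 \<rho> of \<open>z0\<close>.\<close>
  define \<phi> where "\<phi> z = z0 + of_real s + of_real \<rho> * ((z - \<i>) / (z + \<i>))" for z
  define V where "V = {z. z + \<i> \<noteq> 0} \<inter> \<phi> -` U"
  have opV0: "open {z::complex. z + \<i> \<noteq> 0}"
    by (intro open_Collect_neq continuous_intros)
  have cont\<phi>: "continuous_on {z. z + \<i> \<noteq> 0} \<phi>" unfolding \<phi>_def by (intro continuous_intros) auto
  have opV: "open V" unfolding V_def
    using continuous_on_open_vimage[OF opV0, of \<phi>] cont\<phi> U(1) by (simp add: Int_commute)
  have nz: "z + \<i> \<noteq> 0" if "Im z \<ge> 0" for z using that by (auto simp: complex_eq_iff)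
  have \<phi>cb: "\<phi> z \<in> cball z0 (2 * \<rho>)" if "Im z \<ge> 0" for z
  proof -
    have "norm (of_real s + of_real \<rho> * ((z - \<i>) / (z + \<i>))) \<le> \<bar>s\<bar> + \<rho> * norm ((z - \<i>) / (z + \<i>))"
      using \<rho> norm_triangle_ineq[of "of_real s" "of_real \<rho> * ((z - \<i>) / (z + \<i>))"]
      by (simp add: norm_mult norm_divide)
    also have "\<dots> \<le> \<rho> / 2 + \<rho> * 1"
      using s \<rho> norm_cayley_le_1[OF that] by (intro add_mono mult_left_mono) auto
    also have "\<dots> \<le> 2 * \<rho>" using \<rho> by simp
    finally show ?thesis unfolding \<phi>_def
      using norm_minus_commute[of z0 "\<phi> z"] by (simp add: dist_norm \<phi>_def norm_minus_commute add.assoc)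
  qed
  have subV: "{z. Im z \<ge> 0} \<subseteq> V" using nz \<phi>cb cb unfolding V_def by blast
  have hol: "(h \<circ> \<phi>) holomorphic_on V"
  proof (rule holomorphic_on_compose_gen[OF _ U(2)])
    show "\<phi> holomorphic_on V" unfolding \<phi>_def by (intro holomorphic_intros) (auto simp: V_def)
  qed (auto simp: V_def)
  have "compact (h ` cball z0 (2 * \<rho>))"
    by (intro compact_continuous_image continuous_on_subset[OF holomorphic_on_imp_continuous_on[OF U(2)] cb]) simp
  then obtain K where K: "\<And>z. z \<in> cball z0 (2 * \<rho>) \<Longrightarrow> norm (h z) \<le> K"
    using compact_imp_bounded bounded_iff by (metis imageI)
  \<comment> \<open>The height at which i \<eta> is sent to \<open>z0\<close>. The bound on s keeps
    it in [1/3, 3], where the kernel is comparable with the one at height 1.\<close>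
  define \<eta> where "\<eta> = (\<rho> - s) / (\<rho> + s)"
  have ps: "\<rho> + s > 0" using s \<rho> by linarith
  have \<eta>: "1/3 \<le> \<eta>" "\<eta> \<le> 3" using s \<rho> ps by (simp_all add: \<eta>_def field_simps abs_le_iff)
  have \<phi>\<eta>: "\<phi> (Complex 0 \<eta>) = z0"
  proof -
    have e: "\<eta> + 1 = 2 * \<rho> / (\<rho> + s)" "\<eta> - 1 = - 2 * s / (\<rho> + s)"
      using ps by (simp_all add: \<eta>_def field_simps)
    have "(Complex 0 \<eta> - \<i>) / (Complex 0 \<eta> + \<i>) = (\<i> * of_real (\<eta> - 1)) / (\<i> * of_real (\<eta> + 1))"
      by (simp add: Complex_eq algebra_simps)
    also have "\<dots> = of_real ((\<eta> - 1) / (\<eta> + 1))" by simp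
    also have "(\<eta> - 1) / (\<eta> + 1) = - s / \<rho>" unfolding e using ps \<rho> by simp
    finally show ?thesis using \<rho> by (simp add: \<phi>_def)
  qed
  let ?v = "\<lambda>t. ennreal (norm (h (z0 + of_real s + of_real \<rho> * cayley_circle t)) powr p)"
  have hc: "(h \<circ> \<phi>) (of_real t) = h (z0 + of_real s + of_real \<rho> * cayley_circle t)" for t
    by (simp add: \<phi>_def cayley_circle_def)
  have cont: "continuous_on UNIV (\<lambda>t::real. (h \<circ> \<phi>) (of_real t))"
    using subV by (intro continuous_on_compose2[OF holomorphic_on_imp_continuous_on[OF hol]] continuous_intros) auto
  have vm[measurable]: "(\<lambda>t. norm (h (z0 + of_real s + of_real \<rho> * cayley_circle t)) powr p) \<in> borel_measurable borel"
    using borel_measurable_continuous_onI[OF cont] unfolding hc by measurable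
  have "ennreal (norm ((h \<circ> \<phi>) (Complex 0 \<eta>)) powr p) \<le>
    (\<integral>\<^sup>+ t. ennreal (cauchy_density t) * ennreal (norm ((h \<circ> \<phi>) (of_real (0 + \<eta> * t))) powr p) \<partial>lborel)"
    using \<eta> K \<phi>cb p by (intro norm_powr_le_poisson_integral[OF opV subV hol]) auto
  also have "\<dots> = (\<integral>\<^sup>+ t. ennreal (cauchy_density t) * ?v (\<eta> * t) \<partial>lborel)"
    by (simp only: hc add_0)
  also have "\<dots> = (\<integral>\<^sup>+ t. ennreal (poisson_kernel \<eta> t) * ?v t \<partial>lborel)"
    using \<eta> vm by (intro nn_integral_poisson_kernel) auto
  also have "\<dots> \<le> (\<integral>\<^sup>+ t. 27 * (ennreal (cauchy_density t) * ?v t) \<partial>lborel)"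
  proof (rule nn_integral_mono)
    fix t
    \<comment> \<open>The constant is generous: for 1/3 \<le> \<eta> \<le> 3 any factor from 3 on
      works.\<close>
    have "poisson_kernel \<eta> t \<le> 27 * cauchy_density t"
    proof -
      have "\<eta> * t\<^sup>2 \<le> 27 * t\<^sup>2" using \<eta> by (intro mult_right_mono) auto
      moreover have "1 * \<eta> \<le> (27 * \<eta>) * \<eta>" using \<eta> by (intro mult_right_mono) auto
      ultimately have "\<eta> * (1 + t\<^sup>2) \<le> 27 * (t\<^sup>2 + \<eta>\<^sup>2)"
        unfolding distrib_left power2_eq_square by (simp add: mult.assoc)
      moreover have "\<eta>\<^sup>2 > 0" using \<eta> by simp
      hence "t\<^sup>2 + \<eta>\<^sup>2 > 0" "1 + t\<^sup>2 > 0" by (simp_all add: add_nonneg_pos add_pos_nonneg)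
      ultimately have "\<eta> / (t\<^sup>2 + \<eta>\<^sup>2) \<le> 27 / (1 + t\<^sup>2)" by (simp add: field_simps)
      hence "(1/pi) * (\<eta> / (t\<^sup>2 + \<eta>\<^sup>2)) \<le> (1/pi) * (27 / (1 + t\<^sup>2))" by (intro mult_left_mono) auto
      thus ?thesis by (simp add: poisson_kernel_def cauchy_density_def)
    qed
    hence "ennreal (poisson_kernel \<eta> t) \<le> 27 * ennreal (cauchy_density t)"
      by (subst ennreal_numeral[symmetric], subst ennreal_mult[symmetric]) (auto intro: ennreal_leI)
    thus "ennreal (poisson_kernel \<eta> t) * ?v t \<le> 27 * (ennreal (cauchy_density t) * ?v t)"
      by (simp add: mult.assoc[symmetric] mult_right_mono)
  qed
  also have "\<dots> = 27 * (\<integral>\<^sup>+ t. ennreal (cauchy_density t) * ?v t \<partial>lborel)"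
    by (rule nn_integral_cmult) measurable
  finally show ?thesis by (simp add: \<phi>\<eta>)
qed


text \<open>A mean over a circle in the k-th complex coordinate. Real and imaginary parts are
  separate arguments because the later integrals run over \<open>x\<close> alone, with
  \<open>y\<close> as a parameter.\<close>

definition circle_op :: "real \<Rightarrow> 'n \<Rightarrow> (real^'n \<Rightarrow> real^'n \<Rightarrow> ennreal) \<Rightarrow> real^'n \<Rightarrow> real^'n \<Rightarrow> ennreal" where
  "circle_op \<rho> k v x y = (\<integral>\<^sup>+ t. ennreal (cauchy_density t) *
     v (x + (\<rho> * Re (cayley_circle t)) *\<^sub>R axis k 1) (y + (\<rho> * Im (cayley_circle t)) *\<^sub>R axis k 1) \<partial>lborel)"

lemma circle_op_measurable [measurable (raw)]:
  fixes v :: "real^'n \<Rightarrow> real^'n \<Rightarrow> ennreal"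
  assumes "case_prod v \<in> borel_measurable (borel \<Otimes>\<^sub>M borel)"
  shows "case_prod (circle_op \<rho> k v) \<in> borel_measurable (borel \<Otimes>\<^sub>M borel)"
proof -
  have [measurable]: "(\<lambda>x. v (f x) (g x)) \<in> borel_measurable M"
    if "f \<in> M \<rightarrow>\<^sub>M borel" "g \<in> M \<rightarrow>\<^sub>M borel" for f g M
    using measurable_compose[OF measurable_Pair[OF that] assms] by simp
  show ?thesis unfolding circle_op_def[abs_def] case_prod_beta' by measurable
qed

text \<open>Each point of the circle moves \<open>x\<close> by a translation, which leaves the
  integral unchanged; the displacement of \<open>y\<close> is absorbed by the uniformity of
  \<open>N\<close>.\<close>

lemma nn_integral_circle_op_le:
  fixes v :: "real^'n \<Rightarrow> real^'n \<Rightarrow> ennreal"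
  assumes m: "case_prod v \<in> borel_measurable (borel \<Otimes>\<^sub>M borel)"
    and le: "\<And>y. (\<integral>\<^sup>+ x. v x y \<partial>lborel) \<le> N"
  shows "(\<integral>\<^sup>+ x. circle_op \<rho> k v x y \<partial>lborel) \<le> N"
proof -
  have v[measurable]: "(\<lambda>x. v (f x) (g x)) \<in> borel_measurable M"
    if "f \<in> M \<rightarrow>\<^sub>M borel" "g \<in> M \<rightarrow>\<^sub>M borel" for f g M
    using measurable_compose[OF measurable_Pair[OF that] m] by simp
  have "(\<integral>\<^sup>+ x. circle_op \<rho> k v x y \<partial>lborel) = (\<integral>\<^sup>+ t. \<integral>\<^sup>+ x. ennreal (cauchy_density t) *
     v (x + (\<rho> * Re (cayley_circle t)) *\<^sub>R axis k 1) (y + (\<rho> * Im (cayley_circle t)) *\<^sub>R axis k 1) \<partial>lborel \<partial>lborel)"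
    unfolding circle_op_def by (rule lborel_pair.Fubini') measurable
  also have "\<dots> = (\<integral>\<^sup>+ t. ennreal (cauchy_density t) *
     (\<integral>\<^sup>+ x. v (x + (\<rho> * Re (cayley_circle t)) *\<^sub>R axis k 1) (y + (\<rho> * Im (cayley_circle t)) *\<^sub>R axis k 1) \<partial>lborel) \<partial>lborel)"
    by (subst nn_integral_cmult) auto
  also have "\<dots> = (\<integral>\<^sup>+ t. ennreal (cauchy_density t) *
     (\<integral>\<^sup>+ x. v x (y + (\<rho> * Im (cayley_circle t)) *\<^sub>R axis k 1) \<partial>lborel) \<partial>lborel)"
    by (subst nn_integral_lborel_translate[where f="\<lambda>x. v x _"]) auto
  also have "\<dots> \<le> (\<integral>\<^sup>+ t. ennreal (cauchy_density t) * N \<partial>lborel)"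
    by (intro nn_integral_mono mult_left_mono le) auto
  also have "\<dots> = N" by (subst nn_integral_multc) (auto simp: nn_integral_cauchy_density)
  finally show ?thesis .
qed

fun circle_ops :: "real \<Rightarrow> 'n list \<Rightarrow> (real^'n \<Rightarrow> real^'n \<Rightarrow> ennreal) \<Rightarrow> real^'n \<Rightarrow> real^'n \<Rightarrow> ennreal" where
  "circle_ops \<rho> [] v = v"
| "circle_ops \<rho> (k # ks) v = circle_op \<rho> k (circle_ops \<rho> ks v)"

lemma circle_ops_measurable:
  fixes v :: "real^'n \<Rightarrow> real^'n \<Rightarrow> ennreal"
  assumes "case_prod v \<in> borel_measurable (borel \<Otimes>\<^sub>M borel)"
  shows "case_prod (circle_ops \<rho> ks v) \<in> borel_measurable (borel \<Otimes>\<^sub>M borel)"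
  using assms by (induction ks) (auto intro: circle_op_measurable)

lemma nn_integral_circle_ops_le:
  fixes v :: "real^'n \<Rightarrow> real^'n \<Rightarrow> ennreal"
  assumes "case_prod v \<in> borel_measurable (borel \<Otimes>\<^sub>M borel)" "\<And>y. (\<integral>\<^sup>+ x. v x y \<partial>lborel) \<le> N"
  shows "(\<integral>\<^sup>+ x. circle_ops \<rho> ks v x y \<partial>lborel) \<le> N"
  using assms
proof (induction ks arbitrary: y)
  case (Cons k ks)
  show ?case unfolding circle_ops.simps
    using Cons by (intro nn_integral_circle_op_le circle_ops_measurable) auto
qed simp

text \<open>The p-th power of the Hardy quasi-norm, taken with \<open>lborel\<close>, which gives
  the same nonnegative integrals as \<open>lebesgue\<close>.\<close>

definition Hardy_norm :: "real \<Rightarrow> (real^'n) set \<Rightarrow> (complex^'n \<Rightarrow> complex) \<Rightarrow> ennreal" where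
  "Hardy_norm p B F = (SUP y\<in>B. \<integral>\<^sup>+ x. ennreal (norm (F (cplx x y)) powr p) \<partial>lborel)"

lemma Hardy_tube_iff: "F \<in> Hardy_tube p B \<longleftrightarrow> holomorphic_several F (tube B) \<and> Hardy_norm p B F < \<infinity>"
  by (simp add: Hardy_tube_def Hardy_norm_def nn_integral_completion)

lemma continuous_on_F_cplx:
  fixes F :: "complex^'n \<Rightarrow> complex"
  assumes "holomorphic_several F (tube B)"
    and "continuous_on S f" "continuous_on S g" "\<And>s. s \<in> S \<Longrightarrow> g s \<in> B"
  shows "continuous_on S (\<lambda>s. F (cplx (f s) (g s)))"
  using assms
  by (intro continuous_on_compose2[OF holomorphic_several_imp_continuous_on[OF assms(1)]] continuous_on_cplx) auto

lemma F_cplx_measurable: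
  fixes F :: "complex^'n \<Rightarrow> complex"
  assumes "holomorphic_several F (tube B)" "y \<in> B"
  shows "(\<lambda>x. F (cplx x y)) \<in> borel_measurable borel"
  using assms by (intro borel_measurable_continuous_onI continuous_on_F_cplx) (auto intro: continuous_intros)

lemma sign_vectors_cases: "\<sigma> \<in> sign_vectors \<Longrightarrow> \<sigma> k = 1 \<or> \<sigma> k = -1"
  by (auto simp: sign_vectors_def)

lemma octant_add_axis:
  fixes y :: "real^'n"
  assumes "y \<in> octant \<sigma>" "\<sigma> k * (y $ k + t) > 0"
  shows "y + t *\<^sub>R axis k 1 \<in> octant \<sigma>"
  using assms by (auto simp: octant_def axis_def)

text \<open>The indicator extends the function by 0 to all heights, so that the circle averages are
  measurable even at points whose circles leave the tube.\<close>

lemma F_cplx_jointly_measurable: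
  fixes F :: "complex^'n \<Rightarrow> complex"
  assumes "holomorphic_several F (tube B)" "open B"
  shows "(\<lambda>(x, y). indicator B y * ennreal (norm (F (cplx x y)) powr p)) \<in> borel_measurable (borel \<Otimes>\<^sub>M borel)"
proof -
  have "continuous_on (UNIV \<times> B) (\<lambda>z. F (cplx (fst z) (snd z)))"
    by (intro continuous_on_F_cplx[OF assms(1)] continuous_intros) auto
  moreover have "UNIV \<times> B \<in> sets borel" using assms(2) by (intro borel_open open_Times) auto
  ultimately have "(\<lambda>z. indicator (UNIV \<times> B) z *\<^sub>R F (cplx (fst z) (snd z))) \<in> borel_measurable borel"
    by (intro borel_measurable_continuous_on_indicator)
  hence [measurable]: "(\<lambda>z. indicator (UNIV \<times> B) z *\<^sub>R F (cplx (fst z) (snd z))) \<in> borel_measurable (borel \<Otimes>\<^sub>M borel)"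
    by (simp only: borel_prod)
  have [measurable]: "B \<in> sets borel" using assms(2) by simp
  have "(\<lambda>z. indicator B (snd z) * ennreal (norm (indicator (UNIV \<times> B) z *\<^sub>R F (cplx (fst z) (snd z))) powr p))
     \<in> borel_measurable borel" unfolding borel_prod[symmetric] by measurable
  also have "(\<lambda>z. indicator B (snd z) * ennreal (norm (indicator (UNIV \<times> B) z *\<^sub>R F (cplx (fst z) (snd z))) powr p))
    = (\<lambda>(x, y). indicator B y * ennreal (norm (F (cplx x y)) powr p))"
    by (auto simp: fun_eq_iff indicator_def)
  finally show ?thesis by (simp add: borel_prod)
qed

text \<open>The one-variable estimate is applied to one coordinate after the other. Depth 2 \<rho>
  in coordinate k keeps the circle inside the octant, and moving that coordinate leaves the depth in
  the others untouched.\<close>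

lemma norm_powr_le_circle_ops:
  fixes F :: "complex^'n \<Rightarrow> complex" and x y :: "real^'n"
  assumes \<sigma>: "\<sigma> \<in> sign_vectors" and hol: "holomorphic_several F (tube (octant \<sigma>))"
    and p: "p > 0" and \<rho>: "\<rho> > 0" and s: "\<And>k. \<bar>s k\<bar> \<le> \<rho> / 2"
  defines "u \<equiv> \<lambda>x y. indicator (octant \<sigma>) y * ennreal (norm (F (cplx x y)) powr p)"
  assumes "distinct ks" "y \<in> octant \<sigma>" "\<And>k. k \<in> set ks \<Longrightarrow> \<sigma> k * y $ k > 2 * \<rho>"
  shows "u x y \<le> 27 ^ length ks * circle_ops \<rho> ks u (x + (\<Sum>k\<leftarrow>ks. s k *\<^sub>R axis k 1)) y"
  using assms(7-)
proof (induction ks arbitrary: x y)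
  case (Cons k ks)
  let ?h = "\<lambda>c. F (cplx x y + c *s axis k 1)"
  let ?U = "{c. cplx x y + c *s axis k 1 \<in> tube (octant \<sigma>)}"
  have sk: "\<bar>\<sigma> k\<bar> = 1" using sign_vectors_cases[OF \<sigma>, of k] by auto
  have in_oct: "y + t *\<^sub>R axis k 1 \<in> octant \<sigma>" if "\<bar>t\<bar> \<le> 2 * \<rho>" for t
  proof (rule octant_add_axis)
    have "\<bar>\<sigma> k * t\<bar> \<le> 2 * \<rho>" using that sk by (simp add: abs_mult)
    thus "\<sigma> k * (y $ k + t) > 0" using Cons.prems(3)[of k] by (simp add: algebra_simps)
  qed (use Cons in auto)
  have opU: "open ?U" by (intro open_smult_slice open_tube open_octant)
  have cb: "cball 0 (2 * \<rho>) \<subseteq> ?U"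
  proof
    fix c :: complex assume "c \<in> cball 0 (2 * \<rho>)"
    hence "\<bar>Im c\<bar> \<le> 2 * \<rho>" using abs_Im_le_cmod[of c] by simp
    thus "c \<in> ?U" using in_oct[of "Im c"] cplx_shift[of x y "Re c" "Im c" k] by simp
  qed
  have Im_le: "\<bar>\<rho> * Im (cayley_circle t)\<bar> \<le> \<rho>" for t
    using abs_Im_le_cmod[of "cayley_circle t"] \<rho> by (simp add: abs_mult)
  have "u x y = ennreal (norm (?h 0) powr p)" using Cons by (simp add: u_def)
  also have "\<dots> \<le> 27 * (\<integral>\<^sup>+ t. ennreal (cauchy_density t) *
        ennreal (norm (?h (0 + of_real (s k) + of_real \<rho> * cayley_circle t)) powr p) \<partial>lborel)"
    by (rule norm_powr_le_circle_integral[OF opU holomorphic_several_slice[OF hol] cb \<rho> s p])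
  also have "\<dots> \<le> 27 * (\<integral>\<^sup>+ t. 27 ^ length ks * (ennreal (cauchy_density t) *
     circle_ops \<rho> ks u (x + (\<Sum>k\<leftarrow>k#ks. s k *\<^sub>R axis k 1) + (\<rho> * Re (cayley_circle t)) *\<^sub>R axis k 1)
        (y + (\<rho> * Im (cayley_circle t)) *\<^sub>R axis k 1)) \<partial>lborel)"
  proof (intro mult_left_mono nn_integral_mono)
    fix t
    let ?x = "x + (s k + \<rho> * Re (cayley_circle t)) *\<^sub>R axis k 1"
    let ?y = "y + (\<rho> * Im (cayley_circle t)) *\<^sub>R axis k 1"
    have e: "of_real (s k) + of_real \<rho> * cayley_circle t = Complex (s k + \<rho> * Re (cayley_circle t)) (\<rho> * Im (cayley_circle t))"
      by (simp add: complex_eq_iff)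
    have yo: "?y \<in> octant \<sigma>" using Im_le[of t] \<rho> by (intro in_oct) auto
    have "ennreal (norm (?h (0 + of_real (s k) + of_real \<rho> * cayley_circle t)) powr p) = u ?x ?y"
      using yo by (simp add: e cplx_shift u_def)
    also have "\<dots> \<le> 27 ^ length ks * circle_ops \<rho> ks u (?x + (\<Sum>k\<leftarrow>ks. s k *\<^sub>R axis k 1)) ?y"
    proof (rule Cons.IH)
      fix k' assume k': "k' \<in> set ks"
      have e: "?y $ k' = y $ k'" using Cons.prems(1) k' by (auto simp: axis_def)
      show "\<sigma> k' * ?y $ k' > 2 * \<rho>" unfolding e using Cons.prems(3)[of k'] k' by simp
    qed (use Cons.prems yo in auto)
    also have "?x + (\<Sum>k\<leftarrow>ks. s k *\<^sub>R axis k 1) =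
       x + (\<Sum>k\<leftarrow>k#ks. s k *\<^sub>R axis k 1) + (\<rho> * Re (cayley_circle t)) *\<^sub>R axis k 1"
      by (simp add: algebra_simps)
    finally have "ennreal (cauchy_density t) *
        ennreal (norm (?h (0 + of_real (s k) + of_real \<rho> * cayley_circle t)) powr p) \<le>
       ennreal (cauchy_density t) * (27 ^ length ks *
     circle_ops \<rho> ks u (x + (\<Sum>k\<leftarrow>k#ks. s k *\<^sub>R axis k 1) + (\<rho> * Re (cayley_circle t)) *\<^sub>R axis k 1) ?y)"
      by (rule mult_left_mono) simp
    thus "ennreal (cauchy_density t) *
        ennreal (norm (?h (0 + of_real (s k) + of_real \<rho> * cayley_circle t)) powr p) \<le>
        27 ^ length ks * (ennreal (cauchy_density t) *
     circle_ops \<rho> ks u (x + (\<Sum>k\<leftarrow>k#ks. s k *\<^sub>R axis k 1) + (\<rho> * Re (cayley_circle t)) *\<^sub>R axis k 1) ?y)"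
      by (subst mult.left_commute)
  qed auto
  also have "\<dots> \<le> 27 ^ length (k#ks) * circle_ops \<rho> (k#ks) u (x + (\<Sum>k\<leftarrow>k#ks. s k *\<^sub>R axis k 1)) y"
  proof -
    have um: "case_prod u \<in> borel_measurable (borel \<Otimes>\<^sub>M borel)"
      unfolding u_def by (rule F_cplx_jointly_measurable[OF hol open_octant])
    have [measurable]: "(\<lambda>t. circle_ops \<rho> ks u (f t) (g t)) \<in> borel_measurable M"
      if "f \<in> M \<rightarrow>\<^sub>M borel" "g \<in> M \<rightarrow>\<^sub>M borel" for f g and M :: "real measure"
      using measurable_compose[OF measurable_Pair[OF that] circle_ops_measurable[OF um]] by simp
    show ?thesis by (subst nn_integral_cmult) (simp_all add: circle_op_def mult.assoc)
  qed
  finally show ?case .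
qed simp


text \<open>The circle estimate holds for every displacement of the centres in a cube of side
  \<rho>. Integrating over the cube turns the displacement into an integration over
  \<open>x\<close>, which the Hardy norm bounds; dividing by the volume of the cube gives the power
  of \<rho>.\<close>

lemma Hardy_pointwise_bound:
  fixes F :: "complex^'n \<Rightarrow> complex" and x y :: "real^'n"
  assumes \<sigma>: "\<sigma> \<in> sign_vectors" and hol: "holomorphic_several F (tube (octant \<sigma>))"
    and p: "p > 0" and \<rho>: "\<rho> > 0" and y: "\<And>k. \<sigma> k * y $ k > 2 * \<rho>"
  shows "ennreal (norm (F (cplx x y)) powr p) \<le> ennreal ((27 / \<rho>) ^ CARD('n)) * Hardy_norm p (octant \<sigma>) F"
proof -
  define u where "u = (\<lambda>x y. indicator (octant \<sigma>) y * ennreal (norm (F (cplx x y)) powr p))"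
  let ?n = "CARD('n)" and ?N = "Hardy_norm p (octant \<sigma>) F"
  obtain ks :: "'n list" where ks: "set ks = UNIV" "distinct ks"
    using finite_distinct_list[of "UNIV :: 'n set"] by auto
  have len: "length ks = ?n" using ks distinct_card by fastforce
  have "\<sigma> k * y $ k > 0" for k using y[of k] \<rho> by linarith
  hence yo: "y \<in> octant \<sigma>" by (simp add: octant_def)
  have um: "case_prod u \<in> borel_measurable (borel \<Otimes>\<^sub>M borel)"
    unfolding u_def by (rule F_cplx_jointly_measurable[OF hol open_octant])
  have uN: "(\<integral>\<^sup>+ x. u x y \<partial>lborel) \<le> ?N" for y
  proof (cases "y \<in> octant \<sigma>")
    case True thus ?thesis unfolding Hardy_norm_def u_def by (auto intro: SUP_upper2)
  qed (simp add: u_def)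
  define v where "v = (\<lambda>x. circle_ops \<rho> ks u x y)"
  have [measurable]: "v \<in> borel_measurable borel"
    unfolding v_def using measurable_compose[OF _ circle_ops_measurable[OF um], of "\<lambda>x. (x, y)" borel] by simp
  let ?c = "(\<chi> k. \<rho> / 2) :: real^'n"
  let ?Q = "cbox (- ?c) ?c"
  have lam: "u x y \<le> 27 ^ ?n * v (s + x)" if "s \<in> ?Q" for s
  proof -
    have s: "- (\<rho> / 2) \<le> s $ k \<and> s $ k \<le> \<rho> / 2" for k using that by (simp add: mem_box_cart)
    have "\<bar>s $ k\<bar> \<le> \<rho> / 2" for k using s[of k] by linarith
    hence "u x y \<le> 27 ^ length ks * circle_ops \<rho> ks u (x + (\<Sum>k\<leftarrow>ks. s $ k *\<^sub>R axis k 1)) y"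
      unfolding u_def using \<sigma> hol p \<rho> ks yo y by (intro norm_powr_le_circle_ops) auto
    also have "(\<Sum>k\<leftarrow>ks. s $ k *\<^sub>R axis k 1) = (\<Sum>k\<in>UNIV. s $ k *\<^sub>R axis k 1)"
      by (simp add: sum_list_distinct_conv_sum_set[OF ks(2)] ks(1))
    also have "\<dots> = s" by (simp add: vec_eq_iff axis_def if_distrib cong: if_cong)
    finally show ?thesis by (simp add: v_def len add.commute)
  qed
  have Q: "emeasure lborel ?Q = ennreal (\<rho> ^ ?n)"
  proof -
    have "emeasure lborel ?Q = ennreal (measure lborel ?Q)"
      using emeasure_lborel_cbox_finite[of "- ?c" ?c] by (intro emeasure_eq_ennreal_measure) auto
    also have "measure lborel ?Q = (\<Prod>k\<in>UNIV. ?c $ k - (- ?c) $ k)"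
      using \<rho> by (intro content_cbox_cart) (auto simp: interval_ne_empty_cart not_less)
    finally show ?thesis by simp
  qed
  have "ennreal (\<rho> ^ ?n) * u x y = (\<integral>\<^sup>+ s. indicator ?Q s * u x y \<partial>lborel)"
    by (subst nn_integral_multc) (auto simp: Q)
  also have "\<dots> \<le> (\<integral>\<^sup>+ s. 27 ^ ?n * v (s + x) \<partial>lborel)"
    using lam by (intro nn_integral_mono) (auto simp: indicator_def)
  also have "\<dots> = 27 ^ ?n * (\<integral>\<^sup>+ s. v (s + x) \<partial>lborel)"
    by (rule nn_integral_cmult) measurable
  also have "(\<integral>\<^sup>+ s. v (s + x) \<partial>lborel) = (\<integral>\<^sup>+ s. v s \<partial>lborel)"
    by (rule nn_integral_lborel_translate) simp
  also have "\<dots> \<le> ?N" unfolding v_def by (rule nn_integral_circle_ops_le[OF um uN])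
  finally have "ennreal (\<rho> ^ ?n) * u x y \<le> 27 ^ ?n * ?N" by (simp add: mult_left_mono)
  hence "ennreal ((1/\<rho>) ^ ?n) * (ennreal (\<rho> ^ ?n) * u x y) \<le> ennreal ((1/\<rho>) ^ ?n) * (27 ^ ?n * ?N)"
    by (rule mult_left_mono) simp
  also have "ennreal ((1/\<rho>) ^ ?n) * (ennreal (\<rho> ^ ?n) * u x y) = u x y"
    using \<rho> by (simp add: mult.assoc[symmetric] ennreal_mult[symmetric] power_mult_distrib[symmetric])
  also have "ennreal ((1/\<rho>) ^ ?n) * (27 ^ ?n * ?N) = ennreal ((27 / \<rho>) ^ ?n) * ?N"
    using \<rho> by (simp add: mult.assoc[symmetric] ennreal_power[symmetric] ennreal_numeral[symmetric] ennreal_mult[symmetric]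
        power_mult_distrib[symmetric] del: ennreal_numeral)
  finally show ?thesis using yo by (simp add: u_def)
qed

section \<open>Iterated Poisson majorants in an octant\<close>

fun line_avgs :: "'n list \<Rightarrow> real^'n \<Rightarrow> (real^'n \<Rightarrow> ennreal) \<Rightarrow> real^'n \<Rightarrow> ennreal" where
  "line_avgs [] y u = u"
| "line_avgs (k # ks) y u = line_avg (axis k 1) (y $ k) (line_avgs ks y u)"

fun line_maxs :: "real set \<Rightarrow> 'n list \<Rightarrow> (real^'n \<Rightarrow> ennreal) \<Rightarrow> real^'n \<Rightarrow> ennreal" where
  "line_maxs D [] u = u"
| "line_maxs D (k # ks) u = line_max D (axis k 1) (line_maxs D ks u)"

lemma line_avgs_measurable [measurable (raw)]:
  "u \<in> borel_measurable borel \<Longrightarrow> line_avgs ks y u \<in> borel_measurable borel"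
  by (induction ks) auto

lemma line_maxs_measurable:
  "countable D \<Longrightarrow> u \<in> borel_measurable borel \<Longrightarrow> line_maxs D ks u \<in> borel_measurable borel"
  by (induction ks) (auto intro: line_max_measurable)

lemma line_maxs_bound:
  assumes "countable D" "D \<subseteq> {0<..}" "u \<in> borel_measurable borel"
  shows "(\<integral>\<^sup>+ x. (line_maxs D ks u x)\<^sup>2 \<partial>lborel) \<le> 16 ^ length ks * (\<integral>\<^sup>+ x. (u x)\<^sup>2 \<partial>lborel)"
proof (induction ks)
  case (Cons k ks)
  have "(\<integral>\<^sup>+ x. (line_maxs D (k # ks) u x)\<^sup>2 \<partial>lborel) \<le> 16 * (\<integral>\<^sup>+ x. (line_maxs D ks u x)\<^sup>2 \<partial>lborel)"
    using line_max_bound[OF assms(1,2) line_maxs_measurable[OF assms(1,3)]] by simp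
  also have "\<dots> \<le> 16 * (16 ^ length ks * (\<integral>\<^sup>+ x. (u x)\<^sup>2 \<partial>lborel))"
    by (intro mult_left_mono Cons.IH) auto
  finally show ?case by (simp add: mult.assoc)
qed simp

lemma line_avgs_le_line_maxs:
  fixes x y :: "real^'n"
  assumes "\<And>k. \<bar>y $ k\<bar> \<in> D" and u: "u \<in> borel_measurable borel"
  shows "line_avgs ks y u x \<le> line_maxs D ks u x"
proof (induction ks arbitrary: x)
  case (Cons k ks)
  have "line_avgs (k # ks) y u x = line_avg (axis k 1) \<bar>y $ k\<bar> (line_avgs ks y u) x"
    using line_avg_uminus[of "line_avgs ks y u" "axis k 1" "y $ k"] u by (auto simp: abs_if)
  also have "\<dots> \<le> line_avg (axis k 1) \<bar>y $ k\<bar> (line_maxs D ks u) x"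
    by (rule line_avg_mono) (rule Cons.IH)
  also have "\<dots> \<le> line_maxs D (k # ks) u x"
    using line_avg_le_line_max[OF assms(1)[of k]] by simp
  finally show ?case .
qed simp

definition sign_vec :: "('n \<Rightarrow> real) \<Rightarrow> real^'n" where "sign_vec \<sigma> = (\<chi> k. \<sigma> k)"

lemma sign_vec_nth [simp]: "sign_vec \<sigma> $ k = \<sigma> k" by (simp add: sign_vec_def)

lemma sign_mult_self: "\<sigma> \<in> sign_vectors \<Longrightarrow> \<sigma> k * \<sigma> k = 1"
  using sign_vectors_cases[of \<sigma> k] by auto

text \<open>Raising coordinate k keeps every coordinate at depth at least \<delta>, so by the
  pointwise bound the slice is bounded on a closed half plane. The half-plane majorant then holds
  for every exponent \<open>q\<close>, not just for \<open>p\<close>.\<close>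

lemma Hardy_single_majorant:
  fixes F :: "complex^'n \<Rightarrow> complex" and y :: "real^'n"
  assumes \<sigma>: "\<sigma> \<in> sign_vectors" and hol: "holomorphic_several F (tube (octant \<sigma>))"
    and fin: "Hardy_norm p (octant \<sigma>) F < \<infinity>" and p: "p > 0" and q: "q > 0"
    and \<delta>: "\<delta> > 0" "\<And>j. \<sigma> j * y $ j \<ge> \<delta>" and \<eta>: "\<sigma> k * \<eta> \<ge> 0"
  shows "ennreal (norm (F (cplx x (y + \<eta> *\<^sub>R axis k 1))) powr q) \<le>
    line_avg (axis k 1) \<eta> (\<lambda>x. ennreal (norm (F (cplx x y)) powr q)) x"
proof -
  \<comment> \<open>Multiplying the direction by \<sigma> k makes the octant correspond to the upper
    half plane for both signs.\<close>
  define h where "h c = F (cplx x y + c *s (of_real (\<sigma> k) *s axis k 1))" for c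
  let ?U = "{c. cplx x y + c *s (of_real (\<sigma> k) *s axis k 1) \<in> tube (octant \<sigma>)}"
  have sk: "\<sigma> k * \<sigma> k = 1" using sign_mult_self[OF \<sigma>] .
  have shift: "cplx x y + Complex s t *s (of_real (\<sigma> k) *s axis k 1) =
     cplx (x + (\<sigma> k * s) *\<^sub>R axis k 1) (y + (\<sigma> k * t) *\<^sub>R axis k 1)" for s t
    by (simp add: vec_eq_iff cplx_def axis_def complex_eq_iff)
  have deep: "\<sigma> j * (y + (\<sigma> k * t) *\<^sub>R axis k 1) $ j \<ge> \<delta>" if "t \<ge> 0" for t j
  proof (cases "j = k")
    case True
    have "\<sigma> j * (y + (\<sigma> k * t) *\<^sub>R axis k 1) $ j = \<sigma> k * y $ k + (\<sigma> k * \<sigma> k) * t"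
      using True by (simp add: axis_def distrib_left)
    thus ?thesis using \<delta>(2)[of k] that unfolding sk by simp
  qed (use \<delta> in \<open>auto simp: axis_def\<close>)
  have in_oct: "y \<in> octant \<sigma>" if "\<And>j. \<sigma> j * y $ j \<ge> \<delta>" for y :: "real^'n"
    unfolding octant_def using that \<delta>(1) less_le_trans by blast
  have opU: "open ?U" by (intro open_smult_slice open_tube open_octant)
  have sub: "{z. Im z \<ge> 0} \<subseteq> ?U"
  proof
    fix c :: complex assume c: "c \<in> {z. Im z \<ge> 0}"
    show "c \<in> ?U" using shift[of "Re c" "Im c"] in_oct[OF deep] c by simp
  qed
  have holh: "h holomorphic_on ?U" unfolding h_def by (rule holomorphic_several_slice[OF hol])
  \<comment> \<open>The radius is \<delta>/3 because the pointwise bound asks for a depth strictly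
    above twice the radius.\<close>
  define K where "K = enn2real (ennreal ((27 / (\<delta>/3)) ^ CARD('n)) * Hardy_norm p (octant \<sigma>) F)"
  have bound: "norm (h c) \<le> K powr (1/p)" if "Im c \<ge> 0" for c
  proof -
    have "ennreal (norm (F (cplx (x + (\<sigma> k * Re c) *\<^sub>R axis k 1) (y + (\<sigma> k * Im c) *\<^sub>R axis k 1))) powr p)
       \<le> ennreal ((27 / (\<delta>/3)) ^ CARD('n)) * Hardy_norm p (octant \<sigma>) F"
    proof (rule Hardy_pointwise_bound[OF \<sigma> hol p])
      show "2 * (\<delta> / 3) < \<sigma> j * (y + (\<sigma> k * Im c) *\<^sub>R axis k 1) $ j" for j
        using deep[OF that, of j] \<delta>(1) by linarith
    qed (use \<delta>(1) in simp)
    also have "\<dots> = ennreal K" unfolding K_def using fin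
      by (subst ennreal_enn2real) (auto simp: ennreal_mult_less_top)
    finally have "norm (h c) powr p \<le> K"
      using shift[of "Re c" "Im c"] by (simp add: h_def K_def)
    hence "(norm (h c) powr p) powr (1/p) \<le> K powr (1/p)" using p by (intro powr_mono2) auto
    thus ?thesis using p by (simp add: powr_powr)
  qed
  have "ennreal (norm (h (Complex 0 (\<sigma> k * \<eta>))) powr q) \<le>
    (\<integral>\<^sup>+ t. ennreal (cauchy_density t) * ennreal (norm (h (of_real (0 + (\<sigma> k * \<eta>) * t))) powr q) \<partial>lborel)"
    by (rule norm_powr_le_poisson_integral[OF opU sub holh q bound \<eta>])
  moreover have "h (Complex 0 (\<sigma> k * \<eta>)) = F (cplx x (y + \<eta> *\<^sub>R axis k 1))"
    unfolding h_def shift using sk by (simp add: mult.assoc[symmetric])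
  moreover have "h (of_real (0 + (\<sigma> k * \<eta>) * t)) = F (cplx (x + (\<eta> * t) *\<^sub>R axis k 1) y)" for t
  proof -
    have "complex_of_real (0 + (\<sigma> k * \<eta>) * t) = Complex (\<sigma> k * \<eta> * t) 0" by (simp add: Complex_eq)
    thus ?thesis unfolding h_def using shift[of "\<sigma> k * \<eta> * t" 0] sk by (simp add: mult.assoc[symmetric])
  qed
  ultimately show ?thesis by (simp add: line_avg_def)
qed

text \<open>The coordinates are raised one at a time from the base point \<delta> \<sigma>, each at
  the price of one line average. The base height stays fixed throughout.\<close>

lemma Hardy_majorant:
  fixes F :: "complex^'n \<Rightarrow> complex" and y :: "real^'n"
  assumes \<sigma>: "\<sigma> \<in> sign_vectors" and hol: "holomorphic_several F (tube (octant \<sigma>))"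
    and fin: "Hardy_norm p (octant \<sigma>) F < \<infinity>" and p: "p > 0" and q: "q > 0"
    and \<delta>: "\<delta> > 0" and y: "\<And>k. \<sigma> k * y $ k \<ge> 0" and ks: "distinct ks"
  shows "ennreal (norm (F (cplx x (\<delta> *\<^sub>R sign_vec \<sigma> + (\<Sum>k\<leftarrow>ks. y $ k *\<^sub>R axis k 1)))) powr q) \<le>
    line_avgs ks y (\<lambda>x. ennreal (norm (F (cplx x (\<delta> *\<^sub>R sign_vec \<sigma>))) powr q)) x"
  using ks
proof (induction ks arbitrary: x)
  case (Cons k ks)
  let ?y = "\<delta> *\<^sub>R sign_vec \<sigma> + (\<Sum>k\<leftarrow>ks. y $ k *\<^sub>R axis k 1)"
  have deep: "\<sigma> j * ?y $ j \<ge> \<delta>" for j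
  proof -
    have "(\<Sum>k\<leftarrow>ks. y $ k *\<^sub>R axis k 1) $ j = (\<Sum>k\<in>set ks. y $ k *\<^sub>R axis k 1) $ j"
      using Cons.prems by (simp add: sum_list_distinct_conv_sum_set)
    also have "\<dots> = (if j \<in> set ks then y $ j else 0)" by (simp add: axis_def if_distrib cong: if_cong)
    finally have "\<sigma> j * ?y $ j = \<delta> * (\<sigma> j * \<sigma> j) + \<sigma> j * (if j \<in> set ks then y $ j else 0)"
      by (simp add: algebra_simps)
    thus ?thesis using sign_mult_self[OF \<sigma>, of j] y[of j] by simp
  qed
  have "ennreal (norm (F (cplx x (?y + y $ k *\<^sub>R axis k 1))) powr q) \<le>
      line_avg (axis k 1) (y $ k) (\<lambda>x. ennreal (norm (F (cplx x ?y)) powr q)) x"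
    by (rule Hardy_single_majorant[OF \<sigma> hol fin p q \<delta> deep y])
  also have "\<dots> \<le> line_avg (axis k 1) (y $ k) (line_avgs ks y (\<lambda>x. ennreal (norm (F (cplx x (\<delta> *\<^sub>R sign_vec \<sigma>))) powr q))) x"
    using Cons by (intro line_avg_mono) auto
  finally show ?case by (simp add: add_ac)
qed simp

section \<open>Maximal bounds and boundary convergence\<close>

text \<open>On [0, 1] one has t \<le> t^p; normalising by a + b gives the claim. It is what makes
  the integral of |f - g|^p satisfy the triangle inequality.\<close>

lemma powr_add_le:
  fixes a b p :: real
  assumes "a \<ge> 0" "b \<ge> 0" "0 < p" "p \<le> 1"
  shows "(a + b) powr p \<le> a powr p + b powr p"
proof (cases "a + b = 0")
  case True thus ?thesis using assms by simp
next
  case False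
  define s where "s = a + b"
  have s: "s > 0" using False assms by (simp add: s_def)
  have le: "c / s \<le> (c / s) powr p" if "0 \<le> c" "c \<le> s" for c
  proof (cases "c = 0")
    case False
    hence "(c / s) powr 1 \<le> (c / s) powr p" using that s assms by (intro powr_mono') auto
    thus ?thesis using False that s by simp
  qed simp
  have "1 = a / s + b / s" using s by (simp add: s_def add_divide_distrib[symmetric])
  also have "\<dots> \<le> (a / s) powr p + (b / s) powr p"
    using assms by (intro add_mono le) (auto simp: s_def)
  also have "\<dots> = (a powr p + b powr p) / s powr p"
    using assms s by (simp add: powr_divide add_divide_distrib)
  finally show ?thesis using s by (simp add: s_def field_simps)
qed

lemma norm_add_powr_le:
  fixes a b :: "'a::real_normed_vector"
  assumes "0 < p" "p \<le> 1"
  shows "norm (a + b) powr p \<le> norm a powr p + norm b powr p"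
proof -
  have "norm (a + b) powr p \<le> (norm a + norm b) powr p"
    using assms by (intro powr_mono2) (auto simp: norm_triangle_ineq)
  also have "\<dots> \<le> norm a powr p + norm b powr p" using assms by (intro powr_add_le) auto
  finally show ?thesis .
qed

lemma norm_diff_powr_le:
  fixes a b :: "'a::real_normed_vector"
  assumes "0 < p" "p \<le> 1"
  shows "norm (a - b) powr p \<le> norm a powr p + norm b powr p"
  using norm_add_powr_le[OF assms, of a "- b"] by simp

lemma ennreal_norm_diff_powr_le:
  fixes a b :: "'a::real_normed_vector"
  assumes "0 < p" "p \<le> 1"
  shows "ennreal (norm (a - b) powr p) \<le> ennreal (norm a powr p) + ennreal (norm b powr p)"
  using norm_diff_powr_le[OF assms, of a b] by (simp flip: ennreal_plus)

text \<open>A countable dense set of heights: suprema over it are measurable, and the moduli of its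
  coordinates form the countable set of scales for the maximal operator.\<close>

definition rational_octant :: "('n \<Rightarrow> real) \<Rightarrow> (real^'n) set" where
  "rational_octant \<sigma> = {y. \<forall>k. \<sigma> k * y $ k \<in> \<rat> \<inter> {0<..}}"

lemma rational_octant_subset: "rational_octant \<sigma> \<subseteq> octant \<sigma>"
  by (auto simp: rational_octant_def octant_def)

lemma sign_mult_cancel: "\<sigma> \<in> sign_vectors \<Longrightarrow> \<sigma> k * (\<sigma> k * t) = t"
  using sign_mult_self[of \<sigma> k] by (simp add: mult.assoc[symmetric])

lemma countable_rational_octant:
  assumes "\<sigma> \<in> sign_vectors"
  shows "countable (rational_octant \<sigma> :: (real^'n) set)"
proof -
  have "rational_octant \<sigma> \<subseteq> (\<lambda>f. \<chi> k. \<sigma> k * f k) ` (UNIV \<rightarrow>\<^sub>E \<rat>)"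
  proof
    fix y :: "real^'n" assume "y \<in> rational_octant \<sigma>"
    hence "(\<lambda>k. \<sigma> k * y $ k) \<in> UNIV \<rightarrow>\<^sub>E \<rat>" by (auto simp: rational_octant_def)
    moreover have "y = (\<chi> k. \<sigma> k * (\<sigma> k * y $ k))" by (simp only: sign_mult_cancel[OF assms] vec_lambda_eta)
    ultimately show "y \<in> (\<lambda>f. \<chi> k. \<sigma> k * f k) ` (UNIV \<rightarrow>\<^sub>E \<rat>)" by (intro image_eqI)
  qed
  moreover have "countable ((UNIV :: 'n set) \<rightarrow>\<^sub>E (\<rat> :: real set))"
    by (intro countable_PiE) (auto simp: countable_rat)
  ultimately show ?thesis by (meson countable_image countable_subset)
qed

lemma SUP_rational_octant:
  fixes f :: "real^'n \<Rightarrow> real"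
  assumes \<sigma>: "\<sigma> \<in> sign_vectors" and f: "continuous_on (octant \<sigma>) f"
  shows "(SUP y\<in>octant \<sigma>. ennreal (f y)) = (SUP y\<in>rational_octant \<sigma>. ennreal (f y))"
proof (rule antisym)
  show "(SUP y\<in>octant \<sigma>. ennreal (f y)) \<le> (SUP y\<in>rational_octant \<sigma>. ennreal (f y))"
  proof (rule SUP_least)
    fix y assume y: "y \<in> octant \<sigma>"
    have "\<exists>r\<in>\<rat>. \<sigma> k * y $ k < r \<and> r < \<sigma> k * y $ k + inverse (real (Suc m))" for k m
      by (rule Rats_dense_in_real) simp
    then obtain r where r: "\<And>k m. r k m \<in> \<rat>" "\<And>k m. \<sigma> k * y $ k < r k m"
       "\<And>k m. r k m < \<sigma> k * y $ k + inverse (real (Suc m))" by metis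
    define Y where "Y m = (\<chi> k. \<sigma> k * r k m)" for m
    have YQ: "Y m \<in> rational_octant \<sigma>" for m
    proof -
      have "\<sigma> k * y $ k > 0" for k using y by (auto simp: octant_def)
      hence "r k m > 0" for k using r(2)[of k m] less_trans by blast
      thus ?thesis using r(1) by (simp add: rational_octant_def Y_def sign_mult_cancel[OF \<sigma>])
    qed
    have "(\<lambda>m. r k m) \<longlonglongrightarrow> \<sigma> k * y $ k" for k
    proof (rule tendsto_sandwich[OF _ _ tendsto_const])
      show "(\<lambda>m. \<sigma> k * y $ k + inverse (real (Suc m))) \<longlonglongrightarrow> \<sigma> k * y $ k"
        using tendsto_add[OF tendsto_const LIMSEQ_inverse_real_of_nat, of "\<sigma> k * y $ k"] by simp
    qed (intro always_eventually allI less_imp_le r)+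
    hence "(\<lambda>m. \<sigma> k * r k m) \<longlonglongrightarrow> y $ k" for k
      using tendsto_mult_left[of "\<lambda>m. r k m" "\<sigma> k * y $ k" sequentially "\<sigma> k"] by (simp add: sign_mult_cancel[OF \<sigma>])
    hence "Y \<longlonglongrightarrow> y" unfolding Y_def by (intro vec_tendstoI) simp
    hence "(\<lambda>m. f (Y m)) \<longlonglongrightarrow> f y"
      using YQ rational_octant_subset y by (intro continuous_on_tendsto_compose[OF f]) (auto intro!: always_eventually)
    hence "(\<lambda>m. ennreal (f (Y m))) \<longlonglongrightarrow> ennreal (f y)" by (rule tendsto_ennrealI)
    thus "ennreal (f y) \<le> (SUP y\<in>rational_octant \<sigma>. ennreal (f y))"
      by (rule LIMSEQ_le_const2) (intro exI allI impI SUP_upper YQ)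
  qed
qed (intro SUP_subset_mono rational_octant_subset order_refl)

lemma octant_add:
  "y \<in> octant \<sigma> \<Longrightarrow> z \<in> octant \<sigma> \<Longrightarrow> y + z \<in> octant \<sigma>"
  by (auto simp: octant_def distrib_left add_pos_pos)

lemma sign_vec_in_octant: "\<sigma> \<in> sign_vectors \<Longrightarrow> \<delta> > 0 \<Longrightarrow> \<delta> *\<^sub>R sign_vec \<sigma> \<in> octant \<sigma>"
  by (simp add: octant_def mult.left_commute[of "\<sigma> _" \<delta>] sign_mult_self)

text \<open>The supremum runs over the whole octant rather than over a ray or cone, so it dominates
  every approach to the boundary at once.\<close>

definition tube_max :: "real \<Rightarrow> ('n \<Rightarrow> real) \<Rightarrow> (complex^'n \<Rightarrow> complex) \<Rightarrow> real^'n \<Rightarrow> ennreal" where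
  "tube_max p \<sigma> F x = (SUP y\<in>octant \<sigma>. ennreal (norm (F (cplx x y)) powr p))"

lemma le_tube_max: "y \<in> octant \<sigma> \<Longrightarrow> ennreal (norm (F (cplx x y)) powr p) \<le> tube_max p \<sigma> F x"
  unfolding tube_max_def by (rule SUP_upper)

definition shifted :: "('n \<Rightarrow> real) \<Rightarrow> real \<Rightarrow> (complex^'n \<Rightarrow> complex) \<Rightarrow> complex^'n \<Rightarrow> complex" where
  "shifted \<sigma> \<delta> F z = F (z + cplx 0 (\<delta> *\<^sub>R sign_vec \<sigma>))"

lemma shifted_cplx: "shifted \<sigma> \<delta> F (cplx x y) = F (cplx x (y + \<delta> *\<^sub>R sign_vec \<sigma>))"
proof -
  have "cplx x y + cplx 0 (\<delta> *\<^sub>R sign_vec \<sigma>) = cplx x (y + \<delta> *\<^sub>R sign_vec \<sigma>)"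
    by (simp add: cplx_def vec_eq_iff complex_eq_iff)
  thus ?thesis by (simp add: shifted_def)
qed

lemma tube_max_rational:
  fixes F :: "complex^'n \<Rightarrow> complex"
  assumes "\<sigma> \<in> sign_vectors" "p > 0" and c: "continuous_on (octant \<sigma>) (\<lambda>y. F (cplx x y))"
  shows "tube_max p \<sigma> F x = (SUP y\<in>rational_octant \<sigma>. ennreal (norm (F (cplx x y)) powr p))"
  unfolding tube_max_def
  using assms by (intro SUP_rational_octant continuous_on_powr' continuous_intros) auto

lemma tube_max_measurable:
  fixes F :: "complex^'n \<Rightarrow> complex"
  assumes \<sigma>: "\<sigma> \<in> sign_vectors" and p: "p > 0" and hol: "holomorphic_several F (tube (octant \<sigma>))"
  shows "tube_max p \<sigma> F \<in> borel_measurable borel"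
proof -
  have "tube_max p \<sigma> F = (\<lambda>x. SUP y\<in>rational_octant \<sigma>. ennreal (norm (F (cplx x y)) powr p))"
    using \<sigma> p by (intro ext tube_max_rational continuous_on_F_cplx[OF hol] continuous_intros) auto
  also have "\<dots> \<in> borel_measurable borel"
  proof (intro borel_measurable_SUP countable_rational_octant \<sigma>)
    fix y :: "real^'n" assume "y \<in> rational_octant \<sigma>"
    hence [measurable]: "(\<lambda>x. F (cplx x y)) \<in> borel_measurable borel"
      using rational_octant_subset by (intro F_cplx_measurable[OF hol]) auto
    show "(\<lambda>x. ennreal (norm (F (cplx x y)) powr p)) \<in> borel_measurable borel" by measurable
  qed
  finally show ?thesis .
qed

text \<open>With the exponent p/2 the majorant bounds |F|^p by the square of an iterated maximal
  function, and the L^2 inequality costs 16 per coordinate. The right side involves the single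
  height \<delta>, so that it can later converge to the integral of the boundary values.\<close>

lemma shifted_maximal_bound:
  fixes F :: "complex^'n \<Rightarrow> complex"
  assumes \<sigma>: "\<sigma> \<in> sign_vectors" and hol: "holomorphic_several F (tube (octant \<sigma>))"
    and fin: "Hardy_norm p (octant \<sigma>) F < \<infinity>" and p: "p > 0" and \<delta>: "\<delta> > 0"
  shows "(\<integral>\<^sup>+ x. tube_max p \<sigma> (shifted \<sigma> \<delta> F) x \<partial>lborel) \<le>
    16 ^ CARD('n) * (\<integral>\<^sup>+ x. ennreal (norm (F (cplx x (\<delta> *\<^sub>R sign_vec \<sigma>))) powr p) \<partial>lborel)"
proof -
  define D :: "real set" where "D = \<rat> \<inter> {0<..}"
  have D: "countable D" "D \<subseteq> {0<..}" by (auto simp: D_def countable_rat)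
  obtain ks :: "'n list" where ks: "set ks = UNIV" "distinct ks"
    using finite_distinct_list[of "UNIV :: 'n set"] by auto
  have len: "length ks = CARD('n)" using ks distinct_card by fastforce
  define u where "u x = ennreal (norm (F (cplx x (\<delta> *\<^sub>R sign_vec \<sigma>))) powr (p/2))" for x
  have [measurable]: "(\<lambda>x. F (cplx x (\<delta> *\<^sub>R sign_vec \<sigma>))) \<in> borel_measurable borel"
    by (intro F_cplx_measurable[OF hol] sign_vec_in_octant \<sigma> \<delta>)
  have um: "u \<in> borel_measurable borel" unfolding u_def by measurable
  have sq: "(ennreal (r powr (p/2)))\<^sup>2 = ennreal (r powr p)" for r
    by (simp add: power2_eq_square ennreal_mult[symmetric] powr_add[symmetric])
  have le: "tube_max p \<sigma> (shifted \<sigma> \<delta> F) x \<le> (line_maxs D ks u x)\<^sup>2" for x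
  proof -
    have c: "continuous_on (octant \<sigma>) (\<lambda>y. shifted \<sigma> \<delta> F (cplx x y))"
      unfolding shifted_cplx using sign_vec_in_octant[OF \<sigma> \<delta>]
      by (intro continuous_on_F_cplx[OF hol] continuous_intros) (auto intro: octant_add)
    have "tube_max p \<sigma> (shifted \<sigma> \<delta> F) x = (SUP y\<in>rational_octant \<sigma>. ennreal (norm (F (cplx x (y + \<delta> *\<^sub>R sign_vec \<sigma>))) powr p))"
      using tube_max_rational[OF \<sigma> p c] by (simp add: shifted_cplx)
    also have "\<dots> \<le> (line_maxs D ks u x)\<^sup>2"
    proof (rule SUP_least)
      fix y assume y: "y \<in> rational_octant \<sigma>"
      have yD: "\<sigma> k * y $ k \<in> D" for k using y by (auto simp: rational_octant_def D_def)
      have "\<bar>y $ k\<bar> = \<sigma> k * y $ k" for k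
        using yD[of k] sign_vectors_cases[OF \<sigma>, of k] D(2) by auto
      hence ya: "\<bar>y $ k\<bar> \<in> D" for k using yD by simp
      have "(\<Sum>k\<leftarrow>ks. y $ k *\<^sub>R axis k 1) = (\<Sum>k\<in>UNIV. y $ k *\<^sub>R axis k 1)"
        by (simp add: sum_list_distinct_conv_sum_set[OF ks(2)] ks(1))
      also have "\<dots> = y" by (simp add: vec_eq_iff axis_def if_distrib cong: if_cong)
      finally have ysum: "(\<Sum>k\<leftarrow>ks. y $ k *\<^sub>R axis k 1) = y" .
      have "ennreal (norm (F (cplx x (\<delta> *\<^sub>R sign_vec \<sigma> + (\<Sum>k\<leftarrow>ks. y $ k *\<^sub>R axis k 1)))) powr (p/2)) \<le> line_avgs ks y u x"
        unfolding u_def using yD D(2) p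
        by (intro Hardy_majorant[OF \<sigma> hol fin p _ \<delta> _ ks(2)]) (auto intro: less_imp_le)
      also have "\<dots> \<le> line_maxs D ks u x" by (rule line_avgs_le_line_maxs[OF ya um])
      finally have "ennreal (norm (F (cplx x (y + \<delta> *\<^sub>R sign_vec \<sigma>))) powr (p/2)) \<le> line_maxs D ks u x"
        unfolding ysum by (simp add: add.commute)
      from power_mono_ennreal[OF this, of 2]
      show "ennreal (norm (F (cplx x (y + \<delta> *\<^sub>R sign_vec \<sigma>))) powr p) \<le> (line_maxs D ks u x)\<^sup>2"
        by (simp only: sq)
    qed
    finally show ?thesis .
  qed
  have "(\<integral>\<^sup>+ x. tube_max p \<sigma> (shifted \<sigma> \<delta> F) x \<partial>lborel) \<le> (\<integral>\<^sup>+ x. (line_maxs D ks u x)\<^sup>2 \<partial>lborel)"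
    by (intro nn_integral_mono le)
  also have "\<dots> \<le> 16 ^ length ks * (\<integral>\<^sup>+ x. (u x)\<^sup>2 \<partial>lborel)" by (rule line_maxs_bound[OF D um])
  finally show ?thesis by (simp add: u_def sq len)
qed

definition radius :: "nat \<Rightarrow> real" where "radius m = inverse (real (Suc m))"

lemma radius_pos [simp]: "radius m > 0" by (simp add: radius_def)
lemma radius_tendsto: "radius \<longlonglongrightarrow> 0" unfolding radius_def[abs_def] by (rule LIMSEQ_inverse_real_of_nat)

text \<open>Smaller shifts leave more of the octant to the supremum, and as the octant is open each
  of its points is reached by some shift.\<close>

lemma tube_max_SUP:
  fixes F :: "complex^'n \<Rightarrow> complex"
  assumes \<sigma>: "\<sigma> \<in> sign_vectors"
  shows "tube_max p \<sigma> F x = (SUP m. tube_max p \<sigma> (shifted \<sigma> (radius m) F) x)"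
    and "incseq (\<lambda>m. tube_max p \<sigma> (shifted \<sigma> (radius m) F) x)"
proof -
  show "incseq (\<lambda>m. tube_max p \<sigma> (shifted \<sigma> (radius m) F) x)"
  proof (rule incseq_SucI)
    fix m
    have "radius (Suc m) < radius m" by (simp add: radius_def field_simps)
    show "tube_max p \<sigma> (shifted \<sigma> (radius m) F) x \<le> tube_max p \<sigma> (shifted \<sigma> (radius (Suc m)) F) x"
      unfolding tube_max_def[of _ _ "shifted \<sigma> (radius m) F"]
    proof (rule SUP_least)
      fix y assume "y \<in> octant \<sigma>"
      hence "y + (radius m - radius (Suc m)) *\<^sub>R sign_vec \<sigma> \<in> octant \<sigma>"
        using \<open>radius (Suc m) < radius m\<close> by (intro octant_add sign_vec_in_octant \<sigma>) auto
      moreover have "y + radius m *\<^sub>R sign_vec \<sigma> = (y + (radius m - radius (Suc m)) *\<^sub>R sign_vec \<sigma>) + radius (Suc m) *\<^sub>R sign_vec \<sigma>"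
        by (simp add: algebra_simps)
      ultimately show "ennreal (norm (shifted \<sigma> (radius m) F (cplx x y)) powr p) \<le> tube_max p \<sigma> (shifted \<sigma> (radius (Suc m)) F) x"
        unfolding shifted_cplx using le_tube_max[of _ \<sigma> "shifted \<sigma> (radius (Suc m)) F" x p] unfolding shifted_cplx by metis
    qed
  qed
  show "tube_max p \<sigma> F x = (SUP m. tube_max p \<sigma> (shifted \<sigma> (radius m) F) x)"
  proof (rule antisym)
    show "tube_max p \<sigma> F x \<le> (SUP m. tube_max p \<sigma> (shifted \<sigma> (radius m) F) x)"
      unfolding tube_max_def[of _ _ F]
    proof (rule SUP_least)
      fix y assume y: "y \<in> octant \<sigma>"
      have "(\<lambda>m. y - radius m *\<^sub>R sign_vec \<sigma>) \<longlonglongrightarrow> y - 0 *\<^sub>R sign_vec \<sigma>"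
        by (intro tendsto_intros radius_tendsto)
      hence "eventually (\<lambda>m. y - radius m *\<^sub>R sign_vec \<sigma> \<in> octant \<sigma>) sequentially"
        using y by (intro topological_tendstoD[OF _ open_octant]) auto
      then obtain m where m: "y - radius m *\<^sub>R sign_vec \<sigma> \<in> octant \<sigma>" by (auto simp: eventually_sequentially)
      have "ennreal (norm (F (cplx x y)) powr p) \<le> tube_max p \<sigma> (shifted \<sigma> (radius m) F) x"
        using le_tube_max[OF m, of "shifted \<sigma> (radius m) F" x p] by (simp add: shifted_cplx)
      also have "\<dots> \<le> (SUP m. tube_max p \<sigma> (shifted \<sigma> (radius m) F) x)" by (rule SUP_upper) simp
      finally show "ennreal (norm (F (cplx x y)) powr p) \<le> (SUP m. tube_max p \<sigma> (shifted \<sigma> (radius m) F) x)" .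
    qed
    show "(SUP m. tube_max p \<sigma> (shifted \<sigma> (radius m) F) x) \<le> tube_max p \<sigma> F x"
    proof (rule SUP_least)
      fix m
      show "tube_max p \<sigma> (shifted \<sigma> (radius m) F) x \<le> tube_max p \<sigma> F x"
        unfolding tube_max_def[of _ _ "shifted \<sigma> (radius m) F"] shifted_cplx
        by (intro SUP_least le_tube_max octant_add sign_vec_in_octant \<sigma>) auto
    qed
  qed
qed

lemma holomorphic_several_shifted:
  assumes "\<sigma> \<in> sign_vectors" "\<delta> > 0" "holomorphic_several F (tube (octant \<sigma>))"
  shows "holomorphic_several (shifted \<sigma> \<delta> F) (tube (octant \<sigma>))"
  unfolding holomorphic_several_def
proof
  fix z assume z: "z \<in> tube (octant \<sigma>)"
  have "z + cplx 0 (\<delta> *\<^sub>R sign_vec \<sigma>) \<in> tube (octant \<sigma>)"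
    using octant_add[OF _ sign_vec_in_octant[OF assms(1,2)], of "\<chi> k. Im (z $ k)"] z
    by (simp add: tube_def cplx_def plus_vec_def)
  then obtain D where D: "(F has_derivative D) (at (z + cplx 0 (\<delta> *\<^sub>R sign_vec \<sigma>)))"
     "\<forall>(c::complex) v. D (c *s v) = c * D v"
    using assms(3) unfolding holomorphic_several_def by blast
  have "((\<lambda>z. z + cplx 0 (\<delta> *\<^sub>R sign_vec \<sigma>)) has_derivative (\<lambda>h. h)) (at z)"
    by (auto intro!: derivative_eq_intros)
  from diff_chain_at[OF this D(1)] have "(shifted \<sigma> \<delta> F has_derivative D) (at z)"
    by (simp add: o_def shifted_def[abs_def])
  thus "\<exists>D. (shifted \<sigma> \<delta> F has_derivative D) (at z) \<and> (\<forall>(c::complex) v. D (c *s v) = c * D v)"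
    using D(2) by blast
qed

lemma nn_integral_tube_max:
  fixes F :: "complex^'n \<Rightarrow> complex"
  assumes \<sigma>: "\<sigma> \<in> sign_vectors" and hol: "holomorphic_several F (tube (octant \<sigma>))" and p: "p > 0"
  shows "(\<integral>\<^sup>+ x. tube_max p \<sigma> F x \<partial>lborel) = (SUP m. \<integral>\<^sup>+ x. tube_max p \<sigma> (shifted \<sigma> (radius m) F) x \<partial>lborel)"
    and "incseq (\<lambda>m. \<integral>\<^sup>+ x. tube_max p \<sigma> (shifted \<sigma> (radius m) F) x \<partial>lborel)"
proof -
  have inc: "incseq (\<lambda>m. tube_max p \<sigma> (shifted \<sigma> (radius m) F))"
    using tube_max_SUP(2)[OF \<sigma>] by (auto simp: incseq_def le_fun_def)
  show "(\<integral>\<^sup>+ x. tube_max p \<sigma> F x \<partial>lborel) = (SUP m. \<integral>\<^sup>+ x. tube_max p \<sigma> (shifted \<sigma> (radius m) F) x \<partial>lborel)"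
    unfolding tube_max_SUP(1)[OF \<sigma>, of p F] using inc
    by (intro nn_integral_monotone_convergence_SUP)
       (auto intro!: tube_max_measurable holomorphic_several_shifted hol \<sigma> p)
  show "incseq (\<lambda>m. \<integral>\<^sup>+ x. tube_max p \<sigma> (shifted \<sigma> (radius m) F) x \<partial>lborel)"
    using inc by (auto simp: incseq_def le_fun_def intro!: nn_integral_mono)
qed

lemma Hardy_maximal_bound:
  fixes F :: "complex^'n \<Rightarrow> complex"
  assumes \<sigma>: "\<sigma> \<in> sign_vectors" and F: "F \<in> Hardy_tube p (octant \<sigma>)" and p: "p > 0"
  shows "(\<integral>\<^sup>+ x. tube_max p \<sigma> F x \<partial>lborel) \<le> 16 ^ CARD('n) * Hardy_norm p (octant \<sigma>) F"
proof -
  have hol: "holomorphic_several F (tube (octant \<sigma>))" and fin: "Hardy_norm p (octant \<sigma>) F < \<infinity>"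
    using F by (auto simp: Hardy_tube_iff)
  show ?thesis unfolding nn_integral_tube_max(1)[OF \<sigma> hol p]
  proof (rule SUP_least)
    fix m
    have "(\<integral>\<^sup>+ x. tube_max p \<sigma> (shifted \<sigma> (radius m) F) x \<partial>lborel) \<le> 16 ^ CARD('n) *
       (\<integral>\<^sup>+ x. ennreal (norm (F (cplx x (radius m *\<^sub>R sign_vec \<sigma>))) powr p) \<partial>lborel)"
      by (rule shifted_maximal_bound[OF \<sigma> hol fin p]) simp
    also have "\<dots> \<le> 16 ^ CARD('n) * Hardy_norm p (octant \<sigma>) F"
      unfolding Hardy_norm_def by (intro mult_left_mono SUP_upper sign_vec_in_octant \<sigma>) auto
    finally show "(\<integral>\<^sup>+ x. tube_max p \<sigma> (shifted \<sigma> (radius m) F) x \<partial>lborel) \<le> 16 ^ CARD('n) * Hardy_norm p (octant \<sigma>) F" .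
  qed
qed

lemma borel_measurable_lebesgueI: "f \<in> borel_measurable borel \<Longrightarrow> f \<in> borel_measurable lebesgue"
  by (simp add: measurable_completion)

text \<open>The bound by the Hardy norm first shows that \<open>tube_max\<close> is integrable. It
  then serves as dominating function: the integrals of |F|^p at height \<open>radius m\<close>
  converge to that of |f|^p, and the shifted maximal bound passes to the limit.\<close>

lemma Hardy_boundary_convergence:
  fixes F :: "complex^'n \<Rightarrow> complex"
  assumes \<sigma>: "\<sigma> \<in> sign_vectors" and F: "F \<in> Hardy_tube p (octant \<sigma>)" and p: "0 < p" "p < 1"
    and f: "f \<in> borel_measurable lebesgue"
    and lim: "AE x in lebesgue. ((\<lambda>y. F (cplx x y)) \<longlongrightarrow> f x) (at 0 within octant \<sigma>)"
  shows "(\<lambda>m. \<integral>\<^sup>+ x. ennreal (norm (F (cplx x (radius m *\<^sub>R sign_vec \<sigma>)) - f x) powr p) \<partial>lebesgue) \<longlonglongrightarrow> 0"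
    and "(\<integral>\<^sup>+ x. tube_max p \<sigma> F x \<partial>lborel) \<le> 16 ^ CARD('n) * (\<integral>\<^sup>+ x. ennreal (norm (f x) powr p) \<partial>lebesgue)"
proof -
  have hol: "holomorphic_several F (tube (octant \<sigma>))" and fin: "Hardy_norm p (octant \<sigma>) F < \<infinity>"
    using F by (auto simp: Hardy_tube_iff)
  let ?y = "\<lambda>m. radius m *\<^sub>R sign_vec \<sigma>"
  have yo: "?y m \<in> octant \<sigma>" for m by (intro sign_vec_in_octant \<sigma>) simp
  have y0: "?y m \<noteq> 0" for m
  proof
    assume "?y m = 0"
    hence "(0 :: real^'n) \<in> octant \<sigma>" using yo[of m] by metis
    thus False by (simp add: octant_def)
  qed
  have "?y \<longlonglongrightarrow> 0 *\<^sub>R sign_vec \<sigma>" by (intro tendsto_intros radius_tendsto)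
  hence "filterlim ?y (at 0 within octant \<sigma>) sequentially"
    using yo y0 by (auto simp: filterlim_at)
  hence lim': "AE x in lebesgue. (\<lambda>m. F (cplx x (?y m))) \<longlonglongrightarrow> f x"
    using lim filterlim_compose by (auto elim!: eventually_mono)
  have Fm[measurable]: "(\<lambda>x. F (cplx x (?y m))) \<in> borel_measurable lebesgue" for m
    by (intro borel_measurable_lebesgueI F_cplx_measurable[OF hol] yo)
  note f[measurable]
  have Mm[measurable]: "tube_max p \<sigma> F \<in> borel_measurable lebesgue"
    by (intro borel_measurable_lebesgueI tube_max_measurable \<sigma> p hol)
  have Mfin: "(\<integral>\<^sup>+ x. tube_max p \<sigma> F x \<partial>lebesgue) < \<infinity>"
  proof -
    have "(\<integral>\<^sup>+ x. tube_max p \<sigma> F x \<partial>lebesgue) = (\<integral>\<^sup>+ x. tube_max p \<sigma> F x \<partial>lborel)"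
      by (simp add: nn_integral_completion)
    also have "\<dots> \<le> 16 ^ CARD('n) * Hardy_norm p (octant \<sigma>) F" by (rule Hardy_maximal_bound[OF \<sigma> F p(1)])
    also have "\<dots> < \<infinity>" using fin by (auto simp: ennreal_mult_less_top power_less_top_ennreal)
    finally show ?thesis .
  qed
  have plim: "AE x in lebesgue. (\<lambda>m. ennreal (norm (F (cplx x (?y m))) powr p)) \<longlonglongrightarrow> ennreal (norm (f x) powr p)"
    using lim' by eventually_elim (intro tendsto_ennrealI tendsto_powr' tendsto_norm tendsto_const, use p in auto)
  have fM: "AE x in lebesgue. ennreal (norm (f x) powr p) \<le> tube_max p \<sigma> F x"
    using plim by eventually_elim (erule LIMSEQ_le_const2, intro exI allI impI le_tube_max[OF yo])
  have conv: "(\<lambda>m. \<integral>\<^sup>+ x. ennreal (norm (F (cplx x (?y m))) powr p) \<partial>lebesgue) \<longlonglongrightarrow> (\<integral>\<^sup>+ x. ennreal (norm (f x) powr p) \<partial>lebesgue)"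
    by (rule nn_integral_dominated_convergence[where w="tube_max p \<sigma> F"])
       (use plim Mfin le_tube_max[OF yo] in auto)
  show "(\<integral>\<^sup>+ x. tube_max p \<sigma> F x \<partial>lborel) \<le> 16 ^ CARD('n) * (\<integral>\<^sup>+ x. ennreal (norm (f x) powr p) \<partial>lebesgue)"
  proof (rule LIMSEQ_le)
    show "(\<lambda>m. \<integral>\<^sup>+ x. tube_max p \<sigma> (shifted \<sigma> (radius m) F) x \<partial>lborel) \<longlonglongrightarrow> (\<integral>\<^sup>+ x. tube_max p \<sigma> F x \<partial>lborel)"
      unfolding nn_integral_tube_max(1)[OF \<sigma> hol p(1)] by (rule LIMSEQ_SUP[OF nn_integral_tube_max(2)[OF \<sigma> hol p(1)]])
    show "(\<lambda>m. 16 ^ CARD('n) * (\<integral>\<^sup>+ x. ennreal (norm (F (cplx x (?y m))) powr p) \<partial>lebesgue)) \<longlonglongrightarrow>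
       16 ^ CARD('n) * (\<integral>\<^sup>+ x. ennreal (norm (f x) powr p) \<partial>lebesgue)"
      by (intro ennreal_tendsto_cmult conv) (simp add: power_less_top_ennreal)
    show "\<exists>N. \<forall>m\<ge>N. (\<integral>\<^sup>+ x. tube_max p \<sigma> (shifted \<sigma> (radius m) F) x \<partial>lborel) \<le>
       16 ^ CARD('n) * (\<integral>\<^sup>+ x. ennreal (norm (F (cplx x (?y m))) powr p) \<partial>lebesgue)"
      using shifted_maximal_bound[OF \<sigma> hol fin p(1)] by (auto simp: nn_integral_completion)
  qed
  \<comment> \<open>\<open>f\<close> is dominated by the same maximal function, so |F - f|^p is at
    most twice it.\<close>
  have "(\<lambda>m. \<integral>\<^sup>+ x. ennreal (norm (F (cplx x (?y m)) - f x) powr p) \<partial>lebesgue) \<longlonglongrightarrow> (\<integral>\<^sup>+ x. 0 \<partial>(lebesgue :: (real^'n) measure))"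
  proof (rule nn_integral_dominated_convergence[where w="\<lambda>x. 2 * tube_max p \<sigma> F x"])
    show "AE x in lebesgue. ennreal (norm (F (cplx x (?y m)) - f x) powr p) \<le> 2 * tube_max p \<sigma> F x" for m
      using fM
    proof eventually_elim
      case (elim x)
      have "ennreal (norm (F (cplx x (?y m)) - f x) powr p) \<le> ennreal (norm (F (cplx x (?y m))) powr p) + ennreal (norm (f x) powr p)"
        using p by (intro ennreal_norm_diff_powr_le) auto
      also have "\<dots> \<le> tube_max p \<sigma> F x + tube_max p \<sigma> F x"
        by (intro add_mono elim le_tube_max[OF yo])
      finally show ?case by (simp add: mult_2)
    qed
    show "(\<integral>\<^sup>+ x. 2 * tube_max p \<sigma> F x \<partial>lebesgue) < \<infinity>"
      using Mfin by (subst nn_integral_cmult) (auto simp: ennreal_mult_less_top)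
    show "AE x in lebesgue. (\<lambda>m. ennreal (norm (F (cplx x (?y m)) - f x) powr p)) \<longlonglongrightarrow> 0"
      using lim'
    proof eventually_elim
      case (elim x)
      have "(\<lambda>m. norm (F (cplx x (?y m)) - f x)) \<longlonglongrightarrow> 0"
        using elim by (simp add: LIM_zero tendsto_norm_zero)
      hence "(\<lambda>m. norm (F (cplx x (?y m)) - f x) powr p) \<longlonglongrightarrow> 0 powr p"
        using p by (intro tendsto_powr' tendsto_const) auto
      thus ?case using tendsto_ennrealI by fastforce
    qed
  qed measurable
  thus "(\<lambda>m. \<integral>\<^sup>+ x. ennreal (norm (F (cplx x (?y m)) - f x) powr p) \<partial>lebesgue) \<longlonglongrightarrow> 0" by simp
qed

section \<open>Holomorphic functions of several variables\<close>

lemma norm_vector_smult: "norm (c *s (v :: complex^'n)) = norm c * norm v"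
  by (simp add: norm_vec_def norm_mult L2_set_right_distrib)

text \<open>Weierstrass's theorem. Cauchy's inequality on complex lines bounds differences of
  derivatives by differences of the functions, so the derivatives converge uniformly near z; complex
  linearity passes to the limit.\<close>

lemma holomorphic_several_uniform_limit:
  fixes F :: "nat \<Rightarrow> complex^'n \<Rightarrow> complex"
  assumes hol: "\<And>n. holomorphic_several (F n) U"
    and lim: "\<And>z. z \<in> U \<Longrightarrow> \<exists>r>0. ball z r \<subseteq> U \<and> uniform_limit (ball z r) F G sequentially"
  shows "holomorphic_several G U"
  unfolding holomorphic_several_def
proof
  fix z assume "z \<in> U"
  then obtain r where r: "r > 0" "ball z r \<subseteq> U" "uniform_limit (ball z r) F G sequentially"
    using lim by blast
  define S where "S = ball z (r/2)"
  have "\<exists>D. \<forall>x\<in>U. (F n has_derivative D x) (at x) \<and> (\<forall>(c::complex) v. D x (c *s v) = c * D x v)" for n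
    using hol[of n] unfolding holomorphic_several_def by metis
  then obtain D where D: "\<And>n x. x \<in> U \<Longrightarrow> (F n has_derivative D n x) (at x)"
      "\<And>n x c v. x \<in> U \<Longrightarrow> D n x ((c::complex) *s v) = c * D n x v" by metis
  have SU: "S \<subseteq> U" using r by (auto simp: S_def)
  have est: "norm (D m x h - D n x h) \<le> e / (r/4) * norm h"
    if "x \<in> S" and e: "\<And>w. w \<in> ball z r \<Longrightarrow> norm (F m w - F n w) \<le> e" for m n x h e
  proof (cases "h = 0")
    case True
    have "D k x 0 = 0" for k using D(2)[of x k 0 0] that SU by auto
    thus ?thesis using True by simp
  next
    case False
    hence nh: "norm h > 0" by simp
    \<comment> \<open>The parameter disc is scaled by the length of \<open>h\<close>, so that c h
      has length at most r/4 and the slice through \<open>x\<close> stays within r of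
      \<open>z\<close>.\<close>
    let ?R = "(r/4) / norm h"
    have R: "?R > 0" using r nh by simp
    let ?f = "\<lambda>c. F m (x + c *s h) - F n (x + c *s h)"
    have inb: "x + c *s h \<in> ball z r" if "c \<in> cball 0 ?R" for c
    proof -
      have "norm (c *s h) \<le> r/4" using that nh by (simp add: norm_vector_smult field_simps)
      moreover have "dist z x < r/2" using \<open>x \<in> S\<close> by (simp add: S_def)
      ultimately have "dist z (x + c *s h) < r"
        using dist_triangle[of z "x + c *s h" x] r(1) by (simp add: dist_norm)
      thus ?thesis by simp
    qed
    have holf: "?f holomorphic_on cball 0 ?R"
    proof (intro holomorphic_intros)
      have sub: "cball 0 ?R \<subseteq> {c. x + c *s h \<in> U}" using inb r by blast
      show "(\<lambda>c. F m (x + c *s h)) holomorphic_on cball 0 ?R"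
        by (rule holomorphic_on_subset[OF holomorphic_several_slice[OF hol] sub])
      show "(\<lambda>c. F n (x + c *s h)) holomorphic_on cball 0 ?R"
        by (rule holomorphic_on_subset[OF holomorphic_several_slice[OF hol] sub])
    qed
    have dd: "((\<lambda>c. F k (x + c *s h)) has_field_derivative D k x h) (at 0)" for k
    proof -
      have xU: "x \<in> U" using \<open>x \<in> S\<close> SU by auto
      have "((\<lambda>c::complex. x + c *s h) has_derivative (\<lambda>c. c *s h)) (at 0)"
        by (auto intro!: derivative_eq_intros bounded_linear_imp_has_derivative bounded_linear_smult_axis)
      moreover have "(F k has_derivative D k x) (at (x + 0 *s h))" using D(1)[OF xU] by simp
      ultimately have "(F k \<circ> (\<lambda>c. x + c *s h) has_derivative D k x \<circ> (\<lambda>c. c *s h)) (at 0)" by (rule diff_chain_at)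
      thus ?thesis by (simp add: o_def D(2)[OF xU] has_field_derivative_def mult_commute_abs)
    qed
    have "deriv ?f 0 = D m x h - D n x h" by (intro DERIV_imp_deriv DERIV_diff dd)
    moreover have "norm ((deriv ^^ 1) ?f 0) \<le> fact 1 * e / ?R ^ 1"
    proof (rule Cauchy_inequality)
      show "?f holomorphic_on ball 0 ?R" using holf holomorphic_on_subset ball_subset_cball by blast
      show "continuous_on (cball 0 ?R) ?f" by (rule holomorphic_on_imp_continuous_on[OF holf])
      show "norm (?f c) \<le> e" if "norm (0 - c) = ?R" for c using that by (intro e inb) simp
    qed (rule R)
    ultimately have "norm (D m x h - D n x h) \<le> e / ?R" by simp
    thus ?thesis by simp
  qed
  have cauchy: "\<exists>N. \<forall>m\<ge>N. \<forall>n\<ge>N. \<forall>x\<in>S. \<forall>h. norm (D m x h - D n x h) \<le> e * norm h" if "e > 0" for e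
  proof -
    have "uniformly_Cauchy_on (ball z r) F"
      using r(3) uniformly_convergent_Cauchy uniformly_convergent_on_def by blast
    moreover have "e * (r/4) > 0" using that r by simp
    ultimately obtain N where N: "\<forall>w\<in>ball z r. \<forall>m\<ge>N. \<forall>n\<ge>N. dist (F m w) (F n w) < e * (r/4)"
      unfolding uniformly_Cauchy_on_def by meson
    show ?thesis
    proof (intro exI allI impI ballI)
      fix m n x h assume "m \<ge> N" "n \<ge> N" "x \<in> S"
      hence "norm (D m x h - D n x h) \<le> (e * (r/4)) / (r/4) * norm h"
        using N by (intro est) (auto simp: dist_norm less_imp_le)
      thus "norm (D m x h - D n x h) \<le> e * norm h" using r by simp
    qed
  qed
  have "convergent (\<lambda>n. D n x h)" if xS: "x \<in> S" for x h
  proof (intro Cauchy_convergent CauchyI)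
    fix e :: real assume "e > 0"
    hence "e / (2 * (norm h + 1)) > 0" by (simp add: add_nonneg_pos)
    from cauchy[OF this] xS obtain N where N: "\<forall>m\<ge>N. \<forall>n\<ge>N. norm (D m x h - D n x h) \<le> (e / (2 * (norm h + 1))) * norm h"
      by blast
    have "t / (2 * (t + 1)) < 1" if "t \<ge> 0" for t :: real using that by simp
    from this[OF norm_ge_zero] have "norm h / (2 * (norm h + 1)) < 1" .
    hence "e * (norm h / (2 * (norm h + 1))) < e * 1" using \<open>e > 0\<close> by (intro mult_strict_left_mono)
    hence "(e / (2 * (norm h + 1))) * norm h < e" by (simp only: times_divide_eq_right times_divide_eq_left mult_1_right)
    thus "\<exists>M. \<forall>m\<ge>M. \<forall>n\<ge>M. norm (D m x h - D n x h) < e" using N by (meson le_less_trans)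
  qed
  hence L: "(\<lambda>n. D n x h) \<longlonglongrightarrow> lim (\<lambda>n. D n x h)" if "x \<in> S" for x h
    using that by (simp add: convergent_LIMSEQ_iff)
  define D' where "D' x h = lim (\<lambda>n. D n x h)" for x h
  have "\<exists>g. \<forall>x\<in>S. (\<lambda>n. F n x) \<longlonglongrightarrow> g x \<and> (g has_derivative D' x) (at x within S)"
  proof (rule has_derivative_sequence)
    show "convex S" by (simp add: S_def)
    show "(F n has_derivative D n x) (at x within S)" if "x \<in> S" for n x
      using D(1) that SU has_derivative_at_withinI by blast
    show "\<forall>\<^sub>F n in sequentially. \<forall>x\<in>S. \<forall>h. norm (D n x h - D' x h) \<le> e * norm h" if e0: "e > 0" for e
    proof -
      obtain N where N: "\<forall>m\<ge>N. \<forall>n\<ge>N. \<forall>x\<in>S. \<forall>h. norm (D m x h - D n x h) \<le> e * norm h"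
        using cauchy[OF e0] by blast
      have "norm (D m x h - D' x h) \<le> e * norm h" if "m \<ge> N" "x \<in> S" for m x h
      proof (rule LIMSEQ_le_const2)
        show "(\<lambda>n. norm (D m x h - D n x h)) \<longlonglongrightarrow> norm (D m x h - D' x h)"
          unfolding D'_def by (intro tendsto_intros L that)
        show "\<exists>N. \<forall>n\<ge>N. norm (D m x h - D n x h) \<le> e * norm h" using N that by blast
      qed
      thus ?thesis unfolding eventually_sequentially by blast
    qed
    show "z \<in> S" using r by (simp add: S_def)
    show "(\<lambda>n. F n z) \<longlonglongrightarrow> G z" using r by (intro tendsto_uniform_limitI[OF r(3)]) simp
  qed
  then obtain g where g: "\<And>x. x \<in> S \<Longrightarrow> (\<lambda>n. F n x) \<longlonglongrightarrow> g x"
    "\<And>x. x \<in> S \<Longrightarrow> (g has_derivative D' x) (at x within S)" by blast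
  have gG: "g x = G x" if "x \<in> S" for x
    using g(1)[OF that] tendsto_uniform_limitI[OF r(3), of x] that r LIMSEQ_unique
    by (fastforce simp: S_def)
  have zS: "z \<in> S" "open S" using r by (auto simp: S_def)
  have "(g has_derivative D' z) (at z)" using g(2)[OF zS(1)] unfolding at_within_open[OF zS] .
  hence "(G has_derivative D' z) (at z)"
    by (rule has_derivative_transform_within_open[OF _ zS(2,1)]) (rule gG)
  moreover have "D' z (c *s v) = c * D' z v" for c v
  proof -
    have "(\<lambda>n. D n z (c *s v)) \<longlonglongrightarrow> c * D' z v"
      unfolding D(2)[OF \<open>z \<in> U\<close>] D'_def by (intro tendsto_intros L zS)
    thus ?thesis unfolding D'_def by (rule limI)
  qed
  ultimately show "\<exists>D. (G has_derivative D) (at z) \<and> (\<forall>(c::complex) v. D (c *s v) = c * D v)" by blast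
qed

lemma holomorphic_several_const: "holomorphic_several (\<lambda>_. c) U"
  unfolding holomorphic_several_def by (intro ballI exI[of _ "\<lambda>_. 0"]) auto

lemma holomorphic_several_nth: "holomorphic_several (\<lambda>z. z $ k) U"
  unfolding holomorphic_several_def
  by (intro ballI exI[of _ "\<lambda>v. v $ k"]) (auto intro!: bounded_linear_imp_has_derivative bounded_linear_vec_nth)

lemma holomorphic_several_add:
  assumes "holomorphic_several F U" "holomorphic_several G U"
  shows "holomorphic_several (\<lambda>z. F z + G z) U"
  unfolding holomorphic_several_def
proof
  fix z assume "z \<in> U"
  then obtain D E where D: "(F has_derivative D) (at z)" "\<forall>(c::complex) v. D (c *s v) = c * D v"
    and E: "(G has_derivative E) (at z)" "\<forall>(c::complex) v. E (c *s v) = c * E v"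
    using assms unfolding holomorphic_several_def by meson
  show "\<exists>D. ((\<lambda>z. F z + G z) has_derivative D) (at z) \<and> (\<forall>(c::complex) v. D (c *s v) = c * D v)"
    by (rule exI[of _ "\<lambda>v. D v + E v"]) (use D E in \<open>auto intro!: has_derivative_add simp: distrib_left\<close>)
qed

lemma holomorphic_several_mult:
  assumes "holomorphic_several F U" "holomorphic_several G U"
  shows "holomorphic_several (\<lambda>z. F z * G z) U"
  unfolding holomorphic_several_def
proof
  fix z assume "z \<in> U"
  then obtain D E where D: "(F has_derivative D) (at z)" "\<forall>(c::complex) v. D (c *s v) = c * D v"
    and E: "(G has_derivative E) (at z)" "\<forall>(c::complex) v. E (c *s v) = c * E v"
    using assms unfolding holomorphic_several_def by meson
  show "\<exists>D. ((\<lambda>z. F z * G z) has_derivative D) (at z) \<and> (\<forall>(c::complex) v. D (c *s v) = c * D v)"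
    by (rule exI[of _ "\<lambda>v. F z * E v + D v * G z"])
       (intro conjI has_derivative_mult[OF D(1) E(1)], simp add: D(2) E(2) algebra_simps)
qed

lemma holomorphic_several_inverse:
  assumes "holomorphic_several F U" "\<And>z. z \<in> U \<Longrightarrow> F z \<noteq> 0"
  shows "holomorphic_several (\<lambda>z. inverse (F z)) U"
  unfolding holomorphic_several_def
proof
  fix z assume z: "z \<in> U"
  then obtain D where D: "(F has_derivative D) (at z)" "\<forall>(c::complex) v. D (c *s v) = c * D v"
    using assms unfolding holomorphic_several_def by meson
  show "\<exists>D. ((\<lambda>z. inverse (F z)) has_derivative D) (at z) \<and> (\<forall>(c::complex) v. D (c *s v) = c * D v)"
    by (rule exI[of _ "\<lambda>v. - (inverse (F z) * D v * inverse (F z))"])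
       (intro conjI Deriv.has_derivative_inverse[OF assms(2)[OF z] D(1)], simp add: D(2))
qed

lemma holomorphic_several_diff:
  assumes "holomorphic_several F U" "holomorphic_several G U"
  shows "holomorphic_several (\<lambda>z. F z - G z) U"
  using holomorphic_several_add[OF assms(1) holomorphic_several_mult[OF holomorphic_several_const[of "-1"] assms(2)]]
  by simp

lemma holomorphic_several_sum:
  "(\<And>i. i \<in> I \<Longrightarrow> holomorphic_several (F i) U) \<Longrightarrow> holomorphic_several (\<lambda>z. \<Sum>i\<in>I. F i z) U"
  by (induction I rule: infinite_finite_induct) (auto intro: holomorphic_several_const holomorphic_several_add)

lemma holomorphic_several_prod:
  "(\<And>i. i \<in> I \<Longrightarrow> holomorphic_several (F i) U) \<Longrightarrow> holomorphic_several (\<lambda>z. \<Prod>i\<in>I. F i z) U"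
  by (induction I rule: infinite_finite_induct) (auto intro: holomorphic_several_const holomorphic_several_mult)

lemma holomorphic_several_power:
  "holomorphic_several F U \<Longrightarrow> holomorphic_several (\<lambda>z. F z ^ n) U"
  by (induction n) (auto intro: holomorphic_several_const holomorphic_several_mult)

lemma nn_integral_prod_vec:
  fixes f :: "'n::finite \<Rightarrow> real \<Rightarrow> ennreal"
  assumes [measurable]: "\<And>k. f k \<in> borel_measurable borel"
  shows "(\<integral>\<^sup>+ x. (\<Prod>k\<in>UNIV. f k (x $ k)) \<partial>(lborel :: (real^'n) measure)) = (\<Prod>k\<in>UNIV. \<integral>\<^sup>+ t. f k t \<partial>lborel)"
proof -
  define g where "g b = f (SOME k. b = axis k (1::real))" for b :: "real^'n"
  have g: "g (axis k 1) = f k" for k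
  proof -
    have "(SOME k'. axis k (1::real) = (axis k' 1 :: real^'n)) = k" by (rule some_equality) (auto simp: axis_eq_axis)
    thus ?thesis by (simp add: g_def)
  qed
  have B: "(Basis :: (real^'n) set) = (\<lambda>k. axis k 1) ` UNIV" by (auto simp: Basis_vec_def)
  have inj: "inj (\<lambda>k. axis k (1::real) :: real^'n)" by (auto simp: inj_on_def axis_eq_axis)
  have "(\<integral>\<^sup>+ x. (\<Prod>b\<in>(Basis :: (real^'n) set). g b (x \<bullet> b)) \<partial>lborel) = (\<Prod>b\<in>(Basis :: (real^'n) set). integral\<^sup>N lborel (g b))"
    by (rule nn_integral_lborel_prod) (auto simp: B g)
  thus ?thesis unfolding B by (simp add: prod.reindex[OF inj] g inner_axis)
qed

section \<open>Rational functions with real poles\<close>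

lemma sum_powr_le:
  fixes f :: "'i \<Rightarrow> real"
  assumes "0 < p" "p \<le> 1" "finite I" "\<And>i. i \<in> I \<Longrightarrow> f i \<ge> 0"
  shows "(\<Sum>i\<in>I. f i) powr p \<le> (\<Sum>i\<in>I. f i powr p)"
  using assms(3,4)
proof (induction I rule: finite_induct)
  case (insert i I)
  have "(\<Sum>i\<in>insert i I. f i) powr p = (f i + (\<Sum>i\<in>I. f i)) powr p" using insert by simp
  also have "\<dots> \<le> f i powr p + (\<Sum>i\<in>I. f i) powr p"
    using insert assms by (intro powr_add_le sum_nonneg) auto
  also have "\<dots> \<le> f i powr p + (\<Sum>i\<in>I. f i powr p)" using insert by simp
  finally show ?case using insert by simp
qed simp

lemma norm_sum_powr_le:
  fixes f :: "'i \<Rightarrow> 'a::real_normed_vector"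
  assumes "0 < p" "p \<le> 1" "finite I"
  shows "norm (\<Sum>i\<in>I. f i) powr p \<le> (\<Sum>i\<in>I. norm (f i) powr p)"
proof -
  have "norm (\<Sum>i\<in>I. f i) powr p \<le> (\<Sum>i\<in>I. norm (f i)) powr p"
    using assms by (intro powr_mono2) (auto simp: norm_sum)
  also have "\<dots> \<le> (\<Sum>i\<in>I. norm (f i) powr p)" using assms by (intro sum_powr_le) auto
  finally show ?thesis .
qed

lemma nn_integral_even_le:
  fixes f :: "real \<Rightarrow> ennreal"
  assumes [measurable]: "f \<in> borel_measurable borel"
  shows "(\<integral>\<^sup>+ x. f \<bar>x\<bar> \<partial>lborel) \<le> 2 * (\<integral>\<^sup>+ x. indicator {0..} x * f x \<partial>lborel)"
proof -
  have "(\<integral>\<^sup>+ x. f \<bar>x\<bar> \<partial>lborel) \<le> (\<integral>\<^sup>+ x. indicator {0..} x * f x + indicator {0..} (-x) * f (-x) \<partial>lborel)"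
    by (intro nn_integral_mono) (auto simp: indicator_def abs_if)
  also have "\<dots> = (\<integral>\<^sup>+ x. indicator {0..} x * f x \<partial>lborel) + (\<integral>\<^sup>+ x. indicator {0..} (-x) * f (-x) \<partial>lborel)"
    by (rule nn_integral_add) measurable
  also have "(\<integral>\<^sup>+ x. indicator {0..} (-x) * f (-x) \<partial>lborel) = (\<integral>\<^sup>+ x. indicator {0..} x * f x \<partial>lborel)"
    by (rule nn_integral_lborel_uminus[where f="\<lambda>x. indicator {0..} x * f x"]) measurable
  finally show ?thesis by (simp add: mult_2)
qed

lemma nn_integral_powr_origin:
  fixes p :: real
  assumes "p < 1"
  shows "(\<integral>\<^sup>+ x. indicator {x. \<bar>x - a\<bar> < 1} x * ennreal (\<bar>x - a\<bar> powr (-p)) \<partial>lborel) < \<infinity>"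
proof -
  let ?f = "\<lambda>x::real. indicator {..<1} x * ennreal (x powr (-p))"
  have "(\<integral>\<^sup>+ x. indicator {x. \<bar>x - a\<bar> < 1} x * ennreal (\<bar>x - a\<bar> powr (-p)) \<partial>lborel) = (\<integral>\<^sup>+ x. ?f \<bar>x + (-a)\<bar> \<partial>lborel)"
    by (intro nn_integral_cong) (auto simp: indicator_def)
  also have "\<dots> = (\<integral>\<^sup>+ x. ?f \<bar>x\<bar> \<partial>lborel)"
    by (rule nn_integral_lborel_translate[where f="\<lambda>x. ?f \<bar>x\<bar>"]) measurable
  also have "\<dots> \<le> 2 * (\<integral>\<^sup>+ x. indicator {0..} x * ?f x \<partial>lborel)" by (rule nn_integral_even_le) measurable
  also have "\<dots> \<le> 2 * (\<integral>\<^sup>+ x. ennreal (indicat_real {0..1} x * x powr (-p)) \<partial>lborel)"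
    by (intro mult_left_mono nn_integral_mono) (auto simp: indicator_def)
  also have "(\<integral>\<^sup>+ x. ennreal (indicat_real {0..1} x * x powr (-p)) \<partial>lborel) = ennreal (1 powr (-p + 1) / (-p + 1))"
    using assms by (intro nn_integral_has_integral_lebesgue has_integral_powr_from_0) auto
  also have "2 * ennreal (1 powr (-p + 1) / (-p + 1)) < \<infinity>" by (simp add: ennreal_mult_less_top)
  finally show ?thesis .
qed

lemma nn_integral_powr_infinity:
  fixes q :: real
  assumes "q > 1"
  shows "(\<integral>\<^sup>+ x. ennreal ((1 + \<bar>x\<bar>) powr (-q)) \<partial>lborel) < \<infinity>"
proof -
  have "(\<integral>\<^sup>+ x. ennreal ((1 + \<bar>x\<bar>) powr (-q)) \<partial>lborel) \<le> 2 * (\<integral>\<^sup>+ x. indicator {0..} x * ennreal ((1 + x) powr (-q)) \<partial>lborel)"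
    by (rule nn_integral_even_le) measurable
  also have "(\<integral>\<^sup>+ x. indicator {0..} x * ennreal ((1 + x) powr (-q)) \<partial>lborel) =
     (\<integral>\<^sup>+ x. ennreal (indicat_real {1..} (x + 1) * (x + 1) powr (-q)) \<partial>lborel)"
    by (intro nn_integral_cong) (auto simp: indicator_def add.commute)
  also have "\<dots> = (\<integral>\<^sup>+ x. ennreal (indicat_real {1..} x * x powr (-q)) \<partial>lborel)"
    by (rule nn_integral_lborel_translate[where f="\<lambda>x. ennreal (indicat_real {1..} x * x powr (-q))"]) measurable
  also have "\<dots> = ennreal (- (1 powr (-q + 1)) / (-q + 1))"
    using assms by (intro nn_integral_has_integral_lebesgue has_integral_powr_to_inf) auto
  also have "2 * ennreal (- (1 powr (-q + 1)) / (-q + 1)) < \<infinity>" by (simp add: ennreal_mult_less_top)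
  finally show ?thesis .
qed

lemma prod_threshold: "s \<le> m \<Longrightarrow> (\<Prod>j\<in>{1..m}. if j \<le> s then a else b) = a ^ s * (b::real) ^ (m - s)"
proof -
  assume "s \<le> m"
  have 1: "{1..m} \<inter> {j. j \<le> s} = {1..s}" and 2: "{1..m} \<inter> - {j. j \<le> s} = {s+1..m}" using \<open>s \<le> m\<close> by auto
  show ?thesis by (subst prod.If_cases, simp, simp only: 1 2, simp)
qed

text \<open>Each of the \<open>s\<close> numerator factors is absorbed into one denominator factor, so the bound
  does not depend on the imaginary part.\<close>

lemma rational_factor_pointwise:
  fixes a :: "nat \<Rightarrow> real"
  assumes inj: "inj_on a {1..m}" and s: "s < m"
  obtains K where "K \<ge> 0" "\<And>x \<eta>. x \<notin> a ` {1..m} \<Longrightarrow>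
    norm (Complex x \<eta> ^ s / (\<Prod>j\<in>{1..m}. Complex x \<eta> - of_real (a j))) \<le>
      K * ((\<Sum>j\<in>{1..m}. if \<bar>x - a j\<bar> < 1 then 1 / \<bar>x - a j\<bar> else 0) + (1 / (1 + \<bar>x\<bar>)) ^ (m - s))"
proof -
  define P where "P = {(i, j) \<in> {1..m} \<times> {1..m}. i \<noteq> j}"
  have "finite P" unfolding P_def by (rule finite_subset[of _ "{1..m} \<times> {1..m}"]) auto
  \<comment> \<open>Half the least distance between poles, capped at 1: at most one pole lies within
    \<open>r\<close> of a given x, and then its local term in the bound is switched on.\<close>
  define r where "r = Min (insert 1 ((\<lambda>(i, j). \<bar>a i - a j\<bar> / 2) ` P))"
  have fin: "finite (insert 1 ((\<lambda>(i, j). \<bar>a i - a j\<bar> / 2) ` P))" using \<open>finite P\<close> by auto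
  have "r \<in> insert 1 ((\<lambda>(i, j). \<bar>a i - a j\<bar> / 2) ` P)" unfolding r_def using fin by (intro Min_in) auto
  then consider "r = 1" | i j where "(i, j) \<in> P" "r = \<bar>a i - a j\<bar> / 2" by auto
  hence r0: "r > 0"
  proof cases
    case 2
    hence "a i \<noteq> a j" using inj_onD[OF inj] by (auto simp: P_def)
    thus ?thesis using 2 by simp
  qed simp
  have r1: "r \<le> 1" unfolding r_def using fin by (intro Min_le) auto
  have rd: "\<bar>a i - a j\<bar> \<ge> 2 * r" if "i \<in> {1..m}" "j \<in> {1..m}" "i \<noteq> j" for i j
  proof -
    have "r \<le> \<bar>a i - a j\<bar> / 2" unfolding r_def using fin that by (intro Min_le) (auto simp: P_def)
    thus ?thesis by simp
  qed
  define A where "A = 1 + (\<Sum>j\<in>{1..m}. \<bar>a j\<bar>)"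
  have A: "1 + \<bar>a j\<bar> \<le> A" if "j \<in> {1..m}" for j unfolding A_def using that member_le_sum[of j "{1..m}" "\<lambda>j. \<bar>a j\<bar>"] by simp
  have A1: "A \<ge> 1" unfolding A_def by (simp add: sum_nonneg)
  define B where "B = 1 + A / r"
  have B1: "B \<ge> 1" using A1 r0 by (simp add: B_def)
  define K where "K = (1 + A) * B ^ m"
  have K0: "K \<ge> 0" using A1 B1 by (simp add: K_def)
  show ?thesis
  proof (rule that[OF K0])
    fix x \<eta> :: real assume x: "x \<notin> a ` {1..m}"
    define \<zeta> where "\<zeta> = Complex x \<eta>"
    \<comment> \<open>A bound for the j-th factor in terms of x alone: factors with j \<le> s carry
      one power of the numerator, the others none.\<close>
    define \<psi> where "\<psi> j = (if j \<le> s then 1 + A / \<bar>x - a j\<bar> else 1 / \<bar>x - a j\<bar>)" for j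
    have xa: "\<bar>x - a j\<bar> > 0" if "j \<in> {1..m}" for j using x that by auto
    have ge: "norm (\<zeta> - of_real (a j)) \<ge> \<bar>x - a j\<bar>" for j
      using abs_Re_le_cmod[of "\<zeta> - of_real (a j)"] by (simp add: \<zeta>_def)
    have "norm (\<zeta> ^ s / (\<Prod>j\<in>{1..m}. \<zeta> - of_real (a j))) =
        (\<Prod>j\<in>{1..m}. (if j \<le> s then norm \<zeta> else 1) / norm (\<zeta> - of_real (a j)))"
    proof -
      have "norm \<zeta> ^ s = (\<Prod>j\<in>{1..m}. if j \<le> s then norm \<zeta> else 1)"
        using prod_threshold[of s m "norm \<zeta>" 1] s by simp
      thus ?thesis by (simp only: norm_divide norm_power prod_norm[symmetric] prod_dividef)
    qed
    also have "\<dots> \<le> (\<Prod>j\<in>{1..m}. \<psi> j)"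
    proof (rule prod_mono, intro conjI)
      fix j assume j: "j \<in> {1..m}"
      let ?d = "norm (\<zeta> - of_real (a j))"
      have d: "?d > 0" using ge[of j] xa[OF j] by linarith
      have "norm \<zeta> \<le> ?d + \<bar>a j\<bar>" using norm_triangle_ineq[of "\<zeta> - of_real (a j)" "of_real (a j)"] by simp
      hence "norm \<zeta> \<le> ?d + A" using A[OF j] by linarith
      hence 1: "norm \<zeta> / ?d \<le> 1 + A / ?d" using d by (simp add: field_simps)
      have 2: "A / ?d \<le> A / \<bar>x - a j\<bar>" "1 / ?d \<le> 1 / \<bar>x - a j\<bar>"
        using ge[of j] xa[OF j] A1 by (auto intro!: divide_left_mono mult_pos_pos d)
      show "(if j \<le> s then norm \<zeta> else 1) / ?d \<le> \<psi> j" using 1 2 by (auto simp: \<psi>_def)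
    qed auto
    also have "\<dots> \<le> K * ((\<Sum>j\<in>{1..m}. if \<bar>x - a j\<bar> < 1 then 1 / \<bar>x - a j\<bar> else 0) + (1 / (1 + \<bar>x\<bar>)) ^ (m - s))" (is "_ \<le> K * (?S + ?T)")
    proof -
      have S0: "?S \<ge> 0" by (intro sum_nonneg) auto
      have T0: "?T \<ge> 0" by simp
      have \<psi>0: "\<psi> j \<ge> 0" for j using A1 by (auto simp: \<psi>_def)
      have far: "\<psi> j \<le> B" if "j \<in> {1..m}" "\<bar>x - a j\<bar> \<ge> r" for j
      proof -
        have "A / \<bar>x - a j\<bar> \<le> A / r" "1 / \<bar>x - a j\<bar> \<le> A / r"
          using that r0 A1 by (auto intro!: divide_left_mono frac_le)
        thus ?thesis by (auto simp: \<psi>_def B_def)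
      qed
      show ?thesis
      \<comment> \<open>Near a pole one factor is large and all others are at most \<open>B\<close>.
        Away from the poles the m - s factors without numerator each decay like 1 / (1 +
        |x|).\<close>
      proof (cases "\<exists>j\<in>{1..m}. \<bar>x - a j\<bar> < r")
        case True
        then obtain j0 where j0: "j0 \<in> {1..m}" "\<bar>x - a j0\<bar> < r" by blast
        have "\<psi> j \<le> B" if "j \<in> {1..m} - {j0}" for j
        proof (rule far)
          show "\<bar>x - a j\<bar> \<ge> r" using rd[of j j0] j0 that by auto
        qed (use that in auto)
        hence "(\<Prod>j\<in>{1..m} - {j0}. \<psi> j) \<le> B ^ m"
          using \<psi>0 B1 j0 by (intro prod_le_power) auto
        moreover have "\<psi> j0 \<le> (1 + A) / \<bar>x - a j0\<bar>"
        proof -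
          have "1 \<le> 1 / \<bar>x - a j0\<bar>" using j0 r1 xa[OF j0(1)] by (simp add: field_simps)
          moreover have "0 \<le> A / \<bar>x - a j0\<bar>" using A1 by simp
          ultimately show ?thesis by (auto simp: \<psi>_def add_divide_distrib)
        qed
        ultimately have "\<psi> j0 * (\<Prod>j\<in>{1..m} - {j0}. \<psi> j) \<le> (1 + A) / \<bar>x - a j0\<bar> * B ^ m"
          using \<psi>0 A1 by (intro mult_mono prod_nonneg) auto
        also have "\<dots> = K * (1 / \<bar>x - a j0\<bar>)" by (simp add: K_def)
        also have "\<dots> \<le> K * (?S + ?T)"
        proof (rule mult_left_mono[OF _ K0])
          have "(if \<bar>x - a j0\<bar> < 1 then 1 / \<bar>x - a j0\<bar> else 0) \<le> ?S"
            using j0 by (intro member_le_sum) auto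
          moreover have "\<bar>x - a j0\<bar> < 1" using j0 r1 by simp
          ultimately show "1 / \<bar>x - a j0\<bar> \<le> ?S + ?T" using T0 by (simp only: if_True)
        qed
        finally show ?thesis using j0 by (subst prod.remove[of _ j0]) auto
      next
        case False
        have "\<psi> j \<le> B * (if j \<le> s then 1 else 1 / (1 + \<bar>x\<bar>))" if j: "j \<in> {1..m}" for j
        proof -
          have xr: "\<bar>x - a j\<bar> \<ge> r" using False j by (auto simp: not_less)
          have "1 + \<bar>x\<bar> \<le> A + \<bar>x - a j\<bar>" using A[OF j] by linarith
          also have "A \<le> A / r * \<bar>x - a j\<bar>" using xr r0 A1 mult_left_mono[OF xr, of "A / r"] by simp
          hence "A + \<bar>x - a j\<bar> \<le> B * \<bar>x - a j\<bar>" by (simp add: B_def algebra_simps)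
          finally have "1 / \<bar>x - a j\<bar> \<le> B * (1 / (1 + \<bar>x\<bar>))" using xa[OF j] by (simp add: field_simps)
          thus ?thesis using far[OF j xr] by (auto simp: \<psi>_def)
        qed
        hence "(\<Prod>j\<in>{1..m}. \<psi> j) \<le> (\<Prod>j\<in>{1..m}. B * (if j \<le> s then 1 else 1 / (1 + \<bar>x\<bar>)))"
          using \<psi>0 by (intro prod_mono) auto
        also have "\<dots> = B ^ m * ?T"
          by (simp only: prod.distrib prod_constant card_atLeastAtMost prod_threshold[OF less_imp_le[OF s]]) simp
        also have "\<dots> \<le> K * ?T" using A1 B1 T0 by (intro mult_right_mono) (auto simp: K_def mult_ge1_I)
        also have "\<dots> \<le> K * (?S + ?T)" using K0 S0 by (intro mult_left_mono) auto
        finally show ?thesis .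
      qed
    qed
    finally show "norm (Complex x \<eta> ^ s / (\<Prod>j\<in>{1..m}. Complex x \<eta> - of_real (a j))) \<le> K * (?S + ?T)"
      by (simp add: \<zeta>_def)
  qed
qed

text \<open>Both thresholds enter here: p < 1 makes the local singularities integrable and (m - s) p
  > 1 the tail. The constant is independent of the height, as a Hardy norm requires.\<close>

lemma rational_factor_bound:
  fixes a :: "nat \<Rightarrow> real"
  assumes inj: "inj_on a {1..m}" and sm: "(real m - real s) * p > 1" and p: "0 < p" "p < 1"
  obtains C where "C < \<infinity>" "\<And>\<eta>. (\<integral>\<^sup>+ x. ennreal (norm (Complex x \<eta> ^ s /
     (\<Prod>j\<in>{1..m}. Complex x \<eta> - of_real (a j))) powr p) \<partial>lborel) \<le> C"
proof -
  have "(real m - real s) > 0" using sm p by (metis less_trans zero_less_mult_pos2 zero_less_one)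
  hence s: "s < m" by simp
  obtain K where K: "K \<ge> 0" "\<And>x \<eta>. x \<notin> a ` {1..m} \<Longrightarrow>
    norm (Complex x \<eta> ^ s / (\<Prod>j\<in>{1..m}. Complex x \<eta> - of_real (a j))) \<le>
      K * ((\<Sum>j\<in>{1..m}. if \<bar>x - a j\<bar> < 1 then 1 / \<bar>x - a j\<bar> else 0) + (1 / (1 + \<bar>x\<bar>)) ^ (m - s))"
    using rational_factor_pointwise[OF inj s] by blast
  define g where "g x = ennreal (K powr p) * ((\<Sum>j\<in>{1..m}. indicator {x. \<bar>x - a j\<bar> < 1} x * ennreal (\<bar>x - a j\<bar> powr (-p))) +
     ennreal ((1 + \<bar>x\<bar>) powr (- ((real m - real s) * p))))" for x
  have "(\<integral>\<^sup>+ x. g x \<partial>lborel) = ennreal (K powr p) * ((\<Sum>j\<in>{1..m}. \<integral>\<^sup>+ x. indicator {x. \<bar>x - a j\<bar> < 1} x * ennreal (\<bar>x - a j\<bar> powr (-p)) \<partial>lborel) +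
     (\<integral>\<^sup>+ x. ennreal ((1 + \<bar>x\<bar>) powr (- ((real m - real s) * p))) \<partial>lborel))"
    unfolding g_def by (subst nn_integral_cmult, measurable, subst nn_integral_add, measurable, subst nn_integral_sum, measurable)
  also have "\<dots> < \<infinity>"
    using nn_integral_powr_origin[OF p(2)] nn_integral_powr_infinity[OF sm]
    by (auto simp: ennreal_mult_less_top)
  finally have "(\<integral>\<^sup>+ x. g x \<partial>lborel) < \<infinity>" .
  moreover have "(\<integral>\<^sup>+ x. ennreal (norm (Complex x \<eta> ^ s / (\<Prod>j\<in>{1..m}. Complex x \<eta> - of_real (a j))) powr p) \<partial>lborel) \<le> (\<integral>\<^sup>+ x. g x \<partial>lborel)" for \<eta>
  proof (rule nn_integral_mono_AE)
    have "AE x in lborel. x \<notin> a ` {1..m}"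
      by (intro AE_not_in finite_imp_null_set_lborel) auto
    thus "AE x in lborel. ennreal (norm (Complex x \<eta> ^ s / (\<Prod>j\<in>{1..m}. Complex x \<eta> - of_real (a j))) powr p) \<le> g x"
    proof eventually_elim
      case (elim x)
      let ?S = "\<lambda>j. if \<bar>x - a j\<bar> < 1 then 1 / \<bar>x - a j\<bar> else 0" and ?T = "(1 / (1 + \<bar>x\<bar>)) ^ (m - s)"
      have "norm (Complex x \<eta> ^ s / (\<Prod>j\<in>{1..m}. Complex x \<eta> - of_real (a j))) powr p \<le> (K * ((\<Sum>j\<in>{1..m}. ?S j) + ?T)) powr p"
        using K(2)[OF elim] p by (intro powr_mono2) auto
      also have "\<dots> = K powr p * ((\<Sum>j\<in>{1..m}. ?S j) + ?T) powr p"
        by (rule powr_mult)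
      also have "((\<Sum>j\<in>{1..m}. ?S j) + ?T) powr p \<le> (\<Sum>j\<in>{1..m}. ?S j) powr p + ?T powr p"
        using p by (intro powr_add_le sum_nonneg) auto
      also have "(\<Sum>j\<in>{1..m}. ?S j) powr p \<le> (\<Sum>j\<in>{1..m}. ?S j powr p)"
        using p by (intro sum_powr_le) auto
      also have "?T powr p = (1 + \<bar>x\<bar>) powr (- ((real m - real s) * p))"
      proof -
        have "?T = (1 + \<bar>x\<bar>) powr (- (real m - real s))"
        proof -
          have "(1 + \<bar>x\<bar>) powr (- (real m - real s)) = inverse ((1 + \<bar>x\<bar>) powr real (m - s))"
            using s by (simp add: powr_minus[symmetric] of_nat_diff)
          also have "\<dots> = ?T" by (subst powr_realpow) (auto simp: power_one_over field_simps)
          finally show ?thesis by simp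
        qed
        thus ?thesis by (simp only: powr_powr minus_mult_left)
      qed
      finally have *: "norm (Complex x \<eta> ^ s / (\<Prod>j\<in>{1..m}. Complex x \<eta> - of_real (a j))) powr p \<le>
         K powr p * ((\<Sum>j\<in>{1..m}. ?S j powr p) + (1 + \<bar>x\<bar>) powr (- ((real m - real s) * p)))"
        by (simp add: mult_left_mono)
      have S: "ennreal (?S j powr p) = indicator {x. \<bar>x - a j\<bar> < 1} x * ennreal (\<bar>x - a j\<bar> powr (-p))" for j
        by (auto simp: indicator_def powr_minus divide_inverse inverse_powr)
      have "g x = ennreal (K powr p * ((\<Sum>j\<in>{1..m}. ?S j powr p) + (1 + \<bar>x\<bar>) powr (- ((real m - real s) * p))))"
        unfolding g_def by (simp add: S[symmetric] ennreal_mult sum_nonneg)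
      thus ?case using * by (simp add: ennreal_leI)
    qed
  qed
  ultimately show ?thesis by (rule that)
qed

no_notation fps_nth (infixl "$" 75)

definition rational_ext :: "('n \<Rightarrow> nat) \<Rightarrow> (('n \<Rightarrow> nat) \<Rightarrow> complex) \<Rightarrow> nat \<Rightarrow> ('n \<Rightarrow> nat \<Rightarrow> real) \<Rightarrow> complex^'n \<Rightarrow> complex" where
  "rational_ext l c m a z = (\<Sum>s\<in>{s. \<forall>k. s k \<le> l k}. c s * (\<Prod>k\<in>UNIV. z $ k ^ s k)) /
     (\<Prod>k\<in>UNIV. \<Prod>j\<in>{1..m}. z $ k - of_real (a k j))"

lemma finite_exponents: "finite {s :: 'n::finite \<Rightarrow> nat. \<forall>k. s k \<le> l k}"
proof -
  have "{s. \<forall>k. s k \<le> l k} = (\<Pi>\<^sub>E k\<in>UNIV. {..l k})" by (auto simp: PiE_def Pi_def)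
  thus ?thesis by (simp add: finite_PiE)
qed

lemma prod_less_top_ennreal:
  fixes f :: "'i \<Rightarrow> ennreal"
  shows "finite I \<Longrightarrow> (\<And>i. i \<in> I \<Longrightarrow> f i < \<infinity>) \<Longrightarrow> prod f I < \<infinity>"
  by (induction I rule: finite_induct) (auto simp: ennreal_mult_less_top)

lemma prod_mono_ennreal:
  fixes f g :: "'i \<Rightarrow> ennreal"
  shows "(\<And>i. i \<in> I \<Longrightarrow> f i \<le> g i) \<Longrightarrow> prod f I \<le> prod g I"
  by (induction I rule: infinite_finite_induct) (auto intro!: mult_mono)

lemma tube_octant_Im_nonzero: "z \<in> tube (octant \<sigma>) \<Longrightarrow> Im (z $ k) \<noteq> 0"
  by (auto simp: tube_def octant_def dest!: spec[of _ k])

lemma holomorphic_rational_ext: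
  "holomorphic_several (rational_ext l c m a) (tube (octant \<sigma>))"
proof -
  have nz: "z $ k - complex_of_real (a k j) \<noteq> 0" if "z \<in> tube (octant \<sigma>)" for z k j
    using tube_octant_Im_nonzero[OF that, of k] by (auto simp: complex_eq_iff)
  have "holomorphic_several (\<lambda>z. (\<Sum>s\<in>{s. \<forall>k. s k \<le> l k}. c s * (\<Prod>k\<in>UNIV. z $ k ^ s k)) *
     inverse (\<Prod>k\<in>UNIV. \<Prod>j\<in>{1..m}. z $ k - of_real (a k j))) (tube (octant \<sigma>))"
    using nz by (intro holomorphic_several_mult holomorphic_several_sum holomorphic_several_prod holomorphic_several_power
        holomorphic_several_inverse holomorphic_several_const holomorphic_several_nth holomorphic_several_diff) auto
  thus ?thesis by (simp add: rational_ext_def[abs_def] divide_inverse)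
qed

text \<open>Subadditivity separates the monomials, and the integral of each is a product of
  one-variable integrals bounded uniformly in the height. The poles are real, so one function serves
  all octants.\<close>

lemma rational_ext_Hardy:
  fixes l :: "'n::finite \<Rightarrow> nat"
  assumes p: "0 < p" "p < 1" and ml: "(real m - real (Max (range l))) * p > 1"
    and inj: "\<And>k. inj_on (a k) {1..m}"
  shows "rational_ext l c m a \<in> Hardy_tube p (octant \<sigma>)"
proof -
  define h where "h k t \<eta> x = ennreal (norm (Complex x \<eta> ^ t / (\<Prod>j\<in>{1..m}. Complex x \<eta> - of_real (a k j))) powr p)" for k t \<eta> x
  have hm[measurable]: "h k t \<eta> \<in> borel_measurable borel" for k t \<eta>
    unfolding h_def[abs_def] Complex_eq by measurable
  define C where "C k t = (SUP \<eta>. \<integral>\<^sup>+ x. h k t \<eta> x \<partial>lborel)" for k t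
  have C1: "C k t < \<infinity>" if t: "t \<le> l k" for k t
  proof -
    have "l k \<le> Max (range l)" by simp
    from order_trans[OF t this] have "real t \<le> real (Max (range l))" by (rule of_nat_mono)
    hence "(real m - real (Max (range l))) * p \<le> (real m - real t) * p" using p by (intro mult_right_mono) auto
    hence "(real m - real t) * p > 1" using ml by linarith
    from rational_factor_bound[OF inj this p, of k] obtain C' where C': "C' < \<infinity>" "\<And>\<eta>. (\<integral>\<^sup>+ x. h k t \<eta> x \<partial>lborel) \<le> C'"
      unfolding h_def by blast
    have "C k t \<le> C'" unfolding C_def by (intro SUP_least C')
    thus ?thesis using C'(1) by (rule le_less_trans)
  qed
  have C2: "(\<integral>\<^sup>+ x. h k t \<eta> x \<partial>lborel) \<le> C k t" for k t \<eta> unfolding C_def by (rule SUP_upper) simp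
  let ?E = "{s. \<forall>k. s k \<le> l k}"
  define N where "N = (\<Sum>s\<in>?E. ennreal (norm (c s) powr p) * (\<Prod>k\<in>UNIV. C k (s k)))"
  have "(\<Prod>k\<in>UNIV. C k (s k)) < \<infinity>" if "s \<in> ?E" for s
    using that by (intro prod_less_top_ennreal C1) auto
  hence "ennreal (norm (c s) powr p) * (\<Prod>k\<in>UNIV. C k (s k)) < \<infinity>" if "s \<in> ?E" for s
    using that by (simp add: ennreal_mult_less_top)
  hence "N < \<infinity>" unfolding N_def by (simp add: finite_exponents)
  have "(\<integral>\<^sup>+ x. ennreal (norm (rational_ext l c m a (cplx x y)) powr p) \<partial>lborel) \<le> N" for y
  proof -
    have "(\<integral>\<^sup>+ x. ennreal (norm (rational_ext l c m a (cplx x y)) powr p) \<partial>lborel) \<le>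
        (\<integral>\<^sup>+ x. (\<Sum>s\<in>?E. ennreal (norm (c s) powr p) * (\<Prod>k\<in>UNIV. h k (s k) (y $ k) (x $ k))) \<partial>lborel)"
    proof (rule nn_integral_mono)
      fix x :: "real^'n"
      have e: "rational_ext l c m a (cplx x y) = (\<Sum>s\<in>?E. c s * (\<Prod>k\<in>UNIV. Complex (x $ k) (y $ k) ^ s k /
          (\<Prod>j\<in>{1..m}. Complex (x $ k) (y $ k) - of_real (a k j))))"
        by (simp add: rational_ext_def cplx_def sum_divide_distrib prod_dividef)
      have "norm (rational_ext l c m a (cplx x y)) powr p \<le> (\<Sum>s\<in>?E. norm (c s * (\<Prod>k\<in>UNIV. Complex (x $ k) (y $ k) ^ s k /
          (\<Prod>j\<in>{1..m}. Complex (x $ k) (y $ k) - of_real (a k j)))) powr p)"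
        unfolding e using p by (intro norm_sum_powr_le finite_exponents) auto
      also have "\<dots> = (\<Sum>s\<in>?E. norm (c s) powr p * (\<Prod>k\<in>UNIV. norm (Complex (x $ k) (y $ k) ^ s k /
          (\<Prod>j\<in>{1..m}. Complex (x $ k) (y $ k) - of_real (a k j))) powr p))"
        by (simp only: norm_mult prod_norm[symmetric] powr_mult prod_powr_distrib norm_ge_zero)
      finally have "ennreal (norm (rational_ext l c m a (cplx x y)) powr p) \<le> ennreal \<dots>" by (rule ennreal_leI)
      also have "\<dots> = (\<Sum>s\<in>?E. ennreal (norm (c s) powr p) * (\<Prod>k\<in>UNIV. h k (s k) (y $ k) (x $ k)))"
        by (simp add: h_def sum_ennreal[symmetric] ennreal_mult prod_nonneg prod_ennreal)
      finally show "ennreal (norm (rational_ext l c m a (cplx x y)) powr p) \<le> \<dots>" .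
    qed
    also have "\<dots> = (\<Sum>s\<in>?E. ennreal (norm (c s) powr p) * (\<integral>\<^sup>+ x. (\<Prod>k\<in>UNIV. h k (s k) (y $ k) (x $ k)) \<partial>lborel))"
      by (subst nn_integral_sum, measurable) (intro sum.cong refl nn_integral_cmult, measurable)
    also have "\<dots> = (\<Sum>s\<in>?E. ennreal (norm (c s) powr p) * (\<Prod>k\<in>UNIV. \<integral>\<^sup>+ t. h k (s k) (y $ k) t \<partial>lborel))"
      by (simp add: nn_integral_prod_vec[where f="\<lambda>k. h k (_ k) (y $ k)"])
    also have "\<dots> \<le> N" unfolding N_def
      by (intro sum_mono mult_left_mono prod_mono_ennreal C2) auto
    finally show ?thesis .
  qed
  hence "Hardy_norm p (octant \<sigma>) (rational_ext l c m a) \<le> N" unfolding Hardy_norm_def by (intro SUP_least)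
  thus ?thesis using \<open>N < \<infinity>\<close> holomorphic_rational_ext by (auto simp: Hardy_tube_iff)
qed

lemma AE_coordinate_notin:
  fixes A :: "'n::finite \<Rightarrow> real set"
  assumes "\<And>k. finite (A k)"
  shows "AE x in lebesgue. \<forall>k. x $ k \<notin> A k"
proof -
  have "negligible {x::real^'n. x $ k = t}" for k t
    using negligible_standard_hyperplane[of "axis k (1::real) :: real^'n" t] by (simp add: inner_axis axis_in_Basis_iff)
  hence "negligible (\<Union>k\<in>UNIV. \<Union>t\<in>A k. {x::real^'n. x $ k = t})"
    using assms by (intro negligible_Union) auto
  hence "(\<Union>k\<in>UNIV. \<Union>t\<in>A k. {x::real^'n. x $ k = t}) \<in> null_sets lebesgue" by (simp add: negligible_iff_null_sets)
  from AE_not_in[OF this] show ?thesis by eventually_elim auto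
qed

lemma cplx_nth [simp]: "cplx x y $ k = Complex (x $ k) (y $ k)" by (simp add: cplx_def)

lemma tendsto_cplx_nth:
  fixes x :: "real^'n"
  shows "((\<lambda>y. cplx x y $ k) \<longlongrightarrow> of_real (x $ k)) (at 0 within S)"
proof -
  have "((\<lambda>y. of_real (x $ k) + \<i> * of_real (y $ k)) \<longlongrightarrow> of_real (x $ k) + \<i> * of_real ((0::real^'n) $ k)) (at 0 within S)"
    by (intro tendsto_intros)
  thus ?thesis by (simp add: Complex_eq)
qed

lemma rational_ext_boundary:
  fixes l :: "'n::finite \<Rightarrow> nat"
  shows "AE x in lebesgue. ((\<lambda>y. rational_ext l c m a (cplx x y)) \<longlongrightarrow>
     (\<Sum>s\<in>{s. \<forall>k. s k \<le> l k}. c s * (\<Prod>k\<in>UNIV. complex_of_real (x $ k) ^ s k)) /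
     (\<Prod>k\<in>UNIV. \<Prod>j\<in>{1..m}. complex_of_real (x $ k - a k j))) (at 0 within S)"
proof -
  have "AE x in lebesgue. \<forall>k. x $ k \<notin> a k ` {1..m}" by (intro AE_coordinate_notin) auto
  thus ?thesis
  proof eventually_elim
    case (elim x)
    have "(\<Prod>k\<in>UNIV. \<Prod>j\<in>{1..m}. complex_of_real (x $ k) - of_real (a k j)) \<noteq> 0"
      using elim by (auto simp flip: of_real_diff)
    hence "((\<lambda>y. rational_ext l c m a (cplx x y)) \<longlongrightarrow>
     (\<Sum>s\<in>{s. \<forall>k. s k \<le> l k}. c s * (\<Prod>k\<in>UNIV. complex_of_real (x $ k) ^ s k)) /
     (\<Prod>k\<in>UNIV. \<Prod>j\<in>{1..m}. complex_of_real (x $ k) - of_real (a k j))) (at 0 within S)"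
      unfolding rational_ext_def
      by (intro tendsto_divide tendsto_sum tendsto_mult tendsto_prod tendsto_power tendsto_const tendsto_diff tendsto_cplx_nth)
    thus ?case by simp
  qed
qed

lemma rational_class_subset_boundary_Hardy:
  fixes \<sigma> :: "'n::finite \<Rightarrow> real"
  assumes p: "0 < p" "p < 1"
  shows "rational_class p \<subseteq> boundary_Hardy p \<sigma>"
proof
  fix f :: "real^'n \<Rightarrow> complex" assume f: "f \<in> rational_class p"
  then obtain l c m a where *: "(real m - real (Max (range l))) * p > 1" "\<forall>k. inj_on (a k) {1..m}"
     "\<And>x. f x = (\<Sum>s\<in>{s. \<forall>k. s k \<le> l k}. c s * (\<Prod>k\<in>UNIV. complex_of_real (x $ k) ^ s k)) /
     (\<Prod>k\<in>UNIV. \<Prod>j\<in>{1..m}. complex_of_real (x $ k - a k j))" and fL: "f \<in> Lp_space p"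
    unfolding rational_class_def by blast
  have "rational_ext l c m a \<in> Hardy_tube p (octant \<sigma>)" using * p by (intro rational_ext_Hardy) auto
  moreover have "AE x in lebesgue. ((\<lambda>y. rational_ext l c m a (cplx x y)) \<longlongrightarrow> f x) (at 0 within octant \<sigma>)"
    unfolding *(3) by (rule rational_ext_boundary)
  ultimately show "f \<in> boundary_Hardy p \<sigma>" using fL unfolding boundary_Hardy_def by blast
qed

section \<open>Closedness of the boundary spaces\<close>

lemma Hardy_tube_diff:
  fixes F G :: "complex^'n \<Rightarrow> complex"
  assumes p: "0 < p" "p < 1" and F: "F \<in> Hardy_tube p B" "G \<in> Hardy_tube p B"
  shows "(\<lambda>z. F z - G z) \<in> Hardy_tube p B"
proof -
  have hol: "holomorphic_several F (tube B)" "holomorphic_several G (tube B)" and fin: "Hardy_norm p B F < \<infinity>" "Hardy_norm p B G < \<infinity>"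
    using F by (auto simp: Hardy_tube_iff)
  have "Hardy_norm p B (\<lambda>z. F z - G z) \<le> Hardy_norm p B F + Hardy_norm p B G"
    unfolding Hardy_norm_def[of _ _ "\<lambda>z. F z - G z"]
  proof (rule SUP_least)
    fix y assume y: "y \<in> B"
    have [measurable]: "(\<lambda>x. F (cplx x y)) \<in> borel_measurable borel" "(\<lambda>x. G (cplx x y)) \<in> borel_measurable borel"
      using F_cplx_measurable hol y by blast+
    have "(\<integral>\<^sup>+ x. ennreal (norm (F (cplx x y) - G (cplx x y)) powr p) \<partial>lborel) \<le>
      (\<integral>\<^sup>+ x. ennreal (norm (F (cplx x y)) powr p) + ennreal (norm (G (cplx x y)) powr p) \<partial>lborel)"
      using p by (intro nn_integral_mono ennreal_norm_diff_powr_le) auto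
    also have "\<dots> = (\<integral>\<^sup>+ x. ennreal (norm (F (cplx x y)) powr p) \<partial>lborel) + (\<integral>\<^sup>+ x. ennreal (norm (G (cplx x y)) powr p) \<partial>lborel)"
      by (rule nn_integral_add) measurable
    also have "\<dots> \<le> Hardy_norm p B F + Hardy_norm p B G"
      unfolding Hardy_norm_def by (intro add_mono SUP_upper y)
    finally show "(\<integral>\<^sup>+ x. ennreal (norm (F (cplx x y) - G (cplx x y)) powr p) \<partial>lborel) \<le> Hardy_norm p B F + Hardy_norm p B G" .
  qed
  also have "\<dots> < \<infinity>" using fin by simp
  finally show ?thesis using holomorphic_several_diff[OF hol] by (auto simp: Hardy_tube_iff)
qed


text \<open>With r = 1/p this passes from summable p-th powers to summable absolute values.\<close>

lemma summable_powr_ge_1: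
  fixes t :: "nat \<Rightarrow> real"
  assumes "summable t" "\<And>i. t i \<ge> 0" "r \<ge> 1"
  shows "summable (\<lambda>i. t i powr r)"
proof (rule summable_comparison_test_ev[OF _ assms(1)])
  have "t \<longlonglongrightarrow> 0" using assms(1) by (rule summable_LIMSEQ_zero)
  hence "eventually (\<lambda>i. t i < 1) sequentially" by (rule order_tendstoD) simp
  thus "eventually (\<lambda>i. norm (t i powr r) \<le> t i) sequentially"
  proof eventually_elim
    case (elim i)
    show ?case
    proof (cases "t i = 0")
      case False
      hence "t i powr r \<le> t i powr 1" using elim assms by (intro powr_mono') auto
      thus ?thesis using assms(2)[of i] by simp
    qed simp
  qed
qed

lemma ennreal_suminf_finite:
  fixes t :: "nat \<Rightarrow> ennreal"
  assumes "(\<Sum>i. t i) \<noteq> \<infinity>"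
  shows "summable (\<lambda>i. enn2real (t i))" "\<And>i. t i = ennreal (enn2real (t i))"
proof -
  have fin: "t i \<noteq> \<infinity>" for i
  proof
    assume "t i = \<infinity>"
    hence "(\<Sum>i. t i) \<ge> \<infinity>" using sum_le_suminf[of t "{i}"] by (simp add: summableI)
    thus False using assms by (simp add: top_unique)
  qed
  show e: "t i = ennreal (enn2real (t i))" for i using fin[of i] by (simp add: less_top)
  show "summable (\<lambda>i. enn2real (t i))"
    by (rule summable_suminf_not_top) (use assms e in auto)
qed

lemma uniform_limit_geometric:
  fixes D :: "nat \<Rightarrow> 'a \<Rightarrow> complex"
  assumes "\<And>i z. z \<in> S \<Longrightarrow> norm (D i z) powr p \<le> C * (1/2) ^ i" "p > 0" "C \<ge> 0"
  shows "uniform_limit S (\<lambda>n z. \<Sum>i<n. D i z) (\<lambda>z. \<Sum>i. D i z) sequentially"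
proof (rule Weierstrass_m_test)
  fix i z assume z: "z \<in> S"
  have "(norm (D i z) powr p) powr (1/p) \<le> (C * (1/2) ^ i) powr (1/p)"
    using assms(1)[OF z] assms(2) by (intro powr_mono2) auto
  also have "\<dots> = C powr (1/p) * ((1/2) powr (1/p)) ^ i"
    by (simp add: powr_mult powr_power powr_realpow[symmetric] powr_powr mult.commute)
  finally show "norm (D i z) \<le> C powr (1/p) * ((1/2) powr (1/p)) ^ i" using assms(2) by (simp add: powr_powr)
next
  have "((1::real)/2) powr (1/p) < 1" using powr_less_mono2[of "1/p" "1/2" 1] assms(2) by simp
  thus "summable (\<lambda>i. C powr (1/p) * ((1/2) powr (1/p)) ^ i)"
    by (intro summable_mult summable_geometric) simp
qed

text \<open>Approximants converging geometrically are extended to the tube, and the extension of the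
  limit is a telescoping series. The maximal bound in terms of boundary values makes the suprema of
  its terms over the octant summable for almost every x; there the series converges uniformly in y,
  so the boundary limit may be taken term by term.\<close>

lemma Lp_closure_subset_boundary_Hardy:
  fixes \<sigma> :: "'n::finite \<Rightarrow> real"
  assumes \<sigma>: "\<sigma> \<in> sign_vectors" and p: "0 < p" "p < 1" and S: "S \<subseteq> boundary_Hardy p \<sigma>"
  shows "Lp_closure p S \<subseteq> boundary_Hardy p \<sigma>"
proof
  fix g :: "real^'n \<Rightarrow> complex" assume g: "g \<in> Lp_closure p S"
  hence gL: "g \<in> Lp_space p" and ex: "\<And>e. e > 0 \<Longrightarrow> \<exists>f\<in>S. (\<integral>\<^sup>+ x. ennreal (norm (f x - g x) powr p) \<partial>lebesgue) < ennreal e"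
    by (auto simp: Lp_closure_def)
  have "\<forall>j::nat. \<exists>f. f \<in> boundary_Hardy p \<sigma> \<and> (\<integral>\<^sup>+ x. ennreal (norm (f x - g x) powr p) \<partial>lebesgue) < ennreal ((1/2)^j)"
  proof
    fix j :: nat
    have "(1/2::real)^j > 0" by simp
    from ex[OF this] S show "\<exists>f. f \<in> boundary_Hardy p \<sigma> \<and> (\<integral>\<^sup>+ x. ennreal (norm (f x - g x) powr p) \<partial>lebesgue) < ennreal ((1/2)^j)"
      by blast
  qed
  from choice[OF this] obtain f where f: "\<forall>j::nat. f j \<in> boundary_Hardy p \<sigma> \<and> (\<integral>\<^sup>+ x. ennreal (norm (f j x - g x) powr p) \<partial>lebesgue) < ennreal ((1/2)^j)" ..
  have fB: "f j \<in> boundary_Hardy p \<sigma>" and fg: "(\<integral>\<^sup>+ x. ennreal (norm (f j x - g x) powr p) \<partial>lebesgue) < ennreal ((1/2)^j)" for j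
    using f by simp_all
  have "\<forall>j. \<exists>F. F \<in> Hardy_tube p (octant \<sigma>) \<and>
      (AE x in lebesgue. ((\<lambda>y. F (cplx x y)) \<longlongrightarrow> f j x) (at 0 within octant \<sigma>))"
    using fB unfolding boundary_Hardy_def by blast
  from choice[OF this] obtain F where "\<forall>j. F j \<in> Hardy_tube p (octant \<sigma>) \<and>
      (AE x in lebesgue. ((\<lambda>y. F j (cplx x y)) \<longlongrightarrow> f j x) (at 0 within octant \<sigma>))" ..
  hence F: "\<And>j. F j \<in> Hardy_tube p (octant \<sigma>)"
    "\<And>j. AE x in lebesgue. ((\<lambda>y. F j (cplx x y)) \<longlongrightarrow> f j x) (at 0 within octant \<sigma>)"
    by blast+
  have fm[measurable]: "f j \<in> borel_measurable lebesgue" for j using fB[of j] unfolding boundary_Hardy_def Lp_space_def by blast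
  have gm[measurable]: "g \<in> borel_measurable lebesgue" using gL unfolding Lp_space_def by blast
  define D where "D j z = F (Suc j) z - F j z" for j z
  have DH: "D j \<in> Hardy_tube p (octant \<sigma>)" for j unfolding D_def[abs_def] by (rule Hardy_tube_diff[OF p F(1) F(1)])
  have hol: "holomorphic_several (D j) (tube (octant \<sigma>))" "holomorphic_several (F j) (tube (octant \<sigma>))" for j
    using DH F(1) by (auto simp: Hardy_tube_iff)
  have Dlim: "AE x in lebesgue. ((\<lambda>y. D j (cplx x y)) \<longlongrightarrow> f (Suc j) x - f j x) (at 0 within octant \<sigma>)" for j
    using F(2)[of j] F(2)[of "Suc j"] unfolding D_def by eventually_elim (intro tendsto_diff)
  \<comment> \<open>16^n comes from the maximal bound and 2 from (1/2)^(j+1) + (1/2)^j \<le> 2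
    (1/2)^j.\<close>
  define c where "c = (16::real) ^ CARD('n) * 2"
  have c0: "c > 0" by (simp add: c_def)
  have TD: "(\<integral>\<^sup>+ x. tube_max p \<sigma> (D j) x \<partial>lborel) \<le> ennreal (c * (1/2)^j)" for j
  proof -
    have "(\<integral>\<^sup>+ x. ennreal (norm (f (Suc j) x - f j x) powr p) \<partial>lebesgue) \<le>
       (\<integral>\<^sup>+ x. ennreal (norm (f (Suc j) x - g x) powr p) + ennreal (norm (f j x - g x) powr p) \<partial>lebesgue)"
    proof (rule nn_integral_mono)
      fix x
      show "ennreal (norm (f (Suc j) x - f j x) powr p) \<le> ennreal (norm (f (Suc j) x - g x) powr p) + ennreal (norm (f j x - g x) powr p)"
        using ennreal_norm_diff_powr_le[of p "f (Suc j) x - g x" "f j x - g x"] p by simp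
    qed
    also have "\<dots> = (\<integral>\<^sup>+ x. ennreal (norm (f (Suc j) x - g x) powr p) \<partial>lebesgue) + (\<integral>\<^sup>+ x. ennreal (norm (f j x - g x) powr p) \<partial>lebesgue)"
      by (rule nn_integral_add) measurable
    also have "\<dots> \<le> ennreal ((1/2)^Suc j) + ennreal ((1/2)^j)" by (intro add_mono less_imp_le fg)
    also have "\<dots> = ennreal ((1/2)^Suc j + (1/2)^j)" by (rule ennreal_plus[symmetric]) auto
    also have "\<dots> \<le> ennreal (2 * (1/2)^j)" by (intro ennreal_leI) simp
    finally have "16 ^ CARD('n) * (\<integral>\<^sup>+ x. ennreal (norm (f (Suc j) x - f j x) powr p) \<partial>lebesgue) \<le> 16 ^ CARD('n) * ennreal (2 * (1/2)^j)"
      by (rule mult_left_mono) simp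
    also have "\<dots> = ennreal (16 ^ CARD('n)) * ennreal (2 * (1/2)^j)" by (simp add: ennreal_power[symmetric])
    also have "\<dots> = ennreal (c * (1/2)^j)" unfolding c_def by (subst ennreal_mult[symmetric]) (auto simp: mult_ac)
    finally show ?thesis using Hardy_boundary_convergence(2)[OF \<sigma> DH p _ Dlim, of j] by (auto intro: order_trans)
  qed
  have TDm[measurable]: "tube_max p \<sigma> (D j) \<in> borel_measurable borel" "tube_max p \<sigma> (F j) \<in> borel_measurable borel" for j
    by (intro tube_max_measurable \<sigma> p hol)+
  have ND: "Hardy_norm p (octant \<sigma>) (D j) \<le> ennreal (c * (1/2)^j)" for j
    unfolding Hardy_norm_def
    by (intro SUP_least order_trans[OF nn_integral_mono TD[of j]] le_tube_max)
  define G where "G z = F 0 z + (\<Sum>i. D i z)" for z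
  have Fsum: "F n z = F 0 z + (\<Sum>i<n. D i z)" for n z
    unfolding D_def by (induction n) auto
  \<comment> \<open>Points at depth more than 2 \<rho>. The pointwise bound gives uniform
    convergence there, and these open sets exhaust the tube.\<close>
  define Z where "Z \<rho> = {z::complex^'n. \<forall>k. \<sigma> k * Im (z $ k) > 2 * \<rho>}" for \<rho>
  have opZ: "open (Z \<rho>)" for \<rho>
  proof -
    have "Z \<rho> = (\<Inter>k\<in>UNIV. {z. \<sigma> k * Im (z $ k) > 2 * \<rho>})" by (auto simp: Z_def)
    also have "open \<dots>" by (intro open_INT ballI open_Collect_less continuous_intros) auto
    finally show ?thesis .
  qed
  have unifZ: "uniform_limit (Z \<rho>) F G sequentially" if \<rho>: "\<rho> > 0" for \<rho>
  proof -
    have "norm (D i z) powr p \<le> ((27 / \<rho>) ^ CARD('n) * c) * (1/2) ^ i" if z: "z \<in> Z \<rho>" for i z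
    proof -
      define x y where "x = (\<chi> k. Re (z $ k))" and "y = (\<chi> k. Im (z $ k))"
      have zxy: "z = cplx x y" by (simp add: vec_eq_iff x_def y_def)
      have "ennreal (norm (D i z) powr p) \<le> ennreal ((27 / \<rho>) ^ CARD('n)) * Hardy_norm p (octant \<sigma>) (D i)"
        unfolding zxy using z by (intro Hardy_pointwise_bound \<sigma> hol p \<rho>) (auto simp: Z_def y_def)
      also have "\<dots> \<le> ennreal ((27 / \<rho>) ^ CARD('n)) * ennreal (c * (1/2)^i)" by (intro mult_left_mono ND) simp
      also have "\<dots> = ennreal (((27 / \<rho>) ^ CARD('n) * c) * (1/2) ^ i)"
        using \<rho> c0 by (subst ennreal_mult[symmetric]) (auto simp: mult_ac)
      finally show ?thesis using \<rho> c0 by (subst (asm) ennreal_le_iff) auto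
    qed
    hence "uniform_limit (Z \<rho>) (\<lambda>n z. \<Sum>i<n. D i z) (\<lambda>z. \<Sum>i. D i z) sequentially"
      using p \<rho> c0 by (intro uniform_limit_geometric) auto
    hence "uniform_limit (Z \<rho>) (\<lambda>n z. F 0 z + (\<Sum>i<n. D i z)) G sequentially"
      unfolding G_def by (intro uniform_limit_add uniform_limit_const)
    thus ?thesis unfolding Fsum[symmetric] by simp
  qed
  have inZ: "\<exists>\<rho>>0. z \<in> Z \<rho>" if "z \<in> tube (octant \<sigma>)" for z
  proof -
    define M where "M = Min (range (\<lambda>k. \<sigma> k * Im (z $ k)))"
    have "M \<in> range (\<lambda>k. \<sigma> k * Im (z $ k))" unfolding M_def by (intro Min_in) auto
    hence M0: "M > 0" using that by (auto simp: tube_def octant_def)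
    have Mk: "M \<le> \<sigma> k * Im (z $ k)" for k unfolding M_def by (intro Min_le) auto
    have "\<sigma> k * Im (z $ k) > 2 * (M / 3)" for k using M0 Mk[of k] by linarith
    thus ?thesis using M0 by (intro exI[of _ "M/3"]) (auto simp: Z_def)
  qed
  have Ztube: "Z \<rho> \<subseteq> tube (octant \<sigma>)" if "\<rho> > 0" for \<rho>
  proof
    fix z assume z: "z \<in> Z \<rho>"
    have "\<sigma> k * Im (z $ k) > 0" for k
    proof -
      have "\<sigma> k * Im (z $ k) > 2 * \<rho>" using z by (simp add: Z_def)
      thus ?thesis using that by linarith
    qed
    thus "z \<in> tube (octant \<sigma>)" by (simp add: tube_def octant_def)
  qed
  have holG: "holomorphic_several G (tube (octant \<sigma>))"
  proof (rule holomorphic_several_uniform_limit[OF hol(2)])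
    fix z assume "z \<in> tube (octant \<sigma>)"
    then obtain \<rho> where \<rho>: "\<rho> > 0" "z \<in> Z \<rho>" using inZ by blast
    obtain r where r: "r > 0" "ball z r \<subseteq> Z \<rho>" using opZ \<rho>(2) openE by blast
    show "\<exists>r>0. ball z r \<subseteq> tube (octant \<sigma>) \<and> uniform_limit (ball z r) F G sequentially"
      using r Ztube[OF \<rho>(1)] uniform_limit_on_subset[OF unifZ[OF \<rho>(1)]] by blast
  qed
  have limG: "(\<lambda>n. F n z) \<longlonglongrightarrow> G z" if z: "z \<in> tube (octant \<sigma>)" for z
  proof -
    obtain \<rho> where \<rho>: "\<rho> > 0" "z \<in> Z \<rho>" using inZ[OF z] by blast
    show ?thesis by (rule tendsto_uniform_limitI[OF unifZ[OF \<rho>(1)] \<rho>(2)])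
  qed
  \<comment> \<open>One integrable majorant does two things: it bounds the Hardy norm of
    \<open>G\<close>, and its finiteness almost everywhere gives the convergence for fixed
    x.\<close>
  define W where "W x = tube_max p \<sigma> (F 0) x + (\<Sum>i. tube_max p \<sigma> (D i) x)" for x
  have Wm[measurable]: "W \<in> borel_measurable borel" unfolding W_def[abs_def] by measurable
  have Wfin: "(\<integral>\<^sup>+ x. W x \<partial>lborel) < \<infinity>"
  proof -
    have "(\<integral>\<^sup>+ x. W x \<partial>lborel) = (\<integral>\<^sup>+ x. tube_max p \<sigma> (F 0) x \<partial>lborel) + (\<Sum>i. \<integral>\<^sup>+ x. tube_max p \<sigma> (D i) x \<partial>lborel)"
      unfolding W_def by (subst nn_integral_add, measurable, subst nn_integral_suminf, measurable)
    also have "(\<Sum>i. \<integral>\<^sup>+ x. tube_max p \<sigma> (D i) x \<partial>lborel) \<le> (\<Sum>i. ennreal (c * (1/2)^i))"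
      by (intro suminf_le TD) (auto simp: summableI)
    also have "\<dots> = ennreal (\<Sum>i. c * (1/2)^i)"
      using c0 by (intro suminf_ennreal2) (auto intro!: summable_mult summable_geometric)
    finally have "(\<integral>\<^sup>+ x. W x \<partial>lborel) \<le> (\<integral>\<^sup>+ x. tube_max p \<sigma> (F 0) x \<partial>lborel) + ennreal (\<Sum>i. c * (1/2)^i)"
      by (simp add: add_left_mono)
    also have "\<dots> < \<infinity>"
    proof -
      have "(\<integral>\<^sup>+ x. tube_max p \<sigma> (F 0) x \<partial>lborel) \<le> 16 ^ CARD('n) * Hardy_norm p (octant \<sigma>) (F 0)"
        by (rule Hardy_maximal_bound[OF \<sigma> F(1) p(1)])
      also have "\<dots> < \<infinity>" using F(1)[of 0] by (auto simp: Hardy_tube_iff ennreal_mult_less_top power_less_top_ennreal)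
      finally show ?thesis by simp
    qed
    finally show ?thesis .
  qed
  have GW: "ennreal (norm (G (cplx x y)) powr p) \<le> W x" if y: "y \<in> octant \<sigma>" for x y
  proof (rule LIMSEQ_le_const2)
    show "(\<lambda>n. ennreal (norm (F n (cplx x y)) powr p)) \<longlonglongrightarrow> ennreal (norm (G (cplx x y)) powr p)"
      using p y by (intro tendsto_ennrealI tendsto_powr' tendsto_norm tendsto_const limG) auto
    have "ennreal (norm (F n (cplx x y)) powr p) \<le> W x" for n
    proof -
      have "norm (F n (cplx x y)) powr p \<le> norm (F 0 (cplx x y)) powr p + norm (\<Sum>i<n. D i (cplx x y)) powr p"
        unfolding Fsum[of n] using p by (intro norm_add_powr_le) auto
      also have "\<dots> \<le> norm (F 0 (cplx x y)) powr p + (\<Sum>i<n. norm (D i (cplx x y)) powr p)"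
        using p by (intro add_left_mono norm_sum_powr_le) auto
      finally have "ennreal (norm (F n (cplx x y)) powr p) \<le> ennreal \<dots>" by (rule ennreal_leI)
      also have "\<dots> = ennreal (norm (F 0 (cplx x y)) powr p) + (\<Sum>i<n. ennreal (norm (D i (cplx x y)) powr p))"
        by (simp add: ennreal_plus sum_nonneg)
      also have "\<dots> \<le> tube_max p \<sigma> (F 0) x + (\<Sum>i<n. tube_max p \<sigma> (D i) x)"
        by (intro add_mono sum_mono le_tube_max y)
      also have "\<dots> \<le> W x" unfolding W_def by (intro add_left_mono sum_le_suminf) (auto simp: summableI)
      finally show ?thesis .
    qed
    thus "\<exists>N. \<forall>n\<ge>N. ennreal (norm (F n (cplx x y)) powr p) \<le> W x" by blast
  qed
  have "Hardy_norm p (octant \<sigma>) G \<le> (\<integral>\<^sup>+ x. W x \<partial>lborel)"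
    unfolding Hardy_norm_def by (intro SUP_least nn_integral_mono GW)
  hence GH: "G \<in> Hardy_tube p (octant \<sigma>)" using holG Wfin by (auto simp: Hardy_tube_iff)
  have "AE x in lborel. W x \<noteq> \<infinity>" using Wfin by (intro nn_integral_noteq_infinite) auto
  hence AEW: "AE x in lebesgue. W x \<noteq> \<infinity>" by (rule AE_completion)
  have "(\<integral>\<^sup>+ x. (\<Sum>j. ennreal (norm (f j x - g x) powr p)) \<partial>lebesgue) \<noteq> \<infinity>"
  proof -
    have "(\<integral>\<^sup>+ x. (\<Sum>j. ennreal (norm (f j x - g x) powr p)) \<partial>lebesgue) = (\<Sum>j. \<integral>\<^sup>+ x. ennreal (norm (f j x - g x) powr p) \<partial>lebesgue)"
      by (rule nn_integral_suminf) measurable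
    also have "\<dots> \<le> (\<Sum>j. ennreal ((1/2)^j))" by (intro suminf_le less_imp_le fg) (auto simp: summableI)
    also have "\<dots> = ennreal (\<Sum>j. (1/2)^j)" by (intro suminf_ennreal2) (auto intro!: summable_geometric)
    finally show ?thesis by (auto simp: top_unique)
  qed
  hence "AE x in lebesgue. (\<Sum>j. ennreal (norm (f j x - g x) powr p)) \<noteq> \<infinity>"
    by (intro nn_integral_noteq_infinite) auto
  \<comment> \<open>The integrals of the p-th powers of the errors are summable, so the whole
    sequence converges almost everywhere.\<close>
  hence AEf: "AE x in lebesgue. (\<lambda>j. f j x) \<longlonglongrightarrow> g x"
  proof eventually_elim
    case (elim x)
    have "summable (\<lambda>j. norm (f j x - g x) powr p)" using ennreal_suminf_finite(1)[OF elim] by simp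
    from summable_powr_ge_1[OF this, of "1/p"] have "summable (\<lambda>j. (norm (f j x - g x) powr p) powr (1/p))" using p by auto
    hence "summable (\<lambda>j. norm (f j x - g x))" using p by (simp add: powr_powr)
    hence "(\<lambda>j. norm (f j x - g x)) \<longlonglongrightarrow> 0" by (rule summable_LIMSEQ_zero)
    thus ?case using LIM_zero_cancel tendsto_norm_zero_iff by blast
  qed
  have "AE x in lebesgue. \<forall>j. ((\<lambda>y. F j (cplx x y)) \<longlongrightarrow> f j x) (at 0 within octant \<sigma>)"
    using F(2) by (simp add: AE_all_countable)
  hence "AE x in lebesgue. ((\<lambda>y. G (cplx x y)) \<longlongrightarrow> g x) (at 0 within octant \<sigma>)"
    using AEf AEW
  proof eventually_elim
    case (elim x)
    define t where "t i = enn2real (tube_max p \<sigma> (D i) x)" for i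
    have sfin: "(\<Sum>i. tube_max p \<sigma> (D i) x) \<noteq> \<infinity>" using elim(3) by (auto simp: W_def)
    have t: "summable t" "\<And>i. tube_max p \<sigma> (D i) x = ennreal (t i)"
      unfolding t_def using ennreal_suminf_finite[OF sfin] by auto
    have "uniform_limit (octant \<sigma>) (\<lambda>n y. \<Sum>i<n. D i (cplx x y)) (\<lambda>y. \<Sum>i. D i (cplx x y)) sequentially"
    proof (rule Weierstrass_m_test)
      have "t i \<ge> 0" for i by (simp add: t_def)
      thus "summable (\<lambda>i. t i powr (1/p))" using summable_powr_ge_1[OF t(1), of "1/p"] p by simp
      fix i and y :: "real^'n" assume y: "y \<in> octant \<sigma>"
      have "norm (D i (cplx x y)) powr p \<le> t i"
        using le_tube_max[OF y, of "D i" x p] unfolding t(2) by (simp add: t_def)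
      hence "(norm (D i (cplx x y)) powr p) powr (1/p) \<le> t i powr (1/p)" using p by (intro powr_mono2) auto
      thus "norm (D i (cplx x y)) \<le> t i powr (1/p)" using p by (simp add: powr_powr)
    qed
    hence "uniform_limit (octant \<sigma>) (\<lambda>n y. F 0 (cplx x y) + (\<Sum>i<n. D i (cplx x y))) (\<lambda>y. G (cplx x y)) sequentially"
      unfolding G_def by (intro uniform_limit_add uniform_limit_const)
    hence u: "uniform_limit (octant \<sigma>) (\<lambda>n y. F n (cplx x y)) (\<lambda>y. G (cplx x y)) sequentially"
      unfolding Fsum[symmetric] .
    \<comment> \<open>Uniformity in y permits exchanging the limit in n with the limit at the
      boundary.\<close>
    show ?case by (rule swap_uniform_limit[OF _ elim(2) u]) (use elim(1) in auto)
  qed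
  thus "g \<in> boundary_Hardy p \<sigma>" using GH gL unfolding boundary_Hardy_def by blast
qed

section \<open>Interpolation at roots of unity\<close>

definition unit_root :: "nat \<Rightarrow> nat \<Rightarrow> complex" where
  "unit_root M j = cis (2 * pi * real j / real M)"

lemma unit_root_nonzero [simp]: "unit_root M j \<noteq> 0"
  and norm_unit_root [simp]: "norm (unit_root M j) = 1"
  by (auto simp: unit_root_def)

text \<open>The ratio is q^j with q^M = 1, and the geometric sum vanishes unless q = 1, which for
  exponents below M means s = t.\<close>

lemma unit_root_orthogonal:
  assumes "s < M" "t < M"
  shows "(\<Sum>j<M. unit_root M j ^ t / unit_root M j ^ s) = (if s = t then of_nat M else 0)"
proof -
  define q where "q = unit_root M t / unit_root M s"
  have M: "M > 0" using assms by simp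
  have pw: "unit_root M j ^ t = unit_root M t ^ j" for j t
    unfolding unit_root_def Complex.DeMoivre by (rule arg_cong[where f=cis]) (simp add: mult_ac)
  have e: "unit_root M j ^ t / unit_root M j ^ s = q ^ j" for j
    by (simp add: pw q_def power_divide)
  have "unit_root M j ^ M = 1" for j
  proof -
    have e: "real M * (2 * pi * real j / real M) = 2 * pi * real j" using M by simp
    show ?thesis unfolding unit_root_def Complex.DeMoivre e by (rule cis_multiple_2pi) simp
  qed
  hence qM: "q ^ M = 1" by (simp add: q_def power_divide)
  show ?thesis
  proof (cases "s = t")
    case True thus ?thesis by (simp add: e q_def)
  next
    case False
    have inj: "inj_on (\<lambda>k. cis (2 * pi * real k / real M)) {..<M}"
      using Complex.bij_betw_roots_unity[OF M] by (rule bij_betw_imp_inj_on)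
    have "unit_root M t \<noteq> unit_root M s"
      using inj_onD[OF inj, of t s] assms False by (auto simp: unit_root_def)
    hence "q \<noteq> 1" by (simp add: q_def)
    thus ?thesis using False qM by (simp add: e geometric_sum)
  qed
qed

text \<open>The Lagrange basis polynomial of degree below M for the nodes \<rho> times the M-th
  roots of unity, in its form as a geometric sum.\<close>

definition disc_lagrange :: "real \<Rightarrow> nat \<Rightarrow> nat \<Rightarrow> complex \<Rightarrow> complex" where
  "disc_lagrange \<rho> M j u = (\<Sum>s<M. (u / (of_real \<rho> * unit_root M j)) ^ s) / of_nat M"

lemma disc_lagrange_exact:
  assumes "t < M" "\<rho> > 0"
  shows "(\<Sum>j<M. (of_real \<rho> * unit_root M j) ^ t * disc_lagrange \<rho> M j u) = u ^ t"
proof -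
  have "(\<Sum>j<M. (of_real \<rho> * unit_root M j) ^ t * disc_lagrange \<rho> M j u) =
     (\<Sum>j<M. \<Sum>s<M. of_real \<rho> ^ t * (u / of_real \<rho>) ^ s / of_nat M * (unit_root M j ^ t / unit_root M j ^ s))"
    unfolding disc_lagrange_def sum_divide_distrib sum_distrib_left
    by (intro sum.cong refl) (simp add: power_mult_distrib power_divide mult_ac)
  also have "\<dots> = (\<Sum>s<M. of_real \<rho> ^ t * (u / of_real \<rho>) ^ s / of_nat M * (\<Sum>j<M. unit_root M j ^ t / unit_root M j ^ s))"
    unfolding sum_distrib_left by (rule sum.swap)
  also have "\<dots> = (\<Sum>s<M. if s = t then u ^ t else 0)"
  proof (intro sum.cong refl)
    fix s assume s: "s \<in> {..<M}"
    show "of_real \<rho> ^ t * (u / of_real \<rho>) ^ s / of_nat M * (\<Sum>j<M. unit_root M j ^ t / unit_root M j ^ s) = (if s = t then u ^ t else 0)"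
      using s assms by (subst unit_root_orthogonal) (auto simp: power_divide)
  qed
  also have "\<dots> = u ^ t" using assms by simp
  finally show ?thesis .
qed

text \<open>A Lebesgue constant. With the nodes at radius \<rho> > r the terms of each basis
  polynomial are dominated by powers of r / \<rho>, so the bound does not grow with M.\<close>

lemma disc_lagrange_sum_le:
  assumes "norm u \<le> r" "0 \<le> r" "r < \<rho>" "M > 0"
  shows "(\<Sum>j<M. norm (disc_lagrange \<rho> M j u)) \<le> 1 / (1 - r / \<rho>)"
proof -
  have \<rho>: "\<rho> > 0" using assms by linarith
  have q: "0 \<le> r / \<rho>" "r / \<rho> < 1" using assms \<rho> by auto
  have "norm (disc_lagrange \<rho> M j u) \<le> (1 / (1 - r / \<rho>)) / real M" for j
  proof -
    have "norm (\<Sum>s<M. (u / (of_real \<rho> * unit_root M j)) ^ s) \<le> (\<Sum>s<M. (r / \<rho>) ^ s)"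
      using assms \<rho> by (intro order_trans[OF norm_sum] sum_mono)
        (auto simp: norm_power norm_divide norm_mult intro!: power_mono divide_right_mono)
    also have "\<dots> \<le> (\<Sum>s. (r / \<rho>) ^ s)" using q by (intro sum_le_suminf summable_geometric) auto
    also have "\<dots> = 1 / (1 - r / \<rho>)" using q by (intro suminf_geometric) auto
    finally have "norm (\<Sum>s<M. (u / (of_real \<rho> * unit_root M j)) ^ s) / real M \<le> (1 / (1 - r / \<rho>)) / real M"
      by (rule divide_right_mono) simp
    thus ?thesis by (simp only: disc_lagrange_def norm_divide norm_of_nat)
  qed
  hence "(\<Sum>j<M. norm (disc_lagrange \<rho> M j u)) \<le> (\<Sum>j<M. (1 / (1 - r / \<rho>)) / real M)" by (intro sum_mono)
  also have "\<dots> = 1 / (1 - r / \<rho>)" using assms by simp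
  finally show ?thesis .
qed

text \<open>The Taylor polynomial of degree below M is reproduced exactly, so only the remainder is
  interpolated. By Cauchy's inequality on a larger circle it is geometrically small on |v| \<le>
  \<rho>.\<close>

lemma disc_interpolation_error:
  assumes hol: "G holomorphic_on ball 0 1" and bd: "\<And>u. u \<in> ball 0 1 \<Longrightarrow> norm (G u) \<le> K"
    and r: "0 \<le> r" "r < \<rho>" "\<rho> < 1" and M: "M > 0" and u: "norm u \<le> r"
  defines "\<theta> \<equiv> \<rho> / ((1 + \<rho>) / 2)"
  shows "norm (G u - (\<Sum>j<M. G (of_real \<rho> * unit_root M j) * disc_lagrange \<rho> M j u)) \<le>
    (1 + 1 / (1 - r / \<rho>)) * (K * (\<theta> ^ M / (1 - \<theta>)))"
proof -
  have \<rho>: "\<rho> > 0" using r by linarith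
  have \<theta>: "0 < \<theta>" "\<theta> < 1" using \<rho> r by (auto simp: \<theta>_def)
  \<comment> \<open>The radius for Cauchy's inequality, midway between \<rho> and 1.\<close>
  define \<rho>' where "\<rho>' = (1 + \<rho>) / 2"
  have \<rho>': "0 < \<rho>'" "\<rho>' < 1" "\<theta> = \<rho> / \<rho>'" using \<rho> r by (auto simp: \<rho>'_def \<theta>_def)
  have "norm (G 0) \<le> K" by (rule bd) simp
  hence K0: "K \<ge> 0" using norm_ge_zero[of "G 0"] by linarith
  define a where "a n = (deriv ^^ n) G 0 / fact n" for n
  have a: "norm (a n) \<le> K / \<rho>' ^ n" for n
  proof -
    have "norm ((deriv ^^ n) G 0) \<le> fact n * K / \<rho>' ^ n"
    proof (rule Cauchy_inequality)
      show "G holomorphic_on ball 0 \<rho>'" using \<rho>' by (intro holomorphic_on_subset[OF hol]) auto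
      show "continuous_on (cball 0 \<rho>') G"
        using \<rho>' by (intro continuous_on_subset[OF holomorphic_on_imp_continuous_on[OF hol]]) auto
      show "norm (G x) \<le> K" if "norm (0 - x) = \<rho>'" for x using that \<rho>' by (intro bd) auto
    qed (use \<rho>' in auto)
    thus ?thesis unfolding a_def norm_divide by (simp add: field_simps)
  qed
  have ser: "(\<lambda>n. a n * v ^ n) sums G v" if "norm v < 1" for v
    using holomorphic_power_series[OF hol, of v] that by (simp add: a_def)
  define Rm where "Rm v = G v - (\<Sum>n<M. a n * v ^ n)" for v
  have rem: "norm (Rm v) \<le> K * (\<theta> ^ M / (1 - \<theta>))" if v: "norm v \<le> \<rho>" for v
  proof -
    have v1: "norm v < 1" using v r by linarith
    have le: "norm (a (n + M) * v ^ (n + M)) \<le> K * \<theta> ^ M * \<theta> ^ n" for n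
    proof -
      have "norm (a (n + M) * v ^ (n + M)) \<le> (K / \<rho>' ^ (n + M)) * \<rho> ^ (n + M)"
        unfolding norm_mult norm_power using v a K0 \<rho>' by (intro mult_mono power_mono) auto
      also have "\<dots> = K * \<theta> ^ M * \<theta> ^ n" unfolding \<rho>'(3) by (simp add: power_divide power_add mult_ac)
      finally show ?thesis .
    qed
    have "(\<lambda>n. a (n + M) * v ^ (n + M)) sums Rm v"
      unfolding Rm_def using ser[OF v1] by (subst sums_iff_shift) simp
    hence "Rm v = (\<Sum>n. a (n + M) * v ^ (n + M))" by (simp add: sums_iff)
    also have "norm \<dots> \<le> (\<Sum>n. K * \<theta> ^ M * \<theta> ^ n)"
      using \<theta> le by (intro norm_suminf_le summable_mult summable_geometric) auto
    also have "\<dots> = K * (\<theta> ^ M / (1 - \<theta>))" using \<theta> by (simp add: suminf_mult suminf_geometric)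
    finally show ?thesis .
  qed
  have G: "G v = Rm v + (\<Sum>n<M. a n * v ^ n)" for v by (simp add: Rm_def)
  let ?v = "\<lambda>j. of_real \<rho> * unit_root M j"
  have "(\<Sum>j<M. G (?v j) * disc_lagrange \<rho> M j u) =
     (\<Sum>j<M. Rm (?v j) * disc_lagrange \<rho> M j u) + (\<Sum>j<M. \<Sum>n<M. a n * (?v j ^ n * disc_lagrange \<rho> M j u))"
    by (subst G) (simp add: distrib_right sum.distrib sum_distrib_right mult.assoc)
  also have "(\<Sum>j<M. \<Sum>n<M. a n * (?v j ^ n * disc_lagrange \<rho> M j u)) = (\<Sum>n<M. a n * (\<Sum>j<M. ?v j ^ n * disc_lagrange \<rho> M j u))"
    unfolding sum_distrib_left by (rule sum.swap)
  also have "\<dots> = (\<Sum>n<M. a n * u ^ n)"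
    by (intro sum.cong refl) (simp add: disc_lagrange_exact[OF _ \<rho>])
  finally have "G u - (\<Sum>j<M. G (?v j) * disc_lagrange \<rho> M j u) = Rm u - (\<Sum>j<M. Rm (?v j) * disc_lagrange \<rho> M j u)"
    by (simp add: Rm_def)
  also have "norm \<dots> \<le> norm (Rm u) + (\<Sum>j<M. norm (Rm (?v j)) * norm (disc_lagrange \<rho> M j u))"
    by (intro order_trans[OF norm_triangle_ineq4] add_left_mono order_trans[OF norm_sum]) (simp add: norm_mult)
  also have "\<dots> \<le> K * (\<theta> ^ M / (1 - \<theta>)) + (\<Sum>j<M. (K * (\<theta> ^ M / (1 - \<theta>))) * norm (disc_lagrange \<rho> M j u))"
    using u r \<rho> by (intro add_mono rem sum_mono mult_right_mono) (auto simp: norm_mult)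
  also have "\<dots> \<le> K * (\<theta> ^ M / (1 - \<theta>)) + (K * (\<theta> ^ M / (1 - \<theta>))) * (1 / (1 - r / \<rho>))"
    unfolding sum_distrib_left[symmetric] using K0 \<theta> u r M
    by (intro add_left_mono mult_left_mono disc_lagrange_sum_le) auto
  also have "\<dots> = (1 + 1 / (1 - r / \<rho>)) * (K * (\<theta> ^ M / (1 - \<theta>)))"
    by (simp only: distrib_right mult_1_left mult.commute[of "1 / (1 - r / \<rho>)"])
  finally show ?thesis .
qed

text \<open>Variables outside \<open>S\<close> are left alone, so that coordinates can be
  interpolated one at a time by induction on \<open>S\<close>.\<close>

definition polydisc_interp :: "real \<Rightarrow> nat \<Rightarrow> 'n set \<Rightarrow> (('n \<Rightarrow> complex) \<Rightarrow> complex) \<Rightarrow> ('n \<Rightarrow> complex) \<Rightarrow> complex" where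
  "polydisc_interp \<rho> M S g w = (\<Sum>j\<in>S \<rightarrow>\<^sub>E {..<M}. g (\<lambda>i. if i \<in> S then of_real \<rho> * unit_root M (j i) else w i) *
      (\<Prod>k\<in>S. disc_lagrange \<rho> M (j k) (w k)))"

lemma polydisc_interp_empty: "polydisc_interp \<rho> M {} g w = g w"
  by (simp add: polydisc_interp_def)

lemma polydisc_interp_insert:
  assumes "finite S" "k \<notin> S"
  shows "polydisc_interp \<rho> M (insert k S) g w =
    (\<Sum>b<M. polydisc_interp \<rho> M S g (w(k := of_real \<rho> * unit_root M b)) * disc_lagrange \<rho> M b (w k))"
proof -
  let ?\<phi> = "\<lambda>j. g (\<lambda>i. if i \<in> insert k S then of_real \<rho> * unit_root M (j i) else w i) *
      (\<Prod>k\<in>insert k S. disc_lagrange \<rho> M (j k) (w k))"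
  have "polydisc_interp \<rho> M (insert k S) g w = (\<Sum>(b, j)\<in>{..<M} \<times> (S \<rightarrow>\<^sub>E {..<M}). ?\<phi> (j(k := b)))"
    unfolding polydisc_interp_def PiE_insert_eq
    by (subst sum.reindex) (use assms in \<open>auto intro!: inj_combinator sum.cong\<close>)
  also have "\<dots> = (\<Sum>b<M. \<Sum>j\<in>S \<rightarrow>\<^sub>E {..<M}. ?\<phi> (j(k := b)))"
    by (rule sum.cartesian_product[symmetric])
  also have "\<dots> = (\<Sum>b<M. polydisc_interp \<rho> M S g (w(k := of_real \<rho> * unit_root M b)) * disc_lagrange \<rho> M b (w k))"
    unfolding polydisc_interp_def sum_distrib_right
  proof (intro sum.cong refl)
    fix b j
    have 1: "(\<lambda>i. if i \<in> insert k S then of_real \<rho> * unit_root M ((j(k := b)) i) else w i) =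
       (\<lambda>i. if i \<in> S then of_real \<rho> * unit_root M (j i) else (w(k := of_real \<rho> * unit_root M b)) i)"
      using assms by (auto simp: fun_eq_iff)
    have 2: "(\<Prod>i\<in>insert k S. disc_lagrange \<rho> M ((j(k := b)) i) (w i)) =
       disc_lagrange \<rho> M b (w k) * (\<Prod>i\<in>S. disc_lagrange \<rho> M (j i) ((w(k := of_real \<rho> * unit_root M b)) i))"
      using assms by (subst prod.insert) (auto intro!: prod.cong)
    show "?\<phi> (j(k := b)) = g (\<lambda>i. if i \<in> S then of_real \<rho> * unit_root M (j i) else (w(k := of_real \<rho> * unit_root M b)) i) *
       (\<Prod>i\<in>S. disc_lagrange \<rho> M (j i) ((w(k := of_real \<rho> * unit_root M b)) i)) * disc_lagrange \<rho> M b (w k)"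
      unfolding 1 2 by (simp add: mult_ac)
  qed
  finally show ?thesis .
qed

text \<open>Each further coordinate adds a one-variable error and multiplies the earlier ones by the
  Lebesgue constant \<open>L\<close>. Separate holomorphy with one common bound suffices.\<close>

lemma polydisc_interp_error:
  fixes g :: "('n \<Rightarrow> complex) \<Rightarrow> complex"
  assumes hol: "\<And>k w. (\<And>i. norm (w i) < 1) \<Longrightarrow> (\<lambda>\<zeta>. g (w(k := \<zeta>))) holomorphic_on ball 0 1"
    and bd: "\<And>w. (\<And>i. norm (w i) < 1) \<Longrightarrow> norm (g w) \<le> K"
    and r: "0 \<le> r" "r < \<rho>" "\<rho> < 1" and M: "M > 0"
    and S: "finite S" and w: "\<And>i. norm (w i) < 1" "\<And>i. i \<in> S \<Longrightarrow> norm (w i) \<le> r"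
  defines "\<theta> \<equiv> \<rho> / ((1 + \<rho>) / 2)" and "L \<equiv> 1 / (1 - r / \<rho>)"
  shows "norm (g w - polydisc_interp \<rho> M S g w) \<le> real (card S) * L ^ card S * ((1 + L) * (K * (\<theta> ^ M / (1 - \<theta>))))"
  using S w
proof (induction S arbitrary: w rule: finite_induct)
  case empty thus ?case by (simp add: polydisc_interp_empty)
next
  case (insert k S)
  have \<rho>: "\<rho> > 0" using r by linarith
  have "r / \<rho> < 1" "0 \<le> r / \<rho>" using r \<rho> by auto
  hence L1: "L \<ge> 1" by (simp add: L_def)
  define E where "E = (1 + L) * (K * (\<theta> ^ M / (1 - \<theta>)))"
  have "norm (g (\<lambda>_. 0)) \<le> K" by (rule bd) simp
  hence K0: "K \<ge> 0" using norm_ge_zero[of "g (\<lambda>_. 0)"] by linarith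
  have \<theta>: "0 < \<theta>" "\<theta> < 1" using \<rho> r by (auto simp: \<theta>_def)
  have E0: "E \<ge> 0" using L1 K0 \<theta> by (simp add: E_def)
  let ?v = "\<lambda>b. w(k := of_real \<rho> * unit_root M b)"
  have v: "norm (?v b i) < 1" for b i using insert.prems(1) r \<rho> by (simp add: norm_mult)
  have vS: "norm (?v b i) \<le> r" if "i \<in> S" for b i using insert.hyps insert.prems(2)[of i] that by auto
  have IH: "norm (g (?v b) - polydisc_interp \<rho> M S g (?v b)) \<le> real (card S) * L ^ card S * E" for b
    unfolding E_def by (rule insert.IH[OF v vS])
  have "g w - polydisc_interp \<rho> M (insert k S) g w =
     (g w - (\<Sum>b<M. g (?v b) * disc_lagrange \<rho> M b (w k))) +
     (\<Sum>b<M. (g (?v b) - polydisc_interp \<rho> M S g (?v b)) * disc_lagrange \<rho> M b (w k))"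
    using insert.hyps by (subst polydisc_interp_insert) (simp_all add: left_diff_distrib sum_subtractf)
  also have "norm \<dots> \<le> E + (\<Sum>b<M. (real (card S) * L ^ card S * E) * norm (disc_lagrange \<rho> M b (w k)))"
  proof (rule order_trans[OF norm_triangle_ineq], rule add_mono)
    have "norm (g (w(k := w k)) - (\<Sum>b<M. g (w(k := of_real \<rho> * unit_root M b)) * disc_lagrange \<rho> M b (w k))) \<le> E"
      unfolding E_def L_def \<theta>_def
    proof (rule disc_interpolation_error[OF hol[OF insert.prems(1)] _ r M])
      fix \<zeta> :: complex assume "\<zeta> \<in> ball 0 1"
      thus "norm (g (w(k := \<zeta>))) \<le> K" using insert.prems(1) by (intro bd) auto
    qed (use insert.prems(2) in auto)
    thus "norm (g w - (\<Sum>b<M. g (?v b) * disc_lagrange \<rho> M b (w k))) \<le> E" by simp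
    show "norm (\<Sum>b<M. (g (?v b) - polydisc_interp \<rho> M S g (?v b)) * disc_lagrange \<rho> M b (w k)) \<le>
        (\<Sum>b<M. (real (card S) * L ^ card S * E) * norm (disc_lagrange \<rho> M b (w k)))"
      using IH by (intro order_trans[OF norm_sum] sum_mono) (simp add: norm_mult mult_right_mono)
  qed
  also have "\<dots> \<le> E + (real (card S) * L ^ card S * E) * L"
    unfolding sum_distrib_left[symmetric] L_def using E0 L1 insert.prems(2)[of k] r M
    by (intro add_left_mono mult_left_mono disc_lagrange_sum_le) (auto simp: L_def)
  also have "\<dots> \<le> L ^ Suc (card S) * E + (real (card S) * L ^ card S * E) * L"
    using mult_right_mono[OF one_le_power[OF L1, of "Suc (card S)"] E0] by simp
  also have "\<dots> = real (card (insert k S)) * L ^ card (insert k S) * E"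
    using insert.hyps by (simp add: algebra_simps)
  finally show ?case by (simp add: E_def)
qed

lemma polydisc_interp_approx:
  fixes g :: "('n::finite \<Rightarrow> complex) \<Rightarrow> complex"
  assumes hol: "\<And>k w. (\<And>i. norm (w i) < 1) \<Longrightarrow> (\<lambda>\<zeta>. g (w(k := \<zeta>))) holomorphic_on ball 0 1"
    and bd: "\<And>w. (\<And>i. norm (w i) < 1) \<Longrightarrow> norm (g w) \<le> K"
    and r: "0 \<le> r" "r < \<rho>" "\<rho> < 1" and e: "e > 0"
  obtains M where "M > 0" "\<And>w. (\<And>i. norm (w i) \<le> r) \<Longrightarrow> norm (g w - polydisc_interp \<rho> M UNIV g w) < e"
proof -
  define \<theta> where "\<theta> = \<rho> / ((1 + \<rho>) / 2)"
  define L where "L = 1 / (1 - r / \<rho>)"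
  have \<rho>: "\<rho> > 0" using r by linarith
  have \<theta>: "0 < \<theta>" "\<theta> < 1" using \<rho> r by (auto simp: \<theta>_def)
  have "(\<lambda>M. real CARD('n) * L ^ CARD('n) * ((1 + L) * (K * (\<theta> ^ M / (1 - \<theta>))))) \<longlonglongrightarrow>
     real CARD('n) * L ^ CARD('n) * ((1 + L) * (K * (0 / (1 - \<theta>))))"
    using \<theta> by (intro tendsto_intros LIMSEQ_power_zero) auto
  hence "eventually (\<lambda>M. real CARD('n) * L ^ CARD('n) * ((1 + L) * (K * (\<theta> ^ M / (1 - \<theta>)))) < e) sequentially"
    using e by (intro order_tendstoD) auto
  with eventually_gt_at_top[of 0] have "eventually (\<lambda>M. M > 0 \<and> real CARD('n) * L ^ CARD('n) * ((1 + L) * (K * (\<theta> ^ M / (1 - \<theta>)))) < e) sequentially"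
    by (rule eventually_conj)
  then obtain M where M: "M > 0" "real CARD('n) * L ^ CARD('n) * ((1 + L) * (K * (\<theta> ^ M / (1 - \<theta>)))) < e"
    using eventually_happens'[OF sequentially_bot] by blast
  show ?thesis
  proof (rule that[OF M(1)])
    fix w :: "'n \<Rightarrow> complex" assume w: "\<And>i. norm (w i) \<le> r"
    have w1: "norm (w i) < 1" for i using w[of i] r by linarith
    have "norm (g w - polydisc_interp \<rho> M UNIV g w) \<le> real CARD('n) * L ^ CARD('n) * ((1 + L) * (K * (\<theta> ^ M / (1 - \<theta>))))"
      unfolding L_def \<theta>_def by (rule polydisc_interp_error[OF hol bd r M(1)]) (use w w1 in auto)
    thus "norm (g w - polydisc_interp \<rho> M UNIV g w) < e" using M(2) by linarith
  qed
qed

section \<open>Approximation of boundary functions on one octant\<close>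

text \<open>For s = 1 the disc goes to the upper half plane, for s = -1 to the lower one. On the
  circle minus 1 the inverse is \<open>cayley_real s\<close>.\<close>

definition cayley_inv :: "real \<Rightarrow> complex \<Rightarrow> complex" where
  "cayley_inv s w = of_real s * \<i> * ((1 + w) / (1 - w))"

definition cayley_real :: "real \<Rightarrow> real \<Rightarrow> complex" where
  "cayley_real s x = (of_real x - \<i> * of_real s) / (of_real x + \<i> * of_real s)"

lemma Re_moebius: "Re ((1 + w) / (1 - w)) = (1 - (norm w)\<^sup>2) / (norm (1 - w))\<^sup>2"
  unfolding Re_divide cmod_power2 by (simp add: power2_eq_square algebra_simps)

lemma Im_cayley_inv:
  assumes "s * s = 1" shows "s * Im (cayley_inv s w) = (1 - (norm w)\<^sup>2) / (norm (1 - w))\<^sup>2"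
proof -
  have "s * Im (cayley_inv s w) = (s * s) * Re ((1 + w) / (1 - w))"
  proof -
    have "s * Im (of_real s * \<i> * u) = (s * s) * Re u" for u by simp
    thus ?thesis unfolding cayley_inv_def .
  qed
  thus ?thesis using assms Re_moebius by simp
qed

lemma real_plus_i_sign_nonzero: "s \<noteq> 0 \<Longrightarrow> complex_of_real x + \<i> * of_real s \<noteq> 0"
  by (auto simp: complex_eq_iff)

lemma norm_real_i_sign: "norm (complex_of_real x - \<i> * of_real s) = norm (complex_of_real x + \<i> * of_real s)"
  by (simp add: cmod_def)

lemma norm_cayley_real [simp]: "s \<noteq> 0 \<Longrightarrow> norm (cayley_real s x) = 1"
  using real_plus_i_sign_nonzero[of s x] by (simp add: cayley_real_def norm_divide norm_real_i_sign)

lemma one_minus_cayley_real: "s \<noteq> 0 \<Longrightarrow> 1 - cayley_real s x = 2 * \<i> * of_real s / (of_real x + \<i> * of_real s)"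
  and one_plus_cayley_real: "s \<noteq> 0 \<Longrightarrow> 1 + cayley_real s x = 2 * of_real x / (of_real x + \<i> * of_real s)"
  using real_plus_i_sign_nonzero[of s x] by (simp_all add: cayley_real_def field_simps)

lemma cayley_real_neq_1: "s \<noteq> 0 \<Longrightarrow> 1 - cayley_real s x \<noteq> 0"
  using real_plus_i_sign_nonzero[of s x] by (simp add: one_minus_cayley_real)

lemma cayley_inv_cayley_real:
  assumes "s * s = 1" shows "cayley_inv s (cayley_real s x) = of_real x"
proof -
  have s: "s \<noteq> 0" using assms by auto
  have "cayley_inv s (cayley_real s x) = of_real s * \<i> * (of_real x / (\<i> * of_real s))"
    unfolding cayley_inv_def one_minus_cayley_real[OF s] one_plus_cayley_real[OF s]
    using real_plus_i_sign_nonzero[OF s, of x] by simp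
  thus ?thesis using s by simp
qed

lemma continuous_on_cayley_real: "s \<noteq> 0 \<Longrightarrow> continuous_on A (cayley_real s)"
  unfolding cayley_real_def[abs_def] by (intro continuous_intros) (auto simp: real_plus_i_sign_nonzero)

text \<open>In the half-plane coordinate z this is i s R (z + i s) / (z + i s R). It is bounded by R
  on the closed disc, and after division by z + i s it tends to 1 as R grows.\<close>

definition damping :: "real \<Rightarrow> real \<Rightarrow> complex \<Rightarrow> complex" where
  "damping s R w = 2 * \<i> * of_real (s * R) / (of_real (1 + R) - of_real (R - 1) * w)"

lemma damping_denominator:
  fixes w :: complex
  assumes "R \<ge> 1" "norm w \<le> 1" shows "norm (of_real (1 + R) - of_real (R - 1) * w) \<ge> 2"
proof -
  have "norm (of_real (R - 1) * w) \<le> (R - 1) * 1"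
    unfolding norm_mult norm_of_real using assms by (intro mult_mono) auto
  moreover have "norm (of_real (1 + R) :: complex) = 1 + R" using assms unfolding norm_of_real by simp
  ultimately have "(1 + R) - (R - 1) * 1 \<le> norm (of_real (1 + R) :: complex) - norm (of_real (R - 1) * w)"
    by (intro diff_mono) auto
  also have "\<dots> \<le> norm (of_real (1 + R) - of_real (R - 1) * w)" by (rule norm_triangle_ineq2)
  finally show ?thesis by simp
qed

lemma norm_damping_le:
  assumes "R \<ge> 1" "norm w \<le> 1" "s * s = 1" shows "norm (damping s R w) \<le> R"
proof -
  have "s\<^sup>2 = 1" using assms(3) by (simp add: power2_eq_square)
  hence s: "\<bar>s\<bar> = 1" by (simp add: abs_square_eq_1)
  have "norm (damping s R w) \<le> (2 * R) / 2"
    unfolding damping_def norm_divide using s assms damping_denominator[OF assms(1,2)]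
    by (intro frac_le) (auto simp: norm_mult abs_mult)
  thus ?thesis by simp
qed

lemma damping_cayley_real:
  assumes "s * s = 1" "R > 0"
  shows "damping s R (cayley_real s x) / (of_real x + \<i> * of_real s) = \<i> * of_real (s * R) / (of_real x + \<i> * of_real (s * R))"
proof -
  have s: "s \<noteq> 0" using assms by auto
  have n1: "of_real x + \<i> * of_real s \<noteq> (0::complex)" by (rule real_plus_i_sign_nonzero[OF s])
  have n2: "of_real x + \<i> * of_real (s * R) \<noteq> (0::complex)" using s assms by (intro real_plus_i_sign_nonzero) auto
  have eq: "of_real (1 + R) - of_real (R - 1) * cayley_real s x = 2 * (of_real x + \<i> * of_real (s * R)) / (of_real x + \<i> * of_real s)"
    using n1 unfolding cayley_real_def by (simp add: divide_simps) (simp add: algebra_simps)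
  have "2 * \<i> * of_real (s * R) / (2 * b / a) / a = \<i> * of_real (s * R) / b" if "a \<noteq> 0" "b \<noteq> 0" for a b :: complex
    using that by (simp add: divide_simps)
  from this[OF n1 n2] show ?thesis unfolding damping_def eq .
qed

text \<open>The damping factors anticipate the weight with denominators (x + i \<sigma>)^N: on the
  torus this bounded function times that weight is the shifted \<open>F\<close> up to factors that
  tend to 1 with R.\<close>

definition polydisc_fun :: "('n::finite \<Rightarrow> real) \<Rightarrow> real \<Rightarrow> real \<Rightarrow> nat \<Rightarrow> (complex^'n \<Rightarrow> complex) \<Rightarrow> ('n \<Rightarrow> complex) \<Rightarrow> complex" where
  "polydisc_fun \<sigma> \<delta> R N F w = F (\<chi> k. cayley_inv (\<sigma> k) (w k) + \<i> * of_real (\<delta> * \<sigma> k)) * (\<Prod>k\<in>UNIV. damping (\<sigma> k) R (w k) ^ N)"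

lemma polydisc_point_deep:
  assumes \<sigma>: "\<sigma> \<in> sign_vectors" and w: "norm (w k) \<le> 1"
  shows "\<sigma> k * Im ((\<chi> k. cayley_inv (\<sigma> k) (w k) + \<i> * of_real (\<delta> * \<sigma> k)) $ k) \<ge> \<delta>"
proof -
  have ss: "\<sigma> k * \<sigma> k = 1" by (rule sign_mult_self[OF \<sigma>])
  have "\<sigma> k * Im ((\<chi> k. cayley_inv (\<sigma> k) (w k) + \<i> * of_real (\<delta> * \<sigma> k)) $ k) = \<sigma> k * Im (cayley_inv (\<sigma> k) (w k)) + \<delta> * (\<sigma> k * \<sigma> k)"
    by (simp add: algebra_simps)
  also have "\<dots> = (1 - (norm (w k))\<^sup>2) / (norm (1 - w k))\<^sup>2 + \<delta>" unfolding Im_cayley_inv[OF ss] ss by simp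
  \<comment> \<open>At w k = 1 the quotient is 0 by the convention for division by 0, so the bound
    covers the whole closed disc.\<close>
  also have "\<dots> \<ge> \<delta>" using w by (simp add: power_le_one)
  finally show ?thesis .
qed

lemma polydisc_point_in_tube:
  assumes \<sigma>: "\<sigma> \<in> sign_vectors" and w: "\<And>k. norm (w k) \<le> 1" and \<delta>: "\<delta> > 0"
  shows "(\<chi> k. cayley_inv (\<sigma> k) (w k) + \<i> * of_real (\<delta> * \<sigma> k)) \<in> tube (octant \<sigma>)"
proof -
  have "\<sigma> k * Im ((\<chi> k. cayley_inv (\<sigma> k) (w k) + \<i> * of_real (\<delta> * \<sigma> k)) $ k) > 0" for k
    by (rule less_le_trans[OF \<delta> polydisc_point_deep[OF \<sigma> w]])
  thus ?thesis by (simp add: tube_def octant_def)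
qed

lemma polydisc_fun_bound:
  fixes F :: "complex^'n \<Rightarrow> complex"
  assumes \<sigma>: "\<sigma> \<in> sign_vectors" and w: "\<And>k. norm (w k) \<le> 1" and R: "R \<ge> 1"
    and bd: "\<And>z. (\<And>k. \<sigma> k * Im (z $ k) \<ge> \<delta>) \<Longrightarrow> norm (F z) \<le> K"
  shows "norm (polydisc_fun \<sigma> \<delta> R N F w) \<le> K * (R ^ N) ^ CARD('n)"
proof -
  have 1: "norm (F (\<chi> k. cayley_inv (\<sigma> k) (w k) + \<i> * of_real (\<delta> * \<sigma> k))) \<le> K"
    by (intro bd polydisc_point_deep \<sigma> w)
  have "norm (\<Prod>k\<in>UNIV. damping (\<sigma> k) R (w k) ^ N) = (\<Prod>k\<in>UNIV. norm (damping (\<sigma> k) R (w k)) ^ N)"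
    by (simp add: prod_norm[symmetric] norm_power)
  also have "\<dots> \<le> (\<Prod>k\<in>(UNIV::'n set). R ^ N)"
    by (intro prod_mono conjI power_mono norm_damping_le R w sign_mult_self[OF \<sigma>]) auto
  finally have 2: "norm (\<Prod>k\<in>UNIV. damping (\<sigma> k) R (w k) ^ N) \<le> (R ^ N) ^ CARD('n)" by simp
  have K0: "K \<ge> 0" by (rule order_trans[OF norm_ge_zero 1])
  show ?thesis unfolding polydisc_fun_def norm_mult by (intro mult_mono 1 2 K0) auto
qed

text \<open>Changing one polydisc coordinate moves the image point along a single complex line, so
  holomorphy reduces to a slice of \<open>F\<close>.\<close>

lemma polydisc_fun_holomorphic:
  fixes F :: "complex^'n \<Rightarrow> complex"
  assumes \<sigma>: "\<sigma> \<in> sign_vectors" and hol: "holomorphic_several F (tube (octant \<sigma>))"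
    and \<delta>: "\<delta> > 0" and R: "R \<ge> 1" and w: "\<And>i. norm (w i) < 1"
  shows "(\<lambda>\<zeta>. polydisc_fun \<sigma> \<delta> R N F (w(k := \<zeta>))) holomorphic_on ball 0 1"
  unfolding polydisc_fun_def
proof (rule holomorphic_on_mult)
  define z0 where "z0 = (\<chi> k. cayley_inv (\<sigma> k) (w k) + \<i> * of_real (\<delta> * \<sigma> k))"
  define c where "c \<zeta> = cayley_inv (\<sigma> k) \<zeta> - cayley_inv (\<sigma> k) (w k)" for \<zeta>
  have eq: "(\<chi> i. cayley_inv (\<sigma> i) ((w(k := \<zeta>)) i) + \<i> * of_real (\<delta> * \<sigma> i)) = z0 + c \<zeta> *s axis k 1" for \<zeta>
    by (auto simp: vec_eq_iff z0_def c_def axis_def)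
  have hc: "c holomorphic_on ball 0 1"
    unfolding c_def[abs_def] cayley_inv_def by (intro holomorphic_intros) auto
  have "((\<lambda>c. F (z0 + c *s axis k 1)) \<circ> c) holomorphic_on ball 0 1"
  proof (rule holomorphic_on_compose_gen[OF hc holomorphic_several_slice[OF hol]])
    show "c ` ball 0 1 \<subseteq> {c. z0 + c *s axis k 1 \<in> tube (octant \<sigma>)}"
    proof clarify
      fix \<zeta> :: complex assume "\<zeta> \<in> ball 0 1"
      hence "norm ((w(k := \<zeta>)) i) \<le> 1" for i using w[of i] by auto
      thus "z0 + c \<zeta> *s axis k 1 \<in> tube (octant \<sigma>)" unfolding eq[symmetric] by (intro polydisc_point_in_tube \<sigma> \<delta>)
    qed
  qed
  thus "(\<lambda>\<zeta>. F (\<chi> i. cayley_inv (\<sigma> i) ((w(k := \<zeta>)) i) + \<i> * of_real (\<delta> * \<sigma> i))) holomorphic_on ball 0 1"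
    unfolding eq by (simp add: o_def)
  show "(\<lambda>\<zeta>. \<Prod>i\<in>UNIV. damping (\<sigma> i) R ((w(k := \<zeta>)) i) ^ N) holomorphic_on ball 0 1"
  proof (intro holomorphic_on_prod holomorphic_on_power)
    fix i
    have nz: "of_real (1 + R) - of_real (R - 1) * \<zeta> \<noteq> 0" if "\<zeta> \<in> ball 0 1" for \<zeta> :: complex
      using damping_denominator[OF R, of \<zeta>] that by auto
    show "(\<lambda>\<zeta>. damping (\<sigma> i) R ((w(k := \<zeta>)) i)) holomorphic_on ball 0 1"
    proof (cases "i = k")
      case True
      have "(\<lambda>\<zeta>. damping (\<sigma> k) R \<zeta>) holomorphic_on ball 0 1"
        unfolding damping_def using nz by (intro holomorphic_intros) auto
      thus ?thesis using True by simp
    qed simp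
  qed
qed

lemma tendsto_cayley_inv:
  assumes "(u \<longlongrightarrow> w) Fl" "1 - w \<noteq> 0" shows "((\<lambda>x. cayley_inv s (u x)) \<longlongrightarrow> cayley_inv s w) Fl"
  unfolding cayley_inv_def using assms by (intro tendsto_intros) auto

lemma tendsto_polydisc_fun:
  fixes F :: "complex^'n \<Rightarrow> complex"
  assumes \<sigma>: "\<sigma> \<in> sign_vectors" and hol: "holomorphic_several F (tube (octant \<sigma>))"
    and \<delta>: "\<delta> > 0" and R: "R \<ge> 1" and w: "\<And>i. norm (w i) \<le> 1" "\<And>i. 1 - w i \<noteq> 0"
    and u: "\<And>i. ((\<lambda>x. u x i) \<longlongrightarrow> w i) Fl"
  shows "((\<lambda>x. polydisc_fun \<sigma> \<delta> R N F (u x)) \<longlongrightarrow> polydisc_fun \<sigma> \<delta> R N F w) Fl"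
  unfolding polydisc_fun_def
proof (intro tendsto_mult tendsto_prod tendsto_power)
  let ?z = "\<chi> k. cayley_inv (\<sigma> k) (w k) + \<i> * of_real (\<delta> * \<sigma> k)"
  have "?z \<in> tube (octant \<sigma>)" by (intro polydisc_point_in_tube \<sigma> w \<delta>)
  moreover have "\<forall>z\<in>tube (octant \<sigma>). isCont F z"
    using holomorphic_several_imp_continuous_on[OF hol]
    unfolding continuous_on_eq_continuous_at[OF open_tube[OF open_octant]] .
  ultimately have cont: "isCont F ?z" by blast
  show "((\<lambda>x. F (\<chi> k. cayley_inv (\<sigma> k) (u x k) + \<i> * of_real (\<delta> * \<sigma> k))) \<longlongrightarrow> F ?z) Fl"
    by (rule isCont_tendsto_compose[OF cont]) (intro tendsto_vec_lambda tendsto_add tendsto_const tendsto_cayley_inv u w)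
  fix k
  have "of_real (1 + R) - of_real (R - 1) * w k \<noteq> 0" using damping_denominator[OF R w(1), of k] by auto
  thus "((\<lambda>x. damping (\<sigma> k) R (u x k)) \<longlongrightarrow> damping (\<sigma> k) R (w k)) Fl"
    unfolding damping_def by (intro tendsto_intros u) auto
qed

lemma polydisc_fun_cayley_real:
  fixes F :: "complex^'n \<Rightarrow> complex"
  assumes \<sigma>: "\<sigma> \<in> sign_vectors" and R: "R \<ge> 1"
  shows "polydisc_fun \<sigma> \<delta> R N F (\<lambda>k. cayley_real (\<sigma> k) (x $ k)) * (\<Prod>k\<in>UNIV. 1 / (of_real (x $ k) + \<i> * of_real (\<sigma> k)) ^ N) =
    F (cplx x (\<delta> *\<^sub>R sign_vec \<sigma>)) * (\<Prod>k\<in>UNIV. (\<i> * of_real (\<sigma> k * R) / (of_real (x $ k) + \<i> * of_real (\<sigma> k * R))) ^ N)"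
proof -
  have "(\<chi> k. cayley_inv (\<sigma> k) (cayley_real (\<sigma> k) (x $ k)) + \<i> * of_real (\<delta> * \<sigma> k)) = cplx x (\<delta> *\<^sub>R sign_vec \<sigma>)"
    unfolding cayley_inv_cayley_real[OF sign_mult_self[OF \<sigma>]] by (simp add: vec_eq_iff Complex_eq)
  moreover have "(\<Prod>k\<in>UNIV. damping (\<sigma> k) R (cayley_real (\<sigma> k) (x $ k)) ^ N) * (\<Prod>k\<in>UNIV. 1 / (of_real (x $ k) + \<i> * of_real (\<sigma> k)) ^ N)
    = (\<Prod>k\<in>UNIV. (damping (\<sigma> k) R (cayley_real (\<sigma> k) (x $ k)) / (of_real (x $ k) + \<i> * of_real (\<sigma> k))) ^ N)"
    by (simp add: prod.distrib[symmetric] power_divide)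
  ultimately show ?thesis
    unfolding polydisc_fun_def using R by (simp add: mult.assoc damping_cayley_real[OF sign_mult_self[OF \<sigma>]])
qed

lemma nn_integral_weight:
  fixes \<sigma> :: "'n::finite \<Rightarrow> real"
  assumes \<sigma>: "\<sigma> \<in> sign_vectors" and p: "0 < p" and N: "real N * p > 1"
  shows "(\<integral>\<^sup>+ x. ennreal (norm (\<Prod>k\<in>UNIV. 1 / (complex_of_real (x $ k) + \<i> * of_real (\<sigma> k)) ^ N) powr p) \<partial>(lborel :: (real^'n) measure)) < \<infinity>"
proof -
  define h where "h k t = ennreal (norm (1 / (complex_of_real t + \<i> * of_real (\<sigma> k)) ^ N) powr p)" for k t
  have [measurable]: "h k \<in> borel_measurable borel" for k unfolding h_def[abs_def] by measurable
  have hfin: "(\<integral>\<^sup>+ t. h k t \<partial>lborel) < \<infinity>" for k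
  proof -
    have "(\<integral>\<^sup>+ t. h k t \<partial>lborel) \<le> (\<integral>\<^sup>+ t. ennreal (2 powr (real N * p)) * ennreal ((1 + \<bar>t\<bar>) powr (- (real N * p))) \<partial>lborel)"
    proof (rule nn_integral_mono)
      fix t :: real
      let ?d = "norm (complex_of_real t + \<i> * of_real (\<sigma> k))"
      have "\<bar>t\<bar> \<le> ?d" using abs_Re_le_cmod[of "complex_of_real t + \<i> * of_real (\<sigma> k)"] by simp
      moreover have "\<bar>\<sigma> k\<bar> \<le> ?d" using abs_Im_le_cmod[of "complex_of_real t + \<i> * of_real (\<sigma> k)"] by simp
      moreover have "\<bar>\<sigma> k\<bar> = 1" using sign_vectors_cases[OF \<sigma>, of k] by auto
      ultimately have d: "(1 + \<bar>t\<bar>) / 2 \<le> ?d" by simp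
      have d0: "(1 + \<bar>t\<bar>) / 2 > 0" by simp
      have "norm (1 / (complex_of_real t + \<i> * of_real (\<sigma> k)) ^ N) powr p = ?d powr (- (real N * p))"
      proof -
        have dp: "?d > 0" using d d0 by linarith
        have "norm (1 / (complex_of_real t + \<i> * of_real (\<sigma> k)) ^ N) = ?d powr (- real N)"
          unfolding norm_divide norm_power norm_one powr_minus_divide powr_realpow[OF dp] ..
        thus ?thesis by (simp only: powr_powr minus_mult_left)
      qed
      also have "\<dots> \<le> ((1 + \<bar>t\<bar>) / 2) powr (- (real N * p))"
        using d d0 N by (intro powr_mono2') auto
      also have "\<dots> = 2 powr (real N * p) * (1 + \<bar>t\<bar>) powr (- (real N * p))"
        by (simp add: powr_divide powr_minus field_simps)
      finally show "h k t \<le> ennreal (2 powr (real N * p)) * ennreal ((1 + \<bar>t\<bar>) powr (- (real N * p)))"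
        unfolding h_def by (subst ennreal_mult[symmetric]) (auto intro: ennreal_leI)
    qed
    also have "\<dots> = ennreal (2 powr (real N * p)) * (\<integral>\<^sup>+ t. ennreal ((1 + \<bar>t\<bar>) powr (- (real N * p))) \<partial>lborel)"
      by (rule nn_integral_cmult) measurable
    also have "\<dots> < \<infinity>" using nn_integral_powr_infinity[OF N] by (simp add: ennreal_mult_less_top)
    finally show ?thesis .
  qed
  have "(\<integral>\<^sup>+ x. ennreal (norm (\<Prod>k\<in>UNIV. 1 / (complex_of_real (x $ k) + \<i> * of_real (\<sigma> k)) ^ N) powr p) \<partial>(lborel :: (real^'n) measure))
     = (\<integral>\<^sup>+ x. (\<Prod>k\<in>UNIV. h k (x $ k)) \<partial>(lborel :: (real^'n) measure))"
    unfolding h_def by (intro nn_integral_cong) (simp only: prod_norm[symmetric] prod_powr_distrib norm_ge_zero, simp add: prod_ennreal)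
  also have "\<dots> = (\<Prod>k\<in>UNIV. \<integral>\<^sup>+ t. h k t \<partial>lborel)" by (rule nn_integral_prod_vec) measurable
  also have "\<dots> < \<infinity>" by (intro prod_less_top_ennreal hfin) auto
  finally show ?thesis .
qed

lemma Lp_dist_triangle:
  fixes a b c :: "'a \<Rightarrow> complex"
  assumes p: "0 < p" "p \<le> 1" and [measurable]: "a \<in> borel_measurable M" "b \<in> borel_measurable M" "c \<in> borel_measurable M"
  shows "(\<integral>\<^sup>+ x. ennreal (norm (a x - c x) powr p) \<partial>M) \<le>
    (\<integral>\<^sup>+ x. ennreal (norm (a x - b x) powr p) \<partial>M) + (\<integral>\<^sup>+ x. ennreal (norm (b x - c x) powr p) \<partial>M)"
proof -
  have "(\<integral>\<^sup>+ x. ennreal (norm (a x - c x) powr p) \<partial>M) \<le>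
    (\<integral>\<^sup>+ x. ennreal (norm (a x - b x) powr p) + ennreal (norm (b x - c x) powr p) \<partial>M)"
  proof (rule nn_integral_mono)
    fix x
    show "ennreal (norm (a x - c x) powr p) \<le> ennreal (norm (a x - b x) powr p) + ennreal (norm (b x - c x) powr p)"
    proof -
      have "(a x - b x) - (c x - b x) = a x - c x" by simp
      with ennreal_norm_diff_powr_le[OF p, of "a x - b x" "c x - b x"] show ?thesis
        by (simp only: norm_minus_commute[of "c x" "b x"])
    qed
  qed
  also have "\<dots> = (\<integral>\<^sup>+ x. ennreal (norm (a x - b x) powr p) \<partial>M) + (\<integral>\<^sup>+ x. ennreal (norm (b x - c x) powr p) \<partial>M)"
    by (rule nn_integral_add) measurable
  finally show ?thesis .
qed

text \<open>The tensor form of the interpolant is kept, so that its poles can be cleared coordinate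
  by coordinate.\<close>

definition cayley_poly :: "('n::finite \<Rightarrow> real) \<Rightarrow> nat \<Rightarrow> nat \<Rightarrow> (('n \<Rightarrow> nat) \<Rightarrow> complex) \<Rightarrow> (nat \<Rightarrow> complex poly) \<Rightarrow> real^'n \<Rightarrow> complex" where
  "cayley_poly \<sigma> N M c q x = (\<Sum>j\<in>UNIV \<rightarrow>\<^sub>E {..<M}. c j *
     (\<Prod>k\<in>UNIV. poly (q (j k)) (cayley_real (\<sigma> k) (x $ k)) / (of_real (x $ k) + \<i> * of_real (\<sigma> k)) ^ N))"

lemma cayley_poly_measurable:
  fixes \<sigma> :: "'n::finite \<Rightarrow> real"
  assumes \<sigma>: "\<sigma> \<in> sign_vectors" shows "cayley_poly \<sigma> N M c q \<in> borel_measurable borel"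
proof -
  have [measurable]: "(\<lambda>x::real^'n. poly (q j) (cayley_real (\<sigma> k) (x $ k))) \<in> borel_measurable borel" for j k
  proof -
    have s0: "\<sigma> k \<noteq> 0" using sign_mult_self[OF \<sigma>, of k] by auto
    have cm: "cayley_real (\<sigma> k) \<in> borel_measurable borel"
      by (intro borel_measurable_continuous_onI continuous_on_cayley_real s0)
    have "(\<lambda>x::real^'n. cayley_real (\<sigma> k) (x $ k)) \<in> borel_measurable borel"
      by (rule measurable_compose[OF _ cm]) simp
    moreover have "poly (q j) \<in> borel_measurable borel" by (intro borel_measurable_continuous_onI continuous_intros)
    ultimately show ?thesis by (rule measurable_compose)
  qed
  show ?thesis unfolding cayley_poly_def[abs_def] by measurable
qed

lemma cayley_poly_interp:
  fixes g :: "('n::finite \<Rightarrow> complex) \<Rightarrow> complex"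
  assumes "M > 0"
  obtains c q where "\<And>j. degree (q j :: complex poly) < M"
    "\<And>x. polydisc_interp \<rho> M UNIV g (\<lambda>k. of_real r * cayley_real (\<sigma> k) (x $ k)) *
      (\<Prod>k\<in>UNIV. 1 / (of_real (x $ k) + \<i> * of_real (\<sigma> k)) ^ N) = cayley_poly \<sigma> N M c q x"
proof -
  define c where "c j = g (\<lambda>i. of_real \<rho> * unit_root M (j i))" for j :: "'n \<Rightarrow> nat"
  define q where "q j = (\<Sum>s<M. monom ((of_real r / (of_real \<rho> * unit_root M j)) ^ s / of_nat M) s)" for j
  have d: "degree (q j) \<le> M - 1" for j unfolding q_def
  proof (rule degree_sum_le)
    fix s assume "s \<in> {..<M}"
    hence "s \<le> M - 1" by auto
    thus "degree (monom ((of_real r / (of_real \<rho> * unit_root M j)) ^ s / of_nat M) s) \<le> M - 1"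
      using degree_monom_le order_trans by blast
  qed simp
  have deg: "degree (q j) < M" for j using assms d[of j] by linarith
  have q: "disc_lagrange \<rho> M j (of_real r * u) = poly (q j) u" for j u
    unfolding q_def disc_lagrange_def poly_sum sum_divide_distrib
    by (intro sum.cong refl) (simp add: poly_monom power_mult_distrib[symmetric] power_divide[symmetric])
  have "polydisc_interp \<rho> M UNIV g (\<lambda>k. of_real r * cayley_real (\<sigma> k) (x $ k)) *
      (\<Prod>k\<in>UNIV. 1 / (of_real (x $ k) + \<i> * of_real (\<sigma> k)) ^ N) = cayley_poly \<sigma> N M c q x" for x
    unfolding polydisc_interp_def cayley_poly_def sum_distrib_right q
    by (intro sum.cong refl) (simp add: c_def mult.assoc prod.distrib[symmetric])
  with deg show ?thesis by (rule that)
qed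

lemma polydisc_fun_measurable:
  fixes F :: "complex^'n \<Rightarrow> complex"
  assumes \<sigma>: "\<sigma> \<in> sign_vectors" and hol: "holomorphic_several F (tube (octant \<sigma>))"
    and \<delta>: "\<delta> > 0" and R: "R \<ge> 1" and r: "0 \<le> r" "r \<le> 1"
  shows "(\<lambda>x. polydisc_fun \<sigma> \<delta> R N F (\<lambda>k. of_real r * cayley_real (\<sigma> k) (x $ k))) \<in> borel_measurable borel"
proof (rule borel_measurable_continuous_onI, rule continuous_at_imp_continuous_on, rule ballI)
  fix x :: "real^'n"
  have s0: "\<sigma> k \<noteq> 0" for k using sign_mult_self[OF \<sigma>, of k] by auto
  show "isCont (\<lambda>x. polydisc_fun \<sigma> \<delta> R N F (\<lambda>k. of_real r * cayley_real (\<sigma> k) (x $ k))) x"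
    unfolding isCont_def
  proof (rule tendsto_polydisc_fun[OF \<sigma> hol \<delta> R])
    fix k
    show "norm (of_real r * cayley_real (\<sigma> k) (x $ k)) \<le> 1" using r s0 by (simp add: norm_mult)
    show "1 - of_real r * cayley_real (\<sigma> k) (x $ k) \<noteq> 0"
    proof (cases "r = 1")
      case True thus ?thesis using cayley_real_neq_1[OF s0] by simp
    next
      case False
      hence "norm (of_real r * cayley_real (\<sigma> k) (x $ k)) < 1" using r s0 by (simp add: norm_mult)
      thus ?thesis by auto
    qed
    have "isCont (cayley_real (\<sigma> k)) (x $ k)"
      using continuous_on_cayley_real[OF s0, of UNIV] by (simp add: continuous_on_eq_continuous_at)
    hence "((\<lambda>x. cayley_real (\<sigma> k) (x $ k)) \<longlongrightarrow> cayley_real (\<sigma> k) (x $ k)) (at x)"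
      by (rule isCont_tendsto_compose) (intro tendsto_intros)
    thus "((\<lambda>x. of_real r * cayley_real (\<sigma> k) (x $ k)) \<longlongrightarrow> of_real r * cayley_real (\<sigma> k) (x $ k)) (at x)"
      by (intro tendsto_mult tendsto_const)
  qed
qed

text \<open>Four errors of e/8 each: the shift \<delta>, the damping R, a dilation r of the torus,
  and the interpolation. The dilation is there because interpolation is controlled only on smaller
  polydiscs, and the pulled-back function may be discontinuous where a coordinate equals 1, the
  image of infinity.\<close>

lemma boundary_Hardy_approx:
  fixes \<sigma> :: "'n::finite \<Rightarrow> real"
  assumes \<sigma>: "\<sigma> \<in> sign_vectors" and p: "0 < p" "p < 1" and N: "real N * p > 1"
    and f: "f \<in> boundary_Hardy p \<sigma>" and e: "e > 0"
  obtains M c q where "M > 0" "\<And>j. degree (q j) < M"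
    "(\<integral>\<^sup>+ x. ennreal (norm (cayley_poly \<sigma> N M c q x - f x) powr p) \<partial>lebesgue) < ennreal e"
proof -
  obtain F where F: "F \<in> Hardy_tube p (octant \<sigma>)"
     "AE x in lebesgue. ((\<lambda>y. F (cplx x y)) \<longlongrightarrow> f x) (at 0 within octant \<sigma>)" and fm[measurable]: "f \<in> borel_measurable lebesgue"
    using f unfolding boundary_Hardy_def Lp_space_def by blast
  have hol: "holomorphic_several F (tube (octant \<sigma>))" and fin: "Hardy_norm p (octant \<sigma>) F < \<infinity>"
    using F(1) by (auto simp: Hardy_tube_iff)
  have s0: "\<sigma> k \<noteq> 0" for k using sign_mult_self[OF \<sigma>, of k] by auto
  have e4: "ennreal (e/8) > 0" using e by simp
  have "eventually (\<lambda>m. (\<integral>\<^sup>+ x. ennreal (norm (F (cplx x (radius m *\<^sub>R sign_vec \<sigma>)) - f x) powr p) \<partial>lebesgue) < ennreal (e/8)) sequentially"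
    by (rule order_tendstoD(2)[OF Hardy_boundary_convergence(1)[OF \<sigma> F(1) p fm F(2)] e4])
  then obtain m where m: "(\<integral>\<^sup>+ x. ennreal (norm (F (cplx x (radius m *\<^sub>R sign_vec \<sigma>)) - f x) powr p) \<partial>lebesgue) < ennreal (e/8)"
    using eventually_happens'[OF sequentially_bot] by blast
  define \<delta> where "\<delta> = radius m"
  have \<delta>: "\<delta> > 0" by (simp add: \<delta>_def)
  define f1 where "f1 x = F (cplx x (\<delta> *\<^sub>R sign_vec \<sigma>))" for x
  have f1b[measurable]: "f1 \<in> borel_measurable borel"
    unfolding f1_def[abs_def] by (intro F_cplx_measurable[OF hol] sign_vec_in_octant \<sigma> \<delta>)
  have f1fin: "(\<integral>\<^sup>+ x. ennreal (norm (f1 x) powr p) \<partial>lborel) < \<infinity>"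
    unfolding f1_def using fin
    by (rule le_less_trans[rotated]) (unfold Hardy_norm_def, intro SUP_upper sign_vec_in_octant \<sigma> \<delta>)
  define K where "K = enn2real (ennreal ((27 / (\<delta>/3)) ^ CARD('n)) * Hardy_norm p (octant \<sigma>) F) powr (1/p)"
  have K: "norm (F z) \<le> K" if z: "\<And>k. \<sigma> k * Im (z $ k) \<ge> \<delta>" for z
  proof -
    define x y where "x = (\<chi> k. Re (z $ k))" and "y = (\<chi> k. Im (z $ k))"
    have zxy: "z = cplx x y" by (simp add: vec_eq_iff x_def y_def)
    have "ennreal (norm (F (cplx x y)) powr p) \<le> ennreal ((27 / (\<delta>/3)) ^ CARD('n)) * Hardy_norm p (octant \<sigma>) F"
    proof (rule Hardy_pointwise_bound[OF \<sigma> hol p(1)])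
      show "2 * (\<delta> / 3) < \<sigma> k * y $ k" for k using z[of k] \<delta> by (simp add: y_def)
    qed (use \<delta> in simp)
    also have "\<dots> = ennreal (enn2real (ennreal ((27 / (\<delta>/3)) ^ CARD('n)) * Hardy_norm p (octant \<sigma>) F))"
      using fin by (subst ennreal_enn2real) (auto simp: ennreal_mult_less_top)
    finally have "norm (F z) powr p \<le> enn2real (ennreal ((27 / (\<delta>/3)) ^ CARD('n)) * Hardy_norm p (octant \<sigma>) F)"
      unfolding zxy by (subst (asm) ennreal_le_iff) auto
    hence "(norm (F z) powr p) powr (1/p) \<le> K" unfolding K_def using p by (intro powr_mono2) auto
    thus ?thesis using p by (simp add: powr_powr)
  qed
  define d where "d R x = (\<Prod>k\<in>UNIV. (\<i> * of_real (\<sigma> k * R) / (complex_of_real (x $ k) + \<i> * of_real (\<sigma> k * R))) ^ N)" for R and x :: "real^'n"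
  have dm[measurable]: "d R \<in> borel_measurable borel" for R unfolding d_def[abs_def] by measurable
  have d1: "norm (d R x) \<le> 1" for R x
  proof -
    have "norm (\<i> * of_real (\<sigma> k * R) / (complex_of_real (x $ k) + \<i> * of_real (\<sigma> k * R))) \<le> 1" for k
    proof -
      have "norm (\<i> * of_real (\<sigma> k * R)) \<le> norm (complex_of_real (x $ k) + \<i> * of_real (\<sigma> k * R))"
        using abs_Im_le_cmod[of "complex_of_real (x $ k) + \<i> * of_real (\<sigma> k * R)"] by (simp add: norm_mult abs_mult)
      thus ?thesis by (simp add: norm_divide divide_le_eq_1)
    qed
    thus ?thesis unfolding d_def prod_norm[symmetric] norm_power by (intro prod_le_1 conjI power_le_one) auto
  qed
  have dlim: "(\<lambda>i. d (real (Suc i)) x) \<longlonglongrightarrow> 1" for x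
  proof -
    have "(\<lambda>i. (\<i> * of_real (\<sigma> k * real (Suc i)) / (complex_of_real (x $ k) + \<i> * of_real (\<sigma> k * real (Suc i))))) \<longlonglongrightarrow> 1" for k
    proof -
      have eq: "\<i> * of_real (\<sigma> k * real (Suc i)) / (complex_of_real (x $ k) + \<i> * of_real (\<sigma> k * real (Suc i))) =
         \<i> * of_real (\<sigma> k) / (of_real (x $ k * radius i) + \<i> * of_real (\<sigma> k))" for i
      proof -
        have "of_real (x $ k * radius i) + \<i> * of_real (\<sigma> k) =
            (complex_of_real (x $ k) + \<i> * of_real (\<sigma> k * real (Suc i))) / of_real (real (Suc i))"
        proof -
          have "a * inverse n + \<i> * b = (a + \<i> * (b * n)) / n" if "n \<noteq> 0" for a b n :: complex
            using that by (simp add: field_simps)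
          from this[of "of_nat (Suc i)"] show ?thesis unfolding radius_def by (simp del: of_nat_Suc)
        qed
        moreover have "of_real (real (Suc i)) \<noteq> (0::complex)" by (simp del: of_nat_Suc)
        ultimately show ?thesis by (simp add: mult_ac del: of_nat_Suc)
      qed
      have "(\<lambda>i. \<i> * of_real (\<sigma> k) / (of_real (x $ k * radius i) + \<i> * of_real (\<sigma> k))) \<longlonglongrightarrow> \<i> * of_real (\<sigma> k) / (of_real (x $ k * 0) + \<i> * of_real (\<sigma> k))"
        by (intro tendsto_intros radius_tendsto) (use s0 in auto)
      thus ?thesis unfolding eq using s0[of k] by simp
    qed
    hence "(\<lambda>i. d (real (Suc i)) x) \<longlonglongrightarrow> (\<Prod>k\<in>(UNIV::'n set). 1 ^ N)"
      unfolding d_def by (intro tendsto_prod tendsto_power)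
    thus ?thesis by simp
  qed
  \<comment> \<open>The damping factors have modulus at most 1 and tend to 1, so twice |f1|^p
    dominates.\<close>
  have "(\<lambda>i. \<integral>\<^sup>+ x. ennreal (norm (f1 x * d (real (Suc i)) x - f1 x) powr p) \<partial>lborel) \<longlonglongrightarrow> (\<integral>\<^sup>+ x. 0 \<partial>(lborel :: (real^'n) measure))"
  proof (rule nn_integral_dominated_convergence[where w="\<lambda>x. 2 * ennreal (norm (f1 x) powr p)"])
    show "AE x in lborel. ennreal (norm (f1 x * d (real (Suc i)) x - f1 x) powr p) \<le> 2 * ennreal (norm (f1 x) powr p)" for i
    proof (rule AE_I2)
      fix x
      have "norm (f1 x * d (real (Suc i)) x) powr p \<le> norm (f1 x) powr p"
        using d1[of "real (Suc i)" x] p by (intro powr_mono2) (auto simp: norm_mult mult_left_le)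
      hence "norm (f1 x * d (real (Suc i)) x - f1 x) powr p \<le> norm (f1 x) powr p + norm (f1 x) powr p"
        using norm_diff_powr_le[of p "f1 x * d (real (Suc i)) x" "f1 x"] p by simp
      thus "ennreal (norm (f1 x * d (real (Suc i)) x - f1 x) powr p) \<le> 2 * ennreal (norm (f1 x) powr p)"
        unfolding mult_2 ennreal_plus[OF powr_ge_zero powr_ge_zero, symmetric] by (rule ennreal_leI)
    qed
    show "(\<integral>\<^sup>+ x. 2 * ennreal (norm (f1 x) powr p) \<partial>lborel) < \<infinity>"
      using f1fin by (subst nn_integral_cmult) (auto simp: ennreal_mult_less_top)
    show "AE x in lborel. (\<lambda>i. ennreal (norm (f1 x * d (real (Suc i)) x - f1 x) powr p)) \<longlonglongrightarrow> 0"
    proof (rule AE_I2)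
      fix x
      have "(\<lambda>i. f1 x * d (real (Suc i)) x - f1 x) \<longlonglongrightarrow> f1 x * 1 - f1 x" by (intro tendsto_intros dlim)
      hence "(\<lambda>i. norm (f1 x * d (real (Suc i)) x - f1 x)) \<longlonglongrightarrow> 0" by (simp add: tendsto_norm_zero)
      hence "(\<lambda>i. norm (f1 x * d (real (Suc i)) x - f1 x) powr p) \<longlonglongrightarrow> 0 powr p"
        using p by (intro tendsto_powr' tendsto_const) auto
      from tendsto_ennrealI[OF this] show "(\<lambda>i. ennreal (norm (f1 x * d (real (Suc i)) x - f1 x) powr p)) \<longlonglongrightarrow> 0" by simp
    qed
  qed measurable
  hence "(\<lambda>i. \<integral>\<^sup>+ x. ennreal (norm (f1 x * d (real (Suc i)) x - f1 x) powr p) \<partial>lborel) \<longlonglongrightarrow> 0" by simp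
  from order_tendstoD(2)[OF this e4] obtain i where i: "(\<integral>\<^sup>+ x. ennreal (norm (f1 x * d (real (Suc i)) x - f1 x) powr p) \<partial>lborel) < ennreal (e/8)"
    using eventually_happens'[OF sequentially_bot] by blast
  define R where "R = real (Suc i)"
  have R: "R \<ge> 1" by (simp add: R_def)
  define g where "g = polydisc_fun \<sigma> \<delta> R N F"
  define W where "W r x = (\<lambda>k. of_real r * cayley_real (\<sigma> k) (x $ k))" for r and x :: "real^'n"
  define V where "V x = (\<Prod>k\<in>UNIV. 1 / (complex_of_real (x $ k) + \<i> * of_real (\<sigma> k)) ^ N)" for x :: "real^'n"
  have [measurable]: "V \<in> borel_measurable borel" unfolding V_def[abs_def] by measurable
  have Vfin: "(\<integral>\<^sup>+ x. ennreal (norm (V x) powr p) \<partial>lborel) < \<infinity>"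
    unfolding V_def by (rule nn_integral_weight[OF \<sigma> p(1) N])
  define K' where "K' = K * (R ^ N) ^ CARD('n)"
  have gK: "norm (g w) \<le> K'" if "\<And>k. norm (w k) \<le> 1" for w
    unfolding g_def K'_def by (rule polydisc_fun_bound[OF \<sigma> that R K])
  have Wn: "norm (W r x k) \<le> 1" if "0 \<le> r" "r \<le> 1" for r x k using that s0 by (simp add: W_def norm_mult)
  have f2: "f1 x * d R x = g (W 1 x) * V x" for x
    using polydisc_fun_cayley_real[OF \<sigma> R, of \<delta> N F x] by (simp add: g_def W_def V_def f1_def d_def)
  have gm[measurable]: "(\<lambda>x. g (W r x)) \<in> borel_measurable borel" if "0 \<le> r" "r \<le> 1" for r
    unfolding g_def W_def by (rule polydisc_fun_measurable[OF \<sigma> hol \<delta> R that])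
  have rr: "0 \<le> 1 - radius l" "1 - radius l \<le> 1" for l by (auto simp: radius_def inverse_le_1_iff)
  \<comment> \<open>For real x the dilated points tend to a torus point with no coordinate equal to
    1, where \<open>g\<close> is continuous; the bound \<open>K'\<close> and the p-integrable weight
    \<open>V\<close> give the domination.\<close>
  have "(\<lambda>l. \<integral>\<^sup>+ x. ennreal (norm (g (W (1 - radius l) x) * V x - g (W 1 x) * V x) powr p) \<partial>lborel) \<longlonglongrightarrow> (\<integral>\<^sup>+ x. 0 \<partial>(lborel :: (real^'n) measure))"
  proof (rule nn_integral_dominated_convergence[where w="\<lambda>x. ennreal (2 * K' powr p) * ennreal (norm (V x) powr p)"])
    show "(\<lambda>x. ennreal (norm (g (W (1 - radius l) x) * V x - g (W 1 x) * V x) powr p)) \<in> borel_measurable lborel" for l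
      using gm[OF rr, of l] gm[of 1] by measurable
    show "AE x in lborel. ennreal (norm (g (W (1 - radius l) x) * V x - g (W 1 x) * V x) powr p) \<le> ennreal (2 * K' powr p) * ennreal (norm (V x) powr p)" for l
    proof (rule AE_I2)
      fix x
      have "norm (g (W (1 - radius l) x) - g (W 1 x)) powr p \<le> norm (g (W (1 - radius l) x)) powr p + norm (g (W 1 x)) powr p"
        using p by (intro norm_diff_powr_le) auto
      also have "\<dots> \<le> K' powr p + K' powr p"
        using p by (intro add_mono powr_mono2 gK Wn rr) auto
      finally have "norm (g (W (1 - radius l) x) - g (W 1 x)) powr p * norm (V x) powr p \<le> (2 * K' powr p) * norm (V x) powr p"
        by (intro mult_right_mono) auto
      moreover have "norm (g (W (1 - radius l) x) * V x - g (W 1 x) * V x) powr p = norm (g (W (1 - radius l) x) - g (W 1 x)) powr p * norm (V x) powr p"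
        by (simp only: left_diff_distrib[symmetric] norm_mult powr_mult)
      ultimately show "ennreal (norm (g (W (1 - radius l) x) * V x - g (W 1 x) * V x) powr p) \<le> ennreal (2 * K' powr p) * ennreal (norm (V x) powr p)"
        by (subst ennreal_mult[symmetric]) (auto intro: ennreal_leI)
    qed
    show "(\<integral>\<^sup>+ x. ennreal (2 * K' powr p) * ennreal (norm (V x) powr p) \<partial>lborel) < \<infinity>"
      using Vfin by (subst nn_integral_cmult) (auto simp: ennreal_mult_less_top)
    show "AE x in lborel. (\<lambda>l. ennreal (norm (g (W (1 - radius l) x) * V x - g (W 1 x) * V x) powr p)) \<longlonglongrightarrow> 0"
    proof (rule AE_I2)
      fix x
      have "(\<lambda>l. g (W (1 - radius l) x)) \<longlonglongrightarrow> g (W 1 x)"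
        unfolding g_def
      proof (rule tendsto_polydisc_fun[OF \<sigma> hol \<delta> R])
        fix k
        show "norm (W 1 x k) \<le> 1" by (rule Wn) auto
        show "1 - W 1 x k \<noteq> 0" using cayley_real_neq_1[OF s0[of k]] by (simp add: W_def)
        have "(\<lambda>l. of_real (1 - radius l) * cayley_real (\<sigma> k) (x $ k)) \<longlonglongrightarrow> of_real (1 - 0) * cayley_real (\<sigma> k) (x $ k)"
          by (intro tendsto_intros radius_tendsto)
        thus "(\<lambda>l. W (1 - radius l) x k) \<longlonglongrightarrow> W 1 x k" by (simp add: W_def)
      qed
      hence "(\<lambda>l. g (W (1 - radius l) x) * V x - g (W 1 x) * V x) \<longlonglongrightarrow> g (W 1 x) * V x - g (W 1 x) * V x" by (intro tendsto_intros)
      hence "(\<lambda>l. norm (g (W (1 - radius l) x) * V x - g (W 1 x) * V x)) \<longlonglongrightarrow> 0" by (simp add: tendsto_norm_zero)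
      hence "(\<lambda>l. norm (g (W (1 - radius l) x) * V x - g (W 1 x) * V x) powr p) \<longlonglongrightarrow> 0 powr p"
        using p by (intro tendsto_powr' tendsto_const) auto
      from tendsto_ennrealI[OF this] show "(\<lambda>l. ennreal (norm (g (W (1 - radius l) x) * V x - g (W 1 x) * V x) powr p)) \<longlonglongrightarrow> 0" by simp
    qed
  qed measurable
  hence "(\<lambda>l. \<integral>\<^sup>+ x. ennreal (norm (g (W (1 - radius l) x) * V x - g (W 1 x) * V x) powr p) \<partial>lborel) \<longlonglongrightarrow> 0" by simp
  from order_tendstoD(2)[OF this e4] obtain l where l: "(\<integral>\<^sup>+ x. ennreal (norm (g (W (1 - radius l) x) * V x - g (W 1 x) * V x) powr p) \<partial>lborel) < ennreal (e/8)"
    using eventually_happens'[OF sequentially_bot] by blast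
  define r where "r = 1 - radius l"
  have r: "0 \<le> r" "r < 1" "r \<le> 1" using rr[of l] radius_pos[of l] unfolding r_def by linarith+
  define \<rho> where "\<rho> = (1 + r) / 2"
  have \<rho>: "r < \<rho>" "\<rho> < 1" using r by (auto simp: \<rho>_def)
  obtain CV where CV: "(\<integral>\<^sup>+ x. ennreal (norm (V x) powr p) \<partial>lborel) = ennreal CV" "CV \<ge> 0"
    using Vfin by (cases "\<integral>\<^sup>+ x. ennreal (norm (V x) powr p) \<partial>lborel") auto
  \<comment> \<open>Chosen so that \<epsilon>^p times the integral \<open>CV\<close> of |V|^p is at
    most e/16; the added 1 covers CV = 0.\<close>
  define \<epsilon> where "\<epsilon> = (e / (16 * (CV + 1))) powr (1/p)"
  have \<epsilon>: "\<epsilon> > 0" using e CV by (simp add: \<epsilon>_def)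
  have \<epsilon>p: "\<epsilon> powr p = e / (16 * (CV + 1))" using p e CV by (simp add: \<epsilon>_def powr_powr)
  have holg: "(\<lambda>\<zeta>. g (w(k := \<zeta>))) holomorphic_on ball 0 1" if "\<And>i. norm (w i) < 1" for k w
    unfolding g_def by (rule polydisc_fun_holomorphic[OF \<sigma> hol \<delta> R that])
  have bdg: "norm (g w) \<le> K'" if "\<And>i. norm (w i) < 1" for w by (intro gK less_imp_le that)
  obtain M where M: "M > 0" "\<And>w. (\<And>i. norm (w i) \<le> r) \<Longrightarrow> norm (g w - polydisc_interp \<rho> M UNIV g w) < \<epsilon>"
  proof (rule polydisc_interp_approx[OF holg bdg r(1) \<rho> \<epsilon>])
    fix M assume *: "M > 0" "\<And>w. (\<And>i. norm (w i) \<le> r) \<Longrightarrow> norm (g w - polydisc_interp \<rho> M UNIV g w) < \<epsilon>"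
    show thesis by (rule that[OF *])
  qed
  obtain c q where cq: "\<And>j. degree (q j :: complex poly) < M"
    "\<And>x. polydisc_interp \<rho> M UNIV g (\<lambda>k. of_real r * cayley_real (\<sigma> k) (x $ k)) *
      (\<Prod>k\<in>UNIV. 1 / (of_real (x $ k) + \<i> * of_real (\<sigma> k)) ^ N) = cayley_poly \<sigma> N M c q x"
  proof (rule cayley_poly_interp[OF M(1), of \<rho> g r \<sigma> N])
    fix c q assume *: "\<And>j. degree (q j :: complex poly) < M"
      "\<And>x. polydisc_interp \<rho> M UNIV g (\<lambda>k. of_real r * cayley_real (\<sigma> k) (x $ k)) *
      (\<Prod>k\<in>UNIV. 1 / (of_real (x $ k) + \<i> * of_real (\<sigma> k)) ^ N) = cayley_poly \<sigma> N M c q x"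
    show thesis by (rule that[OF *])
  qed
  have cp: "cayley_poly \<sigma> N M c q x = polydisc_interp \<rho> M UNIV g (W r x) * V x" for x
    unfolding cq(2)[symmetric] W_def V_def by simp
  have cpm[measurable]: "cayley_poly \<sigma> N M c q \<in> borel_measurable borel" by (rule cayley_poly_measurable[OF \<sigma>])
  have I4: "(\<integral>\<^sup>+ x. ennreal (norm (cayley_poly \<sigma> N M c q x - g (W r x) * V x) powr p) \<partial>lborel) < ennreal (e/8)"
  proof -
    have "(\<integral>\<^sup>+ x. ennreal (norm (cayley_poly \<sigma> N M c q x - g (W r x) * V x) powr p) \<partial>lborel) \<le> (\<integral>\<^sup>+ x. ennreal (\<epsilon> powr p) * ennreal (norm (V x) powr p) \<partial>lborel)"
    proof (rule nn_integral_mono)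
      fix x
      have "norm (W r x i) \<le> r" for i using r s0 by (simp add: W_def norm_mult)
      from less_imp_le[OF M(2)[OF this]] have "norm (polydisc_interp \<rho> M UNIV g (W r x) - g (W r x)) powr p \<le> \<epsilon> powr p"
        using p by (intro powr_mono2) (auto simp: norm_minus_commute)
      hence "norm (polydisc_interp \<rho> M UNIV g (W r x) - g (W r x)) powr p * norm (V x) powr p \<le> \<epsilon> powr p * norm (V x) powr p"
        by (intro mult_right_mono) auto
      thus "ennreal (norm (cayley_poly \<sigma> N M c q x - g (W r x) * V x) powr p) \<le> ennreal (\<epsilon> powr p) * ennreal (norm (V x) powr p)"
        unfolding cp left_diff_distrib[symmetric] norm_mult powr_mult
        by (subst ennreal_mult[symmetric]) (auto intro: ennreal_leI)
    qed
    also have "\<dots> = ennreal (\<epsilon> powr p) * ennreal CV" by (subst nn_integral_cmult) (auto simp: CV)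
    also have "\<dots> = ennreal (e / (16 * (CV + 1)) * CV)" unfolding \<epsilon>p using CV e by (subst ennreal_mult[symmetric]) auto
    also have "\<dots> < ennreal (e/8)"
    proof (rule ennreal_lessI)
      have "e / (16 * (CV + 1)) * CV \<le> e / (16 * (CV + 1)) * (CV + 1)" using e CV by (intro mult_left_mono) auto
      also have "\<dots> = e / 16" using CV by (simp add: divide_simps)
      also have "\<dots> < e / 8" using e by simp
      finally show "e / (16 * (CV + 1)) * CV < e / 8" .
    qed (use e in simp)
    finally show ?thesis .
  qed
  have leb: "(\<integral>\<^sup>+ x. h x \<partial>lebesgue) = (\<integral>\<^sup>+ x. h x \<partial>lborel)" for h :: "real^'n \<Rightarrow> ennreal" by (simp add: nn_integral_completion)
  let ?a = "cayley_poly \<sigma> N M c q" and ?b = "\<lambda>x. g (W r x) * V x" and ?c = "\<lambda>x. g (W 1 x) * V x"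
  have ms: "?a \<in> borel_measurable lebesgue" "?b \<in> borel_measurable lebesgue" "?c \<in> borel_measurable lebesgue" "f1 \<in> borel_measurable lebesgue"
    using gm[OF r(1,3)] gm[of 1] by (auto intro!: borel_measurable_lebesgueI)
  have p1: "p \<le> 1" using p by simp
  have "(\<integral>\<^sup>+ x. ennreal (norm (?a x - f x) powr p) \<partial>lebesgue) \<le> (\<integral>\<^sup>+ x. ennreal (norm (?a x - ?b x) powr p) \<partial>lebesgue) + (\<integral>\<^sup>+ x. ennreal (norm (?b x - f x) powr p) \<partial>lebesgue)"
    by (rule Lp_dist_triangle[OF p(1) p1 ms(1,2) fm])
  also have "\<dots> \<le> (\<integral>\<^sup>+ x. ennreal (norm (?a x - ?b x) powr p) \<partial>lebesgue) + ((\<integral>\<^sup>+ x. ennreal (norm (?b x - ?c x) powr p) \<partial>lebesgue) + (\<integral>\<^sup>+ x. ennreal (norm (?c x - f x) powr p) \<partial>lebesgue))"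
    by (intro add_left_mono Lp_dist_triangle[OF p(1) p1 ms(2,3) fm])
  also have "\<dots> \<le> (\<integral>\<^sup>+ x. ennreal (norm (?a x - ?b x) powr p) \<partial>lebesgue) + ((\<integral>\<^sup>+ x. ennreal (norm (?b x - ?c x) powr p) \<partial>lebesgue) +
      ((\<integral>\<^sup>+ x. ennreal (norm (?c x - f1 x) powr p) \<partial>lebesgue) + (\<integral>\<^sup>+ x. ennreal (norm (f1 x - f x) powr p) \<partial>lebesgue)))"
    by (intro add_left_mono Lp_dist_triangle[OF p(1) p1 ms(3,4) fm])
  also have "\<dots> \<le> ennreal (e/8) + (ennreal (e/8) + (ennreal (e/8) + ennreal (e/8)))"
  proof (intro add_mono less_imp_le)
    show "(\<integral>\<^sup>+ x. ennreal (norm (?a x - ?b x) powr p) \<partial>lebesgue) < ennreal (e/8)" unfolding leb by (rule I4)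
    show "(\<integral>\<^sup>+ x. ennreal (norm (?b x - ?c x) powr p) \<partial>lebesgue) < ennreal (e/8)" unfolding leb r_def by (rule l)
    show "(\<integral>\<^sup>+ x. ennreal (norm (?c x - f1 x) powr p) \<partial>lebesgue) < ennreal (e/8)" unfolding leb f2[symmetric] R_def by (rule i)
    show "(\<integral>\<^sup>+ x. ennreal (norm (f1 x - f x) powr p) \<partial>lebesgue) < ennreal (e/8)" unfolding f1_def \<delta>_def by (rule m)
  qed
  also have "\<dots> = ennreal (e/8 + (e/8 + (e/8 + e/8)))"
    using e by (simp only: ennreal_plus add_nonneg_nonneg divide_nonneg_pos less_imp_le zero_less_numeral)
  also have "\<dots> < ennreal e" using e by (intro ennreal_lessI) auto
  finally have "(\<integral>\<^sup>+ x. ennreal (norm (?a x - f x) powr p) \<partial>lebesgue) < ennreal e" .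
  with M(1) cq(1) show ?thesis by (rule that)
qed

section \<open>Unimodular weights\<close>

text \<open>The modulus is 2 |sin (pi t)|. For |t| \<le> 1/3 the mean value theorem with cos \<ge>
  1/2 gives the bound; beyond that |sin (pi t)| \<ge> 1/2 does.\<close>

lemma norm_one_minus_cis_ge:
  assumes "\<bar>t\<bar> \<le> 1/2" shows "norm (1 - cis (2 * pi * t)) \<ge> \<bar>t\<bar>"
proof -
  have n2: "(norm (1 - cis (2 * pi * t)))\<^sup>2 = 2 - 2 * cos (2 * pi * t)"
    unfolding cmod_power2 by (simp add: power2_eq_square algebra_simps sin_cos_squared_add3)
  have "cos (2 * pi * t) = 1 - 2 * (sin (pi * t))\<^sup>2"
    using cos_double_sin[of "pi * t"] by (simp add: mult_ac)
  hence "(norm (1 - cis (2 * pi * t)))\<^sup>2 = (2 * sin (pi * t))\<^sup>2"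
    using n2 by (simp add: power2_eq_square)
  hence "(norm (1 - cis (2 * pi * t)))\<^sup>2 = (2 * \<bar>sin (pi * t)\<bar>)\<^sup>2" by (simp add: power_mult_distrib)
  hence n: "norm (1 - cis (2 * pi * t)) = 2 * \<bar>sin (pi * t)\<bar>" by (rule power2_eq_imp_eq) auto
  have main: "2 * sin (pi * u) \<ge> u" if u: "0 \<le> u" "u \<le> 1/2" for u
  proof (cases "u \<le> 1/3")
    case True
    show ?thesis
    proof (cases "u = 0")
      case False
      hence pu: "0 < pi * u" using u by simp
      obtain z where z: "0 < z" "z < pi * u" "sin (pi * u) - sin 0 = (pi * u - 0) * cos z"
        using MVT2[OF pu, of sin cos] by (auto intro: DERIV_sin)
      have "pi * u \<le> pi * (1/3)" using True by (intro mult_left_mono) auto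
      hence "z \<le> pi / 3" using z by linarith
      hence "cos z \<ge> cos (pi / 3)" using z by (intro cos_monotone_0_pi_le) auto
      hence c: "cos z \<ge> 1/2" by (simp add: cos_60)
      have "pi * u * (1/2) \<le> pi * u * cos z" using pu c by (intro mult_left_mono) auto
      hence "2 * (pi * u * (1/2)) \<le> 2 * sin (pi * u)" using z(3) by simp
      moreover have "u \<le> pi * u" using u pi_ge_two by (simp add: mult_le_cancel_right1)
      ultimately show ?thesis by linarith
    qed simp
  next
    case False
    have "sin (pi / 6) \<le> sin (pi * u)"
    proof (rule sin_monotone_2pi_le)
      have "pi * (1/3) \<le> pi * u" using False by (intro mult_left_mono) auto
      thus "pi / 6 \<le> pi * u" using pi_gt_zero by linarith
      have "pi * u \<le> pi * (1/2)" using u by (intro mult_left_mono) auto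
      thus "pi * u \<le> pi / 2" by simp
    qed (use pi_gt_zero in linarith)
    hence "1/2 \<le> sin (pi * u)" by (simp add: sin_30)
    thus ?thesis using u by linarith
  qed
  show ?thesis
  proof (cases "t \<ge> 0")
    case True
    thus ?thesis using main[of t] assms unfolding n by (simp add: abs_if)
  next
    case False
    thus ?thesis using main[of "-t"] assms unfolding n by (simp add: abs_if)
  qed
qed

text \<open>Multiplication by \<open>b\<close> only rotates the circle, hence the uniformity. The
  zeros are \<theta>0 modulo 1 with |\<theta>0| \<le> 1/2, so from any point of [0, 1] one of
  \<theta>0 and \<theta>0 + 1 is within 1/2; each contributes at most \<open>C1\<close>.\<close>

lemma circle_singular_integral:
  assumes p: "0 < p" "p < 1"
  obtains C where "C < \<infinity>" "\<And>b::complex. norm b = 1 \<Longrightarrow>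
    (\<integral>\<^sup>+ \<theta>. indicator {0..1::real} \<theta> * ennreal (norm (1 + cis (2 * pi * \<theta>) * b) powr (-p)) \<partial>lborel) \<le> C"
proof -
  define C1 where "C1 = (\<integral>\<^sup>+ x. indicator {x. \<bar>x - 0\<bar> < 1} x * ennreal (\<bar>x - 0\<bar> powr (-p)) \<partial>lborel)"
  have C1: "C1 < \<infinity>" unfolding C1_def by (rule nn_integral_powr_origin[OF p(2)])
  have sing: "(\<integral>\<^sup>+ x. indicator {x. \<bar>x - a\<bar> < 1} x * ennreal (\<bar>x - a\<bar> powr (-p)) \<partial>lborel) = C1" for a
  proof -
    let ?f = "\<lambda>x::real. indicator {x. \<bar>x\<bar> < 1} x * ennreal (\<bar>x\<bar> powr (-p))"
    have "(\<integral>\<^sup>+ x. indicator {x. \<bar>x - a\<bar> < 1} x * ennreal (\<bar>x - a\<bar> powr (-p)) \<partial>lborel) = (\<integral>\<^sup>+ x. ?f (x + (-a)) \<partial>lborel)"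
      by (intro nn_integral_cong) (auto simp: indicator_def)
    also have "\<dots> = (\<integral>\<^sup>+ x. ?f x \<partial>lborel)" by (rule nn_integral_lborel_translate) measurable
    finally show ?thesis by (simp add: C1_def)
  qed
  show ?thesis
  proof (rule that)
    show "C1 + C1 < \<infinity>" using C1 by simp
    fix b :: complex assume b: "norm b = 1"
    define \<theta>0 where "\<theta>0 = - Arg (- b) / (2 * pi)"
    have Ab: "- b = cis (Arg (- b))" 
    proof -
      have "- b \<noteq> 0" using b by auto
      hence "cis (Arg (- b)) = sgn (- b)" by (rule cis_Arg)
      thus ?thesis using b by (simp add: sgn_div_norm)
    qed
    have b_eq: "b = - cis (2 * pi * (- \<theta>0))"
    proof -
      have "2 * pi * (- \<theta>0) = Arg (- b)" by (simp add: \<theta>0_def)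
      thus ?thesis using Ab by (metis minus_minus)
    qed
    have \<theta>0: "\<bar>\<theta>0\<bar> \<le> 1/2"
    proof -
      have "\<bar>Arg (- b)\<bar> \<le> pi" using Arg_bounded[of "- b"] by (simp add: abs_le_iff)
      thus ?thesis by (simp add: \<theta>0_def abs_mult field_simps)
    qed
    have eq: "1 + cis (2 * pi * \<theta>) * b = 1 - cis (2 * pi * (\<theta> - \<theta>0))" for \<theta>
      by (subst b_eq) (simp add: cis_mult algebra_simps)
    have per: "cis (2 * pi * (t + 1)) = cis (2 * pi * t)" "cis (2 * pi * (t - 1)) = cis (2 * pi * t)" for t
      by (simp_all add: complex_eq_iff distrib_left right_diff_distrib cos_diff sin_diff)
    have "(\<integral>\<^sup>+ \<theta>. indicator {0..1::real} \<theta> * ennreal (norm (1 + cis (2 * pi * \<theta>) * b) powr (-p)) \<partial>lborel) \<le>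
      (\<integral>\<^sup>+ x. indicator {x. \<bar>x - \<theta>0\<bar> < 1} x * ennreal (\<bar>x - \<theta>0\<bar> powr (-p)) +
         indicator {x. \<bar>x - (\<theta>0 + 1)\<bar> < 1} x * ennreal (\<bar>x - (\<theta>0 + 1)\<bar> powr (-p)) \<partial>lborel)"
    proof (rule nn_integral_mono)
      fix x :: real
      have le: "ennreal (norm (1 + cis (2 * pi * x) * b) powr (-p)) \<le> indicator {x. \<bar>x - a\<bar> < 1} x * ennreal (\<bar>x - a\<bar> powr (-p))"
        if a: "cis (2 * pi * (x - a)) = cis (2 * pi * (x - \<theta>0))" "\<bar>x - a\<bar> \<le> 1/2" for a
      \<comment> \<open>At the zero itself the left side is 0, because \<open>0 powr (-p)\<close> is
        0 by convention.\<close>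
      proof (cases "x = a")
        case True
        hence "1 + cis (2 * pi * x) * b = 0" unfolding eq a(1)[symmetric] by simp
        thus ?thesis by simp
      next
        case False
        have "\<bar>x - a\<bar> \<le> norm (1 - cis (2 * pi * (x - a)))" by (rule norm_one_minus_cis_ge[OF a(2)])
        hence "norm (1 + cis (2 * pi * x) * b) powr (-p) \<le> \<bar>x - a\<bar> powr (-p)"
          unfolding eq a(1)[symmetric] using False p by (intro powr_mono2') auto
        thus ?thesis using a(2) by (simp add: indicator_def ennreal_leI)
      qed
      let ?A = "\<lambda>a. indicator {x. \<bar>x - a\<bar> < 1} x * ennreal (\<bar>x - a\<bar> powr (-p))"
      show "indicator {0..1} x * ennreal (norm (1 + cis (2 * pi * x) * b) powr (-p)) \<le> ?A \<theta>0 + ?A (\<theta>0 + 1)"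
      proof (cases "x \<in> {0..1}")
        case True
        have "\<bar>x - \<theta>0\<bar> \<le> 1/2 \<or> \<bar>x - (\<theta>0 + 1)\<bar> \<le> 1/2"
          using \<theta>0 True unfolding atLeastAtMost_iff by linarith
        then consider "\<bar>x - \<theta>0\<bar> \<le> 1/2" | "\<bar>x - (\<theta>0 + 1)\<bar> \<le> 1/2" by blast
        thus ?thesis
        proof cases
          case 1
          from le[of \<theta>0] 1 show ?thesis using True by (simp add: add_increasing2)
        next
          case 2
          have "cis (2 * pi * (x - (\<theta>0 + 1))) = cis (2 * pi * (x - \<theta>0))" using per(2)[of "x - \<theta>0"] by (simp add: algebra_simps)
          from le[OF this 2] show ?thesis using True by (simp add: add_increasing)
        qed
      qed simp
    qed
    also have "\<dots> = C1 + C1"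
      by (subst nn_integral_add) (measurable, simp only: sing)
    finally show "(\<integral>\<^sup>+ \<theta>. indicator {0..1::real} \<theta> * ennreal (norm (1 + cis (2 * pi * \<theta>) * b) powr (-p)) \<partial>lborel) \<le> C1 + C1" .
  qed
qed

text \<open>Averaging over the circle replaces an equidistribution argument: for a suitable unimodular
  \<open>\<lambda>\<close> the weight \<open>1 / (1 + \<lambda> B)\<close> with \<open>B\<close> unimodular costs only a constant factor.\<close>

lemma exists_unimodular_weight:
  assumes p: "0 < p" "p < 1" and C: "C < \<infinity>" "\<And>b::complex. norm b = 1 \<Longrightarrow>
    (\<integral>\<^sup>+ \<theta>. indicator {0..1::real} \<theta> * ennreal (norm (1 + cis (2 * pi * \<theta>) * b) powr (-p)) \<partial>lborel) \<le> C"
    and G[measurable]: "G \<in> borel_measurable borel" and B[measurable]: "B \<in> borel_measurable borel"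
    and B1: "\<And>x. norm (B x :: complex) = 1" and fin: "(\<integral>\<^sup>+ x. G x \<partial>(lborel :: 'a::euclidean_space measure)) < \<infinity>"
  obtains l where "norm l = 1" "l \<noteq> -1"
    "(\<integral>\<^sup>+ x. G x * ennreal (norm (1 + l * B x) powr (-p)) \<partial>lborel) \<le> (C + 1) * (\<integral>\<^sup>+ x. G x \<partial>lborel)"
proof (cases "(\<integral>\<^sup>+ x. G x \<partial>lborel) = 0")
  case True
  hence "AE x in lborel. G x = 0" by (simp add: nn_integral_0_iff_AE)
  hence "(\<integral>\<^sup>+ x. G x * ennreal (norm (1 + 1 * B x) powr (-p)) \<partial>lborel) = 0"
    by (subst nn_integral_0_iff_AE) (measurable, auto)
  thus ?thesis by (intro that[of 1]) auto
next
  case False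
  define I where "I \<theta> = (\<integral>\<^sup>+ x. G x * ennreal (norm (1 + cis (2 * pi * \<theta>) * B x) powr (-p)) \<partial>lborel)" for \<theta>
  let ?g = "\<integral>\<^sup>+ x. G x \<partial>lborel"
  have cism[measurable]: "cis \<in> borel_measurable borel"
    by (intro borel_measurable_continuous_onI) (simp add: cis_conv_exp continuous_intros)
  have [measurable]: "I \<in> borel_measurable borel" unfolding I_def[abs_def] by measurable
  have "(\<integral>\<^sup>+ \<theta>. indicator {0..1} \<theta> * I \<theta> \<partial>lborel) =
     (\<integral>\<^sup>+ \<theta>. \<integral>\<^sup>+ x. indicator {0..1} \<theta> * (G x * ennreal (norm (1 + cis (2 * pi * \<theta>) * B x) powr (-p))) \<partial>lborel \<partial>lborel)"
    unfolding I_def by (subst nn_integral_cmult) auto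
  also have "\<dots> = (\<integral>\<^sup>+ x. \<integral>\<^sup>+ \<theta>. indicator {0..1} \<theta> * (G x * ennreal (norm (1 + cis (2 * pi * \<theta>) * B x) powr (-p))) \<partial>lborel \<partial>lborel)"
    by (rule lborel_pair.Fubini') measurable
  also have "\<dots> = (\<integral>\<^sup>+ x. \<integral>\<^sup>+ \<theta>. G x * (indicator {0..1} \<theta> * ennreal (norm (1 + cis (2 * pi * \<theta>) * B x) powr (-p))) \<partial>lborel \<partial>lborel)"
    by (simp only: mult.left_commute)
  also have "\<dots> = (\<integral>\<^sup>+ x. G x * (\<integral>\<^sup>+ \<theta>. indicator {0..1} \<theta> * ennreal (norm (1 + cis (2 * pi * \<theta>) * B x) powr (-p)) \<partial>lborel) \<partial>lborel)"
    by (intro nn_integral_cong nn_integral_cmult) measurable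
  also have "\<dots> \<le> (\<integral>\<^sup>+ x. G x * C \<partial>lborel)" by (intro nn_integral_mono mult_left_mono C(2) B1) auto
  also have "\<dots> = C * ?g" by (subst nn_integral_multc) (auto simp: mult.commute)
  finally have le: "(\<integral>\<^sup>+ \<theta>. indicator {0..1} \<theta> * I \<theta> \<partial>lborel) \<le> C * ?g" .
  \<comment> \<open>If every \<theta> failed, integrating would give (C + 1) I \<le> C I with I the
    integral of \<open>G\<close>, positive and finite. The null set {1/2} is excluded because it is
    \<lambda> = -1, where the leading coefficient 1 + \<lambda> of the denominator vanishes.\<close>
  have "\<exists>\<theta>. \<theta> \<in> {0..1} - {1/2} \<and> I \<theta> \<le> (C + 1) * ?g"
  proof (rule ccontr)
    assume *: "\<nexists>\<theta>. \<theta> \<in> {0..1} - {1/2} \<and> I \<theta> \<le> (C + 1) * ?g"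
    have "(C + 1) * ?g = (\<integral>\<^sup>+ \<theta>. indicator {0..1::real} \<theta> * ((C + 1) * ?g) \<partial>lborel)"
      by (subst nn_integral_multc) auto
    also have "\<dots> \<le> (\<integral>\<^sup>+ \<theta>. indicator {0..1} \<theta> * I \<theta> \<partial>lborel)"
    proof (rule nn_integral_mono_AE)
      have "AE \<theta> in lborel. \<theta> \<noteq> (1/2::real)" by (rule AE_lborel_singleton)
      thus "AE \<theta> in lborel. indicator {0..1} \<theta> * ((C + 1) * ?g) \<le> indicator {0..1} \<theta> * I \<theta>"
      proof eventually_elim
        case (elim \<theta>)
        show ?case
        proof (cases "\<theta> \<in> {0..1}")
          case True
          hence "\<not> I \<theta> \<le> (C + 1) * ?g" using * elim by blast
          thus ?thesis by (intro mult_left_mono) auto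
        qed simp
      qed
    qed
    finally have "(C + 1) * ?g \<le> C * ?g" using le by (rule order_trans)
    moreover obtain rg where rg: "?g = ennreal rg" "rg > 0" using fin False by (cases ?g) (auto simp: less_le)
    moreover obtain rC where rC: "C = ennreal rC" "rC \<ge> 0" using C(1) by (cases C) auto
    ultimately have "ennreal ((rC + 1) * rg) \<le> ennreal (rC * rg)"
      by (simp add: ennreal_mult ennreal_plus)
    thus False using rg rC by (simp add: ennreal_le_iff algebra_simps)
  qed
  then obtain \<theta> where \<theta>: "\<theta> \<in> {0..1}" "\<theta> \<noteq> 1/2" "I \<theta> \<le> (C + 1) * ?g" by blast
  have "cis (2 * pi * \<theta>) \<noteq> -1"
  proof
    assume "cis (2 * pi * \<theta>) = -1"
    hence "cos (2 * pi * \<theta>) = -1" by (metis cis.sel(1) one_complex.simps(1) uminus_complex.simps(1))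
    hence "cos (2 * pi * \<theta>) = cos pi" by simp
    hence c: "cos (2 * pi * \<theta> - pi) = 1" by (simp add: cos_diff)
    have bd: "\<bar>2 * pi * \<theta> - pi\<bar> \<le> pi"
    proof -
      have "2 * pi * \<theta> \<le> 2 * pi * 1" using \<theta>(1) by (intro mult_left_mono) auto
      moreover have "0 \<le> 2 * pi * \<theta>" using \<theta>(1) by simp
      ultimately show ?thesis by (simp add: abs_le_iff)
    qed
    have "\<bar>2 * pi * \<theta> - pi\<bar> = 0"
    proof (rule cos_inj_pi)
      show "cos \<bar>2 * pi * \<theta> - pi\<bar> = cos 0" using c by (simp only: cos_abs_real cos_zero)
    qed (use bd in auto)
    hence "2 * pi * \<theta> = pi" by simp
    thus False using \<theta>(2) by (simp add: field_simps)
  qed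
  thus ?thesis using \<theta>(3) by (intro that[of "cis (2 * pi * \<theta>)"]) (auto simp: I_def)
qed

section \<open>Gluing the octants\<close>

lemma cayley_real_surj_circle:
  assumes "norm w = 1" "w \<noteq> 1"
  obtains a where "cayley_real 1 a = w"
proof -
  have n: "1 - w \<noteq> 0" using assms by simp
  define a where "a = Re (cayley_inv 1 w)"
  have z: "of_real a = cayley_inv 1 w"
    using Im_cayley_inv[of 1 w] assms by (simp add: complex_eq_iff a_def)
  have 1: "cayley_inv 1 w - \<i> = 2 * \<i> * w / (1 - w)" and 2: "cayley_inv 1 w + \<i> = 2 * \<i> / (1 - w)"
    unfolding cayley_inv_def using n by (simp_all add: divide_simps algebra_simps)
  have "cayley_real 1 a = (2 * \<i> * w / (1 - w)) / (2 * \<i> / (1 - w))"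
    unfolding cayley_real_def z by (simp only: of_real_1 mult_1_right 1 2)
  also have "\<dots> = w" using n by simp
  finally show ?thesis by (rule that)
qed

text \<open>The zeros of \<open>(x + i)\<^sup>m + \<lambda> (x - i)\<^sup>m\<close> are the preimages under the Cayley transform of the
  \<open>m\<close>-th roots of \<open>-1/\<lambda>\<close>: they lie on the unit circle and avoid \<open>1\<close>, hence are real and finite.\<close>

lemma cayley_denominator_factorization:
  fixes l :: complex
  assumes l: "norm l = 1" "l \<noteq> -1" and m: "m > 0"
  obtains a :: "nat \<Rightarrow> real" where "inj_on a {1..m}"
    "\<And>x. (of_real x + \<i>) ^ m + l * (of_real x - \<i>) ^ m = (1 + l) * (\<Prod>j\<in>{1..m}. of_real (x - a j))"
proof -
  define R where "R = {w::complex. w ^ m = - 1 / l}"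
  have l0: "l \<noteq> 0" using l(1) by auto
  have c0: "- 1 / l \<noteq> 0" using l0 by simp
  have cR: "card R = m" unfolding R_def by (rule Complex.card_nth_roots[OF c0 m])
  have fR: "finite R" unfolding R_def by (rule Complex.finite_nth_roots[OF m])
  have "\<exists>a. cayley_real 1 a = w" if w: "w \<in> R" for w
  proof -
    have "norm w ^ m = norm (- 1 / l)" using w by (simp add: R_def norm_power[symmetric])
    hence "norm w ^ m = 1 ^ m" using l by (simp add: norm_divide)
    hence n1: "norm w = 1" using m by (intro power_eq_imp_eq_base[of "norm w" m 1]) auto
    have "w \<noteq> 1"
    proof
      assume "w = 1"
      hence "1 = - 1 / l" using w by (simp add: R_def)
      hence "l = -1" using l0 by (simp add: field_simps)
      thus False using l by simp
    qed
    from cayley_real_surj_circle[OF n1 this] show ?thesis by blast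
  qed
  hence "\<forall>w\<in>R. \<exists>a. cayley_real 1 a = w" by blast
  from bchoice[OF this] obtain g where g: "\<forall>w\<in>R. cayley_real 1 (g w) = w" by blast
  from ex_bij_betw_nat_finite_1[OF fR] obtain h where h: "bij_betw h {1..m} R" unfolding cR by blast
  define a where "a j = g (h j)" for j
  have hR: "h j \<in> R" if "j \<in> {1..m}" for j using h that by (auto simp: bij_betw_def)
  have ca: "cayley_real 1 (a j) = h j" if "j \<in> {1..m}" for j using g hR[OF that] by (simp add: a_def)
  have inj: "inj_on a {1..m}"
  proof (rule inj_onI)
    fix i j assume ij: "i \<in> {1..m}" "j \<in> {1..m}" "a i = a j"
    hence "h i = h j" using ca[OF ij(1)] ca[OF ij(2)] by simp
    thus "i = j" using h ij(1,2) by (auto simp: bij_betw_def dest: inj_onD)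
  qed
  \<comment> \<open>\<open>D\<close> and (1 + l) T have degree at most m, the same coefficient at m,
    and both vanish at the m points a j; hence they are equal.\<close>
  define D :: "complex poly" where "D = [:\<i>, 1:] ^ m + smult l ([:-\<i>, 1:] ^ m)"
  define T :: "complex poly" where "T = (\<Prod>j\<in>{1..m}. [:- of_real (a j), 1:])"
  have dT: "degree T = m" unfolding T_def by (subst degree_prod_sum_eq) auto
  have "lead_coeff T = 1" unfolding T_def by (subst lead_coeff_prod) simp
  hence cT: "poly.coeff T m = 1" unfolding dT .
  have cD: "poly.coeff D m = poly.coeff (smult (1 + l) T) m"
  proof -
    have "poly.coeff D m = poly.coeff ([:\<i>, 1:] ^ m) m + l * poly.coeff ([:-\<i>, 1:] ^ m) m"
      by (simp only: D_def coeff_add coeff_smult)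
    also have "\<dots> = 1 + l * 1" by (simp only: coeff_linear_power)
    finally show ?thesis by (simp only: coeff_smult cT mult_1_right)
  qed
  have "inj_on (\<lambda>j. complex_of_real (a j)) {1..m}"
    using inj unfolding inj_on_def of_real_eq_iff .
  from card_image[OF this] have cA: "m \<le> card ((\<lambda>j. complex_of_real (a j)) ` {1..m})" by simp
  have dD: "degree D \<le> m" unfolding D_def
    by (intro degree_add_le order_trans[OF degree_smult_le]) (simp_all add: degree_linear_power)
  have dT': "degree (smult (1 + l) T) \<le> m" using degree_smult_le[of "1 + l" T] unfolding dT .
  have roots: "poly D z = poly (smult (1 + l) T) z" if "z \<in> (\<lambda>j. complex_of_real (a j)) ` {1..m}" for z
  proof -
    from that obtain j where j: "j \<in> {1..m}" "z = of_real (a j)" by blast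
    have nz: "z + \<i> \<noteq> 0" using real_plus_i_sign_nonzero[of 1 "a j"] j by simp
    have "(z - \<i>) / (z + \<i>) = h j" using ca[OF j(1)] unfolding cayley_real_def j(2) by simp
    hence "z - \<i> = h j * (z + \<i>)" using nz by (simp add: nonzero_divide_eq_eq)
    hence "(z - \<i>) ^ m = h j ^ m * (z + \<i>) ^ m" by (simp only: power_mult_distrib)
    also have "h j ^ m = - 1 / l" using hR[OF j(1)] unfolding R_def by simp
    finally have "(z + \<i>) ^ m + l * (z - \<i>) ^ m = 0" using l0 by simp
    moreover have "poly D z = (z + \<i>) ^ m + l * (z - \<i>) ^ m" unfolding D_def by (simp add: add.commute)
    moreover have "poly T z = 0" unfolding T_def poly_prod using j by (intro prod_zero) auto
    ultimately show ?thesis by simp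
  qed
  have "D = smult (1 + l) T" by (rule poly_eqI_degree_lead_coeff[OF cD cA dD dT' roots])
  hence "poly D (of_real x) = poly (smult (1 + l) T) (of_real x)" for x :: real by simp
  hence "(of_real x + \<i>) ^ m + l * (of_real x - \<i>) ^ m = (1 + l) * (\<Prod>j\<in>{1..m}. of_real (x - a j))" for x :: real
    by (simp add: D_def T_def poly_prod add.commute)
  from that[OF inj this] show thesis .
qed

text \<open>With u = x - i s and d = x + i s a monomial of degree t becomes u^t d^(m - N - t). As t
  < M and N + M \<le> m, the subtractions do not truncate.\<close>

lemma cayley_term_polynomial:
  assumes s: "s \<noteq> 0" and q: "degree q < M" and N: "N + M \<le> m"
  obtains Q :: "complex poly" where "degree Q \<le> m - N"
    "\<And>x. poly q (cayley_real s x) / (of_real x + \<i> * of_real s) ^ N * (of_real x + \<i> * of_real s) ^ m = poly Q (of_real x)"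
proof -
  define Q where "Q = (\<Sum>t\<le>degree q. smult (poly.coeff q t) ([:-\<i> * of_real s, 1:] ^ t * [:\<i> * of_real s, 1:] ^ (m - N - t)))"
  have "degree Q \<le> m - N" unfolding Q_def
  proof (rule degree_sum_le)
    fix t assume t: "t \<in> {..degree q}"
    have "degree ([:-\<i> * of_real s, 1:] ^ t * [:\<i> * of_real s, 1:] ^ (m - N - t)) \<le> t + (m - N - t)"
      by (rule order_trans[OF degree_mult_le]) (simp add: degree_linear_power)
    also have "\<dots> = m - N" using t q N by simp
    finally show "degree (smult (poly.coeff q t) ([:-\<i> * of_real s, 1:] ^ t * [:\<i> * of_real s, 1:] ^ (m - N - t))) \<le> m - N"
      by (rule order_trans[OF degree_smult_le])
  qed simp
  moreover have "poly q (cayley_real s x) / (of_real x + \<i> * of_real s) ^ N * (of_real x + \<i> * of_real s) ^ m = poly Q (of_real x)" for x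
  proof -
    define d u where "d = complex_of_real x + \<i> * of_real s" and "u = complex_of_real x - \<i> * of_real s"
    have d: "d \<noteq> 0" unfolding d_def by (rule real_plus_i_sign_nonzero[OF s])
    have T: "(u / d) ^ t / d ^ N * d ^ m = u ^ t * d ^ (m - N - t)" if "t \<le> degree q" for t
    proof -
      have "m = t + (N + (m - N - t))" using that q N by simp
      hence "d ^ m = d ^ (t + (N + (m - N - t)))" by (rule arg_cong)
      hence "d ^ m = d ^ t * (d ^ N * d ^ (m - N - t))" by (simp only: power_add)
      thus ?thesis using d by (simp add: power_divide)
    qed
    have "poly q (u / d) / d ^ N * d ^ m = (\<Sum>t\<le>degree q. poly.coeff q t * (u ^ t * d ^ (m - N - t)))"
      unfolding poly_altdef sum_divide_distrib sum_distrib_right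
    proof (intro sum.cong refl)
      fix t assume "t \<in> {..degree q}"
      hence "poly.coeff q t * ((u / d) ^ t / d ^ N * d ^ m) = poly.coeff q t * (u ^ t * d ^ (m - N - t))" by (subst T) auto
      thus "poly.coeff q t * (u / d) ^ t / d ^ N * d ^ m = poly.coeff q t * (u ^ t * d ^ (m - N - t))"
        by (simp only: mult.assoc[symmetric] times_divide_eq_right)
    qed
    also have "\<dots> = poly Q (of_real x)"
      unfolding Q_def poly_sum by (intro sum.cong refl) (simp add: u_def d_def add.commute)
    finally show ?thesis unfolding u_def d_def cayley_real_def .
  qed
  ultimately show thesis by (rule that)
qed

text \<open>One common degree bound in each variable separately, matching the choice of a constant
  \<open>l\<close> in \<open>rational_class\<close>.\<close>

definition box_polynomials :: "nat \<Rightarrow> (real^'n \<Rightarrow> complex) set" where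
  "box_polynomials L = {f. \<exists>c. \<forall>x. f x = (\<Sum>s\<in>{s. \<forall>k. s k \<le> L}. c s * (\<Prod>k\<in>UNIV. complex_of_real (x $ k) ^ s k))}"

lemma box_polynomials_scale:
  assumes "f \<in> box_polynomials L" shows "(\<lambda>x. a * f x) \<in> box_polynomials L"
proof -
  obtain c where c: "\<forall>x. f x = (\<Sum>s\<in>{s. \<forall>k. s k \<le> L}. c s * (\<Prod>k\<in>UNIV. complex_of_real (x $ k) ^ s k))"
    using assms unfolding box_polynomials_def by blast
  show ?thesis unfolding box_polynomials_def mem_Collect_eq
    by (intro exI[of _ "\<lambda>s. a * c s"]) (simp add: c sum_distrib_left mult.assoc)
qed

lemma box_polynomials_sum:
  assumes "\<And>i. i \<in> I \<Longrightarrow> f i \<in> box_polynomials L" shows "(\<lambda>x. \<Sum>i\<in>I. f i x) \<in> box_polynomials L"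
proof -
  have "\<forall>i\<in>I. \<exists>c. \<forall>x. f i x = (\<Sum>s\<in>{s. \<forall>k. s k \<le> L}. c s * (\<Prod>k\<in>UNIV. complex_of_real (x $ k) ^ s k))"
    using assms unfolding box_polynomials_def by blast
  from bchoice[OF this] obtain c where
    c: "\<forall>i\<in>I. \<forall>x. f i x = (\<Sum>s\<in>{s. \<forall>k. s k \<le> L}. c i s * (\<Prod>k\<in>UNIV. complex_of_real (x $ k) ^ s k))" by blast
  have eq: "(\<Sum>i\<in>I. f i x) = (\<Sum>s\<in>{s. \<forall>k. s k \<le> L}. (\<Sum>i\<in>I. c i s) * (\<Prod>k\<in>UNIV. complex_of_real (x $ k) ^ s k))" for x
    unfolding sum_distrib_right by (subst sum.swap) (intro sum.cong refl, simp add: c)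
  show ?thesis unfolding box_polynomials_def mem_Collect_eq
    by (intro exI[of _ "\<lambda>s. \<Sum>i\<in>I. c i s"] allI) (rule eq)
qed

lemma box_polynomials_prod:
  fixes Q :: "'n::finite \<Rightarrow> complex poly"
  assumes "\<And>k. degree (Q k) \<le> L"
  shows "(\<lambda>x::real^'n. \<Prod>k\<in>UNIV. poly (Q k) (of_real (x $ k))) \<in> box_polynomials L"
proof -
  have P: "poly (Q k) y = (\<Sum>i\<le>L. poly.coeff (Q k) i * y ^ i)" for k y
    unfolding poly_altdef using assms[of k] by (intro sum.mono_neutral_left) (auto simp: coeff_eq_0)
  have S: "{s. \<forall>k. s k \<le> L} = (\<Pi>\<^sub>E k\<in>(UNIV::'n set). {..L})" by (auto simp: PiE_def Pi_def)
  have eq: "(\<Prod>k\<in>UNIV. poly (Q k) (of_real (x $ k))) =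
     (\<Sum>s\<in>{s. \<forall>k. s k \<le> L}. (\<Prod>k\<in>UNIV. poly.coeff (Q k) (s k)) * (\<Prod>k\<in>UNIV. complex_of_real (x $ k) ^ s k))" for x :: "real^'n"
    unfolding P S by (subst prod_sum_PiE) (auto simp: prod.distrib)
  show ?thesis unfolding box_polynomials_def mem_Collect_eq
    by (intro exI[of _ "\<lambda>s. \<Prod>k\<in>UNIV. poly.coeff (Q k) (s k)"] allI) (rule eq)
qed

section \<open>A partition of unity indexed by the sign vectors\<close>

lemma sign_vectors_PiE: "sign_vectors = (\<Pi>\<^sub>E k\<in>(UNIV::'n set). {-1, 1})"
  by (auto simp: sign_vectors_def PiE_def Pi_def)

lemma finite_sign_vectors: "finite (sign_vectors :: ('n::finite \<Rightarrow> real) set)"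
  unfolding sign_vectors_PiE by (intro finite_PiE) auto

text \<open>The weights attached to the sign vectors form a partition of unity on \<open>\<real>\<^sup>n\<close>, and the powers
  \<open>(x\<^sub>k + i \<sigma>\<^sub>k)\<^sup>m\<close> clear the poles of the Cayley polynomials of sign \<open>\<sigma>\<close>, leaving only the real poles.\<close>

definition sign_weight :: "('n::finite \<Rightarrow> complex) \<Rightarrow> nat \<Rightarrow> ('n \<Rightarrow> real) \<Rightarrow> real^'n \<Rightarrow> complex" where
  "sign_weight l m \<sigma> x = (\<Prod>k\<in>UNIV. (if \<sigma> k = 1 then 1 else l k) * (of_real (x $ k) + \<i> * of_real (\<sigma> k)) ^ m /
     ((of_real (x $ k) + \<i>) ^ m + l k * (of_real (x $ k) - \<i>) ^ m))"

text \<open>The sum over all sign vectors is an expanded product over the coordinates, and in each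
  coordinate the two numerators add up to the denominator.\<close>

lemma sum_sign_weight:
  fixes x :: "real^'n::finite"
  assumes "\<And>k. (of_real (x $ k) + \<i>) ^ m + l k * (of_real (x $ k) - \<i>) ^ m \<noteq> 0"
  shows "(\<Sum>\<sigma>\<in>sign_vectors. sign_weight l m \<sigma> x) = 1"
proof -
  let ?a = "\<lambda>k s::real. (if s = 1 then 1 else l k) * (of_real (x $ k) + \<i> * of_real s) ^ m /
     ((of_real (x $ k) + \<i>) ^ m + l k * (of_real (x $ k) - \<i>) ^ m)"
  have "(\<Sum>\<sigma>\<in>sign_vectors. sign_weight l m \<sigma> x) = (\<Prod>k\<in>UNIV. \<Sum>s\<in>{-1, 1}. ?a k s)"
    unfolding sign_vectors_PiE sign_weight_def by (subst prod_sum_PiE) auto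
  also have "\<dots> = (\<Prod>k\<in>(UNIV::'n set). 1)"
  proof (rule prod.cong[OF refl])
    fix k
    show "(\<Sum>s\<in>{-1, 1}. ?a k s) = 1"
      using assms[of k] by (simp add: add_divide_distrib[symmetric] add.commute)
  qed
  finally show ?thesis by simp
qed

lemma cayley_denominator:
  "(of_real x + \<i>) ^ m + l * (of_real x - \<i>) ^ m = (of_real x + \<i>) ^ m * (1 + l * cayley_real 1 x ^ m)"
proof -
  have "of_real x + \<i> \<noteq> 0" using real_plus_i_sign_nonzero[of 1 x] by simp
  thus ?thesis by (simp add: cayley_real_def power_divide distrib_left)
qed

text \<open>Since |x + i| = |x - i| for real x, the modulus does not depend on \<sigma>: one choice
  of the \<open>l k\<close> controls the weights of all sign vectors at once.\<close>

lemma norm_sign_weight_powr: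
  fixes x :: "real^'n::finite"
  assumes \<sigma>: "\<sigma> \<in> sign_vectors" and l: "\<And>k. norm (l k) = 1"
  shows "norm (sign_weight l m \<sigma> x) powr p = (\<Prod>k\<in>UNIV. norm (1 + l k * cayley_real 1 (x $ k) ^ m) powr (- p))"
proof -
  have "norm ((if \<sigma> k = 1 then 1 else l k) * (of_real (x $ k) + \<i> * of_real (\<sigma> k)) ^ m /
     ((of_real (x $ k) + \<i>) ^ m + l k * (of_real (x $ k) - \<i>) ^ m)) = 1 / norm (1 + l k * cayley_real 1 (x $ k) ^ m)" for k
  proof -
    have nz: "of_real (x $ k) + \<i> \<noteq> 0" using real_plus_i_sign_nonzero[of 1 "x $ k"] by simp
    have "norm (if \<sigma> k = 1 then 1 else l k) = 1" using l by simp
    moreover have "norm (of_real (x $ k) + \<i> * of_real (\<sigma> k)) = norm (of_real (x $ k) + \<i>)"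
      using \<sigma> norm_real_i_sign[of "x $ k" 1] by (auto simp: sign_vectors_def dest!: spec[of _ k])
    ultimately show ?thesis
      unfolding cayley_denominator norm_divide norm_mult norm_power using nz by simp
  qed
  hence "norm (sign_weight l m \<sigma> x) = (\<Prod>k\<in>UNIV. 1 / norm (1 + l k * cayley_real 1 (x $ k) ^ m))"
    unfolding sign_weight_def prod_norm[symmetric] by simp
  also have "\<dots> powr p = (\<Prod>k\<in>UNIV. (1 / norm (1 + l k * cayley_real 1 (x $ k) ^ m)) powr p)"
    by (rule prod_powr_distrib)
  also have "\<dots> = (\<Prod>k\<in>UNIV. norm (1 + l k * cayley_real 1 (x $ k) ^ m) powr (- p))"
    by (intro prod.cong refl) (simp add: powr_divide powr_minus_divide)
  finally show ?thesis .
qed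

lemma sign_weight_measurable: "sign_weight l m \<sigma> \<in> borel_measurable borel"
  unfolding sign_weight_def[abs_def] by measurable

text \<open>The numerator of each weight clears the poles of its own Cayley polynomial, coordinate
  by coordinate, and the denominators are the same for all \<sigma>. The degree m - N leaves the gap
  N that the rational class asks for.\<close>

lemma weighted_cayley_sum_rational:
  fixes l :: "'n::finite \<Rightarrow> complex"
  assumes l: "\<And>k. norm (l k) = 1" "\<And>k. l k \<noteq> -1" and m: "m > 0"
    and q: "\<And>\<sigma> j. \<sigma> \<in> sign_vectors \<Longrightarrow> degree (q \<sigma> j) < M \<sigma>" "\<And>\<sigma>. \<sigma> \<in> sign_vectors \<Longrightarrow> N + M \<sigma> \<le> m"
  obtains P a where "P \<in> box_polynomials (m - N)" "\<And>k. inj_on (a k) {1..m}"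
    "\<And>k x. (of_real x + \<i>) ^ m + l k * (of_real x - \<i>) ^ m = (1 + l k) * (\<Prod>j\<in>{1..m}. of_real (x - a k j))"
    "\<And>x. (\<Sum>\<sigma>\<in>sign_vectors. cayley_poly \<sigma> N (M \<sigma>) (c \<sigma>) (q \<sigma>) x * sign_weight l m \<sigma> x) =
      P x / (\<Prod>k\<in>UNIV. \<Prod>j\<in>{1..m}. complex_of_real (x $ k - a k j))"
proof -
  have "\<forall>k. \<exists>a. inj_on a {1..m} \<and> (\<forall>x. (of_real x + \<i>) ^ m + l k * (of_real x - \<i>) ^ m = (1 + l k) * (\<Prod>j\<in>{1..m}. of_real (x - a j)))"
  proof
    fix k
    show "\<exists>a. inj_on a {1..m} \<and> (\<forall>x. (of_real x + \<i>) ^ m + l k * (of_real x - \<i>) ^ m = (1 + l k) * (\<Prod>j\<in>{1..m}. of_real (x - a j)))"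
    proof (rule cayley_denominator_factorization[OF l(1)[of k] l(2)[of k] m])
      fix a :: "nat \<Rightarrow> real"
      assume *: "inj_on a {1..m}" "\<And>x. (of_real x + \<i>) ^ m + l k * (of_real x - \<i>) ^ m = (1 + l k) * (\<Prod>j\<in>{1..m}. of_real (x - a j))"
      show ?thesis by (intro exI[of _ a] conjI allI *)
    qed
  qed
  from choice[OF this] obtain a where a: "\<forall>k. inj_on (a k) {1..m} \<and>
    (\<forall>x. (of_real x + \<i>) ^ m + l k * (of_real x - \<i>) ^ m = (1 + l k) * (\<Prod>j\<in>{1..m}. of_real (x - a k j)))" by blast
  define D where "D k x = (complex_of_real x + \<i>) ^ m + l k * (of_real x - \<i>) ^ m" for k x
  have Da: "D k x = (1 + l k) * (\<Prod>j\<in>{1..m}. of_real (x - a k j))" for k x using a unfolding D_def by blast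
  \<comment> \<open>A single choice over triples (\<sigma>, j, k) yields all numerator
    polynomials.\<close>
  have "\<forall>i::('n \<Rightarrow> real) \<times> nat \<times> 'n. \<exists>Q. fst i \<in> sign_vectors \<longrightarrow> degree Q \<le> m - N \<and>
    (\<forall>x. poly (q (fst i) (fst (snd i))) (cayley_real (fst i (snd (snd i))) x) / (of_real x + \<i> * of_real (fst i (snd (snd i)))) ^ N * (of_real x + \<i> * of_real (fst i (snd (snd i)))) ^ m = poly Q (of_real x))"
  proof
    fix i :: "('n \<Rightarrow> real) \<times> nat \<times> 'n"
    obtain \<sigma> j k where i: "i = (\<sigma>, j, k)" by (metis prod.collapse)
    show "\<exists>Q. fst i \<in> sign_vectors \<longrightarrow> degree Q \<le> m - N \<and>
    (\<forall>x. poly (q (fst i) (fst (snd i))) (cayley_real (fst i (snd (snd i))) x) / (of_real x + \<i> * of_real (fst i (snd (snd i)))) ^ N * (of_real x + \<i> * of_real (fst i (snd (snd i)))) ^ m = poly Q (of_real x))"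
    proof (cases "\<sigma> \<in> sign_vectors")
      case True
      have "\<sigma> k \<noteq> 0" using sign_mult_self[OF True, of k] by auto
      show ?thesis
      proof (rule cayley_term_polynomial[OF \<open>\<sigma> k \<noteq> 0\<close> q(1)[OF True, of j] q(2)[OF True]])
        fix Q :: "complex poly"
        assume *: "degree Q \<le> m - N"
          "\<And>x. poly (q \<sigma> j) (cayley_real (\<sigma> k) x) / (of_real x + \<i> * of_real (\<sigma> k)) ^ N * (of_real x + \<i> * of_real (\<sigma> k)) ^ m = poly Q (of_real x)"
        show ?thesis unfolding i fst_conv snd_conv by (intro exI[of _ Q] impI conjI allI *)
      qed
    qed (simp add: i)
  qed
  from choice[OF this] obtain Q0 where Q0: "\<forall>i::('n \<Rightarrow> real) \<times> nat \<times> 'n. fst i \<in> sign_vectors \<longrightarrow> degree (Q0 i) \<le> m - N \<and>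
    (\<forall>x. poly (q (fst i) (fst (snd i))) (cayley_real (fst i (snd (snd i))) x) / (of_real x + \<i> * of_real (fst i (snd (snd i)))) ^ N * (of_real x + \<i> * of_real (fst i (snd (snd i)))) ^ m = poly (Q0 i) (of_real x))"
    by blast
  define Q where "Q \<sigma> j k = smult (if \<sigma> k = 1 then 1 else l k) (Q0 (\<sigma>, j, k))" for \<sigma> j k
  have dQ: "degree (Q \<sigma> j k) \<le> m - N" if "\<sigma> \<in> sign_vectors" for \<sigma> j k
    unfolding Q_def using Q0[rule_format, of "(\<sigma>, j, k)"] that by (intro order_trans[OF degree_smult_le]) simp
  have Q: "poly (q \<sigma> j) (cayley_real (\<sigma> k) x) / (of_real x + \<i> * of_real (\<sigma> k)) ^ N *
      ((if \<sigma> k = 1 then 1 else l k) * (of_real x + \<i> * of_real (\<sigma> k)) ^ m / D k x) = poly (Q \<sigma> j k) (of_real x) / D k x"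
    if "\<sigma> \<in> sign_vectors" for \<sigma> j k x
  proof -
    have "poly (q \<sigma> j) (cayley_real (\<sigma> k) x) / (of_real x + \<i> * of_real (\<sigma> k)) ^ N * (of_real x + \<i> * of_real (\<sigma> k)) ^ m = poly (Q0 (\<sigma>, j, k)) (of_real x)"
      using Q0[rule_format, of "(\<sigma>, j, k)"] that by simp
    hence "poly (Q \<sigma> j k) (of_real x) = (if \<sigma> k = 1 then 1 else l k) * (poly (q \<sigma> j) (cayley_real (\<sigma> k) x) / (of_real x + \<i> * of_real (\<sigma> k)) ^ N * (of_real x + \<i> * of_real (\<sigma> k)) ^ m)"
      unfolding Q_def poly_smult by simp
    moreover have "a * (e * b / d) = e * (a * b) / d" for a b d e :: complex by simp
    ultimately show ?thesis by (simp only:)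
  qed
  define P0 where "P0 x = (\<Sum>\<sigma>\<in>sign_vectors. \<Sum>j\<in>UNIV \<rightarrow>\<^sub>E {..<M \<sigma>}. c \<sigma> j * (\<Prod>k\<in>UNIV. poly (Q \<sigma> (j k) k) (of_real (x $ k))))" for x :: "real^'n"
  define P where "P x = (1 / (\<Prod>k\<in>UNIV. 1 + l k)) * P0 x" for x
  have "P \<in> box_polynomials (m - N)" unfolding P_def[abs_def] P0_def
    by (intro box_polynomials_scale box_polynomials_sum box_polynomials_prod dQ)
  moreover have "inj_on (a k) {1..m}" for k using a by blast
  moreover have "(of_real x + \<i>) ^ m + l k * (of_real x - \<i>) ^ m = (1 + l k) * (\<Prod>j\<in>{1..m}. of_real (x - a k j))" for k x
    using a by blast
  moreover have "(\<Sum>\<sigma>\<in>sign_vectors. cayley_poly \<sigma> N (M \<sigma>) (c \<sigma>) (q \<sigma>) x * sign_weight l m \<sigma> x) =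
      P x / (\<Prod>k\<in>UNIV. \<Prod>j\<in>{1..m}. complex_of_real (x $ k - a k j))" for x
  proof -
    have eq: "cayley_poly \<sigma> N (M \<sigma>) (c \<sigma>) (q \<sigma>) x * sign_weight l m \<sigma> x =
      (\<Sum>j\<in>UNIV \<rightarrow>\<^sub>E {..<M \<sigma>}. c \<sigma> j * (\<Prod>k\<in>UNIV. poly (Q \<sigma> (j k) k) (of_real (x $ k)))) / (\<Prod>k\<in>UNIV. D k (x $ k))"
      if \<sigma>: "\<sigma> \<in> sign_vectors" for \<sigma>
    proof -
      have "cayley_poly \<sigma> N (M \<sigma>) (c \<sigma>) (q \<sigma>) x * sign_weight l m \<sigma> x =
        (\<Sum>j\<in>UNIV \<rightarrow>\<^sub>E {..<M \<sigma>}. c \<sigma> j * (\<Prod>k\<in>UNIV. poly (q \<sigma> (j k)) (cayley_real (\<sigma> k) (x $ k)) / (of_real (x $ k) + \<i> * of_real (\<sigma> k)) ^ N *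
          ((if \<sigma> k = 1 then 1 else l k) * (of_real (x $ k) + \<i> * of_real (\<sigma> k)) ^ m / D k (x $ k))))"
        unfolding cayley_poly_def sign_weight_def D_def sum_distrib_right by (simp only: mult.assoc prod.distrib[symmetric])
      also have "\<dots> = (\<Sum>j\<in>UNIV \<rightarrow>\<^sub>E {..<M \<sigma>}. c \<sigma> j * ((\<Prod>k\<in>UNIV. poly (Q \<sigma> (j k) k) (of_real (x $ k))) / (\<Prod>k\<in>UNIV. D k (x $ k))))"
        by (simp only: Q[OF \<sigma>] prod_dividef)
      finally show ?thesis by (simp only: times_divide_eq_right sum_divide_distrib)
    qed
    have "(\<Sum>\<sigma>\<in>sign_vectors. cayley_poly \<sigma> N (M \<sigma>) (c \<sigma>) (q \<sigma>) x * sign_weight l m \<sigma> x) =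
      (\<Sum>\<sigma>\<in>sign_vectors. (\<Sum>j\<in>UNIV \<rightarrow>\<^sub>E {..<M \<sigma>}. c \<sigma> j * (\<Prod>k\<in>UNIV. poly (Q \<sigma> (j k) k) (of_real (x $ k)))) / (\<Prod>k\<in>UNIV. D k (x $ k)))"
      by (intro sum.cong refl eq)
    also have "\<dots> = P0 x / (\<Prod>k\<in>UNIV. D k (x $ k))" by (simp only: P0_def sum_divide_distrib)
    also have "\<dots> = P x / (\<Prod>k\<in>UNIV. \<Prod>j\<in>{1..m}. complex_of_real (x $ k - a k j))"
      unfolding P_def Da prod.distrib by simp
    finally show ?thesis .
  qed
  ultimately show thesis by (rule that)
qed

text \<open>The coordinates are treated in turn: weights already chosen are absorbed into
  \<open>G\<close>, and each new one costs a factor C + 1.\<close>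

lemma exists_unimodular_weights:
  fixes B :: "'i \<Rightarrow> 'a::euclidean_space \<Rightarrow> complex"
  assumes p: "0 < p" "p < 1" and C: "C < \<infinity>" "\<And>b::complex. norm b = 1 \<Longrightarrow>
    (\<integral>\<^sup>+ \<theta>. indicator {0..1::real} \<theta> * ennreal (norm (1 + cis (2 * pi * \<theta>) * b) powr (-p)) \<partial>lborel) \<le> C"
    and G[measurable]: "G \<in> borel_measurable borel" and B[measurable]: "\<And>k. B k \<in> borel_measurable borel"
    and B1: "\<And>k x. norm (B k x) = 1" and fin: "(\<integral>\<^sup>+ x. G x \<partial>lborel) < \<infinity>" and K: "finite K"
  shows "\<exists>l. (\<forall>k\<in>K. norm (l k) = 1 \<and> l k \<noteq> -1) \<and>
    (\<integral>\<^sup>+ x. G x * (\<Prod>k\<in>K. ennreal (norm (1 + l k * B k x) powr (-p))) \<partial>lborel) \<le> (C + 1) ^ card K * (\<integral>\<^sup>+ x. G x \<partial>lborel)"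
  using K
proof (induction K rule: finite_induct)
  case empty
  show ?case by simp
next
  case (insert k K)
  then obtain l where l: "\<forall>k\<in>K. norm (l k) = 1 \<and> l k \<noteq> -1"
    and le: "(\<integral>\<^sup>+ x. G x * (\<Prod>k\<in>K. ennreal (norm (1 + l k * B k x) powr (-p))) \<partial>lborel) \<le> (C + 1) ^ card K * (\<integral>\<^sup>+ x. G x \<partial>lborel)"
    by blast
  define G' where "G' x = G x * (\<Prod>k\<in>K. ennreal (norm (1 + l k * B k x) powr (-p)))" for x
  have G'm: "G' \<in> borel_measurable borel" unfolding G'_def[abs_def] by measurable
  have "(C + 1) ^ card K * (\<integral>\<^sup>+ x. G x \<partial>lborel) < \<infinity>"
    using C(1) fin by (simp add: ennreal_mult_less_top power_less_top_ennreal)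
  hence fin': "(\<integral>\<^sup>+ x. G' x \<partial>lborel) < \<infinity>" using le unfolding G'_def by (rule le_less_trans[rotated])
  show ?case
  proof (rule exists_unimodular_weight[OF p C G'm B B1 fin', of k])
    fix t assume t: "norm t = 1" "t \<noteq> -1"
      "(\<integral>\<^sup>+ x. G' x * ennreal (norm (1 + t * B k x) powr (-p)) \<partial>lborel) \<le> (C + 1) * (\<integral>\<^sup>+ x. G' x \<partial>lborel)"
    let ?l = "l(k := t)"
    have eq: "G x * (\<Prod>i\<in>insert k K. ennreal (norm (1 + ?l i * B i x) powr (-p))) = G' x * ennreal (norm (1 + t * B k x) powr (-p))" for x
    proof -
      have "(\<Prod>i\<in>K. ennreal (norm (1 + ?l i * B i x) powr (-p))) = (\<Prod>i\<in>K. ennreal (norm (1 + l i * B i x) powr (-p)))"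
        using insert.hyps by (intro prod.cong refl) auto
      thus ?thesis unfolding prod.insert[OF insert.hyps] G'_def by (simp add: mult_ac)
    qed
    have "(\<integral>\<^sup>+ x. G x * (\<Prod>i\<in>insert k K. ennreal (norm (1 + ?l i * B i x) powr (-p))) \<partial>lborel) \<le> (C + 1) * (\<integral>\<^sup>+ x. G' x \<partial>lborel)"
      unfolding eq by (rule t(3))
    also have "\<dots> \<le> (C + 1) * ((C + 1) ^ card K * (\<integral>\<^sup>+ x. G x \<partial>lborel))"
      using le unfolding G'_def by (rule mult_left_mono) simp
    also have "\<dots> = (C + 1) ^ card (insert k K) * (\<integral>\<^sup>+ x. G x \<partial>lborel)"
      using insert.hyps by (simp add: mult.assoc)
    finally show ?thesis using l t by (intro exI[of _ ?l]) auto
  qed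
qed

lemma Lp_space_diff_finite:
  assumes p: "0 < p" "p \<le> 1" and f: "f \<in> Lp_space p" and g: "g \<in> borel_measurable lebesgue"
    and d: "(\<integral>\<^sup>+ x. ennreal (norm (g x - f x) powr p) \<partial>lebesgue) < \<infinity>"
  shows "g \<in> Lp_space p"
proof -
  have fm: "f \<in> borel_measurable lebesgue" and ff: "(\<integral>\<^sup>+ x. ennreal (norm (f x) powr p) \<partial>lebesgue) < \<infinity>"
    using f unfolding Lp_space_def by auto
  have "(\<integral>\<^sup>+ x. ennreal (norm (g x - 0) powr p) \<partial>lebesgue) \<le>
    (\<integral>\<^sup>+ x. ennreal (norm (g x - f x) powr p) \<partial>lebesgue) + (\<integral>\<^sup>+ x. ennreal (norm (f x - 0) powr p) \<partial>lebesgue)"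
    by (rule Lp_dist_triangle[OF p g fm]) simp
  also have "\<dots> < \<infinity>" using d ff by simp
  finally show ?thesis using g unfolding Lp_space_def by simp
qed

text \<open>Because the weights sum to 1, only the differences h \<sigma> - h \<sigma>0 meet the
  unbounded weights. The constant \<open>C\<close> is independent of m, so \<epsilon> can be fixed
  before the degrees, and hence m, are known.\<close>

lemma boundary_Hardy_Inter_approx:
  fixes f :: "real^'n \<Rightarrow> complex"
  assumes p: "0 < p" "p < 1" and f: "\<And>\<sigma>. \<sigma> \<in> sign_vectors \<Longrightarrow> f \<in> boundary_Hardy p \<sigma>" and e: "e > 0"
  obtains g where "g \<in> rational_class p" "(\<integral>\<^sup>+ x. ennreal (norm (g x - f x) powr p) \<partial>lebesgue) < ennreal e"
proof -
  let ?SV = "sign_vectors :: ('n \<Rightarrow> real) set"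
  have p1: "p \<le> 1" using p by simp
  define \<sigma>0 where "\<sigma>0 = (\<lambda>_::'n. 1::real)"
  have \<sigma>0: "\<sigma>0 \<in> ?SV" by (simp add: sign_vectors_def \<sigma>0_def)
  have fL: "f \<in> Lp_space p" using f[OF \<sigma>0] unfolding boundary_Hardy_def by blast
  hence fm: "f \<in> borel_measurable lebesgue" unfolding Lp_space_def by blast
  obtain N where N: "real N * p > 1" using reals_Archimedean3[OF p(1)] by blast
  obtain C where C: "C < \<infinity>" "\<And>b::complex. norm b = 1 \<Longrightarrow>
    (\<integral>\<^sup>+ \<theta>. indicator {0..1::real} \<theta> * ennreal (norm (1 + cis (2 * pi * \<theta>) * b) powr (-p)) \<partial>lborel) \<le> C"
  proof (rule circle_singular_integral[OF p])
    fix C assume *: "C < \<infinity>" "\<And>b::complex. norm b = 1 \<Longrightarrow>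
    (\<integral>\<^sup>+ \<theta>. indicator {0..1::real} \<theta> * ennreal (norm (1 + cis (2 * pi * \<theta>) * b) powr (-p)) \<partial>lborel) \<le> C"
    show thesis by (rule that[OF *])
  qed
  obtain rC where rC: "C = ennreal rC" "rC \<ge> 0" using C(1) by (cases C) auto
  \<comment> \<open>Collects the cost of the n weights, the number of sign vectors and the factor 2
    from comparing h \<sigma> with h \<sigma>0 through \<open>f\<close>; the final 1 is for the
    distance from h \<sigma>0 to \<open>f\<close>.\<close>
  define Kc where "Kc = (rC + 1) ^ CARD('n) * (real (card ?SV) * 2) + 1"
  have Kc: "Kc \<ge> 1" using rC by (simp add: Kc_def)
  define \<epsilon> where "\<epsilon> = e / (2 * Kc)"
  have \<epsilon>: "\<epsilon> > 0" using e Kc by (simp add: \<epsilon>_def)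
  have "\<forall>\<sigma>. \<exists>a. \<sigma> \<in> ?SV \<longrightarrow> (\<forall>j. degree (snd (snd a) j) < fst a) \<and>
     (\<integral>\<^sup>+ x. ennreal (norm (cayley_poly \<sigma> N (fst a) (fst (snd a)) (snd (snd a)) x - f x) powr p) \<partial>lebesgue) < ennreal \<epsilon>"
  proof
    fix \<sigma> :: "'n \<Rightarrow> real"
    show "\<exists>a. \<sigma> \<in> ?SV \<longrightarrow> (\<forall>j. degree (snd (snd a) j) < fst a) \<and>
     (\<integral>\<^sup>+ x. ennreal (norm (cayley_poly \<sigma> N (fst a) (fst (snd a)) (snd (snd a)) x - f x) powr p) \<partial>lebesgue) < ennreal \<epsilon>"
    proof (cases "\<sigma> \<in> ?SV")
      case True
      show ?thesis
      proof (rule boundary_Hardy_approx[OF True p N f[OF True] \<epsilon>])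
        fix M c q assume *: "\<And>j::nat. degree (q j) < M"
          "(\<integral>\<^sup>+ x. ennreal (norm (cayley_poly \<sigma> N M c q x - f x) powr p) \<partial>lebesgue) < ennreal \<epsilon>"
        show ?thesis
          by (intro exI[of _ "(M, c, q)"] impI conjI allI) (simp_all only: fst_conv snd_conv *)
      qed
    qed simp
  qed
  from choice[OF this] obtain A where A: "\<forall>\<sigma>. \<sigma> \<in> ?SV \<longrightarrow> (\<forall>j. degree (snd (snd (A \<sigma>)) j) < fst (A \<sigma>)) \<and>
     (\<integral>\<^sup>+ x. ennreal (norm (cayley_poly \<sigma> N (fst (A \<sigma>)) (fst (snd (A \<sigma>))) (snd (snd (A \<sigma>))) x - f x) powr p) \<partial>lebesgue) < ennreal \<epsilon>"
    by blast
  define M c q where "M \<sigma> = fst (A \<sigma>)" and "c \<sigma> = fst (snd (A \<sigma>))" and "q \<sigma> = snd (snd (A \<sigma>))" for \<sigma>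
  define h where "h \<sigma> = cayley_poly \<sigma> N (M \<sigma>) (c \<sigma>) (q \<sigma>)" for \<sigma>
  have dq: "degree (q \<sigma> j) < M \<sigma>" if "\<sigma> \<in> ?SV" for \<sigma> j using A[rule_format, OF that] by (simp add: q_def M_def)
  have hf: "(\<integral>\<^sup>+ x. ennreal (norm (h \<sigma> x - f x) powr p) \<partial>lebesgue) < ennreal \<epsilon>" if "\<sigma> \<in> ?SV" for \<sigma>
    using A[rule_format, OF that] by (simp add: q_def M_def c_def h_def)
  have hm: "h \<sigma> \<in> borel_measurable borel" if "\<sigma> \<in> ?SV" for \<sigma> unfolding h_def by (rule cayley_poly_measurable[OF that])
  \<comment> \<open>Clearing the poles asks for m \<ge> N + M \<sigma> for every \<sigma>; the added
    1 makes m visibly positive.\<close>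
  define m where "m = N + Max (M ` ?SV) + 1"
  have m: "m > 0" by (simp add: m_def)
  have Mm: "N + M \<sigma> \<le> m" if "\<sigma> \<in> ?SV" for \<sigma>
  proof -
    have "M \<sigma> \<le> Max (M ` ?SV)" using that finite_sign_vectors by (intro Max_ge) auto
    thus ?thesis by (simp add: m_def)
  qed
  define G where "G x = (\<Sum>\<sigma>\<in>?SV. ennreal (norm (h \<sigma> x - h \<sigma>0 x) powr p))" for x
  have dm[measurable]: "(\<lambda>x. ennreal (norm (h \<sigma> x - h \<sigma>0 x) powr p)) \<in> borel_measurable borel" if "\<sigma> \<in> ?SV" for \<sigma>
    using hm[OF that] hm[OF \<sigma>0] by measurable
  have Gm: "G \<in> borel_measurable borel" unfolding G_def[abs_def] by (intro borel_measurable_sum dm)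
  have leb: "(\<integral>\<^sup>+ x. u x \<partial>lebesgue) = (\<integral>\<^sup>+ x. u x \<partial>lborel)" for u :: "real^'n \<Rightarrow> ennreal" by (simp add: nn_integral_completion)
  have GI: "(\<integral>\<^sup>+ x. G x \<partial>lborel) \<le> ennreal (real (card ?SV) * (2 * \<epsilon>))"
  proof -
    have "(\<lambda>x. ennreal (norm (h \<sigma> x - h \<sigma>0 x) powr p)) \<in> borel_measurable lborel" if "\<sigma> \<in> ?SV" for \<sigma>
      using hm[OF that] hm[OF \<sigma>0] by measurable
    hence "(\<integral>\<^sup>+ x. G x \<partial>lborel) = (\<Sum>\<sigma>\<in>?SV. \<integral>\<^sup>+ x. ennreal (norm (h \<sigma> x - h \<sigma>0 x) powr p) \<partial>lborel)"
      unfolding G_def by (rule nn_integral_sum)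
    also have "\<dots> \<le> (\<Sum>\<sigma>\<in>?SV. ennreal (2 * \<epsilon>))"
    proof (rule sum_mono)
      fix \<sigma> assume \<sigma>: "\<sigma> \<in> ?SV"
      have "(\<integral>\<^sup>+ x. ennreal (norm (h \<sigma> x - h \<sigma>0 x) powr p) \<partial>lebesgue) \<le>
        (\<integral>\<^sup>+ x. ennreal (norm (h \<sigma> x - f x) powr p) \<partial>lebesgue) + (\<integral>\<^sup>+ x. ennreal (norm (f x - h \<sigma>0 x) powr p) \<partial>lebesgue)"
        by (rule Lp_dist_triangle[OF p(1) p1 borel_measurable_lebesgueI[OF hm[OF \<sigma>]] fm borel_measurable_lebesgueI[OF hm[OF \<sigma>0]]])
      also have "\<dots> \<le> ennreal \<epsilon> + ennreal \<epsilon>"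
        using hf[OF \<sigma>] hf[OF \<sigma>0] unfolding norm_minus_commute[of "f _" "h \<sigma>0 _"] by (intro add_mono less_imp_le)
      also have "\<dots> = ennreal (2 * \<epsilon>)" using \<epsilon> by (simp only: mult_2 ennreal_plus less_imp_le)
      finally show "(\<integral>\<^sup>+ x. ennreal (norm (h \<sigma> x - h \<sigma>0 x) powr p) \<partial>lborel) \<le> ennreal (2 * \<epsilon>)" unfolding leb .
    qed
    also have "\<dots> = ennreal (\<Sum>\<sigma>\<in>?SV. 2 * \<epsilon>)" using \<epsilon> by (intro sum_ennreal) simp
    finally show ?thesis by simp
  qed
  have GI_fin: "(\<integral>\<^sup>+ x. G x \<partial>lborel) < \<infinity>" using GI by (rule le_less_trans) simp
  define B where "B k x = cayley_real 1 (x $ k) ^ m" for k and x :: "real^'n"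
  have Bm: "B k \<in> borel_measurable borel" for k
    unfolding B_def by (intro borel_measurable_continuous_onI continuous_intros continuous_on_compose2[OF continuous_on_cayley_real[of 1 UNIV]]) auto
  have B1: "norm (B k x) = 1" for k x by (simp add: B_def norm_power)
  have "\<exists>l. (\<forall>k\<in>UNIV. norm (l k) = 1 \<and> l k \<noteq> -1) \<and>
    (\<integral>\<^sup>+ x. G x * (\<Prod>k\<in>UNIV. ennreal (norm (1 + l k * B k x) powr (-p))) \<partial>lborel) \<le> (C + 1) ^ CARD('n) * (\<integral>\<^sup>+ x. G x \<partial>lborel)"
    by (rule exists_unimodular_weights[OF p C Gm Bm B1 GI_fin]) auto
  then obtain l where l: "\<forall>k\<in>UNIV. norm (l k) = 1 \<and> l k \<noteq> -1"
    and lI: "(\<integral>\<^sup>+ x. G x * (\<Prod>k\<in>UNIV. ennreal (norm (1 + l k * B k x) powr (-p))) \<partial>lborel) \<le> (C + 1) ^ CARD('n) * (\<integral>\<^sup>+ x. G x \<partial>lborel)"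
    by blast
  have l1: "norm (l k) = 1" and l2: "l k \<noteq> -1" for k using l by auto
  obtain P a where P: "P \<in> box_polynomials (m - N)" and a: "\<And>k. inj_on (a k) {1..m}"
    and Da: "\<And>k x. (of_real x + \<i>) ^ m + l k * (of_real x - \<i>) ^ m = (1 + l k) * (\<Prod>j\<in>{1..m}. of_real (x - a k j))"
    and S: "\<And>x. (\<Sum>\<sigma>\<in>?SV. h \<sigma> x * sign_weight l m \<sigma> x) = P x / (\<Prod>k\<in>UNIV. \<Prod>j\<in>{1..m}. complex_of_real (x $ k - a k j))"
  proof (rule weighted_cayley_sum_rational[OF l1 l2 m dq Mm, where c = c])
    fix P a assume *: "P \<in> box_polynomials (m - N)" "\<And>k. inj_on (a k) {1..m}"
      "\<And>k x. (of_real x + \<i>) ^ m + l k * (of_real x - \<i>) ^ m = (1 + l k) * (\<Prod>j\<in>{1..m}. of_real (x - a k j))"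
      "\<And>x. (\<Sum>\<sigma>\<in>?SV. cayley_poly \<sigma> N (M \<sigma>) (c \<sigma>) (q \<sigma>) x * sign_weight l m \<sigma> x) =
        P x / (\<Prod>k\<in>UNIV. \<Prod>j\<in>{1..m}. complex_of_real (x $ k - a k j))"
    show thesis by (rule that[OF *[folded h_def]])
  qed
  define g where "g x = (\<Sum>\<sigma>\<in>?SV. h \<sigma> x * sign_weight l m \<sigma> x)" for x
  have gm: "g \<in> borel_measurable borel"
    unfolding g_def[abs_def] by (intro borel_measurable_sum borel_measurable_times hm sign_weight_measurable)
  have AEnz: "AE x in lebesgue. \<forall>k. x $ k \<notin> a k ` {1..m}" by (rule AE_coordinate_notin) simp
  have "(\<integral>\<^sup>+ x. ennreal (norm (g x - h \<sigma>0 x) powr p) \<partial>lebesgue) \<le> (\<integral>\<^sup>+ x. G x * (\<Prod>k\<in>UNIV. ennreal (norm (1 + l k * B k x) powr (-p))) \<partial>lebesgue)"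
  proof (rule nn_integral_mono_AE, use AEnz in eventually_elim)
    case (elim x)
    have nz: "(of_real (x $ k) + \<i>) ^ m + l k * (of_real (x $ k) - \<i>) ^ m \<noteq> 0" for k
    proof -
      have "1 + l k \<noteq> 0" using l2[of k] by (metis add.commute add_eq_0_iff)
      moreover have "(\<Prod>j\<in>{1..m}. complex_of_real (x $ k - a k j)) \<noteq> 0" using elim by (auto simp: prod_zero_iff)
      ultimately show ?thesis unfolding Da by simp
    qed
    have "h \<sigma>0 x = h \<sigma>0 x * (\<Sum>\<sigma>\<in>?SV. sign_weight l m \<sigma> x)" using sum_sign_weight[of x m l, OF nz] by simp
    hence "g x - h \<sigma>0 x = (\<Sum>\<sigma>\<in>?SV. (h \<sigma> x - h \<sigma>0 x) * sign_weight l m \<sigma> x)"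
      unfolding g_def left_diff_distrib sum_subtractf sum_distrib_left[symmetric] by simp
    hence "norm (g x - h \<sigma>0 x) powr p \<le> (\<Sum>\<sigma>\<in>?SV. norm ((h \<sigma> x - h \<sigma>0 x) * sign_weight l m \<sigma> x) powr p)"
      using norm_sum_powr_le[OF p(1) p1 finite_sign_vectors] by simp
    also have "\<dots> = (\<Sum>\<sigma>\<in>?SV. norm (h \<sigma> x - h \<sigma>0 x) powr p * (\<Prod>k\<in>UNIV. norm (1 + l k * B k x) powr (-p)))"
      by (intro sum.cong refl) (simp only: norm_mult powr_mult norm_sign_weight_powr[OF _ l1] B_def)
    also have "\<dots> = (\<Sum>\<sigma>\<in>?SV. norm (h \<sigma> x - h \<sigma>0 x) powr p) * (\<Prod>k\<in>UNIV. norm (1 + l k * B k x) powr (-p))"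
      by (simp only: sum_distrib_right)
    finally have "ennreal (norm (g x - h \<sigma>0 x) powr p) \<le> ennreal ((\<Sum>\<sigma>\<in>?SV. norm (h \<sigma> x - h \<sigma>0 x) powr p) * (\<Prod>k\<in>UNIV. norm (1 + l k * B k x) powr (-p)))"
      by (rule ennreal_leI)
    also have "\<dots> = G x * (\<Prod>k\<in>UNIV. ennreal (norm (1 + l k * B k x) powr (-p)))"
      unfolding G_def by (subst ennreal_mult) (auto simp: sum_ennreal prod_ennreal intro: sum_nonneg prod_nonneg)
    finally show ?case .
  qed
  also have "\<dots> \<le> (C + 1) ^ CARD('n) * (\<integral>\<^sup>+ x. G x \<partial>lborel)" unfolding leb by (rule lI)
  also have "\<dots> \<le> (C + 1) ^ CARD('n) * ennreal (real (card ?SV) * (2 * \<epsilon>))" by (intro mult_left_mono GI) simp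
  also have "\<dots> = ennreal ((rC + 1) ^ CARD('n) * (real (card ?SV) * (2 * \<epsilon>)))"
  proof -
    have "C + 1 = ennreal (rC + 1)" using rC by (simp add: ennreal_plus)
    moreover have "ennreal (rC + 1) ^ CARD('n) = ennreal ((rC + 1) ^ CARD('n))" using rC by (intro ennreal_power) simp
    ultimately show ?thesis using rC \<epsilon> by (simp only:) (intro ennreal_mult[symmetric], auto)
  qed
  finally have I1: "(\<integral>\<^sup>+ x. ennreal (norm (g x - h \<sigma>0 x) powr p) \<partial>lebesgue) \<le> ennreal ((rC + 1) ^ CARD('n) * (real (card ?SV) * (2 * \<epsilon>)))" .
  have gL: "g \<in> borel_measurable lebesgue" by (rule borel_measurable_lebesgueI[OF gm])
  have "(\<integral>\<^sup>+ x. ennreal (norm (g x - f x) powr p) \<partial>lebesgue) \<le>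
     (\<integral>\<^sup>+ x. ennreal (norm (g x - h \<sigma>0 x) powr p) \<partial>lebesgue) + (\<integral>\<^sup>+ x. ennreal (norm (h \<sigma>0 x - f x) powr p) \<partial>lebesgue)"
    by (rule Lp_dist_triangle[OF p(1) p1 gL borel_measurable_lebesgueI[OF hm[OF \<sigma>0]] fm])
  also have "\<dots> \<le> ennreal ((rC + 1) ^ CARD('n) * (real (card ?SV) * (2 * \<epsilon>))) + ennreal \<epsilon>"
    by (intro add_mono I1 less_imp_le[OF hf[OF \<sigma>0]])
  also have "\<dots> = ennreal ((rC + 1) ^ CARD('n) * (real (card ?SV) * (2 * \<epsilon>)) + \<epsilon>)"
    using rC \<epsilon> by (intro ennreal_plus[symmetric]) auto
  also have "(rC + 1) ^ CARD('n) * (real (card ?SV) * (2 * \<epsilon>)) + \<epsilon> = Kc * \<epsilon>" by (simp add: Kc_def algebra_simps)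
  also have "Kc * \<epsilon> = e / 2" using Kc by (simp add: \<epsilon>_def)
  also have "ennreal (e / 2) < ennreal e" using e by (intro ennreal_lessI) auto
  finally have gf: "(\<integral>\<^sup>+ x. ennreal (norm (g x - f x) powr p) \<partial>lebesgue) < ennreal e" .
  have gLp: "g \<in> Lp_space p"
    by (rule Lp_space_diff_finite[OF p(1) p1 fL gL]) (rule less_trans[OF gf], simp)
  obtain cP where cP: "\<forall>x. P x = (\<Sum>s\<in>{s. \<forall>k. s k \<le> m - N}. cP s * (\<Prod>k\<in>UNIV. complex_of_real (x $ k) ^ s k))"
    using P unfolding box_polynomials_def by blast
  have "g \<in> rational_class p"
    unfolding rational_class_def mem_Collect_eq
  proof (intro conjI gLp exI[of _ "\<lambda>_::'n. m - N"] exI[of _ cP] exI[of _ m] exI[of _ a] allI)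
    show "m > 0" by (rule m)
    \<comment> \<open>The degree bound is m - N in every variable, so the gap is exactly N, and N
      was chosen with N p > 1.\<close>
    have "real m - real (Max (range (\<lambda>_::'n. m - N))) = real N" by (simp add: m_def)
    thus "1 < (real m - real (Max (range (\<lambda>_::'n. m - N)))) * p" using N by simp
    show "inj_on (a k) {1..m}" for k by (rule a)
    show "g x = (\<Sum>s\<in>{s. \<forall>k. s k \<le> m - N}. cP s * (\<Prod>k\<in>UNIV. complex_of_real (x $ k) ^ s k)) /
                 (\<Prod>k\<in>UNIV. \<Prod>j\<in>{1..m}. complex_of_real (x $ k - a k j))" for x
      unfolding g_def S cP[rule_format] ..
  qed
  from that[OF this gf] show thesis .
qed

text \<open>The witness for non-emptiness: degree bound 0, zero coefficients, and poles at 1, ..., m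
  in every coordinate with m p > 1.\<close>

lemma zero_in_rational_class:
  assumes "0 < p" shows "(\<lambda>_. 0) \<in> rational_class p"
proof -
  obtain m where m: "real m * p > 1" using reals_Archimedean3[OF assms] by blast
  have m0: "m > 0" using m by (cases m) auto
  show ?thesis unfolding rational_class_def mem_Collect_eq
    by (intro conjI exI[of _ "\<lambda>_. 0"] exI[of _ m] exI[of _ "\<lambda>_. real"] allI m0)
      (use assms m in \<open>auto simp: Lp_space_def inj_on_def\<close>)
qed

theorem theorem4p3:
  fixes p :: real
  assumes "0 < p" and "p < 1"
  shows "Lp_closure p (rational_class p) = (\<Inter>\<sigma>\<in>(sign_vectors :: ('n::finite \<Rightarrow> real) set). boundary_Hardy p \<sigma>)
         \<and> Lp_closure p (rational_class p :: (real^'n \<Rightarrow> complex) set) \<noteq> {}"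
proof
  have "Lp_closure p (rational_class p) \<subseteq> boundary_Hardy p \<sigma>" if "\<sigma> \<in> sign_vectors" for \<sigma> :: "'n \<Rightarrow> real"
    by (rule Lp_closure_subset_boundary_Hardy[OF that assms rational_class_subset_boundary_Hardy[OF assms]])
  moreover have "f \<in> Lp_closure p (rational_class p)"
    if "f \<in> (\<Inter>\<sigma>\<in>(sign_vectors :: ('n \<Rightarrow> real) set). boundary_Hardy p \<sigma>)" for f
  proof -
    have f: "f \<in> boundary_Hardy p \<sigma>" if "\<sigma> \<in> sign_vectors" for \<sigma> :: "'n \<Rightarrow> real"
      using \<open>f \<in> (\<Inter>\<sigma>\<in>sign_vectors. boundary_Hardy p \<sigma>)\<close> that by blast
    have "(\<lambda>_::'n. 1) \<in> sign_vectors" by (simp add: sign_vectors_def)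
    from f[OF this] have fL: "f \<in> Lp_space p" unfolding boundary_Hardy_def by blast
    have "\<exists>g\<in>rational_class p. (\<integral>\<^sup>+ x. ennreal (norm (g x - f x) powr p) \<partial>lebesgue) < ennreal e" if "e > 0" for e
      by (rule boundary_Hardy_Inter_approx[OF assms f that]) blast+
    thus ?thesis using fL unfolding Lp_closure_def by blast
  qed
  ultimately show "Lp_closure p (rational_class p) = (\<Inter>\<sigma>\<in>(sign_vectors :: ('n \<Rightarrow> real) set). boundary_Hardy p \<sigma>)"
    by blast
  have "(\<lambda>_::real^'n. 0) \<in> Lp_closure p (rational_class p)"
  proof -
    have z: "(\<lambda>_::real^'n. 0) \<in> rational_class p" by (rule zero_in_rational_class[OF assms(1)])
    hence "(\<lambda>_::real^'n. 0) \<in> Lp_space p" unfolding rational_class_def by blast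
    thus ?thesis unfolding Lp_closure_def using z assms by (auto intro!: bexI[OF _ z])
  qed
  thus "Lp_closure p (rational_class p :: (real^'n \<Rightarrow> complex) set) \<noteq> {}" by blast
qed

end
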